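(* The functor $$A\mapsto \mathrm{Hom}(\mathbb R^\times_+, A)$$ establishes an equivalence from the category of hyperbolic Nash groups (with Nash homomorphisms as morphisms) to the category of finite dimensional left $\mathbb Q$-vector spaces. It has a quasi-inverse $$E\mapsto \mathbb R^\times_+\otimes_{\mathbb Q} E.$$
   Context: Nash manifolds. A subset of $\mathbb R^n$ ($n\ge 0$) is semialgebraic if it is a finite union of sets of the form $\{x\in\mathbb R^n : f_1(x)>0,\dots,f_r(x)>0,\ g_1(x)=\cdots=g_s(x)=0\}$ with $r,s\ge 0$ and $f_i,g_j$ real polynomial functions; by convention $\mathbb R^{-\infty}=\emptyset$. A map between semialgebraic sets is semialgebraic if its graph is semialgebraic. A Nash structure on a topological space $M$ is an element $n\in\{-\infty,0,1,2,\dots\}$ (the dimension; $n=-\infty$ if $M$ is empty) together with a set $\mathcal N$ of triples $(\phi,U,U')$ (Nash charts), where $U\subset\mathbb R^n$ is open semialgebraic, $U'\subset M$ is open and $\phi:U\to U'$ is a homeomorphism, such that: (i) any two elements $(\phi_1,U_1,U_1')$, $(\phi_2,U_2,U_2')$ of $\mathcal N$ are Nash compatible, i.e. $\phi_2^{-1}\circ\phi_1:\phi_1^{-1}(U_1'\cap U_2')\to\phi_2^{-1}(U_1'\cap U_2')$ has semialgebraic domain and codomain and is semialgebraic and smooth; (ii) finitely many of the sets $U'$ cover $M$; (iii) $\mathcal N$ contains every such triple that is Nash compatible with all elements of $\mathcal N$. A Nash manifold is a Hausdorff topological space with a Nash structure; it is in particular a smooth manifold. A continuous map $\varphi:M\to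 N$ of Nash manifolds is a Nash map if for all Nash charts $(\phi,U,U')$ of $M$ and $(\psi,V,V')$ of $N$, the set $\phi^{-1}(U'\cap\varphi^{-1}(V'))$ is semialgebraic and $\psi^{-1}\circ\varphi\circ\phi:\phi^{-1}(U'\cap\varphi^{-1}(V'))\to V$ is semialgebraic and smooth. Products carry the unique Nash structure making the projections submersive Nash maps. Nash groups. A Nash group is a Hausdorff topological group with a Nash structure on its underlying space such that multiplication and inversion are Nash maps. A Nash homomorphism is a group homomorphism between Nash groups that is a Nash map; a Nash isomorphism is a bijective Nash homomorphism (its inverse is automatically a Nash homomorphism). $\mathrm{Hom}(G_1,G_2)$ denotes the set of Nash homomorphisms from $G_1$ to $G_2$; it is an abelian group when $G_2$ is abelian. $\mathbb R_+^\times$ is the multiplicative group of positive real numbers with its obvious Nash structure. A Nash group is hyperbolic if it is Nash isomorphic to $(\mathbb R_+^\times)^n$ for some $n\ge 0$. View $\mathbb R_+^\times$ as a right $\mathbb Q$-vector space with scalar multiplication $x\cdot r:=x^r$ ($x\in\mathbb R_+^\times$, $r\in\mathbb Q$); each map $x\mapsto x^r$ is a Nash homomorphism. For a hyperbolic Nash group $A$, $\mathrm{Hom}(\mathbb R_+^\times,A)$ is a left $\mathbb Q$-vector space via $(r\cdot\phi)(x):=\phi(x^r)$; the functor acts on morphisms by composition. For a finite dimensional left $\mathbb Q$-vector space $E$, the group $\mathbb R_+^\times\otimes_{\mathbb Q}E$ is a hyperbolic Nash group in the obvious way: a basis of $E$ identifies it with $(\mathbb R_+^\times)^{\dim E}$,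 and the resulting Nash structure is independent of the basis. *)

theory Defs
  imports "HOL-Analysis.Analysis" "HOL-Algebra.Free_Abelian_Groups" "HOL-Algebra.Module"
begin

text \<open>
  The Euclidean space of dimension \<open>n\<close> is \<^const>\<open>Euclidean_space\<close> \<open>n\<close>, the space of sequences
  that vanish from index \<open>n\<close> on. A dimension is of type \<^typ>\<open>nat option\<close>, where \<^const>\<open>None\<close> stands
  for \<open>-\<infinity>\<close>; the space of dimension \<open>-\<infinity>\<close> is empty.
\<close>

type_synonym rvec = "nat \<Rightarrow> real"

fun Rspace :: "nat option \<Rightarrow> rvec topology" where
  "Rspace None = subtopology (Euclidean_space 0) {}"
| "Rspace (Some n) = Euclidean_space n"

text \<open>The value at \<^const>\<open>None\<close> is irrelevant: it is only used for maps with empty domain.\<close>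

fun dim_nat :: "nat option \<Rightarrow> nat" where
  "dim_nat None = 0"
| "dim_nat (Some n) = n"

fun dim_add :: "nat option \<Rightarrow> nat option \<Rightarrow> nat option" where
  "dim_add (Some m) (Some n) = Some (m + n)"
| "dim_add _ _ = None"

inductive polynomial_fun :: "nat \<Rightarrow> (rvec \<Rightarrow> real) \<Rightarrow> bool" for n where
  const: "polynomial_fun n (\<lambda>x. c)"
| coord: "i < n \<Longrightarrow> polynomial_fun n (\<lambda>x. x i)"
| add: "polynomial_fun n f \<Longrightarrow> polynomial_fun n g \<Longrightarrow> polynomial_fun n (\<lambda>x. f x + g x)"
| mult: "polynomial_fun n f \<Longrightarrow> polynomial_fun n g \<Longrightarrow> polynomial_fun n (\<lambda>x. f x * g x)"

definition basic_semialgebraic :: "nat \<Rightarrow> rvec set \<Rightarrow> bool" where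
  "basic_semialgebraic n S \<longleftrightarrow>
     (\<exists>P Q. finite P \<and> finite Q \<and> (\<forall>f \<in> P \<union> Q. polynomial_fun n f) \<and>
        S = {x \<in> topspace (Euclidean_space n). (\<forall>f\<in>P. f x > 0) \<and> (\<forall>g\<in>Q. g x = 0)})"

fun semialgebraic :: "nat option \<Rightarrow> rvec set \<Rightarrow> bool" where
  "semialgebraic None S \<longleftrightarrow> S = {}"
| "semialgebraic (Some n) S \<longleftrightarrow> (\<exists>F. finite F \<and> (\<forall>B\<in>F. basic_semialgebraic n B) \<and> S = \<Union>F)"

text \<open>Pairs of vectors of dimensions \<open>m\<close> and \<open>n\<close> correspond to vectors of dimension \<open>m + n\<close>.\<close>

definition vjoin :: "nat \<Rightarrow> rvec \<Rightarrow> rvec \<Rightarrow> rvec" where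
  "vjoin m x y = (\<lambda>i. if i < m then x i else y (i - m))"

definition vfst :: "nat \<Rightarrow> rvec \<Rightarrow> rvec" where
  "vfst m z = (\<lambda>i. if i < m then z i else 0)"

definition vsnd :: "nat \<Rightarrow> rvec \<Rightarrow> rvec" where
  "vsnd m z = (\<lambda>i. z (m + i))"

definition semialgebraic_map ::
  "nat option \<Rightarrow> nat option \<Rightarrow> rvec set \<Rightarrow> rvec set \<Rightarrow> (rvec \<Rightarrow> rvec) \<Rightarrow> bool" where
  "semialgebraic_map d e D E f \<longleftrightarrow>
     semialgebraic d D \<and> semialgebraic e E \<and> f \<in> D \<rightarrow> E \<and>
     semialgebraic (dim_add d e) ((\<lambda>x. vjoin (dim_nat d) x (f x)) ` D)"

text \<open>Meaningful only for open \<open>U\<close>: the partial derivatives are two-sided and use values of \<open>f\<close> at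
  nearby points, which lie in \<open>U\<close>.\<close>

primrec Ck_on :: "nat \<Rightarrow> nat \<Rightarrow> rvec set \<Rightarrow> (rvec \<Rightarrow> real) \<Rightarrow> bool" where
  "Ck_on 0 n U f \<longleftrightarrow> continuous_map (subtopology (Euclidean_space n) U) euclideanreal f"
| "Ck_on (Suc k) n U f \<longleftrightarrow>
     continuous_map (subtopology (Euclidean_space n) U) euclideanreal f \<and>
     (\<forall>i<n. \<exists>g. (\<forall>x\<in>U. ((\<lambda>t. f (x(i := t))) has_real_derivative g x) (at (x i))) \<and>
                Ck_on k n U g)"

definition smooth_map :: "nat option \<Rightarrow> nat option \<Rightarrow> rvec set \<Rightarrow> (rvec \<Rightarrow> rvec) \<Rightarrow> bool" where
  "smooth_map d e U f \<longleftrightarrow> (\<forall>i < dim_nat e. \<forall>k. Ck_on k (dim_nat d) U (\<lambda>x. f x i))"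

type_synonym 'a chart = "(rvec \<Rightarrow> 'a) \<times> rvec set \<times> 'a set"

text \<open>A chart \<open>(\<phi>, U, U')\<close> goes from Euclidean space to the manifold. The map \<open>\<phi>\<close> is required to be
  extensional, so that a chart is determined by its values on \<open>U\<close>.\<close>

definition is_chart :: "'a topology \<Rightarrow> nat option \<Rightarrow> 'a chart \<Rightarrow> bool" where
  "is_chart X d = (\<lambda>(\<phi>, U, U').
     openin (Rspace d) U \<and> semialgebraic d U \<and> openin X U' \<and> \<phi> \<in> extensional U \<and>
     homeomorphic_map (subtopology (Rspace d) U) (subtopology X U') \<phi>)"

definition nash_transition :: "nat option \<Rightarrow> 'a chart \<Rightarrow> 'a chart \<Rightarrow> bool" where
  "nash_transition d = (\<lambda>(\<phi>, U, U') (\<psi>, V, V').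
     let D = {x \<in> U. \<phi> x \<in> U' \<inter> V'}; E = {y \<in> V. \<psi> y \<in> U' \<inter> V'}; f = (\<lambda>x. inv_into V \<psi> (\<phi> x))
     in semialgebraic_map d d D E f \<and> smooth_map d d D f)"

text \<open>Compatibility is a symmetric relation: both transition maps have to be semialgebraic and
  smooth (a smooth semialgebraic homeomorphism such as \<open>x \<mapsto> x\<^sup>3\<close> need not have a smooth inverse).\<close>

definition nash_compatible :: "nat option \<Rightarrow> 'a chart \<Rightarrow> 'a chart \<Rightarrow> bool" where
  "nash_compatible d c c' \<longleftrightarrow> nash_transition d c c' \<and> nash_transition d c' c"

record 'a nash_space =
  ntop :: "'a topology"
  ndim :: "nat option"
  ncharts :: "'a chart set"

definition nash_manifold :: "'a nash_space \<Rightarrow> bool" where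
  "nash_manifold M \<longleftrightarrow>
     Hausdorff_space (ntop M) \<and>
     (topspace (ntop M) = {} \<longrightarrow> ndim M = None) \<and>
     (\<forall>c \<in> ncharts M. is_chart (ntop M) (ndim M) c) \<and>
     (\<forall>c \<in> ncharts M. \<forall>c' \<in> ncharts M. nash_compatible (ndim M) c c') \<and>
     (\<exists>C. finite C \<and> C \<subseteq> ncharts M \<and> topspace (ntop M) = (\<Union>(\<phi>, U, U') \<in> C. U')) \<and>
     (\<forall>c. is_chart (ntop M) (ndim M) c \<and> (\<forall>c' \<in> ncharts M. nash_compatible (ndim M) c c') \<longrightarrow>
        c \<in> ncharts M)"

definition nash_map :: "'a nash_space \<Rightarrow> 'b nash_space \<Rightarrow> ('a \<Rightarrow> 'b) \<Rightarrow> bool" where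
  "nash_map M N f \<longleftrightarrow>
     continuous_map (ntop M) (ntop N) f \<and>
     (\<forall>(\<phi>, U, U') \<in> ncharts M. \<forall>(\<psi>, V, V') \<in> ncharts N.
        let D = {x \<in> U. f (\<phi> x) \<in> V'}; g = (\<lambda>x. inv_into V \<psi> (f (\<phi> x)))
        in semialgebraic_map (ndim M) (ndim N) D V g \<and> smooth_map (ndim M) (ndim N) D g)"

text \<open>The maximal atlas generated by an atlas \<open>C\<close>.\<close>

definition nash_space_of_atlas :: "'a topology \<Rightarrow> nat option \<Rightarrow> 'a chart set \<Rightarrow> 'a nash_space" where
  "nash_space_of_atlas X d C =
     \<lparr>ntop = X, ndim = d,
      ncharts = {c. is_chart X d c \<and> (\<forall>c'\<in>C. nash_compatible d c c')}\<rparr>"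

text \<open>The product structure is generated by the products of charts. Asking only that both
  projections be submersive Nash maps would not determine it: on \<open>\<real> \<times> \<real>\<close>, the global chart
  \<open>(s, t) \<mapsto> (s, s + t\<^sup>3)\<close> also makes both projections submersive.\<close>

definition nash_prod :: "'a nash_space \<Rightarrow> 'b nash_space \<Rightarrow> ('a \<times> 'b) nash_space" where
  "nash_prod M N =
     (let m = dim_nat (ndim M) in
      nash_space_of_atlas (prod_topology (ntop M) (ntop N)) (dim_add (ndim M) (ndim N))
        {(\<lambda>z \<in> {vjoin m x y | x y. x \<in> U \<and> y \<in> V}. (\<phi> (vfst m z), \<psi> (vsnd m z)),
          {vjoin m x y | x y. x \<in> U \<and> y \<in> V}, U' \<times> V') | \<phi> U U' \<psi> V V'.
            (\<phi>, U, U') \<in> ncharts M \<and> (\<psi>, V, V') \<in> ncharts N})"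

text \<open>Transport of structure; \<open>\<kappa>\<close> is meant to be injective on \<open>M\<close>.\<close>

definition nash_image :: "('a \<Rightarrow> 'b) \<Rightarrow> 'a nash_space \<Rightarrow> 'b nash_space" where
  "nash_image \<kappa> M =
     \<lparr>ntop = pullback_topology (\<kappa> ` topspace (ntop M)) (inv_into (topspace (ntop M)) \<kappa>) (ntop M),
      ndim = ndim M,
      ncharts = (\<lambda>(\<phi>, U, U'). (compose U \<kappa> \<phi>, U, \<kappa> ` U')) ` ncharts M\<rparr>"

record 'a nash_grp = "'a monoid" +
  nspace :: "'a nash_space"

definition nash_group :: "'a nash_grp \<Rightarrow> bool" where
  "nash_group G \<longleftrightarrow>
     group G \<and> nash_manifold (nspace G) \<and> topspace (ntop (nspace G)) = carrier G \<and>
     nash_map (nash_prod (nspace G) (nspace G)) (nspace G) (\<lambda>(x, y). x \<otimes>\<^bsub>G\<^esub> y) \<and>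
     nash_map (nspace G) (nspace G) (\<lambda>x. inv\<^bsub>G\<^esub> x)"

text \<open>Morphisms are extensional functions on the carrier, so that equality of morphisms is equality
  in HOL.\<close>

definition nash_hom :: "'a nash_grp \<Rightarrow> 'b nash_grp \<Rightarrow> ('a \<Rightarrow> 'b) set" where
  "nash_hom G H = {f \<in> hom G H. f \<in> extensional (carrier G) \<and> nash_map (nspace G) (nspace H) f}"

definition nash_iso :: "'a nash_grp \<Rightarrow> 'b nash_grp \<Rightarrow> ('a \<Rightarrow> 'b) set" where
  "nash_iso G H = {f \<in> nash_hom G H. bij_betw f (carrier G) (carrier H)}"

definition Rpos :: "real nash_grp" where
  "Rpos =
     \<lparr>carrier = {0<..}, monoid.mult = (*), one = 1,
      nspace = (let U = {x \<in> topspace (Euclidean_space 1). 0 < x 0} in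
        nash_space_of_atlas (top_of_set {0<..}) (Some 1) {(\<lambda>x\<in>U. x 0, U, {0<..})})\<rparr>"

text \<open>The coordinates from index \<open>n\<close> on are zero, so pointwise multiplication stays within the
  carrier.\<close>

definition Rpos_pow :: "nat \<Rightarrow> rvec nash_grp" where
  "Rpos_pow n =
     (let U = {x \<in> topspace (Euclidean_space n). \<forall>i<n. 0 < x i} in
      \<lparr>carrier = U, monoid.mult = (\<lambda>x y i. x i * y i), one = (\<lambda>i. if i < n then 1 else 0),
       nspace = nash_space_of_atlas (subtopology (Euclidean_space n) U) (Some n)
         {(\<lambda>x\<in>U. x, U, U)}\<rparr>)"

definition hyperbolic :: "'a nash_grp \<Rightarrow> bool" where
  "hyperbolic A \<longleftrightarrow> nash_group A \<and> (\<exists>n. nash_iso A (Rpos_pow n) \<noteq> {})"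

definition rat_ring :: "rat ring" where
  "rat_ring = \<lparr>carrier = UNIV, monoid.mult = (*), one = 1, zero = 0, add = (+)\<rparr>"

definition is_basis :: "(rat, 'e) module \<Rightarrow> 'e list \<Rightarrow> bool" where
  "is_basis E bs \<longleftrightarrow>
     set bs \<subseteq> carrier E \<and>
     (\<forall>v \<in> carrier E. \<exists>!c. c \<in> extensional {..<length bs} \<and>
        v = (\<Oplus>\<^bsub>E\<^esub>i\<in>{..<length bs}. c i \<odot>\<^bsub>E\<^esub> (bs ! i)))"

definition fin_dim_qvs :: "(rat, 'e) module \<Rightarrow> bool" where
  "fin_dim_qvs E \<longleftrightarrow> Module.module rat_ring E \<and> (\<exists>bs. is_basis E bs)"

definition linear_maps :: "(rat, 'e) module \<Rightarrow> (rat, 'f) module \<Rightarrow> ('e \<Rightarrow> 'f) set" where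
  "linear_maps E F =
     {f \<in> carrier E \<rightarrow>\<^sub>E carrier F.
        (\<forall>v \<in> carrier E. \<forall>w \<in> carrier E. f (v \<oplus>\<^bsub>E\<^esub> w) = f v \<oplus>\<^bsub>F\<^esub> f w) \<and>
        (\<forall>r. \<forall>v \<in> carrier E. f (r \<odot>\<^bsub>E\<^esub> v) = r \<odot>\<^bsub>F\<^esub> f v)}"

text \<open>A category whose morphisms are extensional functions between underlying sets, composed by
  \<^const>\<open>compose\<close>; associativity and the unit laws hold automatically.\<close>

record ('o, 'x) ccat =
  Obj :: "'o set"
  Und :: "'o \<Rightarrow> 'x set"
  Mor :: "'o \<Rightarrow> 'o \<Rightarrow> ('x \<Rightarrow> 'x) set"

definition is_category :: "('o, 'x) ccat \<Rightarrow> bool" where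
  "is_category C \<longleftrightarrow>
     (\<forall>A \<in> Obj C. \<forall>B \<in> Obj C. Mor C A B \<subseteq> Und C A \<rightarrow>\<^sub>E Und C B) \<and>
     (\<forall>A \<in> Obj C. (\<lambda>x \<in> Und C A. x) \<in> Mor C A A) \<and>
     (\<forall>A \<in> Obj C. \<forall>B \<in> Obj C. \<forall>D \<in> Obj C. \<forall>f \<in> Mor C A B. \<forall>g \<in> Mor C B D.
        compose (Und C A) g f \<in> Mor C A D)"

definition is_functor ::
  "('o, 'x) ccat \<Rightarrow> ('p, 'y) ccat \<Rightarrow> ('o \<Rightarrow> 'p) \<Rightarrow> ('o \<Rightarrow> 'o \<Rightarrow> ('x \<Rightarrow> 'x) \<Rightarrow> ('y \<Rightarrow> 'y)) \<Rightarrow> bool" where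
  "is_functor C D Fo Fm \<longleftrightarrow>
     is_category C \<and> is_category D \<and>
     (\<forall>A \<in> Obj C. Fo A \<in> Obj D) \<and>
     (\<forall>A \<in> Obj C. \<forall>B \<in> Obj C. \<forall>f \<in> Mor C A B. Fm A B f \<in> Mor D (Fo A) (Fo B)) \<and>
     (\<forall>A \<in> Obj C. Fm A A (\<lambda>x \<in> Und C A. x) = (\<lambda>y \<in> Und D (Fo A). y)) \<and>
     (\<forall>A \<in> Obj C. \<forall>B \<in> Obj C. \<forall>E \<in> Obj C. \<forall>f \<in> Mor C A B. \<forall>g \<in> Mor C B E.
        Fm A E (compose (Und C A) g f) = compose (Und D (Fo A)) (Fm B E g) (Fm A B f))"

text \<open>The invertible elements of a set \<open>H\<close> of morphisms from \<open>X\<close> to \<open>Y\<close>, where \<open>H'\<close> is the set of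
  morphisms from \<open>Y\<close> to \<open>X\<close>. The two sides may live in different types.\<close>

definition isos :: "'x set \<Rightarrow> 'y set \<Rightarrow> ('x \<Rightarrow> 'y) set \<Rightarrow> ('y \<Rightarrow> 'x) set \<Rightarrow> ('x \<Rightarrow> 'y) set" where
  "isos X Y H H' =
     {f \<in> H. \<exists>g \<in> H'. compose X g f = (\<lambda>x\<in>X. x) \<and> compose Y f g = (\<lambda>y\<in>Y. y)}"

definition hyperbolic_cat :: "('a nash_grp, 'a) ccat" where
  "hyperbolic_cat = \<lparr>Obj = {A. hyperbolic A}, Und = carrier, Mor = nash_hom\<rparr>"

definition qvs_cat :: "((rat, 'e) module, 'e) ccat" where
  "qvs_cat = \<lparr>Obj = {E. fin_dim_qvs E}, Und = carrier, Mor = linear_maps\<rparr>"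

text \<open>The multiplicative fields of a \<^const>\<open>Module.module\<close> record play no role for vector spaces.\<close>

definition Hom_obj :: "'a nash_grp \<Rightarrow> (rat, real \<Rightarrow> 'a) module" where
  "Hom_obj A =
     \<lparr>carrier = nash_hom Rpos A,
      monoid.mult = undefined, one = undefined,
      zero = (\<lambda>x \<in> carrier Rpos. \<one>\<^bsub>A\<^esub>),
      add = (\<lambda>\<phi> \<psi>. \<lambda>x \<in> carrier Rpos. \<phi> x \<otimes>\<^bsub>A\<^esub> \<psi> x),
      smult = (\<lambda>r \<phi>. \<lambda>x \<in> carrier Rpos. \<phi> (x powr of_rat r))\<rparr>"

definition Hom_mor :: "'a nash_grp \<Rightarrow> 'b nash_grp \<Rightarrow> ('a \<Rightarrow> 'b) \<Rightarrow> (real \<Rightarrow> 'a) \<Rightarrow> (real \<Rightarrow> 'b)" where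
  "Hom_mor A B f = (\<lambda>\<phi> \<in> nash_hom Rpos A. compose (carrier Rpos) f \<phi>)"

type_synonym 'e tens = "((real \<times> 'e) \<Rightarrow>\<^sub>0 int) set"

definition tensor_relations :: "(rat, 'e) module \<Rightarrow> ((real \<times> 'e) \<Rightarrow>\<^sub>0 int) set" where
  "tensor_relations E =
     {frag_of (x * y, v) - frag_of (x, v) - frag_of (y, v) | x y v.
        x \<in> carrier Rpos \<and> y \<in> carrier Rpos \<and> v \<in> carrier E} \<union>
     {frag_of (x, v \<oplus>\<^bsub>E\<^esub> w) - frag_of (x, v) - frag_of (x, w) | x v w.
        x \<in> carrier Rpos \<and> v \<in> carrier E \<and> w \<in> carrier E} \<union>
     {frag_of (x powr of_rat r, v) - frag_of (x, r \<odot>\<^bsub>E\<^esub> v) | x r v.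
        x \<in> carrier Rpos \<and> v \<in> carrier E}"

definition tensor_group :: "(rat, 'e) module \<Rightarrow> 'e tens monoid" where
  "tensor_group E =
     (let G = free_Abelian_group (carrier Rpos \<times> carrier E)
      in G Mod (generate G (tensor_relations E)))"

definition pure_tensor :: "(rat, 'e) module \<Rightarrow> real \<Rightarrow> 'e \<Rightarrow> 'e tens" where
  "pure_tensor E x v =
     (let G = free_Abelian_group (carrier Rpos \<times> carrier E)
      in generate G (tensor_relations E) #>\<^bsub>G\<^esub> frag_of (x, v))"

text \<open>Applied to \<open>t \<in> carrier (Rpos_pow (length bs))\<close>.\<close>

definition basis_map :: "(rat, 'e) module \<Rightarrow> 'e list \<Rightarrow> rvec \<Rightarrow> 'e tens" where
  "basis_map E bs t = (\<Otimes>\<^bsub>tensor_group E\<^esub>i\<in>{..<length bs}. pure_tensor E (t i) (bs ! i))"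

text \<open>The Nash structure is the one that is transported from every basis; it exists since the
  transported structure does not depend on the basis.\<close>

definition tensor_obj :: "(rat, 'e) module \<Rightarrow> 'e tens nash_grp" where
  "tensor_obj E =
     \<lparr>carrier = carrier (tensor_group E),
      monoid.mult = (\<otimes>\<^bsub>tensor_group E\<^esub>),
      one = \<one>\<^bsub>tensor_group E\<^esub>,
      nspace = (THE S. \<forall>bs. is_basis E bs \<longrightarrow>
        S = nash_image (basis_map E bs) (nspace (Rpos_pow (length bs))))\<rparr>"

definition tensor_mor ::
  "(rat, 'e) module \<Rightarrow> (rat, 'f) module \<Rightarrow> ('e \<Rightarrow> 'f) \<Rightarrow> 'e tens \<Rightarrow> 'f tens" where
  "tensor_mor E F f =
     (THE h. h \<in> hom (tensor_group E) (tensor_group F) \<and>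
        h \<in> extensional (carrier (tensor_group E)) \<and>
        (\<forall>x \<in> carrier Rpos. \<forall>v \<in> carrier E. h (pure_tensor E x v) = pure_tensor F x (f v)))"

end

theory Submission
  imports Defs
begin

text \<open>
  The theorem rests on two facts about the multiplicative group of positive reals.

  A Nash endomorphism of this group is \<open>x \<mapsto> x powr r\<close> with a rational \<open>r\<close> (\<open>nash_hom_Rpos_Rpos\<close>). In
  logarithmic coordinates it is additive and differentiable, so it is a real power; it is semialgebraic,
  so \<open>x\<close> and its image satisfy a polynomial equation, and this is impossible for an irrational exponent.
  Consequently, if \<open>F\<close> is a Nash isomorphism from \<open>A\<close> to the \<open>n\<close>-th power of the positive reals, the
  one-parameter subgroups of \<open>A\<close> correspond to the vectors of \<open>n\<close> rational exponents
  (\<open>nash_hom_Rpos_power_vec\<close>, \<open>is_basis_curve_basis\<close>). On the other side, the choice of a basis of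
  a vector space \<open>E\<close> identifies its tensor product with a power of the positive reals, where \<open>x \<otimes> v\<close>
  is the vector of powers of \<open>x\<close> whose exponents are the coordinates of \<open>v\<close> (\<open>tensor_coordinates\<close>).

  The inverse of a bijective Nash homomorphism \<open>F\<close> as above is Nash. Along a one-parameter subgroup, the
  inverse of \<open>F\<close> is a homomorphism with a semialgebraic graph in charts. A semialgebraic function of one
  variable is smooth on some interval, and translations in the group carry the smoothness from there to
  all parameters (\<open>inverse_curve_nash\<close>). The inverse of \<open>F\<close> is a finite product of such curves.

  The two quasi-inverse functors are now compared by explicit maps. The evaluation \<open>x \<otimes> \<phi> \<mapsto> \<phi> x\<close>
  is a Nash isomorphism onto \<open>A\<close> with a Nash inverse (\<open>evaluation_exists\<close>), and \<open>v \<mapsto> (x \<mapsto> x \<otimes> v)\<close> is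
  a linear isomorphism from \<open>E\<close> (\<open>counit_bij\<close>). Both are natural, because homomorphisms from the tensor
  product are determined by pure tensors. A homomorphism from the tensor product is Nash as soon as it is
  Nash along the curves of pure tensors (\<open>nash_map_from_tensor\<close>); this also shows that the Nash
  structure does not depend on the basis (\<open>tspace_unique\<close>) and that linear maps induce Nash homomorphisms.

  The foundations are the theorem of Tarski and Seidenberg, on which the composition of semialgebraic
  maps depends, and a calculus of Nash maps. Quantifiers are eliminated by showing that finitely many
  polynomials in the parameters decide the sign pattern of a family of polynomials in one more variable
  (\<open>uniform_signs_exists\<close>, \<open>definable_ex\<close>). Nash maps are treated through their representations in
  pairs of charts, which compose because the middle space has a finite atlas (\<open>lrep_compose\<close>). The
  facts on generated atlases, products and transported structures rest on this lemma.
\<close>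

section \<open>Elimination of one real variable\<close>

text \<open>Sign patterns on the line matter only up to an increasing reparametrization. Such a
  reparametrization is built on one gap between consecutive roots at a time, so each piece of it
  fixes the complement of the gap.\<close>

lemma piecewise_linear_shift:
  fixes l a b u :: real
  assumes "l < a" "a < u" "l < b" "b < u"
  shows "\<exists>k. strict_mono k \<and> surj k \<and> (\<forall>t. t \<notin> {l<..<u} \<longrightarrow> k t = t) \<and> k a = b"
proof -
  define K where "K a b t = (if t \<le> l \<or> u \<le> t then t else if t \<le> a
      then l + (t - l) * ((b - l) / (a - l)) else b + (t - a) * ((u - b) / (u - a)))" for a b t
  have inv: "K b a (K a b t) = t" if "l < a" "a < u" "l < b" "b < u" for a b t
  proof -
    consider "t \<le> l \<or> u \<le> t" | "l < t" "t \<le> a" | "a < t" "t < u" by linarith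
    then show ?thesis
    proof cases
      case 1
      then show ?thesis by (auto simp: K_def)
    next
      case 2
      have 1: "0 < (t - l) * ((b - l) / (a - l))" using 2 that by simp
      have "(t - l) * ((b - l) / (a - l)) \<le> (a - l) * ((b - l) / (a - l))"
        using 2 that by (intro mult_right_mono) auto
      then have 3: "(t - l) * ((b - l) / (a - l)) \<le> b - l" using that by simp
      have 4: "K a b t = l + (t - l) * ((b - l) / (a - l))" using 2 that by (simp add: K_def)
      then show ?thesis using 1 3 that unfolding K_def[of b a] by simp
    next
      case 3
      have 1: "0 < (t - a) * ((u - b) / (u - a))" using 3 that by simp
      have "(t - a) * ((u - b) / (u - a)) < (u - a) * ((u - b) / (u - a))"
        using 3 that by (intro mult_strict_right_mono) auto
      then have 2: "(t - a) * ((u - b) / (u - a)) < u - b" using that by simp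
      define m where "m = (t - a) * ((u - b) / (u - a))"
      have "K a b t = b + m" using 3 that by (simp add: K_def m_def)
      moreover have "K b a (b + m) = a + m * ((u - a) / (u - b))"
        using 1 2 that unfolding m_def[symmetric] by (simp add: K_def)
      moreover have "m * ((u - a) / (u - b)) = t - a" using that by (simp add: m_def)
      ultimately show ?thesis by simp
    qed
  qed
  have "surj (K a b)" using inv[of b a] assms by (metis surjI)
  moreover have "strict_mono (K a b)"
  proof (rule strict_monoI)
    fix s t :: real assume st: "s < t"
    have mono: "K a b s \<le> K a b t"
    proof -
      have s1: "0 < (b - l) / (a - l)" "0 < (u - b) / (u - a)" using assms by auto
      have f: "l \<le> K a b x \<and> K a b x \<le> b" if "l \<le> x" "x \<le> a" for x
      proof -
        have "(x - l) * ((b - l) / (a - l)) \<le> (a - l) * ((b - l) / (a - l))"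
          using that s1 by (intro mult_right_mono) auto
        moreover have "0 \<le> (x - l) * ((b - l) / (a - l))" using that s1
          by (intro mult_nonneg_nonneg) auto
        ultimately show ?thesis using that assms by (auto simp: K_def)
      qed
      have g: "b \<le> K a b x \<and> K a b x \<le> u" if "a \<le> x" "x \<le> u" for x
      proof -
        have "(x - a) * ((u - b) / (u - a)) \<le> (u - a) * ((u - b) / (u - a))"
          using that s1 by (intro mult_right_mono) auto
        moreover have "0 \<le> (x - a) * ((u - b) / (u - a))" using that s1
          by (intro mult_nonneg_nonneg) auto
        ultimately show ?thesis using that assms by (auto simp: K_def)
      qed
      have id: "K a b x = x" if "x \<le> l \<or> u \<le> x" for x using that by (simp add: K_def)
      consider "s \<le> l" "t \<le> l" | "s \<le> l" "l \<le> t" "t \<le> a" | "s \<le> l" "a \<le> t" "t \<le> u"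
        | "s \<le> l" "u \<le> t" | "l < s" "t \<le> a" | "l \<le> s" "s \<le> a" "a \<le> t" "t \<le> u"
        | "l \<le> s" "s \<le> a" "u \<le> t" | "a < s" "t < u" | "a \<le> s" "s \<le> u" "u \<le> t" | "u \<le> s"
        using st by linarith
      then show ?thesis
      proof cases
        case 5
        have "(s - l) * ((b - l) / (a - l)) \<le> (t - l) * ((b - l) / (a - l))"
          using st s1 by (intro mult_right_mono) auto
        then show ?thesis using 5 st assms by (auto simp: K_def)
      next
        case 8
        have "(s - a) * ((u - b) / (u - a)) \<le> (t - a) * ((u - b) / (u - a))"
          using st s1 by (intro mult_right_mono) auto
        then show ?thesis using 8 st assms by (auto simp: K_def)
      qed (use id f g st assms in \<open>force+\<close>)
    qed
    moreover have "K a b s \<noteq> K a b t"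
      using inv[of a b s] inv[of a b t] assms st by auto
    ultimately show "K a b s < K a b t" by simp
  qed
  moreover have "\<forall>t. t \<notin> {l<..<u} \<longrightarrow> K a b t = t" by (auto simp: K_def)
  moreover have "K a b a = b" using assms by (simp add: K_def)
  ultimately show ?thesis by blast
qed

text \<open>A strictly increasing function changes its sign at most once on a gap. Moving the sign
  change of \<open>P\<close> to that of \<open>Q\<close> matches the signs on the whole gap.\<close>

lemma gap_shift:
  fixes P Q :: "real \<Rightarrow> real"
  assumes lu: "l < u"
    and P: "strict_mono_on {l..u} P" and Q: "strict_mono_on {l..u} Q"
    and IP: "P l < 0 \<Longrightarrow> 0 < P u \<Longrightarrow> \<exists>c\<in>{l<..<u}. P c = 0"
    and IQ: "Q l < 0 \<Longrightarrow> 0 < Q u \<Longrightarrow> \<exists>c\<in>{l<..<u}. Q c = 0"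
    and sl: "sgn (P l) = sgn (Q l)" and su: "sgn (P u) = sgn (Q u)"
  shows "\<exists>k. strict_mono k \<and> surj k \<and> (\<forall>t. t \<notin> {l<..<u} \<longrightarrow> k t = t) \<and>
    (\<forall>t\<in>{l..u}. sgn (P t) = sgn (Q (k t)))"
proof -
  have mono: "f s < f t" if "strict_mono_on {l..u} f" "l \<le> s" "s < t" "t \<le> u" for f :: "real \<Rightarrow> real" and s t
    using that by (auto simp: strict_mono_on_def)
  show ?thesis
  proof (cases "P l < 0 \<and> 0 < P u")
    case True
    then have "Q l < 0" "0 < Q u" using sl su by (auto simp: sgn_if split: if_splits)
    then obtain a b where a: "l < a" "a < u" "P a = 0" and b: "l < b" "b < u" "Q b = 0"
      using IP IQ True by (auto simp: greaterThanLessThan_iff)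
    obtain k where k: "strict_mono k" "surj k" "\<forall>t. t \<notin> {l<..<u} \<longrightarrow> k t = t" "k a = b"
      using piecewise_linear_shift[of l a u b] a b by blast
    have "sgn (P t) = sgn (Q (k t))" if t: "t \<in> {l..u}" for t
    proof -
      have kt: "l \<le> k t" "k t \<le> u"
        using t k(1) k(3) lu by (smt (verit) atLeastAtMost_iff greaterThanLessThan_iff strict_mono_less)+
      consider "t < a" | "t = a" | "a < t" by linarith
      then show ?thesis
      proof cases
        case 1
        then have "k t < b" using k by (metis strict_mono_less)
        then have "Q (k t) < 0" using mono[OF Q kt(1)] b by fastforce
        moreover have "P t < 0" using mono[OF P _ 1] a t by fastforce
        ultimately show ?thesis by simp
      next
        case 2
        then show ?thesis using a b k by simp
      next
        case 3
        then have "b < k t" using k by (metis strict_mono_less)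
        then have "0 < Q (k t)" using mono[OF Q _ _ kt(2), of b] b by fastforce
        moreover have "0 < P t" using mono[OF P _ 3] a t by fastforce
        ultimately show ?thesis by simp
      qed
    qed
    then show ?thesis using k by blast
  next
    case False
    have "sgn (P t) = sgn (Q t)" if t: "t \<in> {l..u}" for t
    proof (cases "P l \<ge> 0")
      case True
      then have "Q l \<ge> 0" using sl by (auto simp: sgn_if split: if_splits)
      then show ?thesis using mono[OF P, of l t] mono[OF Q, of l t] t True sl
        by (cases "t = l") (auto simp: sgn_if)
    next
      case c: False
      then have "P u \<le> 0" using False by simp
      moreover then have "Q u \<le> 0" using su by (auto simp: sgn_if split: if_splits)
      ultimately show ?thesis using mono[OF P, of t u] mono[OF Q, of t u] t su
        by (cases "t = u") (auto simp: sgn_if)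
    qed
    then show ?thesis by (intro exI[of _ id]) (auto simp: strict_mono_def)
  qed
qed

lemma poly_sgn_const_on_gap:
  fixes p :: "real poly"
  assumes "\<And>t. l < t \<Longrightarrow> t < u \<Longrightarrow> poly p t \<noteq> 0" "l < s" "s < u" "l < t" "t < u"
  shows "sgn (poly p s) = sgn (poly p t)"
proof (rule ccontr)
  have 1: False if ab: "l < a" "a < b" "b < u" "sgn (poly p a) \<noteq> sgn (poly p b)" for a b
  proof -
    have "poly p a * poly p b < 0"
      using assms(1)[of a] assms(1)[of b] ab by (auto simp: sgn_if mult_neg_pos mult_pos_neg split: if_splits)
    then obtain c where "a < c" "c < b" "poly p c = 0" using poly_IVT[OF ab(2)] by blast
    then show False using assms(1)[of c] ab by simp
  qed
  assume "sgn (poly p s) \<noteq> sgn (poly p t)"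
  then show False using 1[of s t] 1[of t s] assms by (cases s t rule: linorder_cases) auto
qed

lemma poly_strict_mono_on_gap:
  fixes p :: "real poly"
  assumes "\<And>t. l < t \<Longrightarrow> t < u \<Longrightarrow> 0 < poly (pderiv p) t"
  shows "strict_mono_on {l..u} (poly p)"
proof (rule strict_mono_onI)
  fix s t assume st: "s \<in> {l..u}" "t \<in> {l..u}" "s < t"
  show "poly p s < poly p t"
  proof (rule DERIV_pos_imp_increasing_open[OF st(3)])
    fix x assume "s < x" "x < t"
    then show "\<exists>y. (poly p has_real_derivative y) (at x) \<and> y > 0"
      using assms[of x] st poly_DERIV[of p x] by (auto intro!: exI[of _ "poly (pderiv p) x"])
  qed (auto intro: continuous_intros)
qed

lemma surj_strict_mono_between:
  fixes h :: "real \<Rightarrow> real"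
  assumes "strict_mono h" "surj h" "h l < s" "s < h u"
  obtains t where "l < t" "t < u" "h t = s"
  using assms by (metis strict_mono_less surjD)

lemma poly_gap_shift:
  fixes p q :: "real poly"
  assumes h: "strict_mono h" "surj h" and lu: "l < u"
    and nz: "\<And>t. l < t \<Longrightarrow> t < u \<Longrightarrow> poly (pderiv p) t \<noteq> 0"
    and d: "\<And>t. sgn (poly (pderiv p) t) = sgn (poly (pderiv q) (h t))"
    and sl: "sgn (poly p l) = sgn (poly q (h l))" and su: "sgn (poly p u) = sgn (poly q (h u))"
  shows "\<exists>k. strict_mono k \<and> surj k \<and> (\<forall>t. t \<notin> {l<..<u} \<longrightarrow> k t = t) \<and>
    (\<forall>t\<in>{l..u}. sgn (poly p t) = sgn (poly q (h (k t))))"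
proof -
  have main: "\<exists>k. strict_mono k \<and> surj k \<and> (\<forall>t. t \<notin> {l<..<u} \<longrightarrow> k t = t) \<and>
    (\<forall>t\<in>{l..u}. sgn (poly p t) = sgn (poly q (h (k t))))"
    if pos: "\<And>t. l < t \<Longrightarrow> t < u \<Longrightarrow> poly (pderiv p) t > 0"
      and d: "\<And>t. sgn (poly (pderiv p) t) = sgn (poly (pderiv q) (h t))"
      and sl: "sgn (poly p l) = sgn (poly q (h l))" and su: "sgn (poly p u) = sgn (poly q (h u))"
    for p q :: "real poly"
  proof (rule gap_shift[where P = "poly p" and Q = "\<lambda>t. poly q (h t)"])
    show "l < u" "sgn (poly p l) = sgn (poly q (h l))" "sgn (poly p u) = sgn (poly q (h u))" by fact+
    show "strict_mono_on {l..u} (poly p)" using pos by (rule poly_strict_mono_on_gap)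
    have "strict_mono_on {h l..h u} (poly q)"
    proof (rule poly_strict_mono_on_gap)
      fix s assume "h l < s" "s < h u"
      then obtain t where t: "l < t" "t < u" "h t = s" using surj_strict_mono_between[OF h] by blast
      then show "0 < poly (pderiv q) s" using pos[OF t(1,2)] d[of t] by (auto simp: sgn_if split: if_splits)
    qed
    then show "strict_mono_on {l..u} (\<lambda>t. poly q (h t))"
      using h(1) by (auto simp: strict_mono_on_def strict_mono_less strict_mono_less_eq)
    show "\<exists>c\<in>{l<..<u}. poly p c = 0" if "poly p l < 0" "0 < poly p u"
      using poly_IVT_pos[OF lu that] by auto
    show "\<exists>c\<in>{l<..<u}. poly q (h c) = 0" if "poly q (h l) < 0" "0 < poly q (h u)"
      using poly_IVT_pos[OF _ that] h lu surj_strict_mono_between[OF h]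
      by (metis greaterThanLessThan_iff strict_monoD)
  qed
  have mid: "l < (l + u) / 2" "(l + u) / 2 < u" using lu by (auto simp: field_simps)
  have const: "sgn (poly (pderiv p) t) = sgn (poly (pderiv p) ((l + u) / 2))" if "l < t" "t < u" for t
    by (rule poly_sgn_const_on_gap[OF nz that mid])
  show ?thesis
  proof (cases "poly (pderiv p) ((l + u) / 2) > 0")
    case True
    then have "poly (pderiv p) t > 0" if "l < t" "t < u" for t
      using const[OF that] by (auto simp: sgn_if split: if_splits)
    then show ?thesis using main[OF _ d sl su] by blast
  next
    case False
    then have "poly (pderiv (-p)) t > 0" if "l < t" "t < u" for t
      using const[OF that] nz[OF mid] by (auto simp: sgn_if pderiv_minus split: if_splits)
    then have "\<exists>k. strict_mono k \<and> surj k \<and> (\<forall>t. t \<notin> {l<..<u} \<longrightarrow> k t = t) \<and>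
      (\<forall>t\<in>{l..u}. sgn (poly (-p) t) = sgn (poly (-q) (h (k t))))"
      using d sl su by (intro main) (simp_all add: pderiv_minus sgn_minus)
    then show ?thesis by (simp add: sgn_minus)
  qed
qed

lemma poly_sgn_at_top:
  fixes p :: "real poly"
  shows "\<forall>\<^sub>F t in at_top. sgn (poly p t) = sgn (lead_coeff p)"
proof -
  have pos: "\<forall>\<^sub>F t in at_top. 0 < poly p t" if "0 < lead_coeff p" for p :: "real poly"
    using poly_pinfty_gt_lc[OF that] that by (meson eventually_at_top_linorder less_le_trans)
  consider "lead_coeff p > 0" | "lead_coeff (-p) > 0" | "p = 0"
    using leading_coeff_0_iff linorder_neqE_linordered_idom by force
  then show ?thesis
  proof cases
    case 1
    then show ?thesis using pos[OF 1] by (auto elim!: eventually_mono)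
  next
    case 2
    then show ?thesis using pos[OF 2] by (auto elim!: eventually_mono)
  qed auto
qed

lemma poly_sgn_at_bot:
  fixes p :: "real poly"
  shows "\<forall>\<^sub>F t in at_bot. sgn (poly p t) = sgn (lead_coeff p) * (-1) ^ degree p"
proof -
  have "lead_coeff (pcompose p [:0, -1:]) = lead_coeff p * (-1) ^ degree p"
    by (subst lead_coeff_comp) auto
  then have "\<forall>\<^sub>F t in at_top. sgn (poly (pcompose p [:0, -1:]) t) = sgn (lead_coeff p) * (-1) ^ degree p"
    using poly_sgn_at_top[of "pcompose p [:0, -1:]"] by (simp add: sgn_mult power_sgn)
  then have "\<forall>\<^sub>F t in at_top. sgn (poly p (- t)) = sgn (lead_coeff p) * (-1) ^ degree p"
    by (simp add: poly_pcompose)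
  then show ?thesis by (simp add: at_bot_mirror eventually_filtermap)
qed

text \<open>The reparametrization is corrected gap by gap from left to right. A correction inside a
  gap of \<open>Z\<close> does no harm to the polynomials \<open>ps i\<close>, because they have constant signs there; the
  process starts at \<open>l\<close> and stops at \<open>R\<close>, since outside of these bounds the signs already
  agree.\<close>

lemma poly_sign_step_aux:
  fixes p q :: "real poly" and ps qs :: "'i \<Rightarrow> real poly"
  assumes fin: "finite Z" and RZ: "R \<in> Z"
    and Z: "\<And>i t. i \<in> I \<Longrightarrow> poly (ps i) t = 0 \<Longrightarrow> t \<in> Z"
    and i0: "k \<in> I" "ps k = pderiv p" "qs k = pderiv q"
  shows "\<lbrakk>strict_mono h; surj h; \<And>i t. i \<in> I \<Longrightarrow> sgn (poly (ps i) t) = sgn (poly (qs i) (h t));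
      \<And>z. z \<in> Z \<Longrightarrow> sgn (poly p z) = sgn (poly q (h z));
      \<And>t. R \<le> t \<Longrightarrow> sgn (poly p t) = sgn (poly q (h t));
      l \<in> Z; \<And>t. t \<le> l \<Longrightarrow> sgn (poly p t) = sgn (poly q (h t))\<rbrakk> \<Longrightarrow>
    \<exists>h. strict_mono h \<and> surj h \<and> (\<forall>i\<in>I. \<forall>t. sgn (poly (ps i) t) = sgn (poly (qs i) (h t))) \<and>
       (\<forall>t. sgn (poly p t) = sgn (poly q (h t)))"
proof (induction "card {z \<in> Z. l < z}" arbitrary: l h rule: less_induct)
  case less
  note h = less.prems
  show ?case
  proof (cases "{z \<in> Z. l < z} = {}")
    case True
    then have "R \<le> l" using RZ by auto
    then have "sgn (poly p t) = sgn (poly q (h t))" for t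
      using h(5)[of t] h(7)[of t] by linarith
    then show ?thesis using h by blast
  next
    case False
    define u where "u = Min {z \<in> Z. l < z}"
    have u: "u \<in> Z" "l < u" using Min_in[of "{z \<in> Z. l < z}"] False fin by (auto simp: u_def)
    have gap: "z \<notin> Z" if "l < z" "z < u" for z
    proof
      assume "z \<in> Z"
      then have "u \<le> z" unfolding u_def using fin that by (intro Min_le) auto
      then show False using that by simp
    qed
    have nz: "poly (ps i) t \<noteq> 0" if "i \<in> I" "l < t" "t < u" for i t
      using Z[OF that(1)] gap that by blast
    have "\<exists>k. strict_mono k \<and> surj k \<and> (\<forall>t. t \<notin> {l<..<u} \<longrightarrow> k t = t) \<and>
        (\<forall>t\<in>{l..u}. sgn (poly p t) = sgn (poly q (h (k t))))"
    proof (rule poly_gap_shift[OF h(1,2) u(2)])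
      show "poly (pderiv p) t \<noteq> 0" if "l < t" "t < u" for t using nz[OF i0(1)] that i0 by simp
      show "sgn (poly (pderiv p) t) = sgn (poly (pderiv q) (h t))" for t
        using h(3)[OF i0(1)] i0 by simp
    qed (use h u in auto)
    then obtain k where k: "strict_mono k" "surj k" "\<And>t. t \<notin> {l<..<u} \<Longrightarrow> k t = t"
      and kp: "\<And>t. t \<in> {l..u} \<Longrightarrow> sgn (poly p t) = sgn (poly q (h (k t)))" by blast
    have kin: "l < k t \<and> k t < u" if "l < t" "t < u" for t
      using k(1) k(3)[of l] k(3)[of u] that by (metis greaterThanLessThan_iff order_less_irrefl strict_mono_less)
    show ?thesis
    proof (rule less.hyps[where l = u and h = "h \<circ> k"])
      have "{z \<in> Z. u < z} \<subset> {z \<in> Z. l < z}" using u by auto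
      then show "card {z \<in> Z. u < z} < card {z \<in> Z. l < z}" using fin by (intro psubset_card_mono) auto
      show "strict_mono (h \<circ> k)" using h(1) k(1) by (simp add: strict_mono_def)
      show "surj (h \<circ> k)" using h(2) k(2) by (metis comp_surj)
      show "sgn (poly (ps i) t) = sgn (poly (qs i) ((h \<circ> k) t))" if "i \<in> I" for i t
      proof (cases "l < t \<and> t < u")
        case True
        then have "sgn (poly (ps i) t) = sgn (poly (ps i) (k t))"
          using kin[of t] nz[OF that] by (intro poly_sgn_const_on_gap[of l u]) auto
        then show ?thesis using h(3)[OF that] by simp
      next
        case False
        then show ?thesis using h(3)[OF that] k(3)[of t] by simp
      qed
      show "sgn (poly p z) = sgn (poly q ((h \<circ> k) z))" if "z \<in> Z" for z
        using h(4)[OF that] gap[of z] that k(3)[of z] by (metis comp_apply greaterThanLessThan_iff)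
      show "sgn (poly p t) = sgn (poly q ((h \<circ> k) t))" if Rt: "R \<le> t" for t
      proof -
        have "u \<le> R" if "l < R" using RZ that fin unfolding u_def by (intro Min_le) auto
        then consider "u \<le> t" | "R \<le> l" using Rt by linarith
        then show ?thesis
        proof cases
          case 1
          then show ?thesis using h(5)[OF Rt] k(3)[of t] by simp
        next
          case 2
          then show ?thesis using h(5)[OF Rt] kp[of t] k(3)[of t] by (cases "t \<in> {l..u}") auto
        qed
      qed
      show "u \<in> Z" by fact
      show "sgn (poly p t) = sgn (poly q ((h \<circ> k) t))" if "t \<le> u" for t
        using h(7)[of t] kp[of t] k(3)[of t] that by (cases "t \<le> l") auto
    qed
  qed
qed

text \<open>Between consecutive roots of a family that contains the derivative of \<open>p\<close>, the polynomial
  \<open>p\<close> is strictly monotone. So its signs on the line are determined by the signs of the family,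
  by the signs of \<open>p\<close> at the roots of the family, and by its leading coefficient.\<close>

lemma poly_sign_step:
  fixes p q :: "real poly" and ps qs :: "'i \<Rightarrow> real poly"
  assumes h: "strict_mono h" "surj h" and fin: "finite I" and nz: "\<And>i. i \<in> I \<Longrightarrow> ps i \<noteq> 0"
    and match: "\<And>i t. i \<in> I \<Longrightarrow> sgn (poly (ps i) t) = sgn (poly (qs i) (h t))"
    and i0: "k \<in> I" "ps k = pderiv p" "qs k = pderiv q"
    and deg: "degree p = degree q" and lead: "sgn (lead_coeff p) = sgn (lead_coeff q)"
    and roots: "\<And>i t. i \<in> I \<Longrightarrow> poly (ps i) t = 0 \<Longrightarrow> sgn (poly p t) = sgn (poly q (h t))"
  shows "\<exists>h. strict_mono h \<and> surj h \<and> (\<forall>i\<in>I. \<forall>t. sgn (poly (ps i) t) = sgn (poly (qs i) (h t))) \<and>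
       (\<forall>t. sgn (poly p t) = sgn (poly q (h t)))"
proof -
  define S where "S = (\<Union>i\<in>I. {t. poly (ps i) t = 0})"
  have fS: "finite S" using fin nz by (auto simp: S_def poly_roots_finite)
  have hbot: "filterlim h at_bot at_bot"
  proof (rule filterlim_at_bot[THEN iffD2], intro allI)
    fix z
    obtain x where "h x = z" using h(2) by (metis surjD)
    then have "h t \<le> z" if "t \<le> x" for t using that h(1) by (metis strict_mono_less_eq)
    then show "\<forall>\<^sub>F t in at_bot. h t \<le> z" using eventually_at_bot_linorder by blast
  qed
  have htop: "filterlim h at_top at_top"
  proof (rule filterlim_at_top[THEN iffD2], intro allI)
    fix z
    obtain x where "h x = z" using h(2) by (metis surjD)
    then have "z \<le> h t" if "x \<le> t" for t using that h(1) by (metis strict_mono_less_eq)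
    then show "\<forall>\<^sub>F t in at_top. z \<le> h t" using eventually_at_top_linorder by blast
  qed
  (* Near infinity the signs are those of the leading terms. *)
  have "\<forall>\<^sub>F t in at_bot. sgn (poly p t) = sgn (poly q (h t))"
    using poly_sgn_at_bot[of p] eventually_compose_filterlim[OF poly_sgn_at_bot[of q] hbot]
    by eventually_elim (use deg lead in simp)
  then obtain L where L: "\<And>t. t \<le> L \<Longrightarrow> sgn (poly p t) = sgn (poly q (h t))"
    by (auto simp: eventually_at_bot_linorder)
  have "\<forall>\<^sub>F t in at_top. sgn (poly p t) = sgn (poly q (h t))"
    using poly_sgn_at_top[of p] eventually_compose_filterlim[OF poly_sgn_at_top[of q] htop]
    by eventually_elim (use deg lead in simp)
  then obtain R where R: "\<And>t. R \<le> t \<Longrightarrow> sgn (poly p t) = sgn (poly q (h t))"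
    by (auto simp: eventually_at_top_linorder)
  show ?thesis
  proof (rule poly_sign_step_aux[where Z = "insert L (insert R S)" and R = R and l = L and h = h and ps = ps and qs = qs and I = I, OF _ _ _ i0])
    show "sgn (poly p z) = sgn (poly q (h z))" if "z \<in> insert L (insert R S)" for z
      using that L R roots by (auto simp: S_def)
  qed (use fS h match L R i0 in \<open>auto simp: S_def\<close>)
qed

section \<open>Predicates decided by the signs of polynomials\<close>

text \<open>The number of variables is left open, so that a formula can use coordinates beyond its
  free variables for quantified ones.\<close>

definition pfun :: "(rvec \<Rightarrow> real) \<Rightarrow> bool" where
  "pfun f \<longleftrightarrow> (\<exists>n. polynomial_fun n f)"

lemma polynomial_fun_mono: "polynomial_fun m f \<Longrightarrow> m \<le> n \<Longrightarrow> polynomial_fun n f"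
  by (induction rule: polynomial_fun.induct) (auto intro: polynomial_fun.intros)

lemma pfun_const [simp, intro]: "pfun (\<lambda>x. c)"
  unfolding pfun_def using polynomial_fun.const by blast

lemma pfun_coord [simp, intro]: "pfun (\<lambda>x. x i)"
  unfolding pfun_def by (rule exI[of _ "Suc i"]) (simp add: polynomial_fun.coord)

lemma pfun_add [intro]: "pfun f \<Longrightarrow> pfun g \<Longrightarrow> pfun (\<lambda>x. f x + g x)"
  unfolding pfun_def
  by (metis polynomial_fun.add polynomial_fun_mono max.cobounded1 max.cobounded2)

lemma pfun_mult [intro]: "pfun f \<Longrightarrow> pfun g \<Longrightarrow> pfun (\<lambda>x. f x * g x)"
  unfolding pfun_def
  by (metis polynomial_fun.mult polynomial_fun_mono max.cobounded1 max.cobounded2)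

lemma pfun_diff [intro]:
  assumes "pfun f" "pfun g"
  shows "pfun (\<lambda>x. f x - g x)"
  using pfun_add[OF assms(1) pfun_mult[OF pfun_const[of "-1"] assms(2)]] by simp

lemma pfun_uminus [intro]: "pfun f \<Longrightarrow> pfun (\<lambda>x. - f x)"
  using pfun_diff[OF pfun_const[of 0]] by simp

lemma pfun_sum [intro]: "(\<And>i. i \<in> A \<Longrightarrow> pfun (f i)) \<Longrightarrow> pfun (\<lambda>x. \<Sum>i\<in>A. f i x)"
  by (induction A rule: infinite_finite_induct) auto

lemma pfun_power [intro]: "pfun f \<Longrightarrow> pfun (\<lambda>x. f x ^ k)"
  by (induction k) auto

lemma pfun_induct [consumes 1, case_names const coord add mult]:
  assumes "pfun f" "\<And>c. P (\<lambda>x. c)" "\<And>i. P (\<lambda>x. x i)"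
    "\<And>f g. pfun f \<Longrightarrow> P f \<Longrightarrow> pfun g \<Longrightarrow> P g \<Longrightarrow> P (\<lambda>x. f x + g x)"
    "\<And>f g. pfun f \<Longrightarrow> P f \<Longrightarrow> pfun g \<Longrightarrow> P g \<Longrightarrow> P (\<lambda>x. f x * g x)"
  shows "P f"
proof -
  obtain n where "polynomial_fun n f" using assms(1) by (auto simp: pfun_def)
  then have "pfun f \<and> P f"
  proof (induction rule: polynomial_fun.induct)
    case (add f g)
    then show ?case using assms(4)[of f g] by auto
  next
    case (mult f g)
    then show ?case using assms(5)[of f g] by auto
  qed (use assms in auto)
  then show ?thesis by simp
qed

lemma pfun_subst:
  assumes "pfun f" "\<And>i. pfun (\<lambda>x. s x i)"
  shows "pfun (\<lambda>x. f (s x))"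
  using assms(1) by (induction rule: pfun_induct) (auto intro: assms(2))

definition sgn_equiv :: "(rvec \<Rightarrow> real) set \<Rightarrow> rvec \<Rightarrow> rvec \<Rightarrow> bool" where
  "sgn_equiv F x y \<longleftrightarrow> (\<forall>f\<in>F. sgn (f x) = sgn (f y))"

text \<open>A predicate is a Boolean combination of polynomial sign conditions if and only if the
  signs of finitely many polynomials determine its truth value. In this form the closure under
  Boolean connectives is immediate.\<close>

definition definable :: "(rvec \<Rightarrow> bool) \<Rightarrow> bool" where
  "definable P \<longleftrightarrow> (\<exists>F. finite F \<and> F \<subseteq> Collect pfun \<and> (\<forall>x y. sgn_equiv F x y \<longrightarrow> P x = P y))"

text \<open>The sign pattern of a family of polynomials in one variable is its sequence of common
  signs along the line, that is, the signs up to an increasing reparametrization. Here the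
  pattern depends on a parameter in \<open>X\<close> only through the signs of the finitely many functions in
  \<open>G\<close>.\<close>

definition uniform_signs :: "rvec set \<Rightarrow> (rvec \<Rightarrow> real poly) set \<Rightarrow> (rvec \<Rightarrow> real) set \<Rightarrow> bool" where
  "uniform_signs X M G \<longleftrightarrow> finite G \<and> G \<subseteq> Collect pfun \<and>
     (\<forall>x\<in>X. \<forall>y\<in>X. sgn_equiv G x y \<longrightarrow> (\<exists>h. strict_mono h \<and> surj h \<and>
        (\<forall>f\<in>M. \<forall>t. sgn (poly (f x) t) = sgn (poly (f y) (h t)))))"

lemma uniform_signsD:
  assumes "uniform_signs X M G" "x \<in> X" "y \<in> X" "sgn_equiv G x y"
  obtains h where "strict_mono h" "surj h"
    "\<And>f t. f \<in> M \<Longrightarrow> sgn (poly (f x) t) = sgn (poly (f y) (h t))"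
  using assms unfolding uniform_signs_def by meson

type_synonym ppoly = "(rvec \<Rightarrow> real poly) \<times> nat"

text \<open>The degrees are formal: they do not drop at parameters where a leading coefficient
  vanishes.\<close>

definition degree_family :: "rvec set \<Rightarrow> ppoly multiset \<Rightarrow> bool" where
  "degree_family X M \<longleftrightarrow> (\<forall>(f, d) \<in># M. (\<forall>j. pfun (\<lambda>x. coeff (f x) j)) \<and> (\<forall>x\<in>X. degree (f x) \<le> d))"

text \<open>One step of the pseudo-division of \<open>p\<close> by \<open>q\<close>. It lowers the formal degree, and at a root
  of \<open>q\<close> it differs from \<open>p\<close> only by the formal leading coefficient of \<open>q\<close>, so that its sign
  there gives the sign of \<open>p\<close>.\<close>

definition reduct :: "ppoly \<Rightarrow> ppoly \<Rightarrow> ppoly" where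
  "reduct = (\<lambda>(p, d) (q, e). (\<lambda>x. Polynomial.smult (coeff (q x) e) (p x) -
      Polynomial.smult (coeff (p x) d) (monom 1 (d - e) * q x), d - 1))"

lemma reduct_degree_family:
  assumes p: "\<And>j. pfun (\<lambda>x. coeff (p x) j)" "\<And>x. x \<in> X \<Longrightarrow> degree (p x) \<le> d"
    and q: "\<And>j. pfun (\<lambda>x. coeff (q x) j)" "\<And>x. x \<in> X \<Longrightarrow> degree (q x) \<le> e" and ed: "e \<le> d" "0 < d"
  shows "pfun (\<lambda>x. coeff (fst (reduct (p, d) (q, e)) x) j)"
    and "x \<in> X \<Longrightarrow> degree (fst (reduct (p, d) (q, e)) x) \<le> d - 1"
proof -
  have c: "coeff (fst (reduct (p, d) (q, e)) x) j = coeff (q x) e * coeff (p x) j -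
      coeff (p x) d * (if j < d - e then 0 else coeff (q x) (j - (d - e)))" for x j
    by (simp add: reduct_def coeff_monom_mult)
  show "pfun (\<lambda>x. coeff (fst (reduct (p, d) (q, e)) x) j)"
    unfolding c by (cases "j < d - e") (auto intro!: pfun_diff pfun_mult p q)
  show "degree (fst (reduct (p, d) (q, e)) x) \<le> d - 1" if x: "x \<in> X"
  proof (rule degree_le, intro allI impI)
    fix i assume "d - 1 < i"
    then have "i = d \<or> d < i \<and> e < i - (d - e)" using ed by auto
    then show "coeff (fst (reduct (p, d) (q, e)) x) i = 0"
      unfolding c using ed p(2)[OF x] q(2)[OF x] by (auto simp: coeff_eq_0)
  qed
qed

lemma reduct_root_sgn:
  assumes "poly (q x) t = 0"
  shows "poly (fst (reduct (p, d) (q, e)) x) t = coeff (q x) e * poly (p x) t"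
  using assms by (simp add: reduct_def)

text \<open>A polynomial \<open>p\<close> of maximal formal degree \<open>d\<close> is traded for its derivative and for the
  reducts of \<open>p\<close> by all other members. Their signs determine those of \<open>p\<close>, and \<open>d\<close> is replaced
  by finitely many smaller degrees, which is a descent in the multiset order.\<close>

lemma uniform_signs_exact:
  assumes X: "\<And>x f d. x \<in> X \<Longrightarrow> (f, d) \<in># M \<Longrightarrow> coeff (f x) d \<noteq> 0" and M: "degree_family X M"
    and IH: "\<And>M'. (image_mset snd M', image_mset snd M) \<in> Multiset.mult less_than \<Longrightarrow> degree_family X M' \<Longrightarrow>
      \<exists>G. uniform_signs X (fst ` set_mset M') G"
  shows "\<exists>G. uniform_signs X (fst ` set_mset M) G"
proof (cases "\<forall>(f, d) \<in># M. d = 0")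
  case True
  define G where "G = (\<lambda>(f, d) x. coeff (f x) 0) ` set_mset M"
  have "uniform_signs X (fst ` set_mset M) G"
    unfolding uniform_signs_def
  proof (intro conjI ballI impI)
    show "finite G" by (simp add: G_def)
    show "G \<subseteq> Collect pfun" using M by (auto simp: G_def degree_family_def)
    fix x y assume xy: "x \<in> X" "y \<in> X" "sgn_equiv G x y"
    have "sgn (poly (f x) t) = sgn (poly (f y) t)" if f: "(f, d) \<in># M" for f d t
    proof -
      have d: "d = 0" using bspec[OF True f] by simp
      have "degree (f z) = 0" if "z \<in> X" for z
        using bspec[OF M[unfolded degree_family_def] f] that d by simp
      then have "poly (f z) t = coeff (f z) 0" if "z \<in> X" for z t
        using that degree0_coeffs[of "f z"] by fastforce
      then have "poly (f x) t = coeff (f x) 0" "poly (f y) t = coeff (f y) 0" using xy by auto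
      moreover have "(\<lambda>x. coeff (f x) 0) \<in> G"
        unfolding G_def by (rule image_eqI[OF _ f]) simp
      ultimately show ?thesis using xy by (auto simp: sgn_equiv_def)
    qed
    then show "\<exists>h. strict_mono h \<and> surj h \<and>
        (\<forall>f\<in>fst ` set_mset M. \<forall>t. sgn (poly (f x) t) = sgn (poly (f y) (h t)))"
      by (intro exI[of _ id]) (auto simp: strict_mono_def)
  qed
  then show ?thesis by blast
next
  case False
  define d where "d = Max (snd ` set_mset M)"
  have ne: "snd ` set_mset M \<noteq> {}" using False by auto
  have dmax: "e \<le> d" if "(f, e) \<in># M" for f e
    unfolding d_def using that by (intro Max_ge) force+
  have d0: "0 < d" using False dmax by fastforce
  have "d \<in> snd ` set_mset M" unfolding d_def using ne by (intro Max_in) auto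
  then obtain p where p: "(p, d) \<in># M" by auto
  then obtain N where N: "M = add_mset (p, d) N" using multi_member_split[OF p] by blast
  (* The derivative makes p monotone between the roots of N'; the reducts give its sign at these roots. *)
  define N' where "N' = add_mset (\<lambda>x. pderiv (p x), d - 1) N"
  define M' where "M' = N' + image_mset (reduct (p, d)) N'"
  have pdeg: "pfun (\<lambda>x. coeff (p x) j)" "x \<in> X \<Longrightarrow> degree (p x) \<le> d" for j x
    using M p by (auto simp: degree_family_def)
  have N'deg: "(\<forall>j. pfun (\<lambda>x. coeff (q x) j)) \<and> (\<forall>x\<in>X. degree (q x) \<le> e) \<and> e \<le> d"
    if "(q, e) \<in># N'" for q e
  proof (cases "(q, e) \<in># N")
    case True
    then show ?thesis using M dmax[of q e] by (auto simp: degree_family_def N)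
  next
    case False
    then have "q = (\<lambda>x. pderiv (p x))" "e = d - 1" using that by (auto simp: N'_def)
    then show ?thesis using pdeg(2)
      by (simp add: coeff_pderiv degree_pderiv pfun_mult pdeg(1) diff_le_mono)
  qed
  have M'deg: "degree_family X M'"
    unfolding degree_family_def
  proof (rule ballI)
    fix c assume "c \<in># M'"
    then consider "c \<in># N'" | q e where "(q, e) \<in># N'" "c = reduct (p, d) (q, e)"
      unfolding M'_def by auto
    then show "case c of (f, d) \<Rightarrow> (\<forall>j. pfun (\<lambda>x. coeff (f x) j)) \<and> (\<forall>x\<in>X. degree (f x) \<le> d)"
    proof cases
      case 1
      then show ?thesis using N'deg by (cases c) auto
    next
      case 2
      have "snd c = d - 1" by (simp add: 2 reduct_def)
      then show ?thesis
        using reduct_degree_family[of p X d q e, OF pdeg] N'deg[OF 2(1)] d0 2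
        by (cases c) auto
    qed
  qed
  have "(image_mset snd M', image_mset snd M) \<in> Multiset.mult less_than"
  proof -
    have "(image_mset snd N + add_mset (d - 1) (image_mset (\<lambda>c. d - 1) N'), image_mset snd N + {#d#})
        \<in> Multiset.mult less_than"
      using d0 by (intro one_step_implies_mult) auto
    moreover have "image_mset snd (image_mset (reduct (p, d)) N') = image_mset (\<lambda>c. d - 1) N'"
      unfolding multiset.map_comp by (rule image_mset_cong) (simp add: reduct_def split: prod.splits)
    moreover have "image_mset snd N' = add_mset (d - 1) (image_mset snd N)" by (simp add: N'_def)
    ultimately show ?thesis by (simp add: M'_def N)
  qed
  then obtain G where G: "uniform_signs X (fst ` set_mset M') G" using IH M'deg by blast
  define G' where "G' = G \<union> (\<lambda>(f, d) x. coeff (f x) d) ` set_mset M"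
  have "uniform_signs X (fst ` set_mset M) G'"
    unfolding uniform_signs_def
  proof (intro conjI ballI impI)
    show "finite G'" "G' \<subseteq> Collect pfun" using G M by (auto simp: uniform_signs_def G'_def degree_family_def)
    fix x y assume xy: "x \<in> X" "y \<in> X" "sgn_equiv G' x y"
    then have "sgn_equiv G x y" by (auto simp: sgn_equiv_def G'_def)
    then obtain h where h: "strict_mono h" "surj h"
      and hs: "\<And>f t. f \<in> fst ` set_mset M' \<Longrightarrow> sgn (poly (f x) t) = sgn (poly (f y) (h t))"
      using uniform_signsD[OF G xy(1,2)] by blast
    have leadM: "sgn (coeff (f x) e) = sgn (coeff (f y) e)" if "(f, e) \<in># M" for f e
    proof -
      have "(\<lambda>x. coeff (f x) e) \<in> G'"
        unfolding G'_def by (rule UnI2, rule image_eqI[OF _ that]) simp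
      then show ?thesis using xy(3) by (auto simp: sgn_equiv_def)
    qed
    have lead: "coeff (q x) e \<noteq> 0 \<and> sgn (coeff (q x) e) = sgn (coeff (q y) e)" if "(q, e) \<in># N'" for q e
    proof (cases "(q, e) \<in># N")
      case True
      then have "(q, e) \<in># M" by (simp add: N)
      then show ?thesis using X[OF xy(1)] leadM by auto
    next
      case False
      then have "q = (\<lambda>x. pderiv (p x))" "e = d - 1" using that by (auto simp: N'_def)
      then show ?thesis using X[OF xy(1) p] leadM[OF p] d0
        by (simp add: coeff_pderiv sgn_mult del: of_nat_Suc)
    qed
    have dp: "degree (p z) = d" if "z \<in> X" for z
      using pdeg(2)[OF that] X[OF that p] by (simp add: le_antisym le_degree)
    have "\<exists>h. strict_mono h \<and> surj h \<and>
        (\<forall>f\<in>fst ` set_mset N'. \<forall>t. sgn (poly (f x) t) = sgn (poly (f y) (h t))) \<and>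
        (\<forall>t. sgn (poly (p x) t) = sgn (poly (p y) (h t)))"
    proof (rule poly_sign_step[where ps = "\<lambda>f. f x" and qs = "\<lambda>f. f y" and k = "\<lambda>x. pderiv (p x)", OF h])
      show "f x \<noteq> 0" if "f \<in> fst ` set_mset N'" for f
      proof -
        obtain e where "(f, e) \<in># N'" using \<open>f \<in> fst ` set_mset N'\<close> by auto
        then show ?thesis using lead[of f e] by auto
      qed
      show s: "sgn (poly (f x) t) = sgn (poly (f y) (h t))" if "f \<in> fst ` set_mset N'" for f t
        using hs[of f t] that by (auto simp: M'_def)
      show "degree (p x) = degree (p y)" using dp xy by simp
      show "sgn (lead_coeff (p x)) = sgn (lead_coeff (p y))" using dp xy leadM[OF p] by simp
      show "sgn (poly (p x) t) = sgn (poly (p y) (h t))"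
        if f: "f \<in> fst ` set_mset N'" and t: "poly (f x) t = 0" for f t
      proof -
        obtain e where fe: "(f, e) \<in># N'" using f by auto
        have "poly (f y) (h t) = 0" using s[OF f, of t] t by (auto simp: sgn_if split: if_splits)
        moreover have "fst (reduct (p, d) (f, e)) \<in> fst ` set_mset M'" using fe by (auto simp: M'_def)
        ultimately have "sgn (coeff (f x) e * poly (p x) t) = sgn (coeff (f y) e * poly (p y) (h t))"
          using hs[of "fst (reduct (p, d) (f, e))" t] reduct_root_sgn[of f x t p d e]
            reduct_root_sgn[of f y "h t" p d e] t by simp
        then show ?thesis using lead[OF fe] by (auto simp: sgn_mult sgn_zero_iff)
      qed
    qed (auto simp: N'_def)
    then show "\<exists>h. strict_mono h \<and> surj h \<and>
        (\<forall>f\<in>fst ` set_mset M. \<forall>t. sgn (poly (f x) t) = sgn (poly (f y) (h t)))"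
      by (auto simp: N N'_def)
  qed
  then show ?thesis by blast
qed

text \<open>Where a formal leading coefficient vanishes, its formal degree can be lowered; where none
  of them vanishes, the preceding lemma applies. The signs of the leading coefficients tell the
  finitely many cases apart.\<close>

lemma uniform_signs_exists:
  "degree_family X M \<Longrightarrow> \<exists>G. uniform_signs X (fst ` set_mset M) G"
proof (induction "image_mset snd M" arbitrary: X M rule: wf_induct_rule[OF wf_mult[OF wf_less_than]])
  case 1
  have IH: "\<exists>G. uniform_signs Y (fst ` set_mset N) G"
    if "(image_mset snd N, image_mset snd M) \<in> Multiset.mult less_than" "degree_family Y N" for Y N
    using that by (rule 1(1))
  note M = 1(2)
  define Xz where "Xz c = {x \<in> X. coeff (fst c x) (snd c) = 0}" for c :: ppoly
  have sub: "\<exists>G. uniform_signs (Xz c) (fst ` set_mset M) G" if c: "c \<in># M" for c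
  proof -
    obtain f d where fd: "c = (f, d)" by (cases c)
    obtain N where N: "M = add_mset (f, d) N" using multi_member_split[OF c] fd by blast
    show ?thesis
    proof (cases d)
      case 0
      have "(image_mset snd N + {#}, image_mset snd N + {#d#}) \<in> Multiset.mult less_than"
        by (intro one_step_implies_mult) auto
      moreover have "degree_family (Xz c) N" using M by (auto simp: degree_family_def Xz_def N)
      ultimately obtain G where G: "uniform_signs (Xz c) (fst ` set_mset N) G"
        using IH[of N "Xz c"] by (auto simp: N)
      have z: "f x = 0" if "x \<in> Xz c" for x
      proof -
        have "degree (f x) = 0" "coeff (f x) 0 = 0" using that M by (auto simp: degree_family_def Xz_def N fd 0)
        then show ?thesis using leading_coeff_0_iff by metis
      qed
      have "uniform_signs (Xz c) (fst ` set_mset M) G"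
        using G z unfolding uniform_signs_def N by simp
      then show ?thesis by blast
    next
      case (Suc e)
      have "(image_mset snd N + {#e#}, image_mset snd N + {#d#}) \<in> Multiset.mult less_than"
        by (intro one_step_implies_mult) (auto simp: Suc)
      moreover have "degree_family (Xz c) (add_mset (f, e) N)"
      proof -
        have "degree (f x) \<le> e" if "x \<in> Xz c" for x
        proof -
          have "degree (f x) \<le> Suc e" "coeff (f x) (Suc e) = 0"
            using that M by (auto simp: degree_family_def Xz_def N fd Suc)
          then show ?thesis using leading_coeff_0_iff
            by (metis degree_0 le_SucE zero_le)
        qed
        then show ?thesis using M by (auto simp: degree_family_def Xz_def N)
      qed
      ultimately show ?thesis using IH[of "add_mset (f, e) N" "Xz c"] by (simp add: N fd)
    qed
  qed
  then obtain GG where GG: "\<And>c. c \<in># M \<Longrightarrow> uniform_signs (Xz c) (fst ` set_mset M) (GG c)"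
    by metis
  define X1 where "X1 = {x \<in> X. \<forall>c\<in>#M. coeff (fst c x) (snd c) \<noteq> 0}"
  have "\<exists>G. uniform_signs X1 (fst ` set_mset M) G"
  proof (rule uniform_signs_exact)
    show "coeff (f x) d \<noteq> 0" if "x \<in> X1" "(f, d) \<in># M" for x f d using that by (auto simp: X1_def)
    show "degree_family X1 M" using M by (auto simp: degree_family_def X1_def)
    show "\<exists>G. uniform_signs X1 (fst ` set_mset M') G"
      if "(image_mset snd M', image_mset snd M) \<in> Multiset.mult less_than" "degree_family X1 M'" for M'
      using that by (rule IH)
  qed
  then obtain G1 where G1: "uniform_signs X1 (fst ` set_mset M) G1" by blast
  define G where "G = G1 \<union> (\<Union>c\<in>set_mset M. GG c) \<union> (\<lambda>c x. coeff (fst c x) (snd c)) ` set_mset M"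
  have "uniform_signs X (fst ` set_mset M) G"
    unfolding uniform_signs_def
  proof (intro conjI ballI impI)
    show "finite G" using G1 GG unfolding G_def by (simp add: uniform_signs_def)
    have "GG c \<subseteq> Collect pfun" if "c \<in># M" for c using GG[OF that] by (simp add: uniform_signs_def)
    moreover have "G1 \<subseteq> Collect pfun" using G1 by (simp add: uniform_signs_def)
    moreover have "pfun (\<lambda>x. coeff (fst c x) (snd c))" if "c \<in># M" for c
      using M that by (cases c) (auto simp: degree_family_def)
    ultimately show "G \<subseteq> Collect pfun" unfolding G_def by blast
    fix x y assume xy: "x \<in> X" "y \<in> X" "sgn_equiv G x y"
    have lead: "coeff (fst c x) (snd c) = 0 \<longleftrightarrow> coeff (fst c y) (snd c) = 0" if "c \<in># M" for c
    proof -
      have "(\<lambda>x. coeff (fst c x) (snd c)) \<in> G" using that by (auto simp: G_def)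
      from bspec[OF xy(3)[unfolded sgn_equiv_def] this] show ?thesis
        by (auto simp: sgn_if split: if_splits)
    qed
    show "\<exists>h. strict_mono h \<and> surj h \<and>
        (\<forall>f\<in>fst ` set_mset M. \<forall>t. sgn (poly (f x) t) = sgn (poly (f y) (h t)))"
    proof (cases "x \<in> X1")
      case True
      then have "y \<in> X1" using lead xy by (auto simp: X1_def)
      moreover have "sgn_equiv G1 x y" using xy(3) by (auto simp: sgn_equiv_def G_def)
      ultimately show ?thesis using G1 True unfolding uniform_signs_def by blast
    next
      case False
      then obtain c where c: "c \<in># M" "x \<in> Xz c" using xy by (auto simp: X1_def Xz_def)
      moreover have "y \<in> Xz c" using lead[OF c(1)] c xy by (auto simp: Xz_def)
      moreover have "sgn_equiv (GG c) x y" using xy(3) c by (auto simp: sgn_equiv_def G_def)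
      ultimately show ?thesis using GG[OF c(1)] unfolding uniform_signs_def by blast
    qed
  qed
  then show ?case by blast
qed

lemma pfun_as_poly:
  assumes "pfun f"
  shows "\<exists>F d. (\<forall>j. pfun (\<lambda>x. coeff (F x) j)) \<and> (\<forall>x. degree (F x) \<le> d) \<and>
    (\<forall>x t. f (x(i := t)) = poly (F x) t)"
  using assms
proof (induction rule: pfun_induct)
  case (const c)
  show ?case by (rule exI[of _ "\<lambda>x. [:c:]"]) (auto simp: coeff_pCons split: nat.splits)
next
  case (coord k)
  show ?case
  proof (cases "k = i")
    case True
    then show ?thesis
      by (intro exI[of _ "\<lambda>x. [:0, 1:]"] exI[of _ 1]) (auto simp: coeff_pCons split: nat.splits)
  next
    case False
    have "pfun (\<lambda>x. coeff [:x k:] j)" for j by (cases j) auto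
    then show ?thesis using False by (intro exI[of _ "\<lambda>x. [:x k:]"] exI[of _ 0]) auto
  qed
next
  case (add f g)
  then obtain F d G e where FG: "\<forall>j. pfun (\<lambda>x. coeff (F x) j)" "\<forall>x. degree (F x) \<le> d"
    "\<forall>x t. f (x(i := t)) = poly (F x) t" "\<forall>j. pfun (\<lambda>x. coeff (G x) j)" "\<forall>x. degree (G x) \<le> e"
    "\<forall>x t. g (x(i := t)) = poly (G x) t" by metis
  then have "degree (F x + G x) \<le> max d e" for x
    by (intro degree_add_le) (auto intro: max.coboundedI1 max.coboundedI2)
  then show ?case using FG
    by (intro exI[of _ "\<lambda>x. F x + G x"] exI[of _ "max d e"])
      (auto simp del: fun_upd_apply)
next
  case (mult f g)
  then obtain F d G e where "\<forall>j. pfun (\<lambda>x. coeff (F x) j)" "\<forall>x. degree (F x) \<le> d"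
    "\<forall>x t. f (x(i := t)) = poly (F x) t" "\<forall>j. pfun (\<lambda>x. coeff (G x) j)" "\<forall>x. degree (G x) \<le> e"
    "\<forall>x t. g (x(i := t)) = poly (G x) t" by metis
  then show ?case
    by (intro exI[of _ "\<lambda>x. F x * G x"] exI[of _ "d + e"])
      (auto simp del: fun_upd_apply simp: coeff_mult intro!: pfun_sum pfun_mult order_trans[OF degree_mult_le] add_mono)
qed

text \<open>The reparametrization of the line that matches the sign patterns at \<open>x\<close> and at \<open>y\<close> carries
  a witness for \<open>x\<close> to a witness for \<open>y\<close>. This is the theorem of Tarski and Seidenberg for one
  quantifier.\<close>

lemma definable_ex:
  assumes "definable P"
  shows "definable (\<lambda>x. \<exists>t. P (x(i := t)))"
proof -
  obtain F where F: "finite F" "F \<subseteq> Collect pfun" "\<And>x y. sgn_equiv F x y \<Longrightarrow> P x = P y"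
    using assms by (auto simp: definable_def)
  have "\<forall>f\<in>F. \<exists>H d. (\<forall>j. pfun (\<lambda>x. coeff (H x) j)) \<and> (\<forall>x. degree (H x) \<le> d) \<and>
    (\<forall>x t. f (x(i := t)) = poly (H x) t)"
    using F(2) pfun_as_poly by auto
  then obtain H d where H: "\<And>f j. f \<in> F \<Longrightarrow> pfun (\<lambda>x. coeff (H f x) j)"
    "\<And>f x. f \<in> F \<Longrightarrow> degree (H f x) \<le> d f" "\<And>f x t. f \<in> F \<Longrightarrow> f (x(i := t)) = poly (H f x) t"
    by metis
  define M where "M = mset_set ((\<lambda>f. (H f, d f)) ` F)"
  have M: "set_mset M = (\<lambda>f. (H f, d f)) ` F" using F(1) by (simp add: M_def)
  have "degree_family UNIV M" using H by (auto simp: degree_family_def M)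
  then obtain G where G: "uniform_signs UNIV (fst ` set_mset M) G" using uniform_signs_exists by blast
  have imp: "\<exists>t. P (y(i := t))" if xy: "sgn_equiv G x y" and t: "P (x(i := t))" for x y t
  proof -
    obtain h where "strict_mono h" "surj h" and h: "\<And>f t. f \<in> fst ` set_mset M \<Longrightarrow> sgn (poly (f x) t) = sgn (poly (f y) (h t))"
      by (rule uniform_signsD[OF G UNIV_I UNIV_I xy], rule that)
    have "sgn_equiv F (x(i := t)) (y(i := h t))"
      unfolding sgn_equiv_def
    proof (rule ballI)
      fix f assume f: "f \<in> F"
      then have "H f \<in> fst ` set_mset M" by (auto simp: M image_image)
      then show "sgn (f (x(i := t))) = sgn (f (y(i := h t)))"
        using h[of "H f" t] by (simp only: H(3)[OF f])
    qed
    then show ?thesis using F(3) t by blast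
  qed
  have sym: "sgn_equiv G y x" if "sgn_equiv G x y" for x y using that by (simp add: sgn_equiv_def)
  have "(\<exists>t. P (x(i := t))) = (\<exists>t. P (y(i := t)))" if "sgn_equiv G x y" for x y
    using imp[OF that] imp[OF sym[OF that]] by blast
  then show ?thesis unfolding definable_def
    using G by (intro exI[of _ G]) (simp add: uniform_signs_def)
qed

lemma definable_const [intro]: "definable (\<lambda>x. b)"
  unfolding definable_def by (rule exI[of _ "{}"]) simp

lemma definable_not [intro]: "definable P \<Longrightarrow> definable (\<lambda>x. \<not> P x)"
  unfolding definable_def by auto

lemma definable_bin:
  assumes "definable P" "definable Q"
  shows "definable (\<lambda>x. b (P x) (Q x))"
proof -
  obtain F G where "finite F" "F \<subseteq> Collect pfun" "\<And>x y. sgn_equiv F x y \<Longrightarrow> P x = P y"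
    "finite G" "G \<subseteq> Collect pfun" "\<And>x y. sgn_equiv G x y \<Longrightarrow> Q x = Q y"
    using assms unfolding definable_def by metis
  moreover from this have "b (P x) (Q x) = b (P y) (Q y)" if "sgn_equiv (F \<union> G) x y" for x y
  proof -
    have "P x = P y" "Q x = Q y" using \<open>sgn_equiv (F \<union> G) x y\<close> calculation
      by (simp_all add: sgn_equiv_def ball_Un)
    then show ?thesis by simp
  qed
  ultimately show ?thesis unfolding definable_def by (intro exI[of _ "F \<union> G"]) simp
qed

lemma definable_conj [intro]: "definable P \<Longrightarrow> definable Q \<Longrightarrow> definable (\<lambda>x. P x \<and> Q x)"
  by (rule definable_bin)

lemma definable_disj [intro]: "definable P \<Longrightarrow> definable Q \<Longrightarrow> definable (\<lambda>x. P x \<or> Q x)"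
  by (rule definable_bin)

lemma definable_pos [intro]:
  assumes "pfun f"
  shows "definable (\<lambda>x. 0 < f x)"
  unfolding definable_def using assms
  by (intro exI[of _ "{f}"]) (auto simp: sgn_equiv_def sgn_if split: if_splits)

lemma definable_less [intro]:
  assumes "pfun f" "pfun g"
  shows "definable (\<lambda>x. f x < g x)"
  using definable_pos[OF pfun_diff[OF assms(2,1)]] by simp

lemma definable_eq [intro]:
  assumes "pfun f" "pfun g"
  shows "definable (\<lambda>x. f x = g x)"
proof -
  have "(\<lambda>x. f x = g x) = (\<lambda>x. \<not> f x < g x \<and> \<not> g x < f x)" by (rule ext) linarith
  then show ?thesis by (auto intro!: definable_conj definable_not definable_less assms simp del: not_less)
qed

lemma definable_le [intro]:
  assumes "pfun f" "pfun g"
  shows "definable (\<lambda>x. f x \<le> g x)"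
proof -
  have "(\<lambda>x. f x \<le> g x) = (\<lambda>x. \<not> g x < f x)" by (rule ext) linarith
  then show ?thesis by (auto intro!: definable_conj definable_not definable_less assms simp del: not_less)
qed

lemma definable_ball [intro]:
  "finite A \<Longrightarrow> (\<And>i. i \<in> A \<Longrightarrow> definable (P i)) \<Longrightarrow> definable (\<lambda>x. \<forall>i\<in>A. P i x)"
  by (induction A rule: finite_induct) auto

lemma definable_bex [intro]:
  "finite A \<Longrightarrow> (\<And>i. i \<in> A \<Longrightarrow> definable (P i)) \<Longrightarrow> definable (\<lambda>x. \<exists>i\<in>A. P i x)"
  by (induction A rule: finite_induct) auto

lemma definable_all_less [intro]:
  fixes n :: nat
  assumes "\<And>i. i < n \<Longrightarrow> definable (P i)"
  shows "definable (\<lambda>x. \<forall>i<n. P i x)"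
proof -
  have "definable (\<lambda>x. \<forall>i\<in>{..<n}. P i x)" using assms by (intro definable_ball) auto
  then show ?thesis by (simp only: Ball_def lessThan_iff)
qed

lemma definable_subst:
  assumes "definable P" "\<And>i. pfun (\<lambda>x. s x i)"
  shows "definable (\<lambda>x. P (s x))"
proof -
  obtain F where "finite F" "F \<subseteq> Collect pfun" "\<And>x y. sgn_equiv F x y \<Longrightarrow> P x = P y"
    using assms(1) unfolding definable_def by metis
  then show ?thesis unfolding definable_def using pfun_subst[where s = s, OF _ assms(2)]
    by (intro exI[of _ "(\<lambda>f x. f (s x)) ` F"]) (auto simp: sgn_equiv_def)
qed

section \<open>Semialgebraic sets and the Tarski-Seidenberg theorem\<close>

abbreviation "euc \<equiv> Euclidean_space"
abbreviation "vecs n \<equiv> topspace (euc n)"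
abbreviation "semialg n \<equiv> semialgebraic (Some n)"
abbreviation "points M \<equiv> topspace (ntop M)"

lemma vecs_iff: "x \<in> vecs n \<longleftrightarrow> (\<forall>i\<ge>n. x i = 0)"
  by (simp add: topspace_Euclidean_space)

lemma vfst_in [simp]: "vfst n x \<in> vecs n"
  by (simp add: vecs_iff vfst_def)

lemma vfst_id [simp]: "x \<in> vecs n \<Longrightarrow> vfst n x = x"
  by (auto simp: vecs_iff vfst_def)

lemma pfun_vfst:
  assumes "pfun f"
  shows "polynomial_fun n (\<lambda>x. f (vfst n x))"
  using assms
proof (induction rule: pfun_induct)
  case (coord i)
  then show ?case
    by (cases "i < n") (auto simp: vfst_def intro: polynomial_fun.intros)
qed (auto intro: polynomial_fun.intros)

text \<open>Each vector \<open>\<sigma>\<close> of signs cuts out a basic semialgebraic set, and the set in question is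
  the union of those on which \<open>P\<close> holds somewhere, hence everywhere.\<close>

lemma definable_imp_semialgebraic:
  assumes "definable P"
  shows "semialg n {x \<in> vecs n. P x}"
proof -
  obtain F where F: "finite F" "F \<subseteq> Collect pfun" "\<And>x y. sgn_equiv F x y \<Longrightarrow> P x = P y"
    using assms unfolding definable_def by metis
  define C where "C \<sigma> = {x \<in> vecs n. \<forall>f\<in>F. sgn (f x) = \<sigma> f}" for \<sigma> :: "(rvec \<Rightarrow> real) \<Rightarrow> real"
  define \<Sigma> where "\<Sigma> = {\<sigma> \<in> F \<rightarrow>\<^sub>E {-1, 0, 1}. \<exists>x. x \<in> C \<sigma> \<and> P x}"
  have "finite \<Sigma>" unfolding \<Sigma>_def using F(1) by (simp add: finite_PiE)
  moreover have "basic_semialgebraic n (C \<sigma>)" if "\<sigma> \<in> \<Sigma>" for \<sigma>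
  proof -
    define A where "A = (\<lambda>f x. f (vfst n x)) ` {f \<in> F. \<sigma> f = 1} \<union>
       (\<lambda>f x. - f (vfst n x)) ` {f \<in> F. \<sigma> f = -1}"
    define B where "B = (\<lambda>f x. f (vfst n x)) ` {f \<in> F. \<sigma> f = 0}"
    have "polynomial_fun n f" if "f \<in> A \<union> B" for f
    proof -
      have "polynomial_fun n (\<lambda>x. - g (vfst n x))" if "g \<in> F" for g
        using pfun_vfst[OF pfun_uminus[of g], of n] F(2) that by auto
      then show ?thesis using \<open>f \<in> A \<union> B\<close> F(2) by (auto simp: A_def B_def intro!: pfun_vfst)
    qed
    moreover have "C \<sigma> = {x \<in> vecs n. (\<forall>f\<in>A. f x > 0) \<and> (\<forall>g\<in>B. g x = 0)}"
    proof -
      have "(\<forall>f\<in>F. sgn (f x) = \<sigma> f) \<longleftrightarrow> (\<forall>f\<in>A. f x > 0) \<and> (\<forall>g\<in>B. g x = 0)" if x: "x \<in> vecs n" for x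
      proof -
        have tri: "\<sigma> f = 1 \<or> \<sigma> f = -1 \<or> \<sigma> f = 0" if "f \<in> F" for f
          using \<open>\<sigma> \<in> \<Sigma>\<close> that unfolding \<Sigma>_def by (fastforce dest: PiE_mem)
        have "sgn (f x) = \<sigma> f \<longleftrightarrow> (\<sigma> f = 1 \<longrightarrow> 0 < f x) \<and> (\<sigma> f = -1 \<longrightarrow> f x < 0) \<and> (\<sigma> f = 0 \<longrightarrow> f x = 0)"
          if "f \<in> F" for f
          using tri[OF that] by (elim disjE) (auto simp: sgn_if)
        moreover have "(\<forall>f\<in>A. f x > 0) \<longleftrightarrow> (\<forall>f\<in>F. (\<sigma> f = 1 \<longrightarrow> 0 < f x) \<and> (\<sigma> f = -1 \<longrightarrow> f x < 0))"
          using x unfolding A_def by (simp add: ball_Un) blast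
        moreover have "(\<forall>g\<in>B. g x = 0) \<longleftrightarrow> (\<forall>f\<in>F. \<sigma> f = 0 \<longrightarrow> f x = 0)"
          using x unfolding B_def by auto
        ultimately show ?thesis by blast
      qed
      then show ?thesis unfolding C_def by blast
    qed
    ultimately show ?thesis unfolding basic_semialgebraic_def
      using F(1) by (intro exI[of _ A] exI[of _ B]) (auto simp: A_def B_def)
  qed
  moreover have "{x \<in> vecs n. P x} = \<Union>(C ` \<Sigma>)"
  proof (intro equalityI subsetI)
    fix x assume x: "x \<in> {x \<in> vecs n. P x}"
    define \<sigma> where "\<sigma> = (\<lambda>f\<in>F. sgn (f x))"
    have "x \<in> C \<sigma>" using x by (auto simp: C_def \<sigma>_def)
    moreover have "\<sigma> \<in> \<Sigma>" using x \<open>x \<in> C \<sigma>\<close> unfolding \<Sigma>_def by (auto simp: \<sigma>_def sgn_if)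
    ultimately show "x \<in> \<Union>(C ` \<Sigma>)" by blast
  next
    fix x assume "x \<in> \<Union>(C ` \<Sigma>)"
    then obtain \<sigma> y where "x \<in> C \<sigma>" "y \<in> C \<sigma>" "P y" by (auto simp: \<Sigma>_def)
    then show "x \<in> {x \<in> vecs n. P x}" using F(3)[of x y] by (auto simp: C_def sgn_equiv_def)
  qed
  ultimately show ?thesis by (auto intro!: exI[of _ "C ` \<Sigma>"])
qed

lemma semialgebraic_imp_definable:
  assumes "semialg n S"
  obtains P where "definable P" "S = {x \<in> vecs n. P x}"
proof -
  obtain F where F: "finite F" "\<And>B. B \<in> F \<Longrightarrow> basic_semialgebraic n B" "S = \<Union>F"
    using assms by auto
  have "\<forall>B\<in>F. \<exists>Q. definable Q \<and> B = {x \<in> vecs n. Q x}"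
  proof
    fix B assume "B \<in> F"
    then obtain P Q where "finite P" "finite Q" "\<forall>f \<in> P \<union> Q. polynomial_fun n f"
      "B = {x \<in> vecs n. (\<forall>f\<in>P. f x > 0) \<and> (\<forall>g\<in>Q. g x = 0)}"
      using F(2)[OF \<open>B \<in> F\<close>] unfolding basic_semialgebraic_def by blast
    moreover then have "definable (\<lambda>x. (\<forall>f\<in>P. f x > 0) \<and> (\<forall>g\<in>Q. g x = 0))"
      by (intro definable_conj definable_ball definable_pos definable_eq) (auto simp: pfun_def)
    ultimately show "\<exists>Q. definable Q \<and> B = {x \<in> vecs n. Q x}" by blast
  qed
  then obtain Q where Q: "\<And>B. B \<in> F \<Longrightarrow> definable (Q B)" "\<And>B. B \<in> F \<Longrightarrow> B = {x \<in> vecs n. Q B x}"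
    by metis
  show ?thesis
  proof (rule that)
    show "definable (\<lambda>x. \<exists>B\<in>F. Q B x)" using F(1) Q(1) by blast
    show "S = {x \<in> vecs n. \<exists>B\<in>F. Q B x}" unfolding F(3) using Q(2) by blast
  qed
qed

lemma semialgebraic_subset: "semialg n S \<Longrightarrow> S \<subseteq> vecs n"
  by (erule semialgebraic_imp_definable) blast

lemma definable_mem:
  assumes "semialg n S" "\<And>i. i < n \<Longrightarrow> pfun (\<lambda>x. s x i)" "\<And>x. s x \<in> vecs n"
  shows "definable (\<lambda>x. s x \<in> S)"
proof -
  obtain P where P: "definable P" "S = {x \<in> vecs n. P x}" using semialgebraic_imp_definable[OF assms(1)] .
  have "pfun (\<lambda>x. s x i)" for i
    using assms(2)[of i] assms(3) by (cases "i < n") (auto simp: vecs_iff)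
  then show ?thesis using definable_subst[OF P(1), of s] assms(3) by (simp add: P(2))
qed

section \<open>Semialgebraic maps\<close>

lemma pfun_if_const: "(b \<Longrightarrow> pfun f) \<Longrightarrow> (\<not> b \<Longrightarrow> pfun g) \<Longrightarrow> pfun (\<lambda>x. if b then f x else g x)"
  by (cases b) simp_all

lemma pfun_vfst_entry: "(\<And>j. pfun (\<lambda>w. s w j)) \<Longrightarrow> pfun (\<lambda>w. vfst m (s w) i)"
  by (cases "i < m") (simp_all add: vfst_def)

lemma pfun_vsnd_entry: "(\<And>j. pfun (\<lambda>w. s w j)) \<Longrightarrow> pfun (\<lambda>w. vsnd m (s w) i)"
  by (simp add: vsnd_def)

lemma pfun_vjoin_entry:
  "(\<And>j. pfun (\<lambda>w. s w j)) \<Longrightarrow> (\<And>j. pfun (\<lambda>w. t w j)) \<Longrightarrow> pfun (\<lambda>w. vjoin m (s w) (t w) i)"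
  by (cases "i < m") (simp_all add: vjoin_def)

lemma pfun_upd_entry:
  "(\<And>j. pfun (\<lambda>w. s w j)) \<Longrightarrow> pfun t \<Longrightarrow> pfun (\<lambda>w. ((s w)(i := t w)) j)"
  by (cases "j = i") simp_all

lemmas pfun_entry = pfun_if_const pfun_vfst_entry pfun_vsnd_entry pfun_vjoin_entry pfun_upd_entry pfun_coord pfun_const

lemma if_in_vecs [simp]: "(\<lambda>i. if i < n then f i else 0) \<in> vecs n"
  by (simp add: vecs_iff)

lemma definable_ex_vjoin:
  "definable Q \<Longrightarrow> definable (\<lambda>z. \<exists>y\<in>vecs n. Q (vjoin N z y))"
proof (induction n arbitrary: Q)
  case 0
  have "vecs 0 = {\<lambda>i. 0}" by (auto simp: vecs_iff)
  moreover have "definable (\<lambda>z. Q (vjoin N z (\<lambda>i. 0)))"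
  proof (rule definable_subst[OF 0])
    show "pfun (\<lambda>x. vjoin N x (\<lambda>i. 0) i)" for i by (cases "i < N") (auto simp: vjoin_def)
  qed
  ultimately show ?case by simp
next
  case (Suc n)
  have eq: "(vjoin N z y)(N + n := t) = vjoin N z (y(n := t))" for z y t
    by (auto simp: vjoin_def fun_eq_iff)
  have "(\<exists>y\<in>vecs (Suc n). Q (vjoin N z y)) \<longleftrightarrow> (\<exists>y\<in>vecs n. \<exists>t. Q ((vjoin N z y)(N + n := t)))" for z
  proof
    assume "\<exists>y\<in>vecs (Suc n). Q (vjoin N z y)"
    then obtain y where y: "y \<in> vecs (Suc n)" "Q (vjoin N z y)" by blast
    have "y(n := 0) \<in> vecs n" using y(1) by (auto simp: vecs_iff)
    moreover have "Q (vjoin N z ((y(n := 0))(n := y n)))" using y(2) by simp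
    ultimately show "\<exists>y\<in>vecs n. \<exists>t. Q ((vjoin N z y)(N + n := t))" unfolding eq by blast
  next
    assume "\<exists>y\<in>vecs n. \<exists>t. Q ((vjoin N z y)(N + n := t))"
    then obtain y t where y: "y \<in> vecs n" "Q (vjoin N z (y(n := t)))" unfolding eq by blast
    have "y(n := t) \<in> vecs (Suc n)" using y(1) by (auto simp: vecs_iff)
    then show "\<exists>y\<in>vecs (Suc n). Q (vjoin N z y)" using y(2) by blast
  qed
  then show ?case using Suc.IH[OF definable_ex[OF Suc.prems, of "N + n"]] by (simp del: fun_upd_apply)
qed

lemma definable_ex_vec:
  assumes "definable (\<lambda>w. P (vfst N w) (\<lambda>i. if i < n then w (N + i) else 0))"
  shows "definable (\<lambda>z. \<exists>y\<in>vecs n. P (vfst N z) y)"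
proof -
  have "vfst N (vjoin N z y) = vfst N z" for z y by (auto simp: vfst_def vjoin_def)
  moreover have "(\<lambda>i. if i < n then vjoin N z y (N + i) else 0) = y" if "y \<in> vecs n" for z y
    using that by (auto simp: vjoin_def vecs_iff)
  ultimately show ?thesis using definable_ex_vjoin[OF assms, of n N] by simp
qed

lemma semialgebraic_ex_vec:
  assumes "definable (\<lambda>w. P (vfst N w) (\<lambda>i. if i < n then w (N + i) else 0))"
  shows "semialg N {z \<in> vecs N. \<exists>y\<in>vecs n. P z y}"
proof -
  have "{z \<in> vecs N. \<exists>y\<in>vecs n. P z y} = {z \<in> vecs N. \<exists>y\<in>vecs n. P (vfst N z) y}" by auto
  then show ?thesis using definable_imp_semialgebraic[OF definable_ex_vec[of P N n, OF assms], of N] by simp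
qed

lemma semialgebraic_Int:
  assumes "semialg n S" "semialg n T"
  shows "semialg n (S \<inter> T)"
proof -
  obtain P Q where "definable P" "S = {x \<in> vecs n. P x}" "definable Q" "T = {x \<in> vecs n. Q x}"
    using assms semialgebraic_imp_definable by metis
  moreover from this have "S \<inter> T = {x \<in> vecs n. P x \<and> Q x}" by auto
  ultimately show ?thesis using definable_imp_semialgebraic[OF definable_conj] by metis
qed

lemma semialgebraic_Un:
  assumes "semialg n S" "semialg n T"
  shows "semialg n (S \<union> T)"
proof -
  obtain P Q where "definable P" "S = {x \<in> vecs n. P x}" "definable Q" "T = {x \<in> vecs n. Q x}"
    using assms semialgebraic_imp_definable by metis
  moreover from this have "S \<union> T = {x \<in> vecs n. P x \<or> Q x}" by auto
  ultimately show ?thesis using definable_imp_semialgebraic[OF definable_disj] by metis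
qed

lemma semialgebraic_empty: "semialg n {}"
  using definable_imp_semialgebraic[of "\<lambda>x. False" n] by (simp add: definable_const del: semialgebraic.simps)

lemma semialgebraic_vecs: "semialg n (vecs n)"
  using definable_imp_semialgebraic[of "\<lambda>x. True" n] by (simp add: definable_const del: semialgebraic.simps)

lemma semialgebraic_UN:
  "finite I \<Longrightarrow> (\<And>i. i \<in> I \<Longrightarrow> semialg n (S i)) \<Longrightarrow> semialg n (\<Union>i\<in>I. S i)"
proof (induction I rule: finite_induct)
  case empty
  then show ?case using semialgebraic_empty by simp
next
  case (insert i I)
  then show ?case using semialgebraic_Un[of n "S i" "\<Union>i\<in>I. S i"] by simp
qed

lemma vjoin_in_vecs [simp]: "vjoin m x y \<in> vecs (m + n) \<longleftrightarrow> y \<in> vecs n"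
proof
  assume *: "vjoin m x y \<in> vecs (m + n)"
  have "y i = 0" if "n \<le> i" for i
  proof -
    have "vjoin m x y (m + i) = 0" using * that by (simp add: vecs_iff)
    then show ?thesis by (simp add: vjoin_def)
  qed
  then show "y \<in> vecs n" by (simp add: vecs_iff)
qed (auto simp: vecs_iff vjoin_def)

lemma vfst_vjoin [simp]: "x \<in> vecs m \<Longrightarrow> vfst m (vjoin m x y) = x"
  by (auto simp: vfst_def vjoin_def vecs_iff)

lemma vsnd_vjoin [simp]: "vsnd m (vjoin m x y) = y"
  by (auto simp: vsnd_def vjoin_def)

lemma vjoin_vfst_vsnd [simp]: "vjoin m (vfst m z) (vsnd m z) = z"
  by (auto simp: vsnd_def vjoin_def vfst_def)

lemma vsnd_in_vecs [simp]: "z \<in> vecs (m + n) \<Longrightarrow> vsnd m z \<in> vecs n"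
  by (auto simp: vsnd_def vecs_iff)

lemma vjoin_inject:
  "x \<in> vecs m \<Longrightarrow> x' \<in> vecs m \<Longrightarrow> vjoin m x y = vjoin m x' y' \<longleftrightarrow> x = x' \<and> y = y'"
  by (metis vfst_vjoin vsnd_vjoin)

definition graph_of :: "nat \<Rightarrow> rvec set \<Rightarrow> (rvec \<Rightarrow> rvec) \<Rightarrow> rvec set" where
  "graph_of m D f = (\<lambda>x. vjoin m x (f x)) ` D"

lemma vjoin_in_graph:
  assumes "D \<subseteq> vecs m" "x \<in> vecs m"
  shows "vjoin m x y \<in> graph_of m D f \<longleftrightarrow> x \<in> D \<and> y = f x"
proof -
  have "vjoin m x y = vjoin m x' (f x') \<longleftrightarrow> x = x' \<and> y = f x'" if "x' \<in> D" for x'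
    using vjoin_inject[of x m x'] assms that by blast
  then show ?thesis by (auto simp: graph_of_def image_iff)
qed

text \<open>Membership in the graph as a relation between two vectors, into which other maps can be
  substituted.\<close>

definition on_graph :: "rvec set \<Rightarrow> (rvec \<Rightarrow> rvec) \<Rightarrow> rvec \<Rightarrow> rvec \<Rightarrow> bool" where
  "on_graph D f x y \<longleftrightarrow> x \<in> D \<and> y = f x"

abbreviation "smap m n \<equiv> semialgebraic_map (Some m) (Some n)"

lemma smap_iff:
  "smap m n D E f \<longleftrightarrow> semialg m D \<and> semialg n E \<and> f \<in> D \<rightarrow> E \<and>
     semialg (m + n) (graph_of m D f)"
  by (simp add: semialgebraic_map_def graph_of_def del: semialgebraic.simps)

lemma definable_graph:
  assumes "smap m n D E f" "\<And>i. i < m \<Longrightarrow> pfun (\<lambda>w. s w i)" "\<And>i. i < n \<Longrightarrow> pfun (\<lambda>w. t w i)"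
    "\<And>w. s w \<in> vecs m" "\<And>w. t w \<in> vecs n"
  shows "definable (\<lambda>w. on_graph D f (s w) (t w))"
proof -
  have D: "D \<subseteq> vecs m" using assms(1) semialgebraic_subset by (simp add: smap_iff del: semialgebraic.simps)
  have "definable (\<lambda>w. vjoin m (s w) (t w) \<in> graph_of m D f)"
  proof (rule definable_mem)
    show "semialg (m + n) (graph_of m D f)" using assms(1) by (simp add: smap_iff del: semialgebraic.simps)
    show "pfun (\<lambda>x. vjoin m (s x) (t x) i)" if "i < m + n" for i
      using assms(2)[of i] assms(3)[of "i - m"] that by (cases "i < m") (auto simp: vjoin_def)
  qed (use assms in simp)
  then show ?thesis using vjoin_in_graph[OF D assms(4)] by (simp add: on_graph_def)
qed

lemma smap_preimage:
  assumes f: "smap m n D E f" and S: "semialg n S"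
  shows "semialg m {x \<in> D. f x \<in> S}"
proof -
  have D: "D \<subseteq> vecs m" "E \<subseteq> vecs n" "f \<in> D \<rightarrow> E"
    using assms(1) semialgebraic_subset by (simp_all add: smap_iff del: semialgebraic.simps)
  have "semialg m {x \<in> vecs m. \<exists>y\<in>vecs n. on_graph D f x y \<and> y \<in> S}"
    by (intro semialgebraic_ex_vec definable_conj definable_graph[OF f] definable_mem[OF S])
      (auto intro!: pfun_entry)
  moreover have "{x \<in> vecs m. \<exists>y\<in>vecs n. on_graph D f x y \<and> y \<in> S} = {x \<in> D. f x \<in> S}"
    using D by (auto simp: on_graph_def)
  ultimately show ?thesis by metis
qed

lemma smap_semialgebraicD: "smap m n D E f \<Longrightarrow> semialg m D"
  "smap m n D E f \<Longrightarrow> semialg n E" "smap m n D E f \<Longrightarrow> f \<in> D \<rightarrow> E"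
  by (simp_all add: smap_iff del: semialgebraic.simps)

lemma smap_subsetD: "smap m n D E f \<Longrightarrow> D \<subseteq> vecs m" "smap m n D E f \<Longrightarrow> E \<subseteq> vecs n"
  using smap_semialgebraicD semialgebraic_subset by metis+

lemma smapI:
  assumes "semialg m D" "semialg n E" "f \<in> D \<rightarrow> E"
    "definable P" "\<And>x y. x \<in> vecs m \<Longrightarrow> y \<in> vecs n \<Longrightarrow> P (vjoin m x y) \<longleftrightarrow> x \<in> D \<and> y = f x"
  shows "smap m n D E f"
proof -
  have D: "D \<subseteq> vecs m" "E \<subseteq> vecs n" using assms(1,2) semialgebraic_subset by blast+
  have "graph_of m D f = {z \<in> vecs (m + n). P z}"
  proof (intro equalityI subsetI)
    fix z assume "z \<in> graph_of m D f"
    then obtain x where x: "x \<in> D" "z = vjoin m x (f x)" by (auto simp: graph_of_def)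
    then have "x \<in> vecs m" "f x \<in> vecs n" using D assms(3) by auto
    then show "z \<in> {z \<in> vecs (m + n). P z}" using x assms(5)[of x "f x"] by simp
  next
    fix z assume z: "z \<in> {z \<in> vecs (m + n). P z}"
    then have "vfst m z \<in> D \<and> vsnd m z = f (vfst m z)" using assms(5)[of "vfst m z" "vsnd m z"] by simp
    then have "vjoin m (vfst m z) (vsnd m z) \<in> graph_of m D f"
      using vjoin_in_graph[OF D(1), of "vfst m z" "vsnd m z" f] by (simp del: vjoin_vfst_vsnd)
    then show "z \<in> graph_of m D f" by simp
  qed
  then show ?thesis using assms definable_imp_semialgebraic[OF assms(4), of "m + n"]
    by (simp add: smap_iff del: semialgebraic.simps)
qed

lemma smap_compose:
  assumes f: "smap m n D E f" and g: "smap n k E' G g" and sub: "\<And>x. x \<in> D \<Longrightarrow> f x \<in> E'"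
  shows "smap m k D G (\<lambda>x. g (f x))"
proof (rule smapI)
  note D = smap_subsetD[OF f] smap_subsetD[OF g] smap_semialgebraicD(3)[OF f] smap_semialgebraicD(3)[OF g]
  show "semialg m D" "semialg k G"
    using f g smap_semialgebraicD by blast+
  show "(\<lambda>x. g (f x)) \<in> D \<rightarrow> G" using D sub by auto
  let ?P = "\<lambda>z y. on_graph D f (vfst m z) y \<and> on_graph E' g y (vfst k (vsnd m z))"
  show "definable (\<lambda>z. \<exists>y\<in>vecs n. ?P (vfst (m + k) z) y)"
    by (rule definable_ex_vec, intro definable_conj definable_graph[OF f] definable_graph[OF g])
      (auto intro!: pfun_entry)
  show "(\<exists>y\<in>vecs n. ?P (vfst (m + k) (vjoin m x z)) y) \<longleftrightarrow> x \<in> D \<and> z = g (f x)"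
    if "x \<in> vecs m" "z \<in> vecs k" for x z
    using that D sub by (auto simp: on_graph_def)
qed

lemma smap_codomain:
  assumes "smap m n D E f" "semialg n E'" "\<And>x. x \<in> D \<Longrightarrow> f x \<in> E'"
  shows "smap m n D E' f"
  using assms by (auto simp: smap_iff simp del: semialgebraic.simps)

lemma smap_cong:
  assumes "smap m n D E f" "\<And>x. x \<in> D \<Longrightarrow> f x = g x"
  shows "smap m n D E g"
proof -
  have "graph_of m D g = graph_of m D f" using assms(2) by (auto simp: graph_of_def image_iff)
  then show ?thesis using assms by (auto simp: smap_iff Pi_iff simp del: semialgebraic.simps)
qed

lemma smap_restrict:
  assumes f: "smap m n D E f" and D': "semialg m D'" "D' \<subseteq> D"
  shows "smap m n D' E f"
proof (rule smapI[OF D'(1)])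
  show "semialg n E" using f smap_semialgebraicD by blast
  show "f \<in> D' \<rightarrow> E" using smap_semialgebraicD(3)[OF f] D' by auto
  show "definable (\<lambda>z. vfst m z \<in> D' \<and> on_graph D f (vfst m z) (vfst n (vsnd m z)))"
    by (intro definable_conj definable_graph[OF f] definable_mem[OF D'(1)]) (auto intro!: pfun_entry)
  show "(vfst m (vjoin m x y) \<in> D' \<and> on_graph D f (vfst m (vjoin m x y)) (vfst n (vsnd m (vjoin m x y)))) \<longleftrightarrow> x \<in> D' \<and> y = f x"
    if "x \<in> vecs m" "y \<in> vecs n" for x y using that D'(2) by (auto simp: on_graph_def)
qed

lemma smap_UN:
  assumes I: "finite I" and f: "\<And>i. i \<in> I \<Longrightarrow> smap m n (D i) E f" and E: "semialg n E"
  shows "smap m n (\<Union>i\<in>I. D i) E f"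
proof -
  have "graph_of m (\<Union>i\<in>I. D i) f = (\<Union>i\<in>I. graph_of m (D i) f)" by (auto simp: graph_of_def)
  then show ?thesis unfolding smap_iff
    using semialgebraic_UN[OF I, of m D] semialgebraic_UN[OF I, of "m + n" "\<lambda>i. graph_of m (D i) f"] f E
    by (auto simp: smap_iff simp del: semialgebraic.simps)
qed

text \<open>Real-valued semialgebraic functions are described by predicates and not by graphs, so that
  a function can be given by an equation between polynomials. The predicate reads the argument
  in the first \<open>m\<close> entries and the value in the next one.\<close>

definition sfun :: "nat \<Rightarrow> rvec set \<Rightarrow> (rvec \<Rightarrow> real) \<Rightarrow> bool" where
  "sfun m D h \<longleftrightarrow> semialg m D \<and>
     (\<exists>P. definable P \<and> (\<forall>x\<in>vecs m. \<forall>t. P (x(m := t)) \<longleftrightarrow> x \<in> D \<and> t = h x))"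

lemma smap_component:
  assumes f: "smap m n D E f"
  shows "sfun m D (\<lambda>x. f x i)"
  unfolding sfun_def
proof (intro conjI exI ballI allI)
  show "semialg m D" using smap_semialgebraicD[OF f] by blast
  let ?P = "\<lambda>z y. on_graph D f (vfst m z) y \<and> z m = y i"
  show "definable (\<lambda>z. \<exists>y\<in>vecs n. ?P (vfst (Suc m) z) y)"
    by (rule definable_ex_vec, intro definable_conj definable_graph[OF f] definable_eq)
      (auto intro!: pfun_entry)
  fix x t assume x: "x \<in> vecs m"
  have "vfst m (vfst (Suc m) (x(m := t))) = x" "vfst (Suc m) (x(m := t)) m = t"
    using x by (auto simp: vfst_def vecs_iff)
  then show "(\<exists>y\<in>vecs n. ?P (vfst (Suc m) (x(m := t))) y) \<longleftrightarrow> x \<in> D \<and> t = f x i"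
    using smap_subsetD(2)[OF f] smap_semialgebraicD(3)[OF f] by (auto simp: on_graph_def simp del: fun_upd_apply)
qed

lemma smap_of_components:
  assumes D: "semialg m D" and E: "semialg n E" and f: "f \<in> D \<rightarrow> E"
    and c: "\<And>i. i < n \<Longrightarrow> sfun m D (\<lambda>x. f x i)"
  shows "smap m n D E f"
proof -
  obtain P where P: "\<And>i. i < n \<Longrightarrow> definable (P i)"
      "\<And>i x t. i < n \<Longrightarrow> x \<in> vecs m \<Longrightarrow> P i (x(m := t)) \<longleftrightarrow> x \<in> D \<and> t = f x i"
    using c unfolding sfun_def by metis
  show ?thesis
  proof (rule smapI[OF D E f])
    show "definable (\<lambda>z. vfst m z \<in> D \<and> (\<forall>i<n. P i ((vfst m z)(m := z (m + i)))))"
    proof (intro definable_conj definable_all_less definable_mem[OF D])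
      show "definable (\<lambda>z. P i ((vfst m z)(m := z (m + i))))" if "i < n" for i
        by (rule definable_subst[OF P(1)[OF that]]) (intro pfun_entry)
    qed (auto intro!: pfun_entry)
    fix x y assume x: "x \<in> vecs m" and y: "y \<in> vecs n"
    have "y = f x" if "\<forall>i<n. y i = f x i" "x \<in> D"
    proof -
      have "f x \<in> vecs n" using that(2) f semialgebraic_subset[OF E] by auto
      then show ?thesis using that(1) y by (intro ext) (metis vecs_iff not_le)
    qed
    moreover have "vjoin m x y (m + i) = y i" for i by (simp add: vjoin_def)
    ultimately show "(vfst m (vjoin m x y) \<in> D \<and> (\<forall>i<n. P i ((vfst m (vjoin m x y))(m := vjoin m x y (m + i)))))
        \<longleftrightarrow> x \<in> D \<and> y = f x"
      using P(2) x y by (auto simp del: fun_upd_apply)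
  qed
qed

lemma sfun_of_definable:
  assumes "semialg m D" "definable P"
    "\<And>x t. x \<in> D \<Longrightarrow> P (x(m := t)) \<longleftrightarrow> t = h x"
  shows "sfun m D h"
  unfolding sfun_def
proof (intro conjI exI ballI allI)
  show "semialg m D" by fact
  show "definable (\<lambda>z. vfst m z \<in> D \<and> P z)"
    by (intro definable_conj definable_mem[OF assms(1)] assms(2)) (auto intro!: pfun_entry)
  fix x t assume x: "x \<in> vecs m"
  have "vfst m (x(m := t)) = x" using x by (auto simp: vfst_def vecs_iff)
  then show "(vfst m (x(m := t)) \<in> D \<and> P (x(m := t))) \<longleftrightarrow> x \<in> D \<and> t = h x" using assms(3) by auto
qed

lemma sfun_pfun:
  assumes "semialg m D" "pfun p"
  shows "sfun m D p"
proof (rule sfun_of_definable[OF assms(1)])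
  show "definable (\<lambda>z. z m = p (vfst m z))"
    by (intro definable_eq pfun_subst[OF assms(2)] pfun_entry)
  fix x t assume "x \<in> D"
  then have "x \<in> vecs m" using semialgebraic_subset[OF assms(1)] by auto
  then have "vfst m (x(m := t)) = x" by (auto simp: vfst_def vecs_iff)
  then show "((x(m := t)) m = p (vfst m (x(m := t)))) \<longleftrightarrow> t = p x" by simp
qed

lemma sfun_cong: "sfun m D f \<Longrightarrow> (\<And>x. x \<in> D \<Longrightarrow> f x = g x) \<Longrightarrow> sfun m D g"
  unfolding sfun_def by (metis (no_types, lifting))

lemma smap_pfun:
  assumes "semialg m D" "semialg n E" "f \<in> D \<rightarrow> E"
    "\<And>i. i < n \<Longrightarrow> pfun (\<lambda>x. f x i)"
  shows "smap m n D E f"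
  using assms by (intro smap_of_components sfun_pfun)

section \<open>Calculus of partial derivatives\<close>

text \<open>All but \<open>n\<close> coordinates are constant, so the product topology is given by boxes in the
  first \<open>n\<close> coordinates.\<close>

lemma openin_Euclidean_box:
  "openin (euc n) U \<longleftrightarrow> U \<subseteq> vecs n \<and>
     (\<forall>x\<in>U. \<exists>e>0. \<forall>y\<in>vecs n. (\<forall>i<n. \<bar>y i - x i\<bar> < e) \<longrightarrow> y \<in> U)"
proof
  assume U: "openin (euc n) U"
  have "\<exists>e>0. \<forall>y\<in>vecs n. (\<forall>i<n. \<bar>y i - x i\<bar> < e) \<longrightarrow> y \<in> U" if x: "x \<in> U" for x
  proof -
    obtain T where T: "openin (powertop_real UNIV) T" "U = T \<inter> {x. \<forall>i\<ge>n. x i = 0}"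
      using U unfolding Euclidean_space_def openin_subtopology by blast
    obtain X where X: "x \<in> (\<Pi>\<^sub>E i\<in>UNIV. X i)" "\<And>i. openin euclideanreal (X i)"
      "finite {i. X i \<noteq> topspace euclideanreal}" "(\<Pi>\<^sub>E i\<in>UNIV. X i) \<subseteq> T"
      using product_topology_open_contains_basis[OF T(1), of x] x T(2) by blast
    have "\<exists>e>0. \<forall>t. \<bar>t - x i\<bar> < e \<longrightarrow> t \<in> X i" for i
    proof -
      have "open (X i)" "x i \<in> X i" using X(1,2) by (auto simp: PiE_iff)
      then show ?thesis by (meson open_real)
    qed
    then obtain e where e: "\<And>i. e i > 0" "\<And>i t. \<bar>t - x i\<bar> < e i \<Longrightarrow> t \<in> X i" by metis
    define d where "d = Min (insert 1 (e ` {..<n}))"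
    have "d > 0" unfolding d_def using e(1) by (subst Min_gr_iff) auto
    have d: "d \<le> e i" if "i < n" for i unfolding d_def using that by (intro Min_le) auto
    have "y \<in> U" if y: "y \<in> vecs n" "\<forall>i<n. \<bar>y i - x i\<bar> < d" for y
    proof -
      have "y i \<in> X i" for i
      proof (cases "i < n")
        case True
        then show ?thesis using d[OF True] y(2) e(2)[of "y i" i] by force
      next
        case False
        then have "y i = x i" using y(1) x T(2) by (simp add: vecs_iff)
        then show ?thesis using e(1)[of i] e(2)[of "x i" i] by simp
      qed
      then have "y \<in> T" using X(4) by (auto simp: PiE_iff)
      then show ?thesis using T(2) y(1) by (simp add: vecs_iff)
    qed
    then show ?thesis using \<open>d > 0\<close> by blast
  qed
  then show "U \<subseteq> vecs n \<and> (\<forall>x\<in>U. \<exists>e>0. \<forall>y\<in>vecs n. (\<forall>i<n. \<bar>y i - x i\<bar> < e) \<longrightarrow> y \<in> U)"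
    using openin_subset[OF U] by blast
next
  assume U: "U \<subseteq> vecs n \<and> (\<forall>x\<in>U. \<exists>e>0. \<forall>y\<in>vecs n. (\<forall>i<n. \<bar>y i - x i\<bar> < e) \<longrightarrow> y \<in> U)"
  have "\<exists>T. openin (euc n) T \<and> x \<in> T \<and> T \<subseteq> U" if x: "x \<in> U" for x
  proof -
    obtain e where e: "e > 0" "\<And>y. y \<in> vecs n \<Longrightarrow> (\<And>i. i < n \<Longrightarrow> \<bar>y i - x i\<bar> < e) \<Longrightarrow> y \<in> U"
      using U x by meson
    define B where "B i = {y \<in> vecs n. y i \<in> ball (x i) e}" for i
    have "continuous_map (euc n) euclideanreal (\<lambda>y. y i)" for i
      unfolding Euclidean_space_def
      by (intro continuous_map_from_subtopology continuous_map_product_projection) simp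
    then have B: "openin (euc n) (B i)" for i
      unfolding B_def by (rule openin_continuous_map_preimage) simp
    have "openin (euc n) (vecs n \<inter> (\<Inter>i\<in>{..<n}. B i))"
    proof (cases "n = 0")
      case False
      then have "openin (euc n) (\<Inter>i\<in>{..<n}. B i)" using B by (intro openin_INT2) auto
      then show ?thesis by blast
    qed simp
    moreover have "x \<in> vecs n \<inter> (\<Inter>i\<in>{..<n}. B i)" using U x e(1) by (auto simp: B_def)
    moreover have "vecs n \<inter> (\<Inter>i\<in>{..<n}. B i) \<subseteq> U"
      using e(2) by (fastforce simp: B_def dist_real_def abs_minus_commute)
    ultimately show ?thesis by blast
  qed
  then show "openin (euc n) U" by (subst openin_subopen) blast
qed

lemma continuous_map_open_subtopology:
  assumes U: "openin X U"
  shows "continuous_map (subtopology X U) Y f \<longleftrightarrow>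
    f \<in> U \<rightarrow> topspace Y \<and> (\<forall>W. openin Y W \<longrightarrow> openin X {x \<in> U. f x \<in> W})"
proof -
  have ts: "topspace (subtopology X U) = U" using openin_subset[OF U] by auto
  have "openin (subtopology X U) {x \<in> U. f x \<in> W} \<longleftrightarrow> openin X {x \<in> U. f x \<in> W}" for W
    using openin_open_subtopology[OF U, of "{x \<in> U. f x \<in> W}"] by auto
  then show ?thesis unfolding continuous_map_def ts by simp
qed

lemma open_boxE:
  assumes "openin (euc n) U" "x \<in> U"
  obtains e where "e > 0" "\<And>y. y \<in> vecs n \<Longrightarrow> (\<And>i. i < n \<Longrightarrow> \<bar>y i - x i\<bar> < e) \<Longrightarrow> y \<in> U"
  using assms unfolding openin_Euclidean_box by meson

lemma open_subset_vecs: "openin (euc n) U \<Longrightarrow> U \<subseteq> vecs n"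
  using openin_subset by blast

lemma continuous_boxE:
  assumes U: "openin (euc n) U"
    and f: "continuous_map (subtopology (euc n) U) euclideanreal f"
    and x: "x \<in> U" and e: "0 < (e::real)"
  obtains d where "d > 0" "\<And>y. y \<in> vecs n \<Longrightarrow> (\<And>i. i < n \<Longrightarrow> \<bar>y i - x i\<bar> < d) \<Longrightarrow> y \<in> U \<and> \<bar>f y - f x\<bar> < e"
proof -
  have "openin euclideanreal (ball (f x) e)" by simp
  then have "openin (euc n) {y \<in> U. f y \<in> ball (f x) e}"
    using f unfolding continuous_map_open_subtopology[OF U] by blast
  then obtain d where "d > 0"
    "\<And>y. y \<in> vecs n \<Longrightarrow> (\<And>i. i < n \<Longrightarrow> \<bar>y i - x i\<bar> < d) \<Longrightarrow> y \<in> {y \<in> U. f y \<in> ball (f x) e}"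
    using open_boxE[of n "{y \<in> U. f y \<in> ball (f x) e}" x] x e by auto
  then show ?thesis
    by (intro that[of d]) (auto simp: dist_real_def abs_minus_commute)
qed

lemma eventually_upd_in_open:
  assumes U: "openin (euc n) U" and x: "x \<in> U" and i: "i < n"
  shows "\<forall>\<^sub>F t in nhds (x i). x(i := t) \<in> U"
proof -
  obtain e where e: "e > 0" "\<And>y. y \<in> vecs n \<Longrightarrow> (\<And>i. i < n \<Longrightarrow> \<bar>y i - x i\<bar> < e) \<Longrightarrow> y \<in> U"
    using open_boxE[OF U x] by blast
  have xn: "x \<in> vecs n" using open_subset_vecs[OF U] x by auto
  have "x(i := t) \<in> U" if "dist t (x i) < e" for t
  proof (rule e(2))
    show "x(i := t) \<in> vecs n" using xn i by (auto simp: vecs_iff)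
  qed (use that e(1) in \<open>auto simp: dist_real_def\<close>)
  then show ?thesis using e(1) eventually_nhds_metric by blast
qed

lemma Ck_continuous: "Ck_on k n U f \<Longrightarrow> continuous_map (subtopology (euc n) U) euclideanreal f"
  by (cases k) auto

lemma Ck_Suc_imp: "Ck_on (Suc k) n U f \<Longrightarrow> Ck_on k n U f"
proof (induction k arbitrary: f)
  case 0
  then show ?case by simp
next
  case (Suc k)
  show ?case unfolding Ck_on.simps(2)
  proof (intro conjI allI impI)
    show "continuous_map (subtopology (euc n) U) euclideanreal f" using Ck_continuous[OF Suc.prems] .
    fix i assume "i < n"
    then obtain g where "\<forall>x\<in>U. ((\<lambda>t. f (x(i := t))) has_real_derivative g x) (at (x i))" "Ck_on (Suc k) n U g"
      using Suc.prems unfolding Ck_on.simps(2)[of "Suc k"] by blast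
    then show "\<exists>g. (\<forall>x\<in>U. ((\<lambda>t. f (x(i := t))) has_real_derivative g x) (at (x i))) \<and> Ck_on k n U g"
      using Suc.IH by blast
  qed
qed

lemma Ck_cong:
  assumes U: "openin (euc n) U"
  shows "Ck_on k n U f \<Longrightarrow> (\<And>x. x \<in> U \<Longrightarrow> f x = g x) \<Longrightarrow> Ck_on k n U g"
proof (induction k arbitrary: f g)
  case 0
  then show ?case by (auto elim!: continuous_map_eq)
next
  case (Suc k)
  show ?case unfolding Ck_on.simps(2)
  proof (intro conjI allI impI)
    show "continuous_map (subtopology (euc n) U) euclideanreal g"
      using Ck_continuous[OF Suc.prems(1)] Suc.prems(2) by (auto elim!: continuous_map_eq)
    fix i assume i: "i < n"
    then obtain h where h: "\<forall>x\<in>U. ((\<lambda>t. f (x(i := t))) has_real_derivative h x) (at (x i))" "Ck_on k n U h"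
      using Suc.prems unfolding Ck_on.simps(2) by blast
    have "((\<lambda>t. g (x(i := t))) has_real_derivative h x) (at (x i))" if x: "x \<in> U" for x
    proof -
      have "\<forall>\<^sub>F t in nhds (x i). f (x(i := t)) = g (x(i := t))"
        using eventually_upd_in_open[OF U x i] by eventually_elim (rule Suc.prems(2))
      then show ?thesis using h(1) x DERIV_cong_ev[of "x i" "x i" "\<lambda>t. f (x(i := t))" "\<lambda>t. g (x(i := t))"] by auto
    qed
    then show "\<exists>h. (\<forall>x\<in>U. ((\<lambda>t. g (x(i := t))) has_real_derivative h x) (at (x i))) \<and> Ck_on k n U h"
      using h(2) by blast
  qed
qed

lemma Ck_subset: "Ck_on k n U f \<Longrightarrow> V \<subseteq> U \<Longrightarrow> Ck_on k n V f"
proof (induction k arbitrary: f)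
  case 0
  then show ?case by (auto intro: continuous_map_from_subtopology_mono)
next
  case (Suc k)
  then show ?case unfolding Ck_on.simps(2)
    by (metis continuous_map_from_subtopology_mono subsetD)
qed

lemma continuous_local:
  assumes U: "openin (euc n) U"
    and loc: "\<And>x. x \<in> U \<Longrightarrow> \<exists>V. openin (euc n) V \<and> x \<in> V \<and> V \<subseteq> U \<and>
      continuous_map (subtopology (euc n) V) Y f"
  shows "continuous_map (subtopology (euc n) U) Y f"
proof -
  have "openin (euc n) {x \<in> U. f x \<in> W}" if W: "openin Y W" for W
  proof (subst openin_subopen, intro ballI)
    fix x assume x: "x \<in> {x \<in> U. f x \<in> W}"
    then obtain V where V: "openin (euc n) V" "x \<in> V" "V \<subseteq> U"
      "continuous_map (subtopology (euc n) V) Y f" using loc by blast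
    have "openin (euc n) {y \<in> V. f y \<in> W}"
      using V(4) W unfolding continuous_map_open_subtopology[OF V(1)] by blast
    then show "\<exists>T. openin (euc n) T \<and> x \<in> T \<and> T \<subseteq> {x \<in> U. f x \<in> W}"
      using V x by (intro exI[of _ "{y \<in> V. f y \<in> W}"]) auto
  qed
  moreover have "f \<in> U \<rightarrow> topspace Y"
  proof
    fix x assume "x \<in> U"
    then obtain V where V: "openin (euc n) V" "x \<in> V"
      "continuous_map (subtopology (euc n) V) Y f" using loc by blast
    then show "f x \<in> topspace Y" unfolding continuous_map_open_subtopology[OF V(1)] by blast
  qed
  ultimately show ?thesis unfolding continuous_map_open_subtopology[OF U] by blast
qed

lemma Ck_local:
  assumes U: "openin (euc n) U"
  shows "(\<And>x. x \<in> U \<Longrightarrow> \<exists>V. openin (euc n) V \<and> x \<in> V \<and> V \<subseteq> U \<and> Ck_on k n V f) \<Longrightarrow> Ck_on k n U f"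
proof (induction k arbitrary: f)
  case 0
  then show ?case unfolding Ck_on.simps(1) by (rule continuous_local[OF U])
next
  case (Suc k)
  show ?case unfolding Ck_on.simps(2)
  proof (intro conjI allI impI)
    show "continuous_map (subtopology (euc n) U) euclideanreal f"
      using continuous_local[OF U] Suc.prems Ck_continuous by meson
    fix i assume i: "i < n"
    define g where "g x = deriv (\<lambda>t. f (x(i := t))) (x i)" for x
    have *: "\<exists>V. openin (euc n) V \<and> x \<in> V \<and> V \<subseteq> U \<and> Ck_on k n V g \<and>
        ((\<lambda>t. f (x(i := t))) has_real_derivative g x) (at (x i))" if "x \<in> U" for x
    proof -
      obtain V where V: "openin (euc n) V" "x \<in> V" "V \<subseteq> U" "Ck_on (Suc k) n V f"
        using Suc.prems[OF \<open>x \<in> U\<close>] by blast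
      then obtain h where h: "\<forall>x\<in>V. ((\<lambda>t. f (x(i := t))) has_real_derivative h x) (at (x i))" "Ck_on k n V h"
        using i unfolding Ck_on.simps(2) by blast
      then have "h y = g y" if "y \<in> V" for y
        unfolding g_def using that DERIV_imp_deriv[of "\<lambda>t. f (y(i := t))" "h y" "y i"] by simp
      then show ?thesis using Ck_cong[OF V(1) h(2)] V h(1) by metis
    qed
    then have "Ck_on k n U g" using Suc.IH by meson
    then show "\<exists>g. (\<forall>x\<in>U. ((\<lambda>t. f (x(i := t))) has_real_derivative g x) (at (x i))) \<and> Ck_on k n U g"
      using * by blast
  qed
qed

lemma Ck_SucI:
  assumes "continuous_map (subtopology (euc n) U) euclideanreal f"
    "\<And>i x. i < n \<Longrightarrow> x \<in> U \<Longrightarrow> ((\<lambda>t. f (x(i := t))) has_real_derivative g i x) (at (x i))"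
    "\<And>i. i < n \<Longrightarrow> Ck_on k n U (g i)"
  shows "Ck_on (Suc k) n U f"
  using assms unfolding Ck_on.simps(2) by blast

lemma Ck_SucE:
  assumes "Ck_on (Suc k) n U f"
  obtains g where "\<And>i x. i < n \<Longrightarrow> x \<in> U \<Longrightarrow> ((\<lambda>t. f (x(i := t))) has_real_derivative g i x) (at (x i))"
    "\<And>i. i < n \<Longrightarrow> Ck_on k n U (g i)"
  using assms unfolding Ck_on.simps(2) by metis

lemma Ck_const: "Ck_on k n U (\<lambda>x. c)"
proof (induction k arbitrary: c)
  case (Suc k)
  show ?case by (rule Ck_SucI[where g = "\<lambda>i x. 0"]) (auto intro: Suc)
qed simp

lemma Ck_coord: "Ck_on k n U (\<lambda>x. x j)"
proof (cases k)
  have c: "continuous_map (subtopology (euc n) U) euclideanreal (\<lambda>x. x j)"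
    unfolding Euclidean_space_def
    by (intro continuous_map_from_subtopology continuous_map_product_projection) simp
  {
    case 0
    then show ?thesis using c by simp
  next
    case (Suc k')
    have "((\<lambda>t. (x(i := t)) j) has_real_derivative (if i = j then 1 else 0)) (at (x i))" for x :: rvec and i
      by (cases "i = j") auto
    then show ?thesis unfolding Suc using c Ck_const
      by (intro Ck_SucI[where g = "\<lambda>i x. if i = j then 1 else 0"]) auto
  }
qed

lemma Ck_add: "Ck_on k n U f \<Longrightarrow> Ck_on k n U g \<Longrightarrow> Ck_on k n U (\<lambda>x. f x + g x)"
proof (induction k arbitrary: f g)
  case 0
  then show ?case by (auto intro: continuous_map_add)
next
  case (Suc k)
  obtain f' where f': "\<And>i x. i < n \<Longrightarrow> x \<in> U \<Longrightarrow> ((\<lambda>t. f (x(i := t))) has_real_derivative f' i x) (at (x i))"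
    "\<And>i. i < n \<Longrightarrow> Ck_on k n U (f' i)" by (rule Ck_SucE[OF Suc.prems(1)], rule that)
  obtain g' where g': "\<And>i x. i < n \<Longrightarrow> x \<in> U \<Longrightarrow> ((\<lambda>t. g (x(i := t))) has_real_derivative g' i x) (at (x i))"
    "\<And>i. i < n \<Longrightarrow> Ck_on k n U (g' i)" by (rule Ck_SucE[OF Suc.prems(2)], rule that)
  show ?case
    using Suc.prems[THEN Ck_continuous] f' g' Suc.IH
    by (intro Ck_SucI[where g = "\<lambda>i x. f' i x + g' i x"] continuous_map_add DERIV_add)
      (auto simp del: fun_upd_apply)
qed

lemma Ck_mult: "Ck_on k n U f \<Longrightarrow> Ck_on k n U g \<Longrightarrow> Ck_on k n U (\<lambda>x. f x * g x)"
proof (induction k arbitrary: f g)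
  case 0
  then show ?case by (auto intro: continuous_map_real_mult)
next
  case (Suc k)
  obtain f' where f': "\<And>i x. i < n \<Longrightarrow> x \<in> U \<Longrightarrow> ((\<lambda>t. f (x(i := t))) has_real_derivative f' i x) (at (x i))"
    "\<And>i. i < n \<Longrightarrow> Ck_on k n U (f' i)" by (rule Ck_SucE[OF Suc.prems(1)], rule that)
  obtain g' where g': "\<And>i x. i < n \<Longrightarrow> x \<in> U \<Longrightarrow> ((\<lambda>t. g (x(i := t))) has_real_derivative g' i x) (at (x i))"
    "\<And>i. i < n \<Longrightarrow> Ck_on k n U (g' i)" by (rule Ck_SucE[OF Suc.prems(2)], rule that)
  note fg = Suc.prems[THEN Ck_Suc_imp]
  show ?case
  proof (rule Ck_SucI[where g = "\<lambda>i x. f' i x * g x + g' i x * f x"])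
    show "continuous_map (subtopology (euc n) U) euclideanreal (\<lambda>x. f x * g x)"
      using Suc.prems[THEN Ck_continuous] by (intro continuous_map_real_mult)
    show "((\<lambda>t. f (x(i := t)) * g (x(i := t))) has_real_derivative f' i x * g x + g' i x * f x) (at (x i))"
      if "i < n" "x \<in> U" for i x
      using DERIV_mult[OF f'(1)[OF that] g'(1)[OF that]] by simp
    show "Ck_on k n U (\<lambda>x. f' i x * g x + g' i x * f x)" if "i < n" for i
      using f'(2)[OF that] g'(2)[OF that] fg by (intro Ck_add Suc.IH)
  qed
qed

lemma Ck_sum: "(\<And>i. i \<in> A \<Longrightarrow> Ck_on k n U (f i)) \<Longrightarrow> Ck_on k n U (\<lambda>x. \<Sum>i\<in>A. f i x)"
  by (induction A rule: infinite_finite_induct) (auto intro: Ck_const Ck_add)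

lemma Ck_pfun: "pfun p \<Longrightarrow> Ck_on k n U p"
  by (induction rule: pfun_induct) (auto intro: Ck_const Ck_coord Ck_add Ck_mult)

lemma Ck_inverse:
  assumes nz: "\<And>x. x \<in> U \<Longrightarrow> f x \<noteq> 0"
  shows "Ck_on k n U f \<Longrightarrow> Ck_on k n U (\<lambda>x. inverse (f x))"
proof (induction k)
  case 0
  then show ?case using nz by (auto intro!: continuous_map_real_inverse)
next
  case (Suc k)
  obtain f' where f': "\<And>i x. i < n \<Longrightarrow> x \<in> U \<Longrightarrow> ((\<lambda>t. f (x(i := t))) has_real_derivative f' i x) (at (x i))"
    "\<And>i. i < n \<Longrightarrow> Ck_on k n U (f' i)" by (rule Ck_SucE[OF Suc.prems], rule that)
  have inv: "Ck_on k n U (\<lambda>x. inverse (f x))" using Suc.IH Ck_Suc_imp[OF Suc.prems] .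
  show ?case
  proof (rule Ck_SucI[where g = "\<lambda>i x. (- 1) * (inverse (f x) * f' i x * inverse (f x))"])
    show "continuous_map (subtopology (euc n) U) euclideanreal (\<lambda>x. inverse (f x))"
      using Ck_continuous[OF Suc.prems] nz by (intro continuous_map_real_inverse) auto
    show "((\<lambda>t. inverse (f (x(i := t)))) has_real_derivative (- 1) * (inverse (f x) * f' i x * inverse (f x))) (at (x i))"
      if "i < n" "x \<in> U" for i x
      using DERIV_inverse'[OF f'(1)[OF that]] nz[OF that(2)] by simp
    show "Ck_on k n U (\<lambda>x. (- 1) * (inverse (f x) * f' i x * inverse (f x)))" if "i < n" for i
      using f'(2)[OF that] inv by (intro Ck_mult Ck_const)
  qed
qed

lemma Ck_powr:
  assumes pos: "\<And>x. x \<in> U \<Longrightarrow> 0 < f x"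
  shows "Ck_on k n U f \<Longrightarrow> Ck_on k n U (\<lambda>x. f x powr a)"
proof (induction k arbitrary: a)
  case 0
  then have "continuous_map (subtopology (euc n) U) (top_of_set {0<..}) f"
    using pos by (auto simp: continuous_map_in_subtopology)
  moreover have "continuous_map (top_of_set {0<..}) euclideanreal (\<lambda>t::real. t powr a)"
    by (simp add: continuous_map_iff_continuous) (intro continuous_intros, auto)
  ultimately show ?case using continuous_map_compose[of _ _ f _ "\<lambda>t. t powr a"] by (simp add: o_def)
next
  case (Suc k)
  obtain f' where f': "\<And>i x. i < n \<Longrightarrow> x \<in> U \<Longrightarrow> ((\<lambda>t. f (x(i := t))) has_real_derivative f' i x) (at (x i))"
    "\<And>i. i < n \<Longrightarrow> Ck_on k n U (f' i)" by (rule Ck_SucE[OF Suc.prems], rule that)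
  have pw: "Ck_on k n U (\<lambda>x. f x powr b)" for b using Suc.IH Ck_Suc_imp[OF Suc.prems] .
  show ?case
  proof (rule Ck_SucI[where g = "\<lambda>i x. a * f x powr (a - 1) * f' i x"])
    have "continuous_map (subtopology (euc n) U) (top_of_set {0<..}) f"
      using pos Ck_continuous[OF Suc.prems] by (auto simp: continuous_map_in_subtopology)
    moreover have "continuous_map (top_of_set {0<..}) euclideanreal (\<lambda>t::real. t powr a)"
      by (simp add: continuous_map_iff_continuous) (intro continuous_intros, auto)
    ultimately show "continuous_map (subtopology (euc n) U) euclideanreal (\<lambda>x. f x powr a)"
      using continuous_map_compose[of _ _ f _ "\<lambda>t. t powr a"] by (simp add: o_def)
    show "((\<lambda>t. f (x(i := t)) powr a) has_real_derivative a * f x powr (a - 1) * f' i x) (at (x i))"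
      if "i < n" "x \<in> U" for i x
      using DERIV_fun_powr[OF f'(1)[OF that], of a] pos[OF that(2)] by simp
    show "Ck_on k n U (\<lambda>x. a * f x powr (a - 1) * f' i x)" if "i < n" for i
      using f'(2)[OF that] pw by (intro Ck_mult Ck_const)
  qed
qed

text \<open>One summand of a telescoping sum in which the coordinates move to \<open>\<gamma> t\<close> one after the
  other. Only coordinate \<open>j\<close> moves here, so the mean value theorem in one variable applies.\<close>

lemma chain_rule_coordinate:
  fixes \<gamma> :: "real \<Rightarrow> rvec"
  assumes V: "openin (euc m) V" and j: "j < m"
    and g': "\<And>y. y \<in> V \<Longrightarrow> ((\<lambda>t. g (y(j := t))) has_real_derivative G y) (at (y j))"
    and cG: "continuous_map (subtopology (euc m) V) euclideanreal G"
    and p: "\<gamma> s \<in> V" and \<gamma>: "\<And>i. i < m \<Longrightarrow> ((\<lambda>t. \<gamma> t i) has_real_derivative c i) (at s)"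
  shows "((\<lambda>t. g (\<lambda>i. if i < Suc j then \<gamma> t i else \<gamma> s i) - g (\<lambda>i. if i < j then \<gamma> t i else \<gamma> s i))
    has_real_derivative G (\<gamma> s) * c j) (at s)"
proof -
  define p where "p = \<gamma> s"
  define H where "H t = (\<lambda>i. if i < j then \<gamma> t i else p i)" for t
  define \<Delta> where "\<Delta> t = g ((H t)(j := \<gamma> t j)) - g (H t)" for t
  have H': "(\<lambda>i. if i < Suc j then \<gamma> t i else p i) = (H t)(j := \<gamma> t j)" for t
    by (auto simp: H_def fun_eq_iff less_Suc_eq)
  have pm: "p \<in> vecs m" using open_subset_vecs[OF V] assms(5) by (auto simp: p_def)
  (* The difference quotient in direction j, extended by the partial derivative. *)
  define q where "q t = (if \<gamma> t j = p j then G p else \<Delta> t / (\<gamma> t j - p j))" for t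
  have Hs: "H s = p" by (auto simp: H_def p_def)
  have Hj: "H t j = p j" for t by (simp add: H_def)
  have \<Delta>: "\<Delta> t = q t * (\<gamma> t j - p j)" for t
  proof (cases "\<gamma> t j = p j")
    case True
    then have "(H t)(j := \<gamma> t j) = H t" using Hj by (auto simp: fun_eq_iff)
    then show ?thesis using True by (simp add: \<Delta>_def)
  qed (simp add: q_def)
  have "isCont q s"
    unfolding isCont_def LIM_eq
  proof (intro allI impI)
    fix e :: real assume e: "0 < e"
    obtain d where d: "d > 0" "\<And>y. y \<in> vecs m \<Longrightarrow> (\<And>i. i < m \<Longrightarrow> \<bar>y i - p i\<bar> < d) \<Longrightarrow> y \<in> V \<and> \<bar>G y - G p\<bar> < e"
      using continuous_boxE[OF V cG assms(5) e] unfolding p_def by blast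
    have "\<forall>\<^sub>F t in nhds s. \<forall>i\<in>{..<m}. \<bar>\<gamma> t i - p i\<bar> < d"
    proof (intro eventually_ball_finite ballI)
      fix i assume "i \<in> {..<m}"
      then have "isCont (\<lambda>t. \<gamma> t i) s" using \<gamma> DERIV_isCont by blast
      then have "\<forall>\<^sub>F t in at s. dist (\<gamma> t i) (p i) < d"
        using d(1) unfolding isCont_def p_def by (rule tendstoD)
      then show "\<forall>\<^sub>F t in nhds s. \<bar>\<gamma> t i - p i\<bar> < d"
        using d(1) by (simp add: eventually_nhds_conv_at dist_real_def p_def)
    qed simp
    then obtain r where r: "r > 0" "\<And>t. dist t s < r \<Longrightarrow> \<forall>i\<in>{..<m}. \<bar>\<gamma> t i - p i\<bar> < d"
      unfolding eventually_nhds_metric by blast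
    have "norm (q t - q s) < e" if "t \<noteq> s" "norm (t - s) < r" for t
    proof (cases "\<gamma> t j = p j")
      case True
      then show ?thesis using e by (simp add: q_def p_def)
    next
      case False
      have box: "\<bar>\<gamma> t i - p i\<bar> < d" if "i < m" for i using r(2)[of t] \<open>norm (t - s) < r\<close> that by (simp add: dist_real_def)
      define a b where "a = min (p j) (\<gamma> t j)" and "b = max (p j) (\<gamma> t j)"
      have ab: "a < b" using False by (auto simp: a_def b_def min_def max_def)
      have HV: "(H t)(j := u) \<in> V \<and> \<bar>G ((H t)(j := u)) - G p\<bar> < e" if "a \<le> u" "u \<le> b" for u
      proof (rule d(2))
        show "(H t)(j := u) \<in> vecs m" using pm j by (auto simp: vecs_iff H_def)
        have "\<bar>u - p j\<bar> < d" using that box[OF j] d(1) by (auto simp: a_def b_def min_def max_def split: if_splits)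
        then show "\<bar>((H t)(j := u)) i - p i\<bar> < d" if "i < m" for i
          using box[OF that] d(1) by (auto simp: H_def)
      qed
      have "((\<lambda>u. g ((H t)(j := u))) has_real_derivative G ((H t)(j := u))) (at u)" if "a \<le> u" "u \<le> b" for u
        using g'[of "(H t)(j := u)"] HV[OF that] by simp
      then obtain z where z: "a < z" "z < b"
        "g ((H t)(j := b)) - g ((H t)(j := a)) = (b - a) * G ((H t)(j := z))"
        using MVT2[OF ab, of "\<lambda>u. g ((H t)(j := u))" "\<lambda>u. G ((H t)(j := u))"] by blast
      have Hp: "(H t)(j := p j) = H t" using Hj by (auto simp: fun_eq_iff)
      have "\<Delta> t = (\<gamma> t j - p j) * G ((H t)(j := z))"
      proof (cases "p j < \<gamma> t j")
        case True
        then show ?thesis using z(3) Hp by (simp add: a_def b_def \<Delta>_def)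
      next
        case f: False
        then show ?thesis using z(3) Hp False by (simp add: a_def b_def \<Delta>_def algebra_simps)
      qed
      then have "q t = G ((H t)(j := z))" using False by (simp add: q_def)
      moreover have "q s = G p" by (simp add: q_def p_def)
      ultimately show ?thesis using HV[of z] z by simp
    qed
    then show "\<exists>r>0. \<forall>t. t \<noteq> s \<and> norm (t - s) < r \<longrightarrow> norm (q t - q s) < e" using r(1) by blast
  qed
  moreover obtain k where k: "\<And>z. \<gamma> z j - \<gamma> s j = k z * (z - s)" "isCont k s" "k s = c j"
    using \<gamma>[OF j] unfolding CARAT_DERIV by blast
  moreover have "\<Delta> z - \<Delta> s = (q z * k z) * (z - s)" for z
    using k(1)[of z] by (simp add: \<Delta> p_def)
  moreover have "q s = G p" by (simp add: q_def p_def)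
  ultimately have "(\<Delta> has_real_derivative G p * c j) (at s)"
    unfolding CARAT_DERIV by (intro exI[of _ "\<lambda>z. q z * k z"]) (auto intro: continuous_mult)
  then show ?thesis unfolding p_def[symmetric] H' by (simp add: \<Delta>_def[abs_def] H_def)
qed

text \<open>Continuity of the partial derivatives takes the place of total differentiability.\<close>

lemma chain_rule_curve:
  fixes \<gamma> :: "real \<Rightarrow> rvec"
  assumes V: "openin (euc m) V"
    and g': "\<And>j y. j < m \<Longrightarrow> y \<in> V \<Longrightarrow> ((\<lambda>t. g (y(j := t))) has_real_derivative G j y) (at (y j))"
    and cG: "\<And>j. j < m \<Longrightarrow> continuous_map (subtopology (euc m) V) euclideanreal (G j)"
    and p: "\<gamma> s \<in> V" and \<gamma>: "\<And>i. i < m \<Longrightarrow> ((\<lambda>t. \<gamma> t i) has_real_derivative c i) (at s)"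
    and \<gamma>V: "\<And>t. \<gamma> t \<in> vecs m"
  shows "((\<lambda>t. g (\<gamma> t)) has_real_derivative (\<Sum>j<m. G j (\<gamma> s) * c j)) (at s)"
proof -
  have "((\<lambda>t. g (\<lambda>i. if i < k then \<gamma> t i else \<gamma> s i)) has_real_derivative (\<Sum>j<k. G j (\<gamma> s) * c j)) (at s)"
    if "k \<le> m" for k
    using that
  proof (induction k)
    case (Suc k)
    have "((\<lambda>t. g (\<lambda>i. if i < k then \<gamma> t i else \<gamma> s i) +
        (g (\<lambda>i. if i < Suc k then \<gamma> t i else \<gamma> s i) - g (\<lambda>i. if i < k then \<gamma> t i else \<gamma> s i)))
       has_real_derivative (\<Sum>j<k. G j (\<gamma> s) * c j) + G k (\<gamma> s) * c k) (at s)"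
      using Suc by (intro DERIV_add chain_rule_coordinate[where \<gamma> = \<gamma> and c = c and s = s and G = "G k", OF V _ g' cG p \<gamma>]) auto
    then show ?case by simp
  qed simp
  from this[of m] have "((\<lambda>t. g (\<lambda>i. if i < m then \<gamma> t i else \<gamma> s i)) has_real_derivative (\<Sum>j<m. G j (\<gamma> s) * c j)) (at s)"
    by simp
  moreover have "(\<lambda>i. if i < m then \<gamma> t i else \<gamma> s i) = \<gamma> t" for t
    using \<gamma>V[of t] \<gamma>V[of s] by (auto simp: vecs_iff)
  ultimately show ?thesis by simp
qed

lemma continuous_map_into_open:
  assumes V: "openin (euc m) V" and F: "F \<in> U \<rightarrow> V"
    and c: "\<And>j. j < m \<Longrightarrow> continuous_map (subtopology (euc n) U) euclideanreal (\<lambda>x. F x j)"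
  shows "continuous_map (subtopology (euc n) U) (subtopology (euc m) V) F"
proof -
  have "continuous_map (subtopology (euc n) U) (euc m) (\<lambda>x i. if i < m then F x i else 0)"
    unfolding continuous_map_componentwise_Euclidean_space using c by blast
  moreover have "(\<lambda>i. if i < m then F x i else 0) = F x" if "x \<in> U" for x
    using F that open_subset_vecs[OF V] by (auto simp: vecs_iff Pi_iff fun_eq_iff subset_iff)
  ultimately have "continuous_map (subtopology (euc n) U) (euc m) F"
    by (auto elim!: continuous_map_eq)
  then show ?thesis using F by (auto simp: continuous_map_in_subtopology)
qed

lemma Ck_compose:
  assumes U: "openin (euc n) U" and V: "openin (euc m) V" and F: "F \<in> U \<rightarrow> V"
  shows "(\<And>j. j < m \<Longrightarrow> Ck_on k n U (\<lambda>x. F x j)) \<Longrightarrow> Ck_on k m V g \<Longrightarrow> Ck_on k n U (\<lambda>x. g (F x))"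
proof (induction k arbitrary: g)
  case 0
  then show ?case
    using continuous_map_compose[OF continuous_map_into_open[OF V F], of n euclideanreal g] by (simp add: o_def)
next
  case (Suc k)
  have "\<exists>f'. (\<forall>i<n. Ck_on k n U (f' i)) \<and>
      (\<forall>i<n. \<forall>x\<in>U. ((\<lambda>t. F (x(i := t)) j) has_real_derivative f' i x) (at (x i)))" if "j < m" for j
    by (rule Ck_SucE[OF Suc.prems(1)[OF that]]) blast
  then obtain F' where F': "\<And>i j. j < m \<Longrightarrow> i < n \<Longrightarrow> Ck_on k n U (F' j i)"
      "\<And>i j x. j < m \<Longrightarrow> i < n \<Longrightarrow> x \<in> U \<Longrightarrow> ((\<lambda>t. F (x(i := t)) j) has_real_derivative F' j i x) (at (x i))"
    by metis
  obtain G where G: "\<And>i x. i < m \<Longrightarrow> x \<in> V \<Longrightarrow> ((\<lambda>t. g (x(i := t))) has_real_derivative G i x) (at (x i))"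
    "\<And>i. i < m \<Longrightarrow> Ck_on k m V (G i)" by (rule Ck_SucE[OF Suc.prems(2)], rule that)
  have Fk: "Ck_on k n U (\<lambda>x. F x j)" if "j < m" for j using Ck_Suc_imp[OF Suc.prems(1)[OF that]] .
  show ?case
  proof (rule Ck_SucI[where g = "\<lambda>i x. \<Sum>j<m. G j (F x) * F' j i x"])
    show "continuous_map (subtopology (euc n) U) euclideanreal (\<lambda>x. g (F x))"
      using continuous_map_compose[OF continuous_map_into_open[OF V F], of n euclideanreal g]
        Suc.prems[THEN Ck_continuous] by (simp add: o_def)
    fix i x assume i: "i < n" and x: "x \<in> U"
    define \<gamma> where "\<gamma> t = vfst m (F (x(i := t)))" for t
    have FV: "vfst m (F y) = F y" if "y \<in> U" for y using that F open_subset_vecs[OF V] by auto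
    have "((\<lambda>t. g (\<gamma> t)) has_real_derivative (\<Sum>j<m. G j (\<gamma> (x i)) * F' j i x)) (at (x i))"
    proof (rule chain_rule_curve[where \<gamma> = \<gamma> and c = "\<lambda>j. F' j i x" and s = "x i" and G = G, OF V G(1)])
      show "continuous_map (subtopology (euc m) V) euclideanreal (G j)" if "j < m" for j
        using G(2)[OF that] Ck_continuous by blast
      show "\<gamma> (x i) \<in> V" using FV[OF x] F x by (auto simp: \<gamma>_def)
      show "((\<lambda>t. \<gamma> t j) has_real_derivative F' j i x) (at (x i))" if "j < m" for j
        using F'(2)[OF that i x] that by (simp add: \<gamma>_def vfst_def)
    qed (simp_all add: \<gamma>_def)
    moreover have "\<forall>\<^sub>F t in nhds (x i). g (\<gamma> t) = g (F (x(i := t)))"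
      using eventually_upd_in_open[OF U x i] by eventually_elim (simp add: \<gamma>_def FV)
    moreover have "\<gamma> (x i) = F x" using FV[OF x] by (simp add: \<gamma>_def)
    ultimately show "((\<lambda>t. g (F (x(i := t)))) has_real_derivative (\<Sum>j<m. G j (F x) * F' j i x)) (at (x i))"
      using DERIV_cong_ev[of "x i" "x i" "\<lambda>t. g (\<gamma> t)" "\<lambda>t. g (F (x(i := t)))"] by auto
  next
    show "Ck_on k n U (\<lambda>x. \<Sum>j<m. G j (F x) * F' j i x)" if "i < n" for i
    proof (rule Ck_sum, rule Ck_mult)
      fix j assume "j \<in> {..<m}"
      then have j: "j < m" by simp
      show "Ck_on k n U (\<lambda>x. G j (F x))" by (rule Suc.IH[OF Fk G(2)[OF j]])
      show "Ck_on k n U (F' j i)" by (rule F'(1)[OF j that])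
    qed
  qed
qed

section \<open>Smooth semialgebraic maps between open sets\<close>

definition nashf :: "nat \<Rightarrow> nat \<Rightarrow> rvec set \<Rightarrow> rvec set \<Rightarrow> (rvec \<Rightarrow> rvec) \<Rightarrow> bool" where
  "nashf m n D E f \<longleftrightarrow> openin (euc m) D \<and> smap m n D E f \<and> smooth_map (Some m) (Some n) D f"

lemma smooth_map_iff: "smooth_map (Some m) (Some n) U f \<longleftrightarrow> (\<forall>i<n. \<forall>k. Ck_on k m U (\<lambda>x. f x i))"
  by (simp add: smooth_map_def)

lemma smooth_map_compose:
  assumes "openin (euc m) D" "openin (euc n) E" "f \<in> D \<rightarrow> E"
    "smooth_map (Some m) (Some n) D f" "smooth_map (Some n) (Some k) E g"
  shows "smooth_map (Some m) (Some k) D (\<lambda>x. g (f x))"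
  unfolding smooth_map_iff
proof (intro allI impI)
  fix i l assume "i < k"
  then show "Ck_on l m D (\<lambda>x. g (f x) i)"
    using assms(4,5) unfolding smooth_map_iff
    by (intro Ck_compose[where F = f and g = "\<lambda>y. g y i", OF assms(1-3)]) simp_all
qed

lemma smooth_map_cong:
  assumes "openin (euc m) D" "smooth_map (Some m) (Some n) D f" "\<And>x. x \<in> D \<Longrightarrow> f x = g x"
  shows "smooth_map (Some m) (Some n) D g"
  unfolding smooth_map_iff
proof (intro allI impI)
  fix i l assume "i < n"
  then have "Ck_on l m D (\<lambda>x. f x i)" using assms(2) unfolding smooth_map_iff by blast
  from Ck_cong[OF assms(1) this, of "\<lambda>x. g x i"] show "Ck_on l m D (\<lambda>x. g x i)"
    using assms(3) by (metis (no_types))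
qed

lemma smooth_map_local:
  assumes "openin (euc m) D"
    "\<And>x. x \<in> D \<Longrightarrow> \<exists>V. openin (euc m) V \<and> x \<in> V \<and> V \<subseteq> D \<and> smooth_map (Some m) (Some n) V f"
  shows "smooth_map (Some m) (Some n) D f"
  unfolding smooth_map_iff
proof (intro allI impI Ck_local[OF assms(1)])
  fix i k x assume "i < n" "x \<in> D"
  then show "\<exists>V. openin (euc m) V \<and> x \<in> V \<and> V \<subseteq> D \<and> Ck_on k m V (\<lambda>x. f x i)"
  proof -
    obtain V where "openin (euc m) V" "x \<in> V" "V \<subseteq> D" "smooth_map (Some m) (Some n) V f"
      using assms(2)[OF \<open>x \<in> D\<close>] by blast
    then show ?thesis using \<open>i < n\<close> by (intro exI[of _ V]) (simp add: smooth_map_iff)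
  qed
qed

lemma nashf_compose:
  assumes f: "nashf m n D E f" and g: "nashf n k E' G g" and sub: "\<And>x. x \<in> D \<Longrightarrow> f x \<in> E'"
  shows "nashf m k D G (\<lambda>x. g (f x))"
  unfolding nashf_def
proof (intro conjI)
  show "openin (euc m) D" using f by (simp add: nashf_def)
  show "smap m k D G (\<lambda>x. g (f x))"
    using f g sub unfolding nashf_def by (intro smap_compose[of m n D E f k E' G g]) simp_all
  show "smooth_map (Some m) (Some k) D (\<lambda>x. g (f x))"
    using f g sub unfolding nashf_def by (intro smooth_map_compose[of m D n E' f k g]) simp_all
qed

lemma nashf_cong:
  assumes "nashf m n D E f" "\<And>x. x \<in> D \<Longrightarrow> f x = g x"
  shows "nashf m n D E g"
  unfolding nashf_def
proof (intro conjI)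
  note f = assms(1)[unfolded nashf_def]
  show "openin (euc m) D" using f by blast
  show "smap m n D E g" by (rule smap_cong[of m n D E f]) (use f assms(2) in blast)+
  show "smooth_map (Some m) (Some n) D g" by (rule smooth_map_cong[of m D n f]) (use f assms(2) in blast)+
qed

lemma nashf_codomain:
  assumes "nashf m n D E f" "semialg n E'" "\<And>x. x \<in> D \<Longrightarrow> f x \<in> E'"
  shows "nashf m n D E' f"
  using assms smap_codomain unfolding nashf_def by blast

lemma nashf_restrict:
  assumes f: "nashf m n D E f" and D': "semialg m D'" "D' \<subseteq> D" "openin (euc m) D'"
  shows "nashf m n D' E f"
  using assms smap_restrict[OF _ D'(1,2)] Ck_subset unfolding nashf_def smooth_map_iff by blast

lemma nashf_UN:
  assumes I: "finite I" and f: "\<And>i. i \<in> I \<Longrightarrow> nashf m n (D i) E f" and E: "semialg n E"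
  shows "nashf m n (\<Union>i\<in>I. D i) E f"
  unfolding nashf_def
proof (intro conjI)
  show op: "openin (euc m) (\<Union>i\<in>I. D i)" using f by (auto simp: nashf_def)
  show "smap m n (\<Union>i\<in>I. D i) E f" using f by (intro smap_UN I E) (auto simp: nashf_def)
  show "smooth_map (Some m) (Some n) (\<Union>i\<in>I. D i) f"
  proof (rule smooth_map_local[OF op])
    fix x assume "x \<in> (\<Union>i\<in>I. D i)"
    then obtain i where "i \<in> I" "x \<in> D i" by blast
    then show "\<exists>V. openin (euc m) V \<and> x \<in> V \<and> V \<subseteq> (\<Union>i\<in>I. D i) \<and> smooth_map (Some m) (Some n) V f"
      using f[OF \<open>i \<in> I\<close>] by (intro exI[of _ "D i"]) (auto simp: nashf_def)
  qed
qed

lemma nashf_pfun: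
  assumes "openin (euc m) D" "semialg m D" "semialg n E" "f \<in> D \<rightarrow> E"
    "\<And>i. i < n \<Longrightarrow> pfun (\<lambda>x. f x i)"
  shows "nashf m n D E f"
  using assms smap_pfun[OF assms(2-5)] by (auto simp: nashf_def smooth_map_iff intro: Ck_pfun)

lemma nashf_D:
  assumes "nashf m n D E f"
  shows "openin (euc m) D" "smap m n D E f" "smooth_map (Some m) (Some n) D f"
    "semialg m D" "semialg n E" "\<And>x. x \<in> D \<Longrightarrow> f x \<in> E"
  using assms smap_semialgebraicD[of m n D E f] unfolding nashf_def by auto

section \<open>Charts and local representations\<close>

lemma is_chartD:
  assumes "is_chart X (Some m) (\<phi>, U, U')"
  shows "openin (euc m) U" "semialg m U" "openin X U'" "\<phi> \<in> extensional U"
    "homeomorphic_map (subtopology (euc m) U) (subtopology X U') \<phi>"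
    "\<And>x. x \<in> U \<Longrightarrow> \<phi> x \<in> U'" "inj_on \<phi> U" "\<phi> ` U = U'"
    "continuous_map (subtopology (euc m) U) X \<phi>"
proof -
  show *: "openin (euc m) U" "semialg m U" "openin X U'" "\<phi> \<in> extensional U"
    "homeomorphic_map (subtopology (euc m) U) (subtopology X U') \<phi>"
    using assms by (auto simp: is_chart_def simp del: semialgebraic.simps)
  have ts: "topspace (subtopology (euc m) U) = U" "topspace (subtopology X U') = U'"
    using openin_subset[OF *(1)] openin_subset[OF *(3)] by auto
  show im: "\<phi> ` U = U'" using homeomorphic_imp_surjective_map[OF *(5)] ts by simp
  show "inj_on \<phi> U" using homeomorphic_imp_injective_map[OF *(5)] ts by simp
  show "\<phi> x \<in> U'" if "x \<in> U" for x using im that by blast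
  show "continuous_map (subtopology (euc m) U) X \<phi>"
    using homeomorphic_imp_continuous_map[OF *(5)] by (simp add: continuous_map_in_subtopology)
qed

lemma chart_inv:
  assumes "is_chart X (Some m) (\<phi>, U, U')"
  shows "\<And>a. a \<in> U' \<Longrightarrow> inv_into U \<phi> a \<in> U" "\<And>a. a \<in> U' \<Longrightarrow> \<phi> (inv_into U \<phi> a) = a"
    "\<And>x. x \<in> U \<Longrightarrow> inv_into U \<phi> (\<phi> x) = x"
  using is_chartD(7,8)[OF assms] by (auto intro: inv_into_into f_inv_into_f)

lemma chart_open_preimage:
  assumes c: "is_chart X (Some m) (\<phi>, U, U')" and W: "openin X W"
  shows "openin (euc m) {x \<in> U. \<phi> x \<in> W}"
  using is_chartD(9)[OF c] W unfolding continuous_map_open_subtopology[OF is_chartD(1)[OF c]] by blast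

lemma openin_preimage_topspace:
  assumes "continuous_map X Y f" "openin Y W"
  shows "openin X {a \<in> topspace X. f a \<in> W}"
  using assms by (rule openin_continuous_map_preimage)

definition lrep :: "nat \<Rightarrow> nat \<Rightarrow> ('a \<Rightarrow> 'b) \<Rightarrow> 'a chart \<Rightarrow> 'b chart \<Rightarrow> bool" where
  "lrep m n f = (\<lambda>(\<phi>, U, U') (\<psi>, V, V').
     nashf m n {x \<in> U. f (\<phi> x) \<in> V'} V (\<lambda>x. inv_into V \<psi> (f (\<phi> x))))"

lemma lrep_iff: "lrep m n f (\<phi>, U, U') (\<psi>, V, V') \<longleftrightarrow>
    nashf m n {x \<in> U. f (\<phi> x) \<in> V'} V (\<lambda>x. inv_into V \<psi> (f (\<phi> x)))"
  by (simp add: lrep_def)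

lemma lrep_open_domain:
  assumes c: "is_chart X (Some m) (\<phi>, U, U')" and f: "continuous_map X Y f" and W: "openin Y W"
  shows "openin (euc m) {x \<in> U. f (\<phi> x) \<in> W}"
proof -
  have "{x \<in> U. f (\<phi> x) \<in> W} = {x \<in> U. \<phi> x \<in> {a \<in> topspace X. f a \<in> W}}"
    using is_chartD(6)[OF c] openin_subset[OF is_chartD(3)[OF c]] by auto
  then show ?thesis using chart_open_preimage[OF c openin_preimage_topspace[OF f W]] by simp
qed

lemma nash_transition_iff:
  assumes c: "is_chart X (Some m) (\<phi>, U, U')" and d: "is_chart X (Some m) (\<psi>, V, V')"
  shows "nash_transition (Some m) (\<phi>, U, U') (\<psi>, V, V') \<longleftrightarrow>
    lrep m m (\<lambda>a. a) (\<phi>, U, U') (\<psi>, V, V') \<and> semialg m {y \<in> V. \<psi> y \<in> U'}"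
proof -
  let ?D = "{x \<in> U. \<phi> x \<in> V'}" and ?E = "{y \<in> V. \<psi> y \<in> U'}" and ?f = "\<lambda>x. inv_into V \<psi> (\<phi> x)"
  have D: "{x \<in> U. \<phi> x \<in> U' \<inter> V'} = ?D" and E: "{y \<in> V. \<psi> y \<in> U' \<inter> V'} = ?E"
    using is_chartD(6)[OF c] is_chartD(6)[OF d] by auto
  have op: "openin (euc m) ?D" using chart_open_preimage[OF c is_chartD(3)[OF d]] .
  have fE: "?f x \<in> ?E" if "x \<in> ?D" for x
    using that chart_inv[OF d] is_chartD(6)[OF c] by auto
  have "smap m m ?D ?E ?f \<longleftrightarrow> smap m m ?D V ?f \<and> semialg m ?E"
    using smap_codomain[of m m ?D ?E ?f V] smap_codomain[of m m ?D V ?f ?E] is_chartD(2)[OF d] fE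
      smap_semialgebraicD(2)[of m m ?D ?E ?f] by blast
  then show ?thesis using op unfolding nash_transition_def lrep_iff nashf_def
    unfolding prod.case Let_def D E by blast
qed

text \<open>Compatibility of charts means that the identity is a Nash map in both directions.
  Statements on atlases thereby become statements on maps.\<close>

lemma nash_compatible_iff:
  assumes "is_chart X (Some m) c" "is_chart X (Some m) d"
  shows "nash_compatible (Some m) c d \<longleftrightarrow> lrep m m (\<lambda>a. a) c d \<and> lrep m m (\<lambda>a. a) d c"
proof -
  obtain \<phi> U U' \<psi> V V' where cd: "c = (\<phi>, U, U')" "d = (\<psi>, V, V')" by (metis prod_cases3)
  show ?thesis
    using nash_transition_iff[OF assms[unfolded cd]] nash_transition_iff[OF assms(2,1)[unfolded cd]]
      nashf_D(4)[of m m "{x \<in> U. \<phi> x \<in> V'}" V "\<lambda>x. inv_into V \<psi> (\<phi> x)"]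
      nashf_D(4)[of m m "{x \<in> V. \<psi> x \<in> U'}" U "\<lambda>x. inv_into U \<phi> (\<psi> x)"]
    unfolding nash_compatible_def cd lrep_iff by blast
qed

definition chart_cover :: "'a topology \<Rightarrow> nat \<Rightarrow> 'a chart set \<Rightarrow> bool" where
  "chart_cover X m C \<longleftrightarrow> finite C \<and> (\<forall>c\<in>C. is_chart X (Some m) c) \<and>
     topspace X = (\<Union>(\<phi>, U, U') \<in> C. U')"

lemma chart_coverE:
  assumes "chart_cover X m C" "a \<in> topspace X"
  obtains \<phi> U U' where "(\<phi>, U, U') \<in> C" "a \<in> U'"
  using assms unfolding chart_cover_def by auto

lemma continuous_map_identity: "continuous_map X X (\<lambda>a. a)"
  using continuous_map_id[of X] by (simp add: id_def)

text \<open>The domain of a composite is covered by the preimages of finitely many charts of the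
  middle space, and a finite union of semialgebraic sets is semialgebraic. This is where finite
  covers by charts enter; all further facts on maximal atlases are obtained by composition.\<close>

lemma lrep_compose:
  assumes f: "continuous_map X Y f" and g: "continuous_map Y Z g" and C: "chart_cover Y k C"
    and c: "is_chart X (Some m) c" and d: "is_chart Z (Some n) d"
    and fC: "\<And>e. e \<in> C \<Longrightarrow> lrep m k f c e" and gC: "\<And>e. e \<in> C \<Longrightarrow> lrep k n g e d"
  shows "lrep m n (\<lambda>a. g (f a)) c d"
proof -
  obtain \<phi> U U' \<psi> V V' where cd: "c = (\<phi>, U, U')" "d = (\<psi>, V, V')" by (metis prod_cases3)
  note c' = is_chartD[OF c[unfolded cd]] and d' = is_chartD[OF d[unfolded cd]]
  define D where "D e = {x \<in> U. f (\<phi> x) \<in> snd (snd e) \<and> g (f (\<phi> x)) \<in> V'}" for e :: "'b chart"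
  let ?h = "\<lambda>x. inv_into V \<psi> (g (f (\<phi> x)))"
  have "nashf m n (D e) V ?h" if e: "e \<in> C" for e
  proof -
    obtain \<theta> W W' where e': "e = (\<theta>, W, W')" by (metis prod_cases3)
    have ech: "is_chart Y (Some k) (\<theta>, W, W')" using C e by (auto simp: chart_cover_def e')
    let ?u = "\<lambda>x. inv_into W \<theta> (f (\<phi> x))" and ?v = "\<lambda>y. inv_into V \<psi> (g (\<theta> y))"
    have u: "nashf m k {x \<in> U. f (\<phi> x) \<in> W'} W ?u" using fC[OF e] by (simp add: cd e' lrep_iff)
    have v: "nashf k n {y \<in> W. g (\<theta> y) \<in> V'} V ?v" using gC[OF e] by (simp add: cd e' lrep_iff)
    have D: "D e = {x \<in> {x \<in> U. f (\<phi> x) \<in> W'}. ?u x \<in> {y \<in> W. g (\<theta> y) \<in> V'}}"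
      using chart_inv[OF ech] by (auto simp: D_def e')
    have "openin X {a \<in> topspace X. f a \<in> W' \<inter> {b \<in> topspace Y. g b \<in> V'}}"
      by (rule openin_preimage_topspace[OF f])
        (intro openin_Int is_chartD(3)[OF ech] openin_preimage_topspace[OF g] d'(3))
    from chart_open_preimage[OF c[unfolded cd] this]
    have "openin (euc m) {x \<in> U. \<phi> x \<in> {a \<in> topspace X. f a \<in> W' \<inter> {b \<in> topspace Y. g b \<in> V'}}}" .
    moreover have "{x \<in> U. \<phi> x \<in> {a \<in> topspace X. f a \<in> W' \<inter> {b \<in> topspace Y. g b \<in> V'}}} = D e"
      using c'(6) openin_subset[OF c'(3)] openin_subset[OF is_chartD(3)[OF ech]] by (auto simp: D_def e')
    ultimately have op: "openin (euc m) (D e)" by simp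
    have sa: "semialg m (D e)"
      unfolding D by (rule smap_preimage[OF nashf_D(2)[OF u] nashf_D(4)[OF v]])
    have "nashf m k (D e) W ?u" by (rule nashf_restrict[OF u sa _ op]) (auto simp: D_def e')
    from nashf_compose[OF this v] have "nashf m n (D e) V (\<lambda>x. ?v (?u x))" unfolding D by blast
    then show ?thesis
      by (rule nashf_cong) (use chart_inv[OF ech] in \<open>auto simp: D_def e'\<close>)
  qed
  then have "nashf m n (\<Union>e\<in>C. D e) V ?h"
    using C d'(2) by (intro nashf_UN) (auto simp: chart_cover_def)
  moreover have "(\<Union>e\<in>C. D e) = {x \<in> U. g (f (\<phi> x)) \<in> V'}"
  proof -
    have "\<exists>e\<in>C. f (\<phi> x) \<in> snd (snd e)" if "x \<in> U" for x
    proof -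
      have "f (\<phi> x) \<in> topspace Y"
        using continuous_map_image_subset_topspace[OF f] c'(6)[OF that] openin_subset[OF c'(3)] by blast
      then show ?thesis using chart_coverE[OF C] by (metis snd_conv)
    qed
    then show ?thesis by (auto simp: D_def)
  qed
  ultimately show ?thesis by (simp add: cd lrep_iff)
qed

section \<open>Nash manifolds and Nash maps\<close>

text \<open>The dimension \<open>-\<infinity>\<close> belongs to the empty manifold only, so these are the nonempty Nash
  manifolds.\<close>

definition manif :: "'a nash_space \<Rightarrow> nat \<Rightarrow> bool" where
  "manif M m \<longleftrightarrow> nash_manifold M \<and> ndim M = Some m"

lemma manif_chart: "manif M m \<Longrightarrow> c \<in> ncharts M \<Longrightarrow> is_chart (ntop M) (Some m) c"
  unfolding manif_def nash_manifold_def by metis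

lemma manif_Hausdorff: "manif M m \<Longrightarrow> Hausdorff_space (ntop M)"
  unfolding manif_def nash_manifold_def by metis

lemma manif_compat:
  assumes "manif M m" "c \<in> ncharts M" "d \<in> ncharts M"
  shows "lrep m m (\<lambda>a. a) c d"
proof -
  have "nash_compatible (Some m) c d" using assms unfolding manif_def nash_manifold_def by metis
  then show ?thesis using nash_compatible_iff manif_chart assms by blast
qed

lemma manif_cover:
  assumes "manif M m"
  obtains C where "C \<subseteq> ncharts M" "chart_cover (ntop M) m C"
proof -
  obtain C where "finite C" "C \<subseteq> ncharts M" "points M = (\<Union>(\<phi>, U, U') \<in> C. U')"
    using assms unfolding manif_def nash_manifold_def by metis
  then show ?thesis using that[of C] manif_chart[OF assms] unfolding chart_cover_def by blast
qed

lemma manif_maximal: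
  assumes "manif M m" "is_chart (ntop M) (Some m) c"
    "\<And>d. d \<in> ncharts M \<Longrightarrow> lrep m m (\<lambda>a. a) c d \<and> lrep m m (\<lambda>a. a) d c"
  shows "c \<in> ncharts M"
proof -
  have "nash_compatible (ndim M) c d" if "d \<in> ncharts M" for d
    using nash_compatible_iff[OF assms(2) manif_chart[OF assms(1) that]] assms(3)[OF that] assms(1)
    by (simp add: manif_def)
  then show ?thesis using assms(1,2) unfolding manif_def nash_manifold_def by metis
qed

lemma nash_map_iff:
  assumes M: "manif M m" and N: "manif N n"
  shows "nash_map M N f \<longleftrightarrow> continuous_map (ntop M) (ntop N) f \<and>
    (\<forall>c\<in>ncharts M. \<forall>d\<in>ncharts N. lrep m n f c d)"
proof -
  have dim: "ndim M = Some m" "ndim N = Some n" using assms by (auto simp: manif_def)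
  have "(let D = {x \<in> U. f (\<phi> x) \<in> V'}; g = (\<lambda>x. inv_into V \<psi> (f (\<phi> x)))
        in semialgebraic_map (Some m) (Some n) D V g \<and> smooth_map (Some m) (Some n) D g) \<longleftrightarrow>
      lrep m n f (\<phi>, U, U') (\<psi>, V, V')"
    if f: "continuous_map (ntop M) (ntop N) f" and c: "(\<phi>, U, U') \<in> ncharts M" and d: "(\<psi>, V, V') \<in> ncharts N"
    for \<phi> U U' \<psi> V V'
    using lrep_open_domain[OF manif_chart[OF M c] f is_chartD(3)[OF manif_chart[OF N d]]]
    by (simp add: lrep_iff nashf_def Let_def)
  then show ?thesis unfolding nash_map_def dim by (fastforce split: prod.splits)
qed

text \<open>Two charts that are compatible with every chart of an atlas are compatible with each
  other: compose the two transition maps through the atlas.\<close>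

lemma manif_of_atlas:
  assumes H: "Hausdorff_space X" and ne: "topspace X \<noteq> {}"
    and C: "\<And>c. c \<in> C \<Longrightarrow> is_chart X (Some m) c"
    and compat: "\<And>c d. c \<in> C \<Longrightarrow> d \<in> C \<Longrightarrow> lrep m m (\<lambda>a. a) c d"
    and C0: "C0 \<subseteq> C" "finite C0" "topspace X = (\<Union>(\<phi>, U, U') \<in> C0. U')"
  shows "manif (nash_space_of_atlas X (Some m) C) m" "C \<subseteq> ncharts (nash_space_of_atlas X (Some m) C)"
proof -
  let ?M = "nash_space_of_atlas X (Some m) C"
  have cc: "c \<in> ncharts ?M \<longleftrightarrow> is_chart X (Some m) c \<and> (\<forall>d\<in>C. lrep m m (\<lambda>a. a) c d \<and> lrep m m (\<lambda>a. a) d c)" for c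
    using nash_compatible_iff[of X m c] C unfolding nash_space_of_atlas_def by auto
  have cover: "chart_cover X m C0" using C0 C by (auto simp: chart_cover_def)
  show sub: "C \<subseteq> ncharts ?M" using cc C compat by auto
  have "lrep m m (\<lambda>a. a) c d" if "c \<in> ncharts ?M" "d \<in> ncharts ?M" for c d
    by (rule lrep_compose[where f = "\<lambda>a. a" and g = "\<lambda>a. a",
          OF continuous_map_identity continuous_map_identity cover])
      (use that[unfolded cc] C0 in blast)+
  then have "nash_compatible (Some m) c d" if "c \<in> ncharts ?M" "d \<in> ncharts ?M" for c d
    using nash_compatible_iff[of X m c d] that[unfolded cc] that by blast
  then show "manif ?M m" unfolding manif_def nash_manifold_def
    using H ne C0 sub by (intro conjI) (auto simp: nash_space_of_atlas_def intro!: exI[of _ C0])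
qed

lemma nash_space_of_atlas_sel [simp]:
  "ntop (nash_space_of_atlas X d C) = X" "ndim (nash_space_of_atlas X d C) = d"
  by (simp_all add: nash_space_of_atlas_def)

text \<open>The local representation in arbitrary charts is a composite of transition maps with local
  representations in the given atlases.\<close>

lemma nash_mapI_atlas:
  assumes M: "manif M m" and N: "manif N n" and f: "continuous_map (ntop M) (ntop N) f"
    and C: "C \<subseteq> ncharts M" "chart_cover (ntop M) m C" and C': "C' \<subseteq> ncharts N" "chart_cover (ntop N) n C'"
    and l: "\<And>c d. c \<in> C \<Longrightarrow> d \<in> C' \<Longrightarrow> lrep m n f c d"
  shows "nash_map M N f"
  unfolding nash_map_iff[OF M N]
proof (intro conjI f ballI)
  fix c d assume c: "c \<in> ncharts M" and d: "d \<in> ncharts N"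
  have fe: "lrep m n f c e" if e: "e \<in> C'" for e
    by (rule lrep_compose[where f = "\<lambda>a. a" and g = f,
          OF continuous_map_identity f C(2) manif_chart[OF M c]])
      (use manif_chart[OF N] C' C e l manif_compat[OF M c] in blast)+
  show "lrep m n f c d"
    by (rule lrep_compose[where f = f and g = "\<lambda>a. a",
          OF f continuous_map_identity C'(2) manif_chart[OF M c] manif_chart[OF N d]])
      (use fe C' manif_compat[OF N _ d] in blast)+
qed

lemma nash_map_compose:
  assumes "manif M m" "manif N k" "manif P n" "nash_map M N f" "nash_map N P g"
  shows "nash_map M P (\<lambda>a. g (f a))"
proof -
  obtain C where C: "C \<subseteq> ncharts N" "chart_cover (ntop N) k C" using manif_cover[OF assms(2)] .
  have f: "continuous_map (ntop M) (ntop N) f" "\<And>c d. c \<in> ncharts M \<Longrightarrow> d \<in> ncharts N \<Longrightarrow> lrep m k f c d"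
    using assms(4) unfolding nash_map_iff[OF assms(1,2)] by auto
  have g: "continuous_map (ntop N) (ntop P) g" "\<And>c d. c \<in> ncharts N \<Longrightarrow> d \<in> ncharts P \<Longrightarrow> lrep k n g c d"
    using assms(5) unfolding nash_map_iff[OF assms(2,3)] by auto
  have "lrep m n (\<lambda>a. g (f a)) c d" if "c \<in> ncharts M" "d \<in> ncharts P" for c d
    by (rule lrep_compose[OF f(1) g(1) C(2) manif_chart[OF assms(1) that(1)] manif_chart[OF assms(3) that(2)]])
      (use that f g C in blast)+
  then show ?thesis unfolding nash_map_iff[OF assms(1,3)]
    using continuous_map_compose[OF f(1) g(1)] by (simp add: o_def)
qed

lemma nash_map_id: "manif M m \<Longrightarrow> nash_map M M (\<lambda>a. a)"
  using nash_map_iff[of M m M m "\<lambda>a. a"] manif_compat continuous_map_identity by blast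

lemma lrep_cong:
  assumes c: "is_chart X (Some m) c" and eq: "\<And>a. a \<in> topspace X \<Longrightarrow> f a = g a" and f: "lrep m n f c d"
  shows "lrep m n g c d"
proof -
  obtain \<phi> U U' \<psi> V V' where cd: "c = (\<phi>, U, U')" "d = (\<psi>, V, V')" by (metis prod_cases3)
  have "f (\<phi> x) = g (\<phi> x)" if "x \<in> U" for x
    using is_chartD(6)[OF c[unfolded cd] that] openin_subset[OF is_chartD(3)[OF c[unfolded cd]]] by (auto intro: eq)
  then have D: "{x \<in> U. f (\<phi> x) \<in> V'} = {x \<in> U. g (\<phi> x) \<in> V'}" and
    h: "\<And>x. x \<in> {x \<in> U. f (\<phi> x) \<in> V'} \<Longrightarrow> inv_into V \<psi> (f (\<phi> x)) = inv_into V \<psi> (g (\<phi> x))" by auto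
  from nashf_cong[OF f[unfolded cd lrep_iff] h] show ?thesis unfolding cd lrep_iff D .
qed

lemma nash_map_cong:
  assumes "manif M m" "manif N n" "nash_map M N f" "\<And>a. a \<in> points M \<Longrightarrow> f a = g a"
  shows "nash_map M N g"
  using assms(3) unfolding nash_map_iff[OF assms(1,2)]
  using continuous_map_eq[of "ntop M" "ntop N" f g] assms(4) lrep_cong[where f = f and g = g, OF manif_chart[OF assms(1)] assms(4)] by blast

text \<open>A chart of \<open>M\<close> is compatible with all charts of \<open>N\<close> if the identity is Nash in both
  directions, hence it belongs to the maximal atlas of \<open>N\<close>.\<close>

lemma manif_eqI:
  assumes M: "manif M m" and N: "manif N m"
    and MN: "nash_map M N (\<lambda>a. a)" and NM: "nash_map N M (\<lambda>a. a)"
  shows "M = (N :: 'a nash_space)"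
proof -
  have mn: "continuous_map (ntop M) (ntop N) (\<lambda>a. a)"
    "\<And>c d. c \<in> ncharts M \<Longrightarrow> d \<in> ncharts N \<Longrightarrow> lrep m m (\<lambda>a. a) c d"
    using MN unfolding nash_map_iff[OF M N] by auto
  have nm: "continuous_map (ntop N) (ntop M) (\<lambda>a. a)"
    "\<And>c d. c \<in> ncharts N \<Longrightarrow> d \<in> ncharts M \<Longrightarrow> lrep m m (\<lambda>a. a) c d"
    using NM unfolding nash_map_iff[OF N M] by auto
  have ts: "points M = points N"
    using continuous_map_image_subset_topspace[OF mn(1)] continuous_map_image_subset_topspace[OF nm(1)] by auto
  have "openin (ntop M) S" if "openin (ntop N) S" for S
  proof -
    have "{x \<in> points M. x \<in> S} = S" using openin_subset[OF that] ts by auto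
    then show ?thesis using openin_preimage_topspace[OF mn(1) that] by simp
  qed
  moreover have "openin (ntop N) S" if "openin (ntop M) S" for S
  proof -
    have "{x \<in> points N. x \<in> S} = S" using openin_subset[OF that] ts by auto
    then show ?thesis using openin_preimage_topspace[OF nm(1) that] by simp
  qed
  ultimately have top: "ntop M = ntop N" unfolding topology_eq by blast
  have "c \<in> ncharts M" if "c \<in> ncharts N" for c
    by (rule manif_maximal[OF M manif_chart[OF N that, folded top]]) (use mn(2)[OF _ that] nm(2)[OF that] in blast)
  moreover have "c \<in> ncharts N" if "c \<in> ncharts M" for c
    by (rule manif_maximal[OF N manif_chart[OF M that, unfolded top]]) (use nm(2)[OF _ that] mn(2)[OF that] in blast)
  ultimately have "ncharts M = ncharts N" by blast
  then show ?thesis using top M N unfolding manif_def by (cases M, cases N) simp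
qed

section \<open>Open semialgebraic sets as Nash manifolds\<close>

definition Opn :: "nat \<Rightarrow> rvec set \<Rightarrow> rvec nash_space" where
  "Opn n U = nash_space_of_atlas (subtopology (euc n) U) (Some n) {(\<lambda>x\<in>U. x, U, U)}"

lemma ntop_Opn [simp]: "ntop (Opn n U) = subtopology (euc n) U"
  by (simp add: Opn_def)

lemma nashf_identity:
  assumes "openin (euc m) D" "semialg m D" "semialg m E" "D \<subseteq> E"
  shows "nashf m m D E (\<lambda>x. x)"
  using assms by (intro nashf_pfun) auto

lemma Opn_chart:
  assumes U: "openin (euc n) U" "semialg n U"
  shows "is_chart (subtopology (euc n) U) (Some n) (\<lambda>x\<in>U. x, U, U)"
proof -
  have "homeomorphic_map (subtopology (euc n) U) (subtopology (euc n) U) (\<lambda>x\<in>U. x)"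
    by (rule homeomorphic_map_eq[of _ _ id]) auto
  moreover have "openin (subtopology (euc n) U) U"
    using U openin_subtopology_refl openin_subset by blast
  ultimately show ?thesis using U by (simp add: is_chart_def subtopology_subtopology del: semialgebraic.simps)
qed

lemma Opn_manif:
  assumes U: "openin (euc n) U" "semialg n U" and ne: "U \<noteq> {}"
  shows "manif (Opn n U) n" "(\<lambda>x\<in>U. x, U, U) \<in> ncharts (Opn n U)"
    "chart_cover (ntop (Opn n U)) n {(\<lambda>x\<in>U. x, U, U)}"
proof -
  have ts: "topspace (subtopology (euc n) U) = U" using open_subset_vecs[OF U(1)] by auto
  have "lrep n n (\<lambda>a. a) (\<lambda>x\<in>U. x, U, U) (\<lambda>x\<in>U. x, U, U)"
  proof -
    have "inv_into U (\<lambda>x\<in>U. x) x = x" if "x \<in> U" for x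
      by (rule inv_into_f_eq) (use that in \<open>auto simp: inj_on_def\<close>)
    then have "nashf n n U U (\<lambda>x. inv_into U (\<lambda>x\<in>U. x) ((\<lambda>x\<in>U. x) x))"
      by (intro nashf_cong[OF nashf_identity[OF U(1,2,2)]]) auto
    moreover have "{x \<in> U. (\<lambda>x\<in>U. x) x \<in> U} = U" by auto
    ultimately show ?thesis by (simp add: lrep_iff)
  qed
  then have "manif (Opn n U) n \<and> {(\<lambda>x\<in>U. x, U, U)} \<subseteq> ncharts (Opn n U)"
    unfolding Opn_def
    by (intro conjI manif_of_atlas[where C = "{(\<lambda>x\<in>U. x, U, U)}" and ?C0.0 = "{(\<lambda>x\<in>U. x, U, U)}"])
      (use ts ne Opn_chart[OF U] Hausdorff_Euclidean_space in \<open>simp_all add: Hausdorff_space_subtopology\<close>)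
  then show "manif (Opn n U) n" "(\<lambda>x\<in>U. x, U, U) \<in> ncharts (Opn n U)" by auto
  show "chart_cover (ntop (Opn n U)) n {(\<lambda>x\<in>U. x, U, U)}"
    using Opn_chart[OF U] ts by (simp add: chart_cover_def)
qed

lemma restrict_id_inv: "x \<in> U \<Longrightarrow> inv_into U (\<lambda>x\<in>U. x) x = x"
  by (rule inv_into_f_eq) (auto simp: inj_on_def)

lemma lrep_Opn_domain:
  "lrep m n f (\<lambda>x\<in>U. x, U, U) (\<psi>, V, V') \<longleftrightarrow> nashf m n {x \<in> U. f x \<in> V'} V (\<lambda>x. inv_into V \<psi> (f x))"
proof -
  have D: "{x \<in> U. f ((\<lambda>x\<in>U. x) x) \<in> V'} = {x \<in> U. f x \<in> V'}" by auto
  show ?thesis unfolding lrep_iff D by (auto elim!: nashf_cong)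
qed

lemma nash_map_from_Opn:
  assumes U: "openin (euc m) U" "semialg m U" "U \<noteq> {}" and N: "manif N n"
    and f: "continuous_map (subtopology (euc m) U) (ntop N) f"
    and C: "C \<subseteq> ncharts N" "chart_cover (ntop N) n C"
    and l: "\<And>\<psi> V V'. (\<psi>, V, V') \<in> C \<Longrightarrow> nashf m n {x \<in> U. f x \<in> V'} V (\<lambda>x. inv_into V \<psi> (f x))"
  shows "nash_map (Opn m U) N f"
proof (rule nash_mapI_atlas[OF Opn_manif(1)[OF U] N _ _ Opn_manif(3)[OF U] C])
  show "continuous_map (ntop (Opn m U)) (ntop N) f" using f by simp
  show "{(\<lambda>x\<in>U. x, U, U)} \<subseteq> ncharts (Opn m U)" using Opn_manif(2)[OF U] by simp
  fix c d assume "c \<in> {(\<lambda>x\<in>U. x, U, U)}" "d \<in> C"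
  moreover obtain \<psi> V V' where "d = (\<psi>, V, V')" by (metis prod_cases3)
  ultimately show "lrep m n f c d" using l[of \<psi> V V'] lrep_Opn_domain[of m n f U \<psi> V V'] by simp
qed

lemma nashf_continuous:
  assumes f: "nashf m n U E f" and V: "openin (euc n) V" and sub: "f \<in> U \<rightarrow> V"
  shows "continuous_map (subtopology (euc m) U) (subtopology (euc n) V) f"
proof (rule continuous_map_into_open[OF V sub])
  fix j assume "j < n"
  then show "continuous_map (subtopology (euc m) U) euclideanreal (\<lambda>x. f x j)"
    using Ck_continuous nashf_D(3)[OF f] unfolding smooth_map_iff by blast
qed

lemma nash_map_Opn_Opn:
  assumes U: "openin (euc m) U" "semialg m U" "U \<noteq> {}"
    and V: "openin (euc n) V" "semialg n V" "V \<noteq> {}"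
  shows "nash_map (Opn m U) (Opn n V) f \<longleftrightarrow> nashf m n U V f"
proof
  assume f: "nash_map (Opn m U) (Opn n V) f"
  have tsU: "topspace (subtopology (euc m) U) = U" using open_subset_vecs[OF U(1)] by auto
  have tsV: "topspace (subtopology (euc n) V) = V" using open_subset_vecs[OF V(1)] by auto
  note f' = f[unfolded nash_map_iff[OF Opn_manif(1)[OF U] Opn_manif(1)[OF V]]]
  have sub: "f x \<in> V" if "x \<in> U" for x
    using continuous_map_image_subset_topspace[of "ntop (Opn m U)" "ntop (Opn n V)" f] f' tsU tsV that by auto
  have "lrep m n f (\<lambda>x\<in>U. x, U, U) (\<lambda>x\<in>V. x, V, V)"
    using f' Opn_manif(2)[OF U] Opn_manif(2)[OF V] by blast
  then have "nashf m n {x \<in> U. f x \<in> V} V (\<lambda>x. inv_into V (\<lambda>x\<in>V. x) (f x))"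
    unfolding lrep_Opn_domain .
  moreover have "{x \<in> U. f x \<in> V} = U" using sub by auto
  ultimately have "nashf m n U V (\<lambda>x. inv_into V (\<lambda>x\<in>V. x) (f x))" by simp
  then show "nashf m n U V f" by (rule nashf_cong) (use sub in \<open>simp add: restrict_id_inv\<close>)
next
  assume f: "nashf m n U V f"
  have sub: "f \<in> U \<rightarrow> V" using nashf_D(6)[OF f] by auto
  show "nash_map (Opn m U) (Opn n V) f"
  proof (rule nash_map_from_Opn[OF U Opn_manif(1)[OF V] _ _ Opn_manif(3)[OF V]])
    show "continuous_map (subtopology (euc m) U) (ntop (Opn n V)) f"
      using nashf_continuous[OF f V(1) sub] by simp
    show "{(\<lambda>x\<in>V. x, V, V)} \<subseteq> ncharts (Opn n V)" using Opn_manif(2)[OF V] by simp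
    fix \<psi> W W' assume "(\<psi>, W, W') \<in> {(\<lambda>x\<in>V. x, V, V)}"
    moreover have "{x \<in> U. f x \<in> V} = U" using sub by auto
    moreover have "nashf m n U V (\<lambda>x. inv_into V (\<lambda>x\<in>V. x) (f x))"
      by (rule nashf_cong[OF f]) (use nashf_D(6)[OF f] in \<open>simp add: restrict_id_inv\<close>)
    ultimately show "nashf m n {x \<in> U. f x \<in> W'} W (\<lambda>x. inv_into W \<psi> (f x))" by auto
  qed
qed

section \<open>Products\<close>

definition vprod :: "nat \<Rightarrow> rvec set \<Rightarrow> rvec set \<Rightarrow> rvec set" where
  "vprod m U V = {vjoin m x y | x y. x \<in> U \<and> y \<in> V}"

lemma vprod_iff:
  assumes "U \<subseteq> vecs m"
  shows "z \<in> vprod m U V \<longleftrightarrow> vfst m z \<in> U \<and> vsnd m z \<in> V"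
proof
  assume "z \<in> vprod m U V"
  then show "vfst m z \<in> U \<and> vsnd m z \<in> V" using assms by (auto simp: vprod_def)
next
  assume "vfst m z \<in> U \<and> vsnd m z \<in> V"
  then show "z \<in> vprod m U V" unfolding vprod_def
    by (intro CollectI exI[of _ "vfst m z"] exI[of _ "vsnd m z"]) simp
qed

lemma vprod_semialgebraic:
  assumes "semialg m U" "semialg n V"
  shows "semialg (m + n) (vprod m U V)"
proof -
  have sub: "U \<subseteq> vecs m" "V \<subseteq> vecs n" using assms semialgebraic_subset by blast+
  have "definable (\<lambda>z. vfst m z \<in> U \<and> vfst n (vsnd m z) \<in> V)"
    by (intro definable_conj definable_mem[OF assms(1)] definable_mem[OF assms(2)] pfun_entry) auto
  moreover have "vprod m U V = {z \<in> vecs (m + n). vfst m z \<in> U \<and> vfst n (vsnd m z) \<in> V}"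
  proof (intro equalityI subsetI)
    fix z assume z: "z \<in> vprod m U V"
    then have "z \<in> vecs (m + n)" using sub by (auto simp: vprod_def)
    then show "z \<in> {z \<in> vecs (m + n). vfst m z \<in> U \<and> vfst n (vsnd m z) \<in> V}"
      using z by (simp add: vprod_iff[OF sub(1)])
  qed (auto simp: vprod_iff[OF sub(1)])
  ultimately show ?thesis using definable_imp_semialgebraic by simp
qed

lemma vprod_open:
  assumes U: "openin (euc m) U" and V: "openin (euc n) V"
  shows "openin (euc (m + n)) (vprod m U V)"
  unfolding openin_Euclidean_box
proof (intro conjI ballI)
  note sub = open_subset_vecs[OF U] open_subset_vecs[OF V]
  show "vprod m U V \<subseteq> vecs (m + n)" using sub by (auto simp: vprod_def)
  fix z assume z: "z \<in> vprod m U V"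
  then have zz: "vfst m z \<in> U" "vsnd m z \<in> V" by (auto simp: vprod_iff[OF sub(1)])
  obtain d where d: "d > 0" "\<And>y. y \<in> vecs m \<Longrightarrow> (\<And>i. i < m \<Longrightarrow> \<bar>y i - vfst m z i\<bar> < d) \<Longrightarrow> y \<in> U"
    using open_boxE[OF U zz(1)] by blast
  obtain e where e: "e > 0" "\<And>y. y \<in> vecs n \<Longrightarrow> (\<And>i. i < n \<Longrightarrow> \<bar>y i - vsnd m z i\<bar> < e) \<Longrightarrow> y \<in> V"
    using open_boxE[OF V zz(2)] by blast
  have "y \<in> vprod m U V" if y: "y \<in> vecs (m + n)" "\<forall>i<m + n. \<bar>y i - z i\<bar> < min d e" for y
    unfolding vprod_iff[OF sub(1)]
  proof
    show "vfst m y \<in> U" by (rule d(2)) (use y in \<open>auto simp: vfst_def\<close>)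
    show "vsnd m y \<in> V"
    proof (rule e(2))
      show "vsnd m y \<in> vecs n" using y by simp
      show "\<bar>vsnd m y i - vsnd m z i\<bar> < e" if "i < n" for i
        using y(2)[rule_format, of "m + i"] that by (simp add: vsnd_def)
    qed
  qed
  then show "\<exists>e>0. \<forall>y\<in>vecs (m + n). (\<forall>i<m + n. \<bar>y i - z i\<bar> < e) \<longrightarrow> y \<in> vprod m U V"
    using d(1) e(1) by (intro exI[of _ "min d e"]) auto
qed

lemma nashf_components:
  assumes "openin (euc k) D" "semialg k D" "semialg n E"
    "f \<in> D \<rightarrow> E" "\<And>i. i < n \<Longrightarrow> \<exists>l E g j. nashf k l D E g \<and> j < l \<and> (\<forall>x\<in>D. f x i = g x j)"
  shows "nashf k n D E f"
  unfolding nashf_def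
proof (intro conjI)
  show "openin (euc k) D" by fact
  have "sfun k D (\<lambda>x. f x i) \<and> (\<forall>r. Ck_on r k D (\<lambda>x. f x i))" if "i < n" for i
  proof -
    obtain l E g j where g: "nashf k l D E g" "j < l" "\<forall>x\<in>D. f x i = g x j" using assms(5)[OF \<open>i < n\<close>] by blast
    have "sfun k D (\<lambda>x. g x j)" by (rule smap_component[OF nashf_D(2)[OF g(1)]])
    then have "sfun k D (\<lambda>x. f x i)" by (rule sfun_cong) (use g(3) in simp)
    moreover have "Ck_on r k D (\<lambda>x. f x i)" for r
    proof (rule Ck_cong[OF assms(1)])
      show "Ck_on r k D (\<lambda>x. g x j)" using nashf_D(3)[OF g(1)] g(2) unfolding smooth_map_iff by blast
    qed (use g(3) in simp)
    ultimately show ?thesis by blast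
  qed
  then show "smap k n D E f" "smooth_map (Some k) (Some n) D f"
    using assms(2-4) by (auto intro: smap_of_components simp: smooth_map_iff simp del: semialgebraic.simps)
qed

lemma nashf_vjoin:
  assumes f: "nashf k m D E f" and g: "nashf k n D E' g"
  shows "nashf k (m + n) D (vprod m E E') (\<lambda>z. vjoin m (f z) (g z))"
proof (rule nashf_components)
  show "openin (euc k) D" "semialg k D" using nashf_D[OF f] by blast+
  show "semialg (m + n) (vprod m E E')"
    using vprod_semialgebraic nashf_D(5)[OF f] nashf_D(5)[OF g] by blast
  show "(\<lambda>z. vjoin m (f z) (g z)) \<in> D \<rightarrow> vprod m E E'"
    using nashf_D(6)[OF f] nashf_D(6)[OF g] by (auto simp: vprod_def)
  fix i assume i: "i < m + n"
  show "\<exists>l E h j. nashf k l D E h \<and> j < l \<and> (\<forall>x\<in>D. vjoin m (f x) (g x) i = h x j)"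
  proof (cases "i < m")
    case True
    then show ?thesis using f by (intro exI[of _ m] exI[of _ E] exI[of _ f] exI[of _ i]) (simp add: vjoin_def)
  next
    case False
    then show ?thesis using g i
      by (intro exI[of _ n] exI[of _ E'] exI[of _ g] exI[of _ "i - m"]) (simp add: vjoin_def)
  qed
qed

lemma nashf_vfst_vsnd:
  assumes U: "openin (euc m) U" "semialg m U"
    and V: "openin (euc n) V" "semialg n V"
  shows "nashf (m + n) m (vprod m U V) U (vfst m)" "nashf (m + n) n (vprod m U V) V (vsnd m)"
  using open_subset_vecs[OF U(1)] U V
  by (auto intro!: nashf_pfun vprod_open vprod_semialgebraic pfun_entry simp: vprod_iff simp del: semialgebraic.simps)

fun prod_chart :: "nat \<Rightarrow> 'a chart \<Rightarrow> 'b chart \<Rightarrow> ('a \<times> 'b) chart" where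
  "prod_chart m (\<phi>, U, U') (\<psi>, V, V') =
     (\<lambda>z \<in> vprod m U V. (\<phi> (vfst m z), \<psi> (vsnd m z)), vprod m U V, U' \<times> V')"

lemma nash_prod_eq:
  assumes M: "manif M m" and N: "manif N n"
  shows "nash_prod M N = nash_space_of_atlas (prod_topology (ntop M) (ntop N)) (Some (m + n))
     {prod_chart m c d | c d. c \<in> ncharts M \<and> d \<in> ncharts N}"
proof -
  have eq: "(\<lambda>z \<in> {vjoin m x y | x y. x \<in> U \<and> y \<in> V}. (\<phi> (vfst m z), \<psi> (vsnd m z)),
      {vjoin m x y | x y. x \<in> U \<and> y \<in> V}, U' \<times> V') = prod_chart m (\<phi>, U, U') (\<psi>, V, V')"
    for \<phi> :: "rvec \<Rightarrow> 'a" and U U' and \<psi> :: "rvec \<Rightarrow> 'b" and V V'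
    by (simp add: vprod_def)
  have step: "{prod_chart m c d | c d. c \<in> ncharts M \<and> d \<in> ncharts N} =
      {prod_chart m (\<phi>, U, U') (\<psi>, V, V') | \<phi> U U' \<psi> V V'. (\<phi>, U, U') \<in> ncharts M \<and> (\<psi>, V, V') \<in> ncharts N}"
    by (intro Collect_cong) (simp only: split_paired_Ex)
  have d: "dim_nat (ndim M) = m" "dim_add (ndim M) (ndim N) = Some (m + n)" using M N by (simp_all add: manif_def)
  show ?thesis unfolding nash_prod_def Let_def d eq step ..
qed

lemma chart_inv_continuous:
  assumes c: "is_chart X (Some m) (\<phi>, U, U')" and W: "openin (euc m) W" "W \<subseteq> U"
  shows "openin X (\<phi> ` W)"
proof -
  have "open_map (subtopology (euc m) U) (subtopology X U') \<phi>"
    using is_chartD(5)[OF c] homeomorphic_imp_open_map by blast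
  then have "openin (subtopology X U') (\<phi> ` W)"
    unfolding open_map_def using W openin_open_subtopology[OF is_chartD(1)[OF c]] by auto
  then show ?thesis using openin_open_subtopology[OF is_chartD(3)[OF c]] by blast
qed

lemma homeomorphic_map_open_subsets:
  assumes "openin X U" "openin Y V" "bij_betw f U V" "continuous_map (subtopology X U) Y f"
    "\<And>W. openin X W \<Longrightarrow> W \<subseteq> U \<Longrightarrow> openin Y (f ` W)"
  shows "homeomorphic_map (subtopology X U) (subtopology Y V) f"
proof -
  have ts: "topspace (subtopology X U) = U" "topspace (subtopology Y V) = V"
    using openin_subset assms(1,2) by fastforce+
  have im: "f ` U = V" using assms(3) by (rule bij_betw_imp_surj_on)
  have "open_map (subtopology X U) (subtopology Y V) f"
    unfolding open_map_def
  proof (intro allI impI)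
    fix W assume "openin (subtopology X U) W"
    then have W: "openin X W" "W \<subseteq> U" using openin_open_subtopology[OF assms(1)] by auto
    then show "openin (subtopology Y V) (f ` W)"
      using assms(5)[OF W] openin_open_subtopology[OF assms(2)] im by blast
  qed
  moreover have "continuous_map (subtopology X U) (subtopology Y V) f"
    using assms(4) im ts by (auto simp: continuous_map_in_subtopology)
  ultimately show ?thesis using ts im assms(3)
    by (auto intro!: bijective_open_imp_homeomorphic_map simp: bij_betw_def)
qed

lemma prod_chart_is_chart:
  assumes c: "is_chart X (Some m) c" and d: "is_chart Y (Some n) d"
  shows "is_chart (prod_topology X Y) (Some (m + n)) (prod_chart m c d)"
proof -
  obtain \<phi> U U' \<psi> V V' where cd: "c = (\<phi>, U, U')" "d = (\<psi>, V, V')" by (metis prod_cases3)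
  note c' = is_chartD[OF c[unfolded cd]] and d' = is_chartD[OF d[unfolded cd]]
  note sub = open_subset_vecs[OF c'(1)] open_subset_vecs[OF d'(1)]
  let ?W = "vprod m U V" and ?\<phi> = "\<lambda>z \<in> vprod m U V. (\<phi> (vfst m z), \<psi> (vsnd m z))"
  have op: "openin (euc (m + n)) ?W" using vprod_open c'(1) d'(1) by blast
  have op': "openin (prod_topology X Y) (U' \<times> V')" using c'(3) d'(3) by (simp add: openin_prod_Times_iff)
  have "homeomorphic_map (subtopology (euc (m + n)) ?W) (subtopology (prod_topology X Y) (U' \<times> V')) ?\<phi>"
  proof (rule homeomorphic_map_open_subsets[OF op op'])
    show "bij_betw ?\<phi> ?W (U' \<times> V')"
      unfolding bij_betw_def
    proof
      show "inj_on ?\<phi> ?W"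
      proof (rule inj_onI)
        fix z w assume zw: "z \<in> ?W" "w \<in> ?W" "?\<phi> z = ?\<phi> w"
        then have "vfst m z = vfst m w" "vsnd m z = vsnd m w"
          using c'(7) d'(7) by (auto simp: vprod_iff[OF sub(1)] dest: inj_onD)
        then show "z = w" by (metis vjoin_vfst_vsnd)
      qed
      show "?\<phi> ` ?W = U' \<times> V'"
      proof (intro equalityI subsetI)
        fix p assume "p \<in> U' \<times> V'"
        then obtain x y where "x \<in> U" "y \<in> V" "p = (\<phi> x, \<psi> y)" using c'(8) d'(8) by auto
        moreover from this have "vjoin m x y \<in> ?W" by (auto simp: vprod_def)
        ultimately show "p \<in> ?\<phi> ` ?W" using sub by (intro image_eqI[of _ _ "vjoin m x y"]) auto
      qed (use c'(6) d'(6) in \<open>auto simp: vprod_iff[OF sub(1)]\<close>)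
    qed
    have "continuous_map (subtopology (euc (m + n)) ?W) X (\<phi> \<circ> vfst m)"
      by (rule continuous_map_compose[OF nashf_continuous[OF nashf_vfst_vsnd(1)[OF c'(1,2) d'(1,2)] c'(1)] c'(9)])
        (auto simp: vprod_iff[OF sub(1)])
    moreover have "continuous_map (subtopology (euc (m + n)) ?W) Y (\<psi> \<circ> vsnd m)"
      by (rule continuous_map_compose[OF nashf_continuous[OF nashf_vfst_vsnd(2)[OF c'(1,2) d'(1,2)] d'(1)] d'(9)])
        (auto simp: vprod_iff[OF sub(1)])
    ultimately have "continuous_map (subtopology (euc (m + n)) ?W) (prod_topology X Y)
        (\<lambda>z. (\<phi> (vfst m z), \<psi> (vsnd m z)))"
      by (simp add: continuous_map_pairwise o_def)
    then show "continuous_map (subtopology (euc (m + n)) ?W) (prod_topology X Y) ?\<phi>"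
      by (rule continuous_map_eq) simp
    fix T assume T: "openin (euc (m + n)) T" "T \<subseteq> ?W"
    show "openin (prod_topology X Y) (?\<phi> ` T)"
    proof (subst openin_subopen, intro ballI)
      fix p assume "p \<in> ?\<phi> ` T"
      then obtain z where z: "z \<in> T" "p = ?\<phi> z" by blast
      obtain e where e: "e > 0" "\<And>y. y \<in> vecs (m + n) \<Longrightarrow> (\<And>i. i < m + n \<Longrightarrow> \<bar>y i - z i\<bar> < e) \<Longrightarrow> y \<in> T"
        using open_boxE[OF T(1) z(1)] by blast
      have zW: "vfst m z \<in> U" "vsnd m z \<in> V" using z T by (auto simp: vprod_iff[OF sub(1)])
      define A where "A = {x \<in> U. \<forall>i<m. \<bar>x i - z i\<bar> < e}"
      define B where "B = {y \<in> V. \<forall>i<n. \<bar>y i - vsnd m z i\<bar> < e}"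
      have box_open: "openin (euc k) {x \<in> S. \<forall>i<k. \<bar>x i - w i\<bar> < e}"
        if S: "openin (euc k) S" for k S and w :: rvec
      proof -
        have "openin (euc k) {x \<in> S. x i \<in> ball (w i) e}" for i
        proof -
          have "openin euclideanreal (ball (w i) e)" by simp
          then show ?thesis
            using Ck_continuous[OF Ck_coord[of 0 k S i]] unfolding continuous_map_open_subtopology[OF S] by blast
        qed
        then have "openin (euc k) (S \<inter> (\<Inter>i\<in>{..<k}. {x \<in> S. x i \<in> ball (w i) e}))"
        proof (cases "k = 0")
          case False
          assume *: "\<And>i. openin (euc k) {x \<in> S. x i \<in> ball (w i) e}"
          have "openin (euc k) (\<Inter>i\<in>{..<k}. {x \<in> S. x i \<in> ball (w i) e})"
            using False * by (intro openin_INT2) auto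
          then show ?thesis using S by blast
        qed (use S in simp)
        moreover have "S \<inter> (\<Inter>i\<in>{..<k}. {x \<in> S. x i \<in> ball (w i) e}) = {x \<in> S. \<forall>i<k. \<bar>x i - w i\<bar> < e}"
          by (auto simp: dist_real_def abs_minus_commute)
        ultimately show ?thesis by simp
      qed
      have AB: "openin (euc m) A" "openin (euc n) B"
        unfolding A_def B_def using box_open[OF c'(1)] box_open[OF d'(1)] by blast+
      have "openin X (\<phi> ` A)" "openin Y (\<psi> ` B)"
        using chart_inv_continuous[OF c[unfolded cd] AB(1)] chart_inv_continuous[OF d[unfolded cd] AB(2)]
        by (auto simp: A_def B_def)
      then have "openin (prod_topology X Y) (\<phi> ` A \<times> \<psi> ` B)" by (simp add: openin_prod_Times_iff)
      moreover have "p \<in> \<phi> ` A \<times> \<psi> ` B"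
        using z(2) zW e(1) T(2) z(1) by (auto simp: A_def B_def vfst_def)
      moreover have "\<phi> ` A \<times> \<psi> ` B \<subseteq> ?\<phi> ` T"
      proof
        fix q assume "q \<in> \<phi> ` A \<times> \<psi> ` B"
        then obtain x y where xy: "x \<in> A" "y \<in> B" "q = (\<phi> x, \<psi> y)" by auto
        have x: "x \<in> vecs m" "y \<in> vecs n" using xy sub by (auto simp: A_def B_def)
        have "vjoin m x y \<in> T"
        proof (rule e(2))
          show "vjoin m x y \<in> vecs (m + n)" using x by simp
          show "\<bar>vjoin m x y i - z i\<bar> < e" if "i < m + n" for i
          proof (cases "i < m")
            case True
            then show ?thesis using xy by (auto simp: vjoin_def A_def)
          next
            case False
            then have "i - m < n" "vsnd m z (i - m) = z i" using that by (auto simp: vsnd_def)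
            moreover have "\<forall>i<n. \<bar>y i - vsnd m z i\<bar> < e" using xy(2) by (simp add: B_def)
            ultimately show ?thesis using False by (metis vjoin_def)
          qed
        qed
        then show "q \<in> ?\<phi> ` T" using T(2) xy x by (intro image_eqI[of _ _ "vjoin m x y"]) auto
      qed
      ultimately show "\<exists>S. openin (prod_topology X Y) S \<and> p \<in> S \<and> S \<subseteq> ?\<phi> ` T" by blast
    qed
  qed
  then show ?thesis using op op' vprod_semialgebraic[OF c'(2) d'(2)]
    by (simp add: cd is_chart_def del: semialgebraic.simps)
qed

lemma prod_chart_inv:
  assumes c: "is_chart X (Some m) (\<phi>, U, U')" and d: "is_chart Y (Some n) (\<psi>, V, V')"
    and "a \<in> U'" "b \<in> V'"
  shows "inv_into (vprod m U V) (\<lambda>z \<in> vprod m U V. (\<phi> (vfst m z), \<psi> (vsnd m z))) (a, b) =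
    vjoin m (inv_into U \<phi> a) (inv_into V \<psi> b)"
proof (rule inv_into_f_eq)
  note sub = open_subset_vecs[OF is_chartD(1)[OF c]] open_subset_vecs[OF is_chartD(1)[OF d]]
  note pc = prod_chart_is_chart[OF c d, simplified]
  note ci = chart_inv[OF c] and di = chart_inv[OF d]
  show "inj_on (\<lambda>z \<in> vprod m U V. (\<phi> (vfst m z), \<psi> (vsnd m z))) (vprod m U V)" using is_chartD(7)[OF pc] .
  show "vjoin m (inv_into U \<phi> a) (inv_into V \<psi> b) \<in> vprod m U V"
    using ci(1)[OF assms(3)] di(1)[OF assms(4)] by (auto simp: vprod_def)
  then show "(\<lambda>z \<in> vprod m U V. (\<phi> (vfst m z), \<psi> (vsnd m z))) (vjoin m (inv_into U \<phi> a) (inv_into V \<psi> b)) = (a, b)"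
    using ci di assms(3,4) sub by (simp add: subset_iff)
qed

lemma lrep_pair:
  assumes c: "is_chart X (Some k) c" and d: "is_chart Y (Some m) d" and e: "is_chart Z (Some n) e"
    and f: "continuous_map X Y f" "lrep k m f c d" and g: "continuous_map X Z g" "lrep k n g c e"
  shows "lrep k (m + n) (\<lambda>a. (f a, g a)) c (prod_chart m d e)"
proof -
  obtain \<phi> U U' \<psi> V V' \<theta> W W' where cde: "c = (\<phi>, U, U')" "d = (\<psi>, V, V')" "e = (\<theta>, W, W')"
    by (metis prod_cases3)
  note c' = is_chartD[OF c[unfolded cde]] and d' = is_chartD[OF d[unfolded cde]] and e' = is_chartD[OF e[unfolded cde]]
  let ?D1 = "{x \<in> U. f (\<phi> x) \<in> V'}" and ?D2 = "{x \<in> U. g (\<phi> x) \<in> W'}"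
  have f': "nashf k m ?D1 V (\<lambda>x. inv_into V \<psi> (f (\<phi> x)))" using f(2) by (simp add: cde lrep_iff)
  have g': "nashf k n ?D2 W (\<lambda>x. inv_into W \<theta> (g (\<phi> x)))" using g(2) by (simp add: cde lrep_iff)
  have D: "openin (euc k) (?D1 \<inter> ?D2)" "semialg k (?D1 \<inter> ?D2)"
    using nashf_D(1,4)[OF f'] nashf_D(1,4)[OF g'] semialgebraic_Int by blast+
  have "nashf k m (?D1 \<inter> ?D2) V (\<lambda>x. inv_into V \<psi> (f (\<phi> x)))" by (rule nashf_restrict[OF f' D(2) _ D(1)]) blast
  moreover have "nashf k n (?D1 \<inter> ?D2) W (\<lambda>x. inv_into W \<theta> (g (\<phi> x)))" by (rule nashf_restrict[OF g' D(2) _ D(1)]) blast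
  ultimately have "nashf k (m + n) (?D1 \<inter> ?D2) (vprod m V W)
      (\<lambda>x. vjoin m (inv_into V \<psi> (f (\<phi> x))) (inv_into W \<theta> (g (\<phi> x))))" by (rule nashf_vjoin)
  then have "nashf k (m + n) (?D1 \<inter> ?D2) (vprod m V W)
      (\<lambda>x. inv_into (vprod m V W) (\<lambda>z \<in> vprod m V W. (\<psi> (vfst m z), \<theta> (vsnd m z))) (f (\<phi> x), g (\<phi> x)))"
    by (rule nashf_cong) (use prod_chart_inv[OF d[unfolded cde] e[unfolded cde]] in auto)
  moreover have "?D1 \<inter> ?D2 = {x \<in> U. (f (\<phi> x), g (\<phi> x)) \<in> V' \<times> W'}" by auto
  ultimately show ?thesis by (simp add: cde lrep_iff)
qed

lemma lrep_projections:
  assumes c: "is_chart X (Some m) c" and d: "is_chart Y (Some n) d"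
    and c1: "is_chart X (Some m) c1" "lrep m m (\<lambda>a. a) c c1" and d1: "is_chart Y (Some n) d1" "lrep n n (\<lambda>a. a) d d1"
  shows "lrep (m + n) m fst (prod_chart m c d) c1" "lrep (m + n) n snd (prod_chart m c d) d1"
proof -
  obtain \<phi> U U' \<psi> V V' \<phi>1 U1 U1' \<psi>1 V1 V1' where cd: "c = (\<phi>, U, U')" "d = (\<psi>, V, V')"
    "c1 = (\<phi>1, U1, U1')" "d1 = (\<psi>1, V1, V1')" by (metis prod_cases3)
  note c' = is_chartD[OF c[unfolded cd]] and d' = is_chartD[OF d[unfolded cd]]
  note sub = open_subset_vecs[OF c'(1)]
  have c1': "nashf m m {x \<in> U. \<phi> x \<in> U1'} U1 (\<lambda>x. inv_into U1 \<phi>1 (\<phi> x))" using c1(2) by (simp add: cd lrep_iff)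
  have d1': "nashf n n {x \<in> V. \<psi> x \<in> V1'} V1 (\<lambda>x. inv_into V1 \<psi>1 (\<psi> x))" using d1(2) by (simp add: cd lrep_iff)
  have 1: "{z \<in> vprod m U V. fst ((\<lambda>z \<in> vprod m U V. (\<phi> (vfst m z), \<psi> (vsnd m z))) z) \<in> U1'} =
      vprod m {x \<in> U. \<phi> x \<in> U1'} V" using sub by (auto simp: vprod_iff subset_iff)
  have 2: "{z \<in> vprod m U V. snd ((\<lambda>z \<in> vprod m U V. (\<phi> (vfst m z), \<psi> (vsnd m z))) z) \<in> V1'} =
      vprod m U {x \<in> V. \<psi> x \<in> V1'}" using sub by (auto simp: vprod_iff subset_iff)
  have "nashf (m + n) m (vprod m {x \<in> U. \<phi> x \<in> U1'} V) U1 (\<lambda>z. inv_into U1 \<phi>1 (\<phi> (vfst m z)))"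
    by (rule nashf_compose[OF nashf_vfst_vsnd(1)[OF nashf_D(1,4)[OF c1'] d'(1,2)] c1'])
      (use sub in \<open>auto simp: vprod_iff subset_iff\<close>)
  then have "nashf (m + n) m (vprod m {x \<in> U. \<phi> x \<in> U1'} V) U1
      (\<lambda>z. inv_into U1 \<phi>1 (fst ((\<lambda>z \<in> vprod m U V. (\<phi> (vfst m z), \<psi> (vsnd m z))) z)))"
    by (rule nashf_cong) (use 1 in auto)
  then show "lrep (m + n) m fst (prod_chart m c d) c1" unfolding cd prod_chart.simps lrep_iff 1 .
  have "nashf (m + n) n (vprod m U {x \<in> V. \<psi> x \<in> V1'}) V1 (\<lambda>z. inv_into V1 \<psi>1 (\<psi> (vsnd m z)))"
    by (rule nashf_compose[OF nashf_vfst_vsnd(2)[OF c'(1,2) nashf_D(1,4)[OF d1']] d1'])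
      (use sub in \<open>auto simp: vprod_iff subset_iff\<close>)
  then have "nashf (m + n) n (vprod m U {x \<in> V. \<psi> x \<in> V1'}) V1
      (\<lambda>z. inv_into V1 \<psi>1 (snd ((\<lambda>z \<in> vprod m U V. (\<phi> (vfst m z), \<psi> (vsnd m z))) z)))"
    by (rule nashf_cong) (use 2 in auto)
  then show "lrep (m + n) n snd (prod_chart m c d) d1" unfolding cd prod_chart.simps lrep_iff 2 .
qed

lemma prod_charts_subset:
  assumes "C \<subseteq> A" "D \<subseteq> B"
  shows "(\<lambda>(c, d). prod_chart m c d) ` (C \<times> D) \<subseteq> {prod_chart m c d | c d. c \<in> A \<and> d \<in> B}"
proof
  fix x assume "x \<in> (\<lambda>(c, d). prod_chart m c d) ` (C \<times> D)"
  then obtain p where p: "p \<in> C \<times> D" "x = (case p of (c, d) \<Rightarrow> prod_chart m c d)" by blast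
  then have "fst p \<in> C" "snd p \<in> D" "x = prod_chart m (fst p) (snd p)" by (simp_all add: mem_Times_iff case_prod_unfold)
  then show "x \<in> {prod_chart m c d | c d. c \<in> A \<and> d \<in> B}" using assms by blast
qed

lemma chart_cover_prod:
  assumes C: "chart_cover X m C" and D: "chart_cover Y n D"
  shows "chart_cover (prod_topology X Y) (m + n) ((\<lambda>(c, d). prod_chart m c d) ` (C \<times> D))"
  unfolding chart_cover_def
proof (intro conjI ballI)
  let ?C0 = "(\<lambda>(c, d). prod_chart m c d) ` (C \<times> D)"
  show "finite ?C0" using C D by (simp add: chart_cover_def)
  show "is_chart (prod_topology X Y) (Some (m + n)) e" if e: "e \<in> ?C0" for e
  proof -
    have "e \<in> {prod_chart m c d | c d. c \<in> C \<and> d \<in> D}"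
      by (rule subsetD[OF prod_charts_subset[OF subset_refl subset_refl] e])
    then obtain c d where cd: "c \<in> C" "d \<in> D" "e = prod_chart m c d" by blast
    have "is_chart X (Some m) c" "is_chart Y (Some n) d" using C D cd(1,2) by (simp_all only: chart_cover_def)
    then show ?thesis unfolding cd(3) by (rule prod_chart_is_chart)
  qed
  have sp: "(case prod_chart m c d of (\<phi>, U, U') \<Rightarrow> U') = (case c of (\<phi>, U, U') \<Rightarrow> U') \<times> (case d of (\<phi>, U, U') \<Rightarrow> U')"
    for c :: "'a chart" and d :: "'b chart" by (cases c; cases d) simp
  have "topspace (prod_topology X Y) = (\<Union>(\<phi>, U, U') \<in> C. U') \<times> (\<Union>(\<phi>, U, U') \<in> D. U')"
    using C D by (simp add: chart_cover_def)
  also have "\<dots> = (\<Union>(c, d)\<in>C \<times> D. case prod_chart m c d of (\<phi>, U, U') \<Rightarrow> U')"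
    unfolding sp by blast
  also have "\<dots> = (\<Union>(\<phi>, U, U') \<in> ?C0. U')" by (simp add: image_image case_prod_unfold)
  finally show "topspace (prod_topology X Y) = (\<Union>(\<phi>, U, U') \<in> ?C0. U')" .
qed

text \<open>Transition maps between product charts are pairs of composites of projections with
  transition maps.\<close>

lemma nash_prod_manif:
  assumes M: "manif M m" and N: "manif N n" and ne: "points M \<noteq> {}" "points N \<noteq> {}"
  shows "manif (nash_prod M N) (m + n)"
    "\<And>c d. c \<in> ncharts M \<Longrightarrow> d \<in> ncharts N \<Longrightarrow> prod_chart m c d \<in> ncharts (nash_prod M N)"
    "ntop (nash_prod M N) = prod_topology (ntop M) (ntop N)"
proof -
  let ?P = "{prod_chart m c d | c d. c \<in> ncharts M \<and> d \<in> ncharts N}"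
  obtain C where C: "C \<subseteq> ncharts M" "chart_cover (ntop M) m C" using manif_cover[OF M] .
  obtain D where D: "D \<subseteq> ncharts N" "chart_cover (ntop N) n D" using manif_cover[OF N] .
  let ?C0 = "(\<lambda>(c, d). prod_chart m c d) ` (C \<times> D)"
  note sub = prod_charts_subset[OF C(1) D(1), of m] and cover = chart_cover_prod[OF C(2) D(2)]
  have ch: "is_chart (prod_topology (ntop M) (ntop N)) (Some (m + n)) (prod_chart m c d)"
    if "c \<in> ncharts M" "d \<in> ncharts N" for c d
    by (rule prod_chart_is_chart[OF manif_chart[OF M that(1)] manif_chart[OF N that(2)]])
  have lr: "lrep (m + n) (m + n) (\<lambda>a. a) (prod_chart m c d) (prod_chart m c1 d1)"
    if cd: "c \<in> ncharts M" "d \<in> ncharts N" "c1 \<in> ncharts M" "d1 \<in> ncharts N" for c d c1 d1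
  proof -
    note lp = lrep_projections[OF manif_chart[OF M cd(1)] manif_chart[OF N cd(2)]
        manif_chart[OF M cd(3)] manif_compat[OF M cd(1,3)] manif_chart[OF N cd(4)] manif_compat[OF N cd(2,4)]]
    have "lrep (m + n) (m + n) (\<lambda>a. (fst a, snd a)) (prod_chart m c d) (prod_chart m c1 d1)"
      by (rule lrep_pair[OF ch[OF cd(1,2)] manif_chart[OF M cd(3)] manif_chart[OF N cd(4)] _ lp(1) _ lp(2)])
        (simp_all add: continuous_map_fst continuous_map_snd)
    then show ?thesis by simp
  qed
  have "manif (nash_prod M N) (m + n) \<and> ?P \<subseteq> ncharts (nash_prod M N)"
    unfolding nash_prod_eq[OF M N]
  proof (intro conjI manif_of_atlas[where C = ?P and ?C0.0 = ?C0])
    show "Hausdorff_space (prod_topology (ntop M) (ntop N))" "Hausdorff_space (prod_topology (ntop M) (ntop N))"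
      using manif_Hausdorff[OF M] manif_Hausdorff[OF N] by (simp_all add: Hausdorff_space_prod_topology)
    show "topspace (prod_topology (ntop M) (ntop N)) \<noteq> {}" "topspace (prod_topology (ntop M) (ntop N)) \<noteq> {}"
      using ne by auto
    show "?C0 \<subseteq> ?P" "?C0 \<subseteq> ?P" by (rule sub)+
    show "finite ?C0" "finite ?C0" using cover by (simp_all add: chart_cover_def)
    show "topspace (prod_topology (ntop M) (ntop N)) = (\<Union>(\<phi>, U, U') \<in> ?C0. U')"
      "topspace (prod_topology (ntop M) (ntop N)) = (\<Union>(\<phi>, U, U') \<in> ?C0. U')"
      using cover by (simp_all add: chart_cover_def)
  qed (use ch lr in blast)+
  then show "manif (nash_prod M N) (m + n)"
    "\<And>c d. c \<in> ncharts M \<Longrightarrow> d \<in> ncharts N \<Longrightarrow> prod_chart m c d \<in> ncharts (nash_prod M N)" by blast+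
  show "ntop (nash_prod M N) = prod_topology (ntop M) (ntop N)" by (simp add: nash_prod_eq[OF M N])
qed

lemma nash_prod_cover:
  assumes M: "manif M m" and N: "manif N n" and ne: "points M \<noteq> {}" "points N \<noteq> {}"
  obtains C where "C \<subseteq> {prod_chart m c d | c d. c \<in> ncharts M \<and> d \<in> ncharts N}"
    "chart_cover (ntop (nash_prod M N)) (m + n) C"
proof -
  obtain C where C: "C \<subseteq> ncharts M" "chart_cover (ntop M) m C" using manif_cover[OF M] .
  obtain D where D: "D \<subseteq> ncharts N" "chart_cover (ntop N) n D" using manif_cover[OF N] .
  note P = nash_prod_manif[OF M N ne]
  show ?thesis
    using that[OF prod_charts_subset[OF C(1) D(1), of m]] chart_cover_prod[OF C(2) D(2)] by (simp add: P(3))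
qed

lemma nash_map_Pair:
  assumes P: "manif P k" and M: "manif M m" and N: "manif N n"
    and ne: "points M \<noteq> {}" "points N \<noteq> {}"
    and f: "nash_map P M f" and g: "nash_map P N g"
  shows "nash_map P (nash_prod M N) (\<lambda>a. (f a, g a))"
proof -
  note MN = nash_prod_manif[OF M N ne]
  obtain C where C: "C \<subseteq> {prod_chart m c d | c d. c \<in> ncharts M \<and> d \<in> ncharts N}"
    "chart_cover (ntop (nash_prod M N)) (m + n) C" using nash_prod_cover[OF M N ne] .
  obtain D where D: "D \<subseteq> ncharts P" "chart_cover (ntop P) k D" using manif_cover[OF P] .
  note f' = f[unfolded nash_map_iff[OF P M]] and g' = g[unfolded nash_map_iff[OF P N]]
  show ?thesis
  proof (rule nash_mapI_atlas[OF P MN(1) _ D _ C(2)])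
    show "continuous_map (ntop P) (ntop (nash_prod M N)) (\<lambda>a. (f a, g a))"
      using f' g' by (simp add: MN(3) continuous_map_pairwise o_def)
    show "C \<subseteq> ncharts (nash_prod M N)" using C(1) MN(2) by blast
    fix c d assume c: "c \<in> D" and "d \<in> C"
    then obtain d1 d2 where d: "d = prod_chart m d1 d2" "d1 \<in> ncharts M" "d2 \<in> ncharts N" using C(1) by blast
    have cP: "c \<in> ncharts P" using c D by blast
    show "lrep k (m + n) (\<lambda>a. (f a, g a)) c d"
      unfolding d(1)
      by (rule lrep_pair[OF manif_chart[OF P cP] manif_chart[OF M d(2)] manif_chart[OF N d(3)]])
        (use f' g' d cP in blast)+
  qed
qed

lemma nash_map_fst_snd:
  assumes M: "manif M m" and N: "manif N n" and ne: "points M \<noteq> {}" "points N \<noteq> {}"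
  shows "nash_map (nash_prod M N) M fst" "nash_map (nash_prod M N) N snd"
proof -
  note MN = nash_prod_manif[OF M N ne]
  obtain C where C: "C \<subseteq> {prod_chart m c d | c d. c \<in> ncharts M \<and> d \<in> ncharts N}"
    "chart_cover (ntop (nash_prod M N)) (m + n) C" using nash_prod_cover[OF M N ne] .
  have CN: "C \<subseteq> ncharts (nash_prod M N)" using C(1) MN(2) by blast
  obtain D where D: "D \<subseteq> ncharts M" "chart_cover (ntop M) m D" using manif_cover[OF M] .
  obtain E where E: "E \<subseteq> ncharts N" "chart_cover (ntop N) n E" using manif_cover[OF N] .
  have ne': "ncharts M \<noteq> {}" "ncharts N \<noteq> {}" using D E ne by (auto simp: chart_cover_def)
  have lp: "lrep (m + n) m fst (prod_chart m c d) c1 \<and> lrep (m + n) n snd (prod_chart m c d) d1"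
    if cd: "c \<in> ncharts M" "d \<in> ncharts N" "c1 \<in> ncharts M" "d1 \<in> ncharts N" for c d c1 d1
    using lrep_projections[OF manif_chart[OF M cd(1)] manif_chart[OF N cd(2)]
        manif_chart[OF M cd(3)] manif_compat[OF M cd(1,3)] manif_chart[OF N cd(4)] manif_compat[OF N cd(2,4)]]
    by blast
  show "nash_map (nash_prod M N) M fst"
  proof (rule nash_mapI_atlas[OF MN(1) M _ CN C(2) D])
    fix c d assume "c \<in> C" "d \<in> D"
    then show "lrep (m + n) m fst c d" using C(1) D(1) lp ne' by blast
  qed (simp add: MN(3) continuous_map_fst)
  show "nash_map (nash_prod M N) N snd"
  proof (rule nash_mapI_atlas[OF MN(1) N _ CN C(2) E])
    fix c d assume "c \<in> C" "d \<in> E"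
    then show "lrep (m + n) n snd c d" using C(1) E(1) lp ne' by blast
  qed (simp add: MN(3) continuous_map_snd)
qed

section \<open>Transport of structure\<close>

lemma nash_image_sel:
  "ntop (nash_image \<kappa> M) = pullback_topology (\<kappa> ` points M) (inv_into (points M) \<kappa>) (ntop M)"
  "ndim (nash_image \<kappa> M) = ndim M"
  "ncharts (nash_image \<kappa> M) = (\<lambda>(\<phi>, U, U'). (compose U \<kappa> \<phi>, U, \<kappa> ` U')) ` ncharts M"
  by (simp_all add: nash_image_def)

lemma nash_image_homeomorphic:
  assumes inj: "inj_on \<kappa> (points M)"
  shows "homeomorphic_map (ntop M) (ntop (nash_image \<kappa> M)) \<kappa>"
    "points (nash_image \<kappa> M) = \<kappa> ` points M"
proof -
  let ?T = "points M"
  have pre: "inv_into ?T \<kappa> -` U \<inter> \<kappa> ` ?T = \<kappa> ` U" if "U \<subseteq> ?T" for U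
    using that inj by (auto simp: inv_into_f_f subset_iff)
  have op: "openin (ntop (nash_image \<kappa> M)) S \<longleftrightarrow> (\<exists>U. openin (ntop M) U \<and> S = \<kappa> ` U)" for S
    unfolding nash_image_sel openin_pullback_topology using pre openin_subset by metis
  show ts: "points (nash_image \<kappa> M) = \<kappa> ` ?T"
    unfolding nash_image_sel topspace_pullback_topology using pre[of ?T] by simp
  show "homeomorphic_map (ntop M) (ntop (nash_image \<kappa> M)) \<kappa>"
  proof (rule bijective_open_imp_homeomorphic_map)
    show "continuous_map (ntop M) (ntop (nash_image \<kappa> M)) \<kappa>"
      unfolding continuous_map_def ts op
    proof (intro conjI allI impI)
      fix S assume "\<exists>U. openin (ntop M) U \<and> S = \<kappa> ` U"
      then obtain U where U: "openin (ntop M) U" "S = \<kappa> ` U" by blast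
      then have "{x \<in> ?T. \<kappa> x \<in> S} = U" using inj openin_subset[OF U(1)] by (auto simp: inj_on_def subset_iff)
      then show "openin (ntop M) {x \<in> ?T. \<kappa> x \<in> S}" using U by simp
    qed auto
    show "open_map (ntop M) (ntop (nash_image \<kappa> M)) \<kappa>" unfolding open_map_def op by blast
    show "\<kappa> ` ?T = points (nash_image \<kappa> M)" using ts by simp
    show "inj_on \<kappa> ?T" by fact
  qed
qed

lemma inv_into_compose:
  assumes "inj_on \<phi> U" "\<phi> ` U = U'" "inj_on \<kappa> T" "U' \<subseteq> T" "a \<in> U'"
  shows "inv_into U (compose U \<kappa> \<phi>) (\<kappa> a) = inv_into U \<phi> a"
proof (rule inv_into_f_eq)
  show "inj_on (compose U \<kappa> \<phi>) U"
    using assms(1-4) by (auto simp: inj_on_def compose_def image_iff subset_iff) blast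
  show "inv_into U \<phi> a \<in> U" using assms(2,5) by (auto intro: inv_into_into)
  then show "compose U \<kappa> \<phi> (inv_into U \<phi> a) = \<kappa> a" using assms(2,5) by (simp add: compose_def f_inv_into_f)
qed

lemma lrep_transport_target:
  assumes c: "is_chart X (Some m) (\<phi>, U, U')" and d: "is_chart Y (Some n) (\<psi>, V, V')"
    and inj: "inj_on \<kappa> (topspace Y)" and f: "\<And>a. a \<in> topspace X \<Longrightarrow> f a \<in> topspace Y"
  shows "lrep m n (\<lambda>a. \<kappa> (f a)) (\<phi>, U, U') (compose V \<kappa> \<psi>, V, \<kappa> ` V') \<longleftrightarrow> lrep m n f (\<phi>, U, U') (\<psi>, V, V')"
proof -
  note c' = is_chartD[OF c] and d' = is_chartD[OF d]
  note sub = openin_subset[OF c'(3)] openin_subset[OF d'(3)]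
  have fY: "f (\<phi> x) \<in> topspace Y" if "x \<in> U" for x using f c'(6)[OF that] sub by blast
  have D: "{x \<in> U. \<kappa> (f (\<phi> x)) \<in> \<kappa> ` V'} = {x \<in> U. f (\<phi> x) \<in> V'}"
    using fY sub(2) inj by (auto simp: inj_on_def subset_iff)
  have "inv_into V (compose V \<kappa> \<psi>) (\<kappa> (f (\<phi> x))) = inv_into V \<psi> (f (\<phi> x))" if "f (\<phi> x) \<in> V'" for x
    using inv_into_compose[OF d'(7,8) inj sub(2) that] .
  then show ?thesis unfolding lrep_iff D by (auto elim!: nashf_cong)
qed

lemma lrep_transport_source:
  "lrep m n g (compose U \<kappa> \<phi>, U, W) d \<longleftrightarrow> lrep m n (\<lambda>a. g (\<kappa> a)) (\<phi>, U, U') d"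
proof -
  obtain \<psi> V V' where d: "d = (\<psi>, V, V')" by (metis prod_cases3)
  have D: "{x \<in> U. g (compose U \<kappa> \<phi> x) \<in> V'} = {x \<in> U. g (\<kappa> (\<phi> x)) \<in> V'}" by (auto simp: compose_def)
  show ?thesis unfolding d lrep_iff D by (auto elim!: nashf_cong simp: compose_def)
qed

lemma transport_is_chart:
  assumes h: "homeomorphic_map X Y \<kappa>" and c: "is_chart X (Some m) (\<phi>, U, U')"
  shows "is_chart Y (Some m) (compose U \<kappa> \<phi>, U, \<kappa> ` U')"
proof -
  note c' = is_chartD[OF c]
  have "homeomorphic_map (subtopology X U') (subtopology Y (\<kappa> ` U')) \<kappa>"
    using homeomorphic_map_subtopologies[OF h] openin_subset[OF c'(3)] by (metis Int_absorb1 homeomorphic_imp_surjective_map h image_mono)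
  then have "homeomorphic_map (subtopology (euc m) U) (subtopology Y (\<kappa> ` U')) (\<kappa> \<circ> \<phi>)"
    using c'(5) homeomorphic_map_compose by blast
  then have "homeomorphic_map (subtopology (euc m) U) (subtopology Y (\<kappa> ` U')) (compose U \<kappa> \<phi>)"
    by (rule homeomorphic_map_eq) (simp add: compose_def)
  moreover have "openin Y (\<kappa> ` U')"
    using homeomorphic_imp_open_map[OF h] c'(3) by (auto simp: open_map_def)
  ultimately show ?thesis using c' by (simp add: is_chart_def compose_extensional del: semialgebraic.simps)
qed

text \<open>Local representations are unchanged when a chart is followed by \<open>\<kappa>\<close>, so the transition
  maps of the image are those of \<open>M\<close>.\<close>

lemma nash_image_manif:
  assumes M: "manif M m" and inj: "inj_on \<kappa> (points M)"
  shows "manif (nash_image \<kappa> M) m" "nash_map M (nash_image \<kappa> M) \<kappa>"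
    "nash_map (nash_image \<kappa> M) M (inv_into (points M) \<kappa>)"
proof -
  let ?N = "nash_image \<kappa> M" and ?T = "points M"
  define \<mu> where "\<mu> = inv_into ?T \<kappa>"
  note h = nash_image_homeomorphic(1)[OF inj] and ts = nash_image_homeomorphic(2)[OF inj]
  have inv: "\<mu> (\<kappa> a) = a" if "a \<in> ?T" for a using that inj by (simp add: \<mu>_def)
  have inv': "\<kappa> (\<mu> b) = b" "\<mu> b \<in> ?T" if "b \<in> \<kappa> ` ?T" for b
    using that by (simp_all add: \<mu>_def f_inv_into_f inv_into_into)
  define tr where "tr = (\<lambda>(\<phi>, U, U'). (compose U \<kappa> \<phi>, U, \<kappa> ` U') :: 'b chart)"
  have tr: "ncharts ?N = tr ` ncharts M" by (simp add: nash_image_sel tr_def)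
  have ch: "is_chart (ntop ?N) (Some m) (tr c)" if "c \<in> ncharts M" for c
    using transport_is_chart[OF h] manif_chart[OF M that] by (cases c) (auto simp: tr_def)
  have h': "homeomorphic_map (ntop ?N) (ntop M) \<mu>"
  proof -
    obtain g where "homeomorphic_maps (ntop M) (ntop ?N) \<kappa> g" using h homeomorphic_map_maps by blast
    then have g: "homeomorphic_map (ntop ?N) (ntop M) g" "\<And>a. a \<in> ?T \<Longrightarrow> g (\<kappa> a) = a"
      using homeomorphic_maps_map by (auto simp: homeomorphic_maps_def)
    show ?thesis by (rule homeomorphic_map_eq[OF g(1)]) (auto simp: ts inv g(2))
  qed
  have lt: "lrep m m \<kappa> c (tr d)" if "c \<in> ncharts M" "d \<in> ncharts M" for c d
    using lrep_transport_target[of "ntop M" m "fst c" "fst (snd c)" "snd (snd c)" "ntop M" m "fst d" "fst (snd d)" "snd (snd d)" \<kappa> "\<lambda>a. a"]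
      manif_chart[OF M] that inj manif_compat[OF M that] by (simp add: tr_def case_prod_unfold)
  have lN: "lrep m m (\<lambda>a. a) (tr c) (tr d)" if "c \<in> ncharts M" "d \<in> ncharts M" for c d
    using lt[OF that] lrep_transport_source[of m m "\<lambda>a. a" "fst (snd c)" \<kappa> "fst c" "\<kappa> ` snd (snd c)" "tr d" "snd (snd c)"]
    by (simp add: tr_def case_prod_unfold)
  have ls: "lrep m m \<mu> (tr c) d" if "c \<in> ncharts M" "d \<in> ncharts M" for c d
  proof -
    have "lrep m m (\<lambda>a. \<mu> (\<kappa> a)) c d"
      by (rule lrep_cong[OF manif_chart[OF M that(1)] _ manif_compat[OF M that]]) (simp add: inv)
    then show ?thesis
      using lrep_transport_source[of m m \<mu> "fst (snd c)" \<kappa> "fst c" "\<kappa> ` snd (snd c)" d "snd (snd c)"]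
      by (simp add: tr_def case_prod_unfold)
  qed
  obtain C where C: "C \<subseteq> ncharts M" "chart_cover (ntop M) m C" using manif_cover[OF M] .
  have cover: "chart_cover (ntop ?N) m (tr ` C)"
    unfolding chart_cover_def
  proof (intro conjI)
    show "finite (tr ` C)" using C(2) by (simp add: chart_cover_def)
    show "\<forall>c\<in>tr ` C. is_chart (ntop ?N) (Some m) c" using ch C(1) by blast
    have "(\<Union>(\<phi>, U, U')\<in>tr ` C. U') = \<kappa> ` (\<Union>(\<phi>, U, U')\<in>C. U')"
      by (auto simp: tr_def case_prod_unfold)
    then show "points ?N = (\<Union>(\<phi>, U, U')\<in>tr ` C. U')" using C(2) by (simp add: ts chart_cover_def)
  qed
  show N: "manif ?N m"
    unfolding manif_def nash_manifold_def
  proof (intro conjI ballI allI impI)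
    show "ndim ?N = Some m" using M by (simp add: nash_image_sel manif_def)
    show "Hausdorff_space (ntop ?N)"
      using manif_Hausdorff[OF M] homeomorphic_map_imp_homeomorphic_space[OF h] homeomorphic_Hausdorff_space by blast
    show "ndim ?N = None" if "points ?N = {}"
    proof -
      have "?T = {}" using that unfolding ts by blast
      then show ?thesis using M unfolding nash_image_sel manif_def nash_manifold_def by blast
    qed
    show "is_chart (ntop ?N) (ndim ?N) c" if "c \<in> ncharts ?N" for c
      using ch that tr M by (auto simp: nash_image_sel(2) manif_def)
    show "nash_compatible (ndim ?N) c d" if cd': "c \<in> ncharts ?N" "d \<in> ncharts ?N" for c d
    proof -
      obtain c1 d1 where cd: "c1 \<in> ncharts M" "d1 \<in> ncharts M" "c = tr c1" "d = tr d1"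
        using cd' unfolding tr by blast
      have "nash_compatible (Some m) c d"
        using nash_compatible_iff[OF ch[OF cd(1)] ch[OF cd(2)]] lN[OF cd(1,2)] lN[OF cd(2,1)] cd(3,4) by simp
      then show ?thesis using M by (simp add: nash_image_sel(2) manif_def)
    qed
    show "\<exists>C. finite C \<and> C \<subseteq> ncharts ?N \<and> points ?N = (\<Union>(\<phi>, U, U') \<in> C. U')"
      using cover C(1) unfolding tr chart_cover_def by blast
    fix c assume "is_chart (ntop ?N) (ndim ?N) c \<and> (\<forall>d\<in>ncharts ?N. nash_compatible (ndim ?N) c d)"
    then have c: "is_chart (ntop ?N) (Some m) c" "\<And>d. d \<in> ncharts M \<Longrightarrow> nash_compatible (Some m) c (tr d)"
      using M by (auto simp: tr nash_image_sel(2) manif_def)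
    obtain \<phi> U U' where c3: "c = (\<phi>, U, U')" by (metis prod_cases3)
    note c' = is_chartD[OF c(1)[unfolded c3]]
    have U'sub: "U' \<subseteq> \<kappa> ` ?T" using openin_subset[OF c'(3)] ts by simp
    have pull: "is_chart (ntop M) (Some m) (compose U \<mu> \<phi>, U, \<mu> ` U')"
      by (rule transport_is_chart[OF h' c(1)[unfolded c3]])
    have "(compose U \<mu> \<phi>, U, \<mu> ` U') \<in> ncharts M"
    proof (rule manif_maximal[OF M pull])
      fix d assume d: "d \<in> ncharts M"
      have l: "lrep m m (\<lambda>a. a) c (tr d)" "lrep m m (\<lambda>a. a) (tr d) c"
        using c(2)[OF d] nash_compatible_iff[OF c(1) ch[OF d]] by blast+
      obtain \<psi> V V' where d3: "d = (\<psi>, V, V')" by (metis prod_cases3)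
      note dch = manif_chart[OF M d, unfolded d3]
      have trd: "tr d = (compose V \<kappa> \<psi>, V, \<kappa> ` V')" by (simp add: tr_def d3)
      have "lrep m m (\<lambda>a. \<kappa> (\<mu> a)) c (tr d)"
        by (rule lrep_cong[OF c(1) _ l(1)]) (simp add: ts inv')
      note A = this[unfolded trd, unfolded c3]
      have muT: "\<mu> a \<in> ?T" if "a \<in> points ?N" for a using that inv'(2) by (simp add: ts)
      have "lrep m m \<mu> (\<phi>, U, U') (\<psi>, V, V')"
        using A lrep_transport_target[OF c(1)[unfolded c3] dch inj, of \<mu>, OF muT] by blast
      then have 1: "lrep m m (\<lambda>a. a) (compose U \<mu> \<phi>, U, \<mu> ` U') d"
        unfolding d3 using lrep_transport_source[of m m "\<lambda>a. a" U \<mu> \<phi> "\<mu> ` U'" "(\<psi>, V, V')" U'] by simp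
      have "lrep m m \<kappa> d c"
        using l(2)[unfolded trd] lrep_transport_source[of m m "\<lambda>a. a" V \<kappa> \<psi> "\<kappa> ` V'" c V'] by (simp add: d3)
      moreover have "inj_on \<mu> (points ?N)" by (rule inj_onI) (metis inv'(1) ts)
      moreover have "\<kappa> a \<in> points ?N" if "a \<in> ?T" for a using that by (simp add: ts)
      ultimately have "lrep m m (\<lambda>a. \<mu> (\<kappa> a)) d (compose U \<mu> \<phi>, U, \<mu> ` U')"
        using lrep_transport_target[OF dch c(1)[unfolded c3], of \<mu> \<kappa>] unfolding c3 d3 by blast
      then have 2: "lrep m m (\<lambda>a. a) d (compose U \<mu> \<phi>, U, \<mu> ` U')"
        by (rule lrep_cong[OF manif_chart[OF M d], rotated]) (simp add: inv)
      show "lrep m m (\<lambda>a. a) (compose U \<mu> \<phi>, U, \<mu> ` U') d \<and> lrep m m (\<lambda>a. a) d (compose U \<mu> \<phi>, U, \<mu> ` U')"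
        using 1 2 by blast
    qed
    then have "tr (compose U \<mu> \<phi>, U, \<mu> ` U') \<in> ncharts ?N" unfolding tr by blast
    moreover have "compose U \<kappa> (compose U \<mu> \<phi>) = \<phi>"
      using c'(4,6) U'sub by (auto simp: compose_def fun_eq_iff extensional_def inv' subset_iff restrict_def)
    moreover have "\<kappa> ` \<mu> ` U' = U'" using U'sub inv'(1) by (force simp: image_image subset_iff)
    ultimately show "c \<in> ncharts ?N" by (simp add: tr_def c3)
  qed
  show "nash_map M ?N \<kappa>"
    unfolding nash_map_iff[OF M N] using homeomorphic_imp_continuous_map[OF h] lt tr by auto
  show "nash_map ?N M (inv_into ?T \<kappa>)"
    unfolding nash_map_iff[OF N M] \<mu>_def[symmetric] using homeomorphic_imp_continuous_map[OF h'] ls tr by auto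
qed

section \<open>Positive reals and their powers\<close>

(* Keeps the dimension 1 from being rewritten to Suc 0. *)
declare One_nat_def [simp del]

definition Upos :: "nat \<Rightarrow> rvec set" where
  "Upos n = {x \<in> vecs n. \<forall>i<n. 0 < x i}"

lemma Upos_D: "x \<in> Upos n \<Longrightarrow> x \<in> vecs n" "x \<in> Upos n \<Longrightarrow> i < n \<Longrightarrow> 0 < x i"
  by (simp_all add: Upos_def)

lemma Upos_open: "openin (euc n) (Upos n)"
  unfolding openin_Euclidean_box
proof (intro conjI ballI)
  show "Upos n \<subseteq> vecs n" by (auto simp: Upos_def)
  fix x assume x: "x \<in> Upos n"
  define e where "e = Min (insert 1 (x ` {..<n}))"
  have e0: "0 < e" unfolding e_def by (subst Min_gr_iff) (use Upos_D[OF x] in auto)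
  have e: "e \<le> x i" if "i < n" for i unfolding e_def using that by (intro Min_le) auto
  have "y \<in> Upos n" if y: "y \<in> vecs n" "\<forall>i<n. \<bar>y i - x i\<bar> < e" for y
  proof -
    have "0 < y i" if "i < n" for i
    proof -
      have "\<bar>y i - x i\<bar> < x i" using e[OF that] y(2) that by force
      then show ?thesis by linarith
    qed
    then show ?thesis using y by (simp add: Upos_def)
  qed
  then show "\<exists>e>0. \<forall>y\<in>vecs n. (\<forall>i<n. \<bar>y i - x i\<bar> < e) \<longrightarrow> y \<in> Upos n" using e0 by blast
qed

lemma Upos_semialgebraic: "semialg n (Upos n)"
  unfolding Upos_def by (intro definable_imp_semialgebraic definable_all_less definable_pos pfun_coord)

lemma Upos_nonempty: "Upos n \<noteq> {}"
proof -
  have "(\<lambda>i. if i < n then 1 else 0) \<in> Upos n" by (simp add: Upos_def)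
  then show ?thesis by blast
qed

lemmas Upos_good = Upos_open Upos_semialgebraic Upos_nonempty

lemma Rpos_pow_sel:
  "carrier (Rpos_pow n) = Upos n" "nspace (Rpos_pow n) = Opn n (Upos n)"
  "x \<otimes>\<^bsub>Rpos_pow n\<^esub> y = (\<lambda>i. x i * y i)" "\<one>\<^bsub>Rpos_pow n\<^esub> = (\<lambda>i. if i < n then 1 else 0)"
  by (simp_all add: Rpos_pow_def Upos_def Opn_def Let_def)

lemma vecs_Int_Upos [simp]: "vecs n \<inter> Upos n = Upos n"
  by (auto simp: Upos_def)

lemma topspace_Opn_Upos [simp]: "points (Opn n (Upos n)) = Upos n"
  using open_subset_vecs[OF Upos_open, of n] by auto

definition one_vec :: "real \<Rightarrow> rvec" where
  "one_vec t = (\<lambda>i. if i < 1 then t else 0)"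

lemma one_vec_0 [simp]: "one_vec t 0 = t"
  by (simp add: one_vec_def)

lemma one_vec_in_vecs [simp]: "one_vec t \<in> vecs 1"
  by (simp add: vecs_iff one_vec_def)

lemma one_vec_in [simp]: "one_vec t \<in> Upos 1 \<longleftrightarrow> 0 < t"
  by (simp add: Upos_def)

lemma Upos_1_pos: "x \<in> Upos 1 \<Longrightarrow> 0 < x 0"
  by (simp add: Upos_def)

lemma one_vec_of [simp]: "x \<in> Upos 1 \<Longrightarrow> one_vec (x 0) = x"
  by (auto simp: one_vec_def Upos_def vecs_iff)

lemma Rpos_sel:
  "carrier Rpos = {0<..}" "x \<otimes>\<^bsub>Rpos\<^esub> y = x * y" "\<one>\<^bsub>Rpos\<^esub> = 1"
  "nspace Rpos = nash_space_of_atlas (top_of_set {0<..}) (Some 1) {(\<lambda>x\<in>Upos 1. x 0, Upos 1, {0<..})}"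
  by (simp_all add: Rpos_def Upos_def Let_def)

lemma Rpos_ntop [simp]: "ntop (nspace Rpos) = top_of_set {0<..}"
  by (simp add: Rpos_sel)

lemma continuous_map_first_coord: "continuous_map (subtopology (euc n) U) euclideanreal (\<lambda>x. x i)"
  using Ck_continuous[OF Ck_coord] .

lemma Rpos_chart: "is_chart (top_of_set {0<..}) (Some 1) (\<lambda>x\<in>Upos 1. x 0, Upos 1, {0<..})"
proof -
  have "homeomorphic_maps (subtopology (euc 1) (Upos 1)) (top_of_set {0<..}) (\<lambda>x\<in>Upos 1. x 0) one_vec"
    unfolding homeomorphic_maps_def
  proof (intro conjI ballI)
    have "continuous_map (subtopology (euc 1) (Upos 1)) (top_of_set {0<..}) (\<lambda>x. x 0)"
      using continuous_map_first_coord by (auto simp: continuous_map_in_subtopology Upos_def)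
    then show "continuous_map (subtopology (euc 1) (Upos 1)) (top_of_set {0<..}) (\<lambda>x\<in>Upos 1. x 0)"
      by (rule continuous_map_eq) simp
    have "continuous_map (top_of_set {0<..}) (euc 1) one_vec"
      unfolding one_vec_def continuous_map_componentwise_Euclidean_space
      by (simp add: continuous_map_from_subtopology flip: id_def)
    then show "continuous_map (top_of_set {0<..}) (subtopology (euc 1) (Upos 1)) one_vec"
      by (auto simp: continuous_map_in_subtopology)
  qed auto
  then have "homeomorphic_map (subtopology (euc 1) (Upos 1)) (top_of_set {0<..}) (\<lambda>x\<in>Upos 1. x 0)"
    using homeomorphic_map_maps by blast
  then show ?thesis using Upos_open Upos_semialgebraic
    by (simp add: is_chart_def subtopology_subtopology del: semialgebraic.simps)
qed

lemma Rpos_chart_inv: "0 < t \<Longrightarrow> inv_into (Upos 1) (\<lambda>x\<in>Upos 1. x 0) t = one_vec t"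
proof (rule inv_into_f_eq)
  show "inj_on (\<lambda>x\<in>Upos 1. x 0) (Upos 1)" using is_chartD(7)[OF Rpos_chart] .
qed auto

lemma Rpos_manif: "manif (nspace Rpos) 1" "(\<lambda>x\<in>Upos 1. x 0, Upos 1, {0<..}) \<in> ncharts (nspace Rpos)"
  "chart_cover (ntop (nspace Rpos)) 1 {(\<lambda>x\<in>Upos 1. x 0, Upos 1, {0<..})}"
proof -
  let ?c = "(\<lambda>x\<in>Upos 1. x 0, Upos 1, {0<..}) :: real chart"
  have "lrep 1 1 (\<lambda>a. a) ?c ?c"
  proof -
    have "{x \<in> Upos 1. (\<lambda>x\<in>Upos 1. x 0) x \<in> {0<..}} = Upos 1" by (auto simp: Upos_def)
    moreover have "nashf 1 1 (Upos 1) (Upos 1) (\<lambda>x. inv_into (Upos 1) (\<lambda>x\<in>Upos 1. x 0) ((\<lambda>x\<in>Upos 1. x 0) x))"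
      by (rule nashf_cong[OF nashf_identity[OF Upos_open Upos_semialgebraic Upos_semialgebraic subset_refl]])
        (frule Upos_1_pos, simp add: Rpos_chart_inv)
    ultimately show ?thesis by (simp add: lrep_iff)
  qed
  then have "manif (nspace Rpos) 1 \<and> {?c} \<subseteq> ncharts (nspace Rpos)"
    unfolding Rpos_sel
    by (intro conjI manif_of_atlas[where C = "{?c}" and ?C0.0 = "{?c}"])
      (use Rpos_chart in \<open>simp_all add: Hausdorff_space_subtopology\<close>)
  then show "manif (nspace Rpos) 1" "?c \<in> ncharts (nspace Rpos)" by auto
  show "chart_cover (ntop (nspace Rpos)) 1 {?c}" using Rpos_chart by (simp add: chart_cover_def)
qed

lemma nash_map_one_vec: "nash_map (nspace Rpos) (Opn 1 (Upos 1)) one_vec"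
proof (rule nash_mapI_atlas[OF Rpos_manif(1) Opn_manif(1)[OF Upos_good] _ _ Rpos_manif(3) _ Opn_manif(3)[OF Upos_good]])
  have "continuous_map (top_of_set {0<..}) (euc 1) one_vec"
    unfolding one_vec_def continuous_map_componentwise_Euclidean_space
    by (simp add: continuous_map_from_subtopology flip: id_def)
  then show "continuous_map (ntop (nspace Rpos)) (ntop (Opn 1 (Upos 1))) one_vec"
    by (auto simp: continuous_map_in_subtopology)
  show "{(\<lambda>x\<in>Upos 1. x 0, Upos 1, {0<..})} \<subseteq> ncharts (nspace Rpos)" using Rpos_manif(2) by simp
  show "{(\<lambda>x\<in>Upos 1. x, Upos 1, Upos 1)} \<subseteq> ncharts (Opn 1 (Upos 1))" using Opn_manif(2)[OF Upos_good] by simp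
  have "{x \<in> Upos 1. one_vec ((\<lambda>x\<in>Upos 1. x 0) x) \<in> Upos 1} = Upos 1" by (auto dest: Upos_1_pos)
  moreover have "nashf 1 1 (Upos 1) (Upos 1) (\<lambda>x. inv_into (Upos 1) (\<lambda>x\<in>Upos 1. x) (one_vec ((\<lambda>x\<in>Upos 1. x 0) x)))"
    by (rule nashf_cong[OF nashf_identity[OF Upos_open Upos_semialgebraic Upos_semialgebraic subset_refl]])
      (frule Upos_1_pos, simp add: restrict_id_inv)
  ultimately have "lrep 1 1 one_vec (\<lambda>x\<in>Upos 1. x 0, Upos 1, {0<..}) (\<lambda>x\<in>Upos 1. x, Upos 1, Upos 1)"
    by (simp add: lrep_iff)
  then show "lrep 1 1 one_vec c d" if "c \<in> {(\<lambda>x\<in>Upos 1. x 0, Upos 1, {0<..})}"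
    "d \<in> {(\<lambda>x\<in>Upos 1. x, Upos 1, Upos 1)}" for c d using that by auto
qed

lemma nash_map_first_coord: "nash_map (Opn 1 (Upos 1)) (nspace Rpos) (\<lambda>x. x 0)"
proof (rule nash_map_from_Opn[OF Upos_good Rpos_manif(1) _ _ Rpos_manif(3)])
  show "continuous_map (subtopology (euc 1) (Upos 1)) (ntop (nspace Rpos)) (\<lambda>x. x 0)"
    using continuous_map_first_coord by (auto simp: continuous_map_in_subtopology Upos_def)
  show "{(\<lambda>x\<in>Upos 1. x 0, Upos 1, {0<..})} \<subseteq> ncharts (nspace Rpos)" using Rpos_manif(2) by simp
  have "{x \<in> Upos 1. x 0 \<in> {0<..}} = Upos 1" by (auto simp: Upos_def)
  moreover have "nashf 1 1 (Upos 1) (Upos 1) (\<lambda>x. inv_into (Upos 1) (\<lambda>x\<in>Upos 1. x 0) (x 0))"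
    by (rule nashf_cong[OF nashf_identity[OF Upos_open Upos_semialgebraic Upos_semialgebraic subset_refl]])
      (frule Upos_1_pos, simp add: Rpos_chart_inv)
  ultimately show "nashf 1 1 {x \<in> Upos 1. x 0 \<in> V'} V (\<lambda>x. inv_into V \<psi> (x 0))"
    if "(\<psi>, V, V') \<in> {(\<lambda>x\<in>Upos 1. x 0, Upos 1, {0<..})}" for \<psi> V V' using that by auto
qed

lemma nash_map_from_Rpos:
  assumes N: "manif N n"
  shows "nash_map (nspace Rpos) N f \<longleftrightarrow> nash_map (Opn 1 (Upos 1)) N (\<lambda>x. f (x 0))"
proof
  show "nash_map (Opn 1 (Upos 1)) N (\<lambda>x. f (x 0))" if "nash_map (nspace Rpos) N f"
    by (rule nash_map_compose[OF Opn_manif(1)[OF Upos_good] Rpos_manif(1) N nash_map_first_coord that])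
  assume "nash_map (Opn 1 (Upos 1)) N (\<lambda>x. f (x 0))"
  from nash_map_compose[OF Rpos_manif(1) Opn_manif(1)[OF Upos_good] N nash_map_one_vec this]
  show "nash_map (nspace Rpos) N f" by simp
qed

lemma nash_map_into_Opn:
  assumes P: "manif P k" and V: "openin (euc n) V" "semialg n V" "V \<noteq> {}"
    and f: "\<And>a. a \<in> points P \<Longrightarrow> f a \<in> V"
    and c: "\<And>i. i < n \<Longrightarrow> nash_map P (nspace Rpos) (\<lambda>a. f a i)"
  shows "nash_map P (Opn n V) f"
proof -
  obtain C where C: "C \<subseteq> ncharts P" "chart_cover (ntop P) k C" using manif_cover[OF P] .
  note Rm = Rpos_manif(1)
  have ci: "nash_map P (Opn 1 (Upos 1)) (\<lambda>a. one_vec (f a i))" if "i < n" for i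
    by (rule nash_map_compose[OF P Rpos_manif(1) Opn_manif(1)[OF Upos_good] c[OF that] nash_map_one_vec])
  note ci' = ci[unfolded nash_map_iff[OF P Opn_manif(1)[OF Upos_good]]]
  have pos: "0 < f a i" if "a \<in> points P" "i < n" for a i
  proof -
    have "continuous_map (ntop P) (ntop (nspace Rpos)) (\<lambda>a. f a i)"
      using c[OF that(2)] unfolding nash_map_iff[OF P Rm] by blast
    then have "(\<lambda>a. f a i) ` points P \<subseteq> {0<..}"
      using continuous_map_image_subset_topspace by fastforce
    then show ?thesis using that by auto
  qed
  show ?thesis
  proof (rule nash_mapI_atlas[OF P Opn_manif(1)[OF V] _ C _ Opn_manif(3)[OF V]])
    have "continuous_map (ntop P) euclideanreal (\<lambda>a. f a i)" if "i < n" for i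
      using c[OF that] unfolding nash_map_iff[OF P Rm] by (auto simp: continuous_map_in_subtopology)
    then have "continuous_map (ntop P) (euc n) (\<lambda>a i. if i < n then f a i else 0)"
      unfolding continuous_map_componentwise_Euclidean_space by blast
    moreover have "(\<lambda>i. if i < n then f a i else 0) = f a" if "a \<in> points P" for a
      using f[OF that] open_subset_vecs[OF V(1)] by (auto simp: vecs_iff fun_eq_iff subset_iff)
    ultimately have "continuous_map (ntop P) (euc n) f" by (auto elim!: continuous_map_eq)
    then show "continuous_map (ntop P) (ntop (Opn n V)) f"
      using f by (auto simp: continuous_map_in_subtopology)
    show "{(\<lambda>x\<in>V. x, V, V)} \<subseteq> ncharts (Opn n V)" using Opn_manif(2)[OF V] by simp
    fix c d assume "c \<in> C" and d: "d \<in> {(\<lambda>x\<in>V. x, V, V)}"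
    obtain \<phi> U U' where c3: "c = (\<phi>, U, U')" by (metis prod_cases3)
    have cP: "(\<phi>, U, U') \<in> ncharts P" using \<open>c \<in> C\<close> C(1) c3 by blast
    note ch = is_chartD[OF manif_chart[OF P cP]]
    have \<phi>: "\<phi> x \<in> points P" if "x \<in> U" for x
      using ch(6)[OF that] openin_subset[OF ch(3)] by blast
    have "nashf k n U V (\<lambda>x. f (\<phi> x))"
    proof (rule nashf_components[OF ch(1,2) V(2)])
      show "(\<lambda>x. f (\<phi> x)) \<in> U \<rightarrow> V" using f \<phi> by auto
      fix i assume i: "i < n"
      have "lrep k 1 (\<lambda>a. one_vec (f a i)) (\<phi>, U, U') (\<lambda>x\<in>Upos 1. x, Upos 1, Upos 1)"
        using ci'[OF i] cP Opn_manif(2)[OF Upos_good] by blast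
      then have "nashf k 1 {x \<in> U. one_vec (f (\<phi> x) i) \<in> Upos 1} (Upos 1)
          (\<lambda>x. inv_into (Upos 1) (\<lambda>x\<in>Upos 1. x) (one_vec (f (\<phi> x) i)))" by (simp add: lrep_iff)
      moreover have "{x \<in> U. one_vec (f (\<phi> x) i) \<in> Upos 1} = U" using pos[OF \<phi> i] by auto
      ultimately have "nashf k 1 U (Upos 1) (\<lambda>x. inv_into (Upos 1) (\<lambda>x\<in>Upos 1. x) (one_vec (f (\<phi> x) i)))" by simp
      then have "nashf k 1 U (Upos 1) (\<lambda>x. one_vec (f (\<phi> x) i))"
        by (rule nashf_cong) (use pos[OF \<phi> i] in \<open>simp add: restrict_id_inv\<close>)
      then show "\<exists>l E g j. nashf k l U E g \<and> j < l \<and> (\<forall>x\<in>U. f (\<phi> x) i = g x j)"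
        by (intro exI[of _ 1] exI[of _ "Upos 1"] exI[of _ "\<lambda>x. one_vec (f (\<phi> x) i)"] exI[of _ 0]) simp
    qed
    moreover have "{x \<in> U. f (\<phi> x) \<in> V} = U" using f \<phi> by auto
    moreover have "inv_into V (\<lambda>x\<in>V. x) (f (\<phi> x)) = f (\<phi> x)" if "x \<in> U" for x
      using f[OF \<phi>[OF that]] by (simp add: restrict_id_inv)
    ultimately show "lrep k n f c d" using d by (auto simp: c3 lrep_iff elim: nashf_cong)
  qed
qed

lemma nash_map_coord_Upos:
  assumes "i < n"
  shows "nash_map (Opn n (Upos n)) (nspace Rpos) (\<lambda>x. x i)"
proof -
  have "nash_map (Opn n (Upos n)) (Opn 1 (Upos 1)) (\<lambda>x. one_vec (x i))"
    unfolding nash_map_Opn_Opn[OF Upos_good Upos_good]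
  proof (rule nashf_pfun[OF Upos_open Upos_semialgebraic Upos_semialgebraic])
    show "(\<lambda>x. one_vec (x i)) \<in> Upos n \<rightarrow> Upos 1" using Upos_D(2)[OF _ assms] by simp
  qed (simp add: one_vec_def pfun_coord)
  from nash_map_compose[OF Opn_manif(1)[OF Upos_good] Opn_manif(1)[OF Upos_good] Rpos_manif(1) this nash_map_first_coord]
  show ?thesis by simp
qed

lemma nash_map_prod_Opn:
  assumes U: "openin (euc m) U" "semialg m U" "U \<noteq> {}"
    and V: "openin (euc n) V" "semialg n V" "V \<noteq> {}"
  shows "nash_map (nash_prod (Opn m U) (Opn n V)) (Opn (m + n) (vprod m U V)) (\<lambda>(x, y). vjoin m x y)"
proof -
  have ts: "points (Opn m U) = U" "points (Opn n V) = V"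
    using open_subset_vecs[OF U(1)] open_subset_vecs[OF V(1)] by auto
  note sub = open_subset_vecs[OF U(1)] open_subset_vecs[OF V(1)]
  have ne: "points (Opn m U) \<noteq> {}" "points (Opn n V) \<noteq> {}" using U V ts by auto
  note P = nash_prod_manif[OF Opn_manif(1)[OF U] Opn_manif(1)[OF V] ne]
  have W: "openin (euc (m + n)) (vprod m U V)" "semialg (m + n) (vprod m U V)" "vprod m U V \<noteq> {}"
    using vprod_open vprod_semialgebraic U V by (auto simp: vprod_def simp del: semialgebraic.simps)
  let ?c = "\<lambda>U. (\<lambda>x\<in>U. x, U, U) :: rvec chart"
  have cov: "chart_cover (ntop (nash_prod (Opn m U) (Opn n V))) (m + n) {prod_chart m (?c U) (?c V)}"
    using chart_cover_prod[OF Opn_manif(3)[OF U] Opn_manif(3)[OF V]] by (simp only: P(3)) simp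
  show ?thesis
  proof (rule nash_mapI_atlas[OF P(1) Opn_manif(1)[OF W] _ _ cov _ Opn_manif(3)[OF W]])
    show "{prod_chart m (?c U) (?c V)} \<subseteq> ncharts (nash_prod (Opn m U) (Opn n V))"
      using P(2)[OF Opn_manif(2)[OF U] Opn_manif(2)[OF V]] by blast
    show "{?c (vprod m U V)} \<subseteq> ncharts (Opn (m + n) (vprod m U V))" using Opn_manif(2)[OF W] by simp
    let ?X = "prod_topology (ntop (Opn m U)) (ntop (Opn n V))"
    have c: "continuous_map ?X euclideanreal (\<lambda>p. case p of (x, y) \<Rightarrow> vjoin m x y i)" for i
    proof (cases "i < m")
      case True
      have "continuous_map ?X euclideanreal ((\<lambda>x. x i) \<circ> fst)"
        using continuous_map_first_coord by (intro continuous_map_compose[OF continuous_map_fst]) simp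
      then show ?thesis using True by (simp add: o_def vjoin_def case_prod_unfold)
    next
      case False
      have "continuous_map ?X euclideanreal ((\<lambda>x. x (i - m)) \<circ> snd)"
        using continuous_map_first_coord by (intro continuous_map_compose[OF continuous_map_snd]) simp
      then show ?thesis using False by (simp add: o_def vjoin_def case_prod_unfold)
    qed
    have "continuous_map ?X (euc (m + n))
        (\<lambda>p i. if i < m + n then case p of (x, y) \<Rightarrow> vjoin m x y i else 0)"
      unfolding continuous_map_componentwise_Euclidean_space using c by blast
    then have "continuous_map ?X (euc (m + n)) (\<lambda>(x, y). vjoin m x y)"
    proof (rule continuous_map_eq)
      fix p assume "p \<in> topspace ?X"
      then have "fst p \<in> U" "snd p \<in> V" using ts by auto
      then have "snd p \<in> vecs n" using sub by auto
      then have "vjoin m (fst p) (snd p) \<in> vecs (m + n)" by simp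
      then show "(\<lambda>i. if i < m + n then case p of (x, y) \<Rightarrow> vjoin m x y i else 0) = (case p of (x, y) \<Rightarrow> vjoin m x y)"
        by (auto simp: vecs_iff case_prod_unfold)
    qed
    then show "continuous_map (ntop (nash_prod (Opn m U) (Opn n V))) (ntop (Opn (m + n) (vprod m U V))) (\<lambda>(x, y). vjoin m x y)"
      unfolding P(3) ntop_Opn[of "m + n"] continuous_map_in_subtopology using ts by (auto simp: vprod_def)
    have "nashf (m + n) (m + n) (vprod m U V) (vprod m U V) (\<lambda>z. z)"
      using W by (intro nashf_identity) auto
    then have "nashf (m + n) (m + n) (vprod m U V) (vprod m U V) (\<lambda>z. inv_into (vprod m U V) (\<lambda>x\<in>vprod m U V. x)
        (case (\<lambda>z\<in>vprod m U V. ((\<lambda>x\<in>U. x) (vfst m z), (\<lambda>x\<in>V. x) (vsnd m z))) z of (x, y) \<Rightarrow> vjoin m x y))"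
      by (rule nashf_cong) (simp add: restrict_id_inv vprod_iff[OF sub(1)])
    moreover have "{z \<in> vprod m U V. (case (\<lambda>z\<in>vprod m U V. ((\<lambda>x\<in>U. x) (vfst m z), (\<lambda>x\<in>V. x) (vsnd m z))) z of
        (x, y) \<Rightarrow> vjoin m x y) \<in> vprod m U V} = vprod m U V" by (auto simp: vprod_iff[OF sub(1)])
    ultimately have "lrep (m + n) (m + n) (\<lambda>(x, y). vjoin m x y) (prod_chart m (?c U) (?c V)) (?c (vprod m U V))"
      by (simp add: lrep_iff)
    then show "lrep (m + n) (m + n) (\<lambda>(x, y). vjoin m x y) c d"
      if "c \<in> {prod_chart m (?c U) (?c V)}" "d \<in> {?c (vprod m U V)}" for c d using that by blast
  qed
qed

section \<open>Nash groups\<close>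

text \<open>The carrier contains the unit element, hence the dimension is a natural number.\<close>

lemma nash_groupD:
  assumes "nash_group A"
  shows "manif (nspace A) (the (ndim (nspace A)))" "points (nspace A) = carrier A" "group A" "carrier A \<noteq> {}"
proof -
  have g: "group A" "nash_manifold (nspace A)" "points (nspace A) = carrier A"
    using assms unfolding nash_group_def by blast+
  have ne: "carrier A \<noteq> {}" using group.is_monoid[OF g(1)] monoid.one_closed by blast
  have "ndim (nspace A) \<noteq> None"
  proof
    assume None: "ndim (nspace A) = None"
    obtain a where "a \<in> carrier A" using ne by blast
    moreover obtain C where C: "C \<subseteq> ncharts (nspace A)" "points (nspace A) = (\<Union>(\<phi>, U, U') \<in> C. U')"
      using g(2) unfolding nash_manifold_def by metis
    ultimately have "a \<in> (\<Union>(\<phi>, U, U') \<in> C. U')" using g(3) by simp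
    then obtain \<phi> U U' where c: "(\<phi>, U, U') \<in> ncharts (nspace A)" "a \<in> U'" using C(1) by auto
    then have "is_chart (ntop (nspace A)) None (\<phi>, U, U')" using g(2) None unfolding nash_manifold_def by metis
    then have "U = {}" "homeomorphic_map (subtopology (Rspace None) U) (subtopology (ntop (nspace A)) U') \<phi>" "openin (ntop (nspace A)) U'"
      by (auto simp: is_chart_def)
    then have "topspace (subtopology (ntop (nspace A)) U') = {}"
      using homeomorphic_imp_surjective_map by fastforce
    then show False using c(2) openin_subset[OF \<open>openin (ntop (nspace A)) U'\<close>] by auto
  qed
  then show "manif (nspace A) (the (ndim (nspace A)))" using g by (auto simp: manif_def)
  show "points (nspace A) = carrier A" "group A" "carrier A \<noteq> {}" by fact+
qed

lemma nash_map_mult: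
  assumes A: "nash_group A" and P: "manif P k" and f: "nash_map P (nspace A) f" and g: "nash_map P (nspace A) g"
  shows "nash_map P (nspace A) (\<lambda>a. f a \<otimes>\<^bsub>A\<^esub> g a)"
proof -
  note d = nash_groupD[OF A]
  have ne: "points (nspace A) \<noteq> {}" using d by simp
  have m: "nash_map (nash_prod (nspace A) (nspace A)) (nspace A) (\<lambda>(x, y). x \<otimes>\<^bsub>A\<^esub> y)"
    using A unfolding nash_group_def by blast
  from nash_map_compose[OF P nash_prod_manif(1)[OF d(1) d(1) ne ne] d(1) nash_map_Pair[OF P d(1) d(1) ne ne f g] m]
  show ?thesis by simp
qed

lemma nash_map_const:
  assumes P: "manif P k" and N: "manif N n" and a: "a \<in> points N"
  shows "nash_map P N (\<lambda>x. a)"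
  unfolding nash_map_iff[OF P N]
proof (intro conjI ballI)
  show "continuous_map (ntop P) (ntop N) (\<lambda>x. a)" using a by simp
  fix c d assume c: "c \<in> ncharts P" and d: "d \<in> ncharts N"
  obtain \<phi> U U' \<psi> V V' where cd: "c = (\<phi>, U, U')" "d = (\<psi>, V, V')" by (metis prod_cases3)
  note c' = is_chartD[OF manif_chart[OF P c[unfolded cd]]] and d' = is_chartD[OF manif_chart[OF N d[unfolded cd]]]
  show "lrep k n (\<lambda>x. a) c d"
  proof (cases "a \<in> V'")
    case True
    then have "{x \<in> U. a \<in> V'} = U" by simp
    moreover have "nashf k n U V (\<lambda>x. inv_into V \<psi> a)"
      by (rule nashf_pfun[OF c'(1,2) d'(2)])
        (use chart_inv(1)[OF manif_chart[OF N d[unfolded cd]] True] in auto)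
    ultimately show ?thesis by (simp add: cd lrep_iff)
  next
    case False
    then have "{x \<in> U. a \<in> V'} = {}" by simp
    moreover have "nashf k n {} V (\<lambda>x. inv_into V \<psi> a)"
      by (rule nashf_pfun[OF _ semialgebraic_empty d'(2)]) auto
    ultimately show ?thesis by (simp only: cd lrep_iff)
  qed
qed

lemma group_Rpos_pow: "comm_group (Rpos_pow n)"
proof (rule comm_groupI)
  show "\<exists>y\<in>carrier (Rpos_pow n). y \<otimes>\<^bsub>Rpos_pow n\<^esub> x = \<one>\<^bsub>Rpos_pow n\<^esub>" if "x \<in> carrier (Rpos_pow n)" for x
  proof
    show "(\<lambda>i. inverse (x i)) \<in> carrier (Rpos_pow n)" using that by (auto simp: Rpos_pow_sel Upos_def vecs_iff)
    have "inverse (x i) * x i = (if i < n then 1 else 0)" for i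
      using that by (auto simp: Rpos_pow_sel Upos_def vecs_iff dest: spec[of _ i])
    then show "(\<lambda>i. inverse (x i)) \<otimes>\<^bsub>Rpos_pow n\<^esub> x = \<one>\<^bsub>Rpos_pow n\<^esub>" by (simp add: Rpos_pow_sel)
  qed
qed (auto simp: Rpos_pow_sel Upos_def vecs_iff fun_eq_iff)

lemma Rpos_pow_inv: "x \<in> Upos n \<Longrightarrow> inv\<^bsub>Rpos_pow n\<^esub> x = (\<lambda>i. inverse (x i))"
proof -
  assume x: "x \<in> Upos n"
  interpret comm_group "Rpos_pow n" by (rule group_Rpos_pow)
  show ?thesis
  proof (rule inv_equality)
    have "inverse (x i) * x i = (if i < n then 1 else 0)" for i
      using x by (auto simp: Upos_def vecs_iff dest: spec[of _ i])
    then show "(\<lambda>i. inverse (x i)) \<otimes>\<^bsub>Rpos_pow n\<^esub> x = \<one>\<^bsub>Rpos_pow n\<^esub>" by (simp add: Rpos_pow_sel)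
  qed (use x in \<open>auto simp: Rpos_pow_sel Upos_def vecs_iff\<close>)
qed

text \<open>For \<open>r = (p - p') / q\<close>, the value \<open>t = x powr r\<close> is the positive solution of the
  polynomial equation \<open>t ^ q * x ^ p' = x ^ p\<close>.\<close>

lemma sfun_powr:
  assumes D: "semialg m D" and j: "j < m" and pos: "\<And>x. x \<in> D \<Longrightarrow> 0 < x j"
  shows "sfun m D (\<lambda>x. x j powr of_rat r)"
proof -
  obtain a b where r: "r = Fract a b" "0 < b" by (metis Rat_cases)
  define p p' q where "p = nat a" and "p' = nat (- a)" and "q = nat b"
  have rr: "of_rat r = (real p - real p') / real q" using r by (simp add: of_rat_rat p_def p'_def q_def)
  have q0: "0 < q" using r by (simp add: q_def)
  show ?thesis
  proof (rule sfun_of_definable[OF D])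
    show "definable (\<lambda>z. 0 < z m \<and> z m ^ q * z j ^ p' = z j ^ p)"
      by (intro definable_conj definable_pos definable_eq pfun_mult pfun_power pfun_coord)
    fix x t assume x: "x \<in> D"
    have xj: "0 < x j" using pos[OF x] .
    have "t ^ q * x j ^ p' = x j ^ p \<longleftrightarrow> t = x j powr of_rat r" if t: "0 < t"
    proof -
      have "t ^ q * x j ^ p' = x j ^ p \<longleftrightarrow> ln (t ^ q * x j ^ p') = ln (x j ^ p)"
        using t xj by (subst ln_inj_iff) auto
      also have "\<dots> \<longleftrightarrow> real q * ln t + real p' * ln (x j) = real p * ln (x j)"
        using t xj by (simp add: ln_mult ln_realpow)
      also have "\<dots> \<longleftrightarrow> ln t = of_rat r * ln (x j)"
        using q0 by (simp add: rr field_simps)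
      also have "\<dots> \<longleftrightarrow> ln t = ln (x j powr of_rat r)" using xj by (simp add: ln_powr)
      also have "\<dots> \<longleftrightarrow> t = x j powr of_rat r" using t xj by (subst ln_inj_iff) auto
      finally show ?thesis .
    qed
    moreover have "0 < x j powr of_rat r" using xj by simp
    ultimately show "(0 < (x(m := t)) m \<and> (x(m := t)) m ^ q * (x(m := t)) j ^ p' = (x(m := t)) j ^ p) \<longleftrightarrow>
        t = x j powr of_rat r" using j by auto
  qed
qed

lemma nashf_powr:
  assumes "j < n"
  shows "nashf n 1 (Upos n) (Upos 1) (\<lambda>x. one_vec (x j powr of_rat r))"
  unfolding nashf_def
proof (intro conjI)
  have pos: "0 < x j" if "x \<in> Upos n" for x using Upos_D(2)[OF that assms] .
  show "openin (euc n) (Upos n)" by (rule Upos_open)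
  have eq: "one_vec t i = t" if "i < 1" for t i using that by (simp add: one_vec_def)
  have sf: "sfun n (Upos n) (\<lambda>x. x j powr of_rat r)"
    by (rule sfun_powr) (use Upos_semialgebraic assms pos in blast)+
  show "smap n 1 (Upos n) (Upos 1) (\<lambda>x. one_vec (x j powr of_rat r))"
  proof (rule smap_of_components[OF Upos_semialgebraic Upos_semialgebraic])
    show "(\<lambda>x. one_vec (x j powr of_rat r)) \<in> Upos n \<rightarrow> Upos 1"
    proof
      fix x assume "x \<in> Upos n"
      then have "0 < x j" by (rule pos)
      then show "one_vec (x j powr of_rat r) \<in> Upos 1" by simp
    qed
    show "sfun n (Upos n) (\<lambda>x. one_vec (x j powr of_rat r) i)" if "i < 1" for i
      using sf by (simp add: eq[OF that])
  qed
  show "smooth_map (Some n) (Some 1) (Upos n) (\<lambda>x. one_vec (x j powr of_rat r))"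
    unfolding smooth_map_iff
  proof (intro allI impI)
    fix i k :: nat assume i: "i < 1"
    have "Ck_on k n (Upos n) (\<lambda>x. x j powr of_rat r)" by (rule Ck_powr[OF _ Ck_coord]) (rule pos)
    then show "Ck_on k n (Upos n) (\<lambda>x. one_vec (x j powr of_rat r) i)" by (simp add: eq[OF i])
  qed
qed

lemma nash_map_powr: "nash_map (nspace Rpos) (nspace Rpos) (\<lambda>t. t powr of_rat r)"
proof -
  have "nash_map (Opn 1 (Upos 1)) (Opn 1 (Upos 1)) (\<lambda>x. one_vec (x 0 powr of_rat r))"
    unfolding nash_map_Opn_Opn[OF Upos_good Upos_good] by (rule nashf_powr) simp
  from nash_map_compose[OF Opn_manif(1)[OF Upos_good] Opn_manif(1)[OF Upos_good] Rpos_manif(1) this nash_map_first_coord]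
  show ?thesis by (simp add: nash_map_from_Rpos[OF Rpos_manif(1)])
qed

lemma nash_map_mult_Rpos:
  assumes P: "manif P k" and f: "nash_map P (nspace Rpos) f" and g: "nash_map P (nspace Rpos) g"
  shows "nash_map P (nspace Rpos) (\<lambda>a. f a * g a)"
proof -
  let ?O = "Opn 1 (Upos 1)" and ?W = "vprod 1 (Upos 1) (Upos 1)"
  note O = Opn_manif(1)[OF Upos_good, of 1]
  have W: "openin (euc (1 + 1)) ?W" "semialg (1 + 1) ?W" "?W \<noteq> {}"
    using vprod_open[OF Upos_open[of 1] Upos_open[of 1]] vprod_semialgebraic[OF Upos_semialgebraic[of 1] Upos_semialgebraic[of 1]]
      Upos_nonempty[of 1] by (auto simp: vprod_def simp del: semialgebraic.simps)
  have ne: "points ?O \<noteq> {}" using Upos_nonempty by simp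
  have "nashf (1 + 1) 1 ?W (Upos 1) (\<lambda>z. one_vec (z 0 * z 1))"
  proof (rule nashf_pfun[OF W(1,2) Upos_semialgebraic])
    show "(\<lambda>z. one_vec (z 0 * z 1)) \<in> ?W \<rightarrow> Upos 1" by (auto simp: vprod_def vjoin_def dest!: Upos_1_pos)
  qed (simp add: one_vec_def pfun_mult)
  then have m: "nash_map (Opn (1 + 1) ?W) ?O (\<lambda>z. one_vec (z 0 * z 1))"
    unfolding nash_map_Opn_Opn[OF W Upos_good] .
  have fg: "nash_map P (nash_prod ?O ?O) (\<lambda>a. (one_vec (f a), one_vec (g a)))"
    by (rule nash_map_Pair[OF P O O ne ne])
      (rule nash_map_compose[OF P Rpos_manif(1) O _ nash_map_one_vec], use f g in blast)+
  note mm = nash_map_compose[OF nash_prod_manif(1)[OF O O ne ne] Opn_manif(1)[OF W] O nash_map_prod_Opn[OF Upos_good Upos_good] m]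
  from nash_map_compose[OF P O Rpos_manif(1) nash_map_compose[OF P nash_prod_manif(1)[OF O O ne ne] O fg mm] nash_map_first_coord]
  show ?thesis by (simp add: vjoin_def)
qed

lemma nash_group_Rpos_pow: "nash_group (Rpos_pow n)"
  unfolding nash_group_def Rpos_pow_sel
proof (intro conjI)
  let ?O = "Opn n (Upos n)"
  note O = Opn_manif(1)[OF Upos_good, of n]
  have ne: "points ?O \<noteq> {}" using Upos_nonempty by simp
  note P = nash_prod_manif[OF O O ne ne]
  show "group (Rpos_pow n)" using group_Rpos_pow comm_group.axioms(2) by blast
  show "nash_manifold ?O" using O by (simp add: manif_def)
  show "points ?O = Upos n" by simp
  show "nash_map (nash_prod ?O ?O) ?O (\<lambda>(x, y) i. x i * y i)"
  proof (rule nash_map_into_Opn[OF P(1) Upos_good])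
    show "(case p of (x, y) \<Rightarrow> \<lambda>i. x i * y i) \<in> Upos n" if "p \<in> points (nash_prod ?O ?O)" for p
    proof -
      obtain x y where p: "p = (x, y)" by (cases p)
      have "x \<in> Upos n" "y \<in> Upos n" using that by (simp_all add: P(3) p)
      then show ?thesis by (simp add: p Upos_def vecs_iff)
    qed
    fix i assume i: "i < n"
    have "nash_map (nash_prod ?O ?O) (nspace Rpos) (\<lambda>p. fst p i)" "nash_map (nash_prod ?O ?O) (nspace Rpos) (\<lambda>p. snd p i)"
      using nash_map_compose[OF P(1) O Rpos_manif(1) nash_map_fst_snd(1)[OF O O ne ne] nash_map_coord_Upos[OF i]]
        nash_map_compose[OF P(1) O Rpos_manif(1) nash_map_fst_snd(2)[OF O O ne ne] nash_map_coord_Upos[OF i]] by simp_all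
    from nash_map_mult_Rpos[OF P(1) this]
    show "nash_map (nash_prod ?O ?O) (nspace Rpos) (\<lambda>p. (case p of (x, y) \<Rightarrow> \<lambda>i. x i * y i) i)"
      by (simp add: case_prod_unfold)
  qed
  have "nash_map ?O ?O (\<lambda>x i. if i < n then x i powr of_rat (-1) else 0)"
  proof (rule nash_map_into_Opn[OF O Upos_good])
    show "(\<lambda>i. if i < n then x i powr of_rat (-1) else 0) \<in> Upos n" if "x \<in> points ?O" for x
      using that Upos_D(2)[of x n] by (auto simp: Upos_def)
    fix i assume i: "i < n"
    show "nash_map ?O (nspace Rpos) (\<lambda>x. if i < n then x i powr of_rat (-1) else 0)"
      using nash_map_compose[OF O Rpos_manif(1) Rpos_manif(1) nash_map_coord_Upos[OF i] nash_map_powr[of "-1"]] i by simp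
  qed
  then show "nash_map ?O ?O (\<lambda>x. inv\<^bsub>Rpos_pow n\<^esub> x)"
  proof (rule nash_map_cong[OF O O])
    fix x assume "x \<in> points ?O"
    then have x: "x \<in> Upos n" by simp
    have "(if i < n then x i powr of_rat (-1) else 0) = inverse (x i)" for i
    proof (cases "i < n")
      case True
      have "x i powr - 1 = inverse (x i)" using Upos_D(2)[OF x True] by (simp add: powr_minus)
      then show ?thesis using True by (simp add: of_rat_minus)
    next
      case False
      then show ?thesis using Upos_D(1)[OF x] by (simp add: vecs_iff)
    qed
    then show "(\<lambda>i. if i < n then x i powr of_rat (-1) else 0) = inv\<^bsub>Rpos_pow n\<^esub> x" using Rpos_pow_inv[OF x] by simp
  qed
qed

section \<open>Semialgebraic functions of one variable\<close>

text \<open>Polynomials in two variables are polynomials in the second variable with coefficients in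
  the first, so that the degree and the derivative in the second variable are those of a
  univariate polynomial.\<close>

definition eval2 :: "real poly poly \<Rightarrow> real \<Rightarrow> real \<Rightarrow> real" where
  "eval2 Q x y = poly (poly Q [:y:]) x"

lemma eval2_simps:
  "eval2 0 x y = 0" "eval2 (pCons a Q) x y = poly a x + y * eval2 Q x y"
  "eval2 (P + Q) x y = eval2 P x y + eval2 Q x y" "eval2 (P * Q) x y = eval2 P x y * eval2 Q x y"
  by (simp_all add: eval2_def)

lemma polynomial_fun_2_eval2:
  "polynomial_fun 2 P \<Longrightarrow> \<exists>Q. \<forall>z. P z = eval2 Q (z 0) (z 1)"
proof (induction rule: polynomial_fun.induct)
  case (const c)
  show ?case by (rule exI[of _ "[:[:c:]:]"]) (simp add: eval2_def)
next
  case (coord i)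
  then consider "i = 0" | "i = 1" by linarith
  then show ?case
  proof cases
    case 1
    then show ?thesis by (intro exI[of _ "[:[:0, 1:]:]"]) (simp add: eval2_def)
  next
    case 2
    then show ?thesis by (intro exI[of _ "[:0, 1:]"]) (simp add: eval2_def)
  qed
next
  case (add f g)
  then obtain P Q where "\<forall>z. f z = eval2 P (z 0) (z 1)" "\<forall>z. g z = eval2 Q (z 0) (z 1)" by blast
  then show ?case by (intro exI[of _ "P + Q"]) (simp add: eval2_simps)
next
  case (mult f g)
  then obtain P Q where "\<forall>z. f z = eval2 P (z 0) (z 1)" "\<forall>z. g z = eval2 Q (z 0) (z 1)" by blast
  then show ?case by (intro exI[of _ "P * Q"]) (simp add: eval2_simps)
qed

lemma polynomial_fun_poly: "i < n \<Longrightarrow> polynomial_fun n (\<lambda>z. poly p (z i))"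
proof (induction p)
  case (pCons a p)
  then show ?case unfolding poly_pCons
    by (intro polynomial_fun.add polynomial_fun.mult polynomial_fun.const polynomial_fun.coord) auto
qed (simp add: polynomial_fun.const)

lemma polynomial_fun_eval2: "polynomial_fun 2 (\<lambda>z. eval2 Q (z 0) (z 1))"
proof (induction Q)
  case 0
  then show ?case by (simp add: eval2_simps polynomial_fun.const)
next
  case (pCons a Q)
  then show ?case unfolding eval2_simps
    by (intro polynomial_fun.add polynomial_fun.mult polynomial_fun_poly polynomial_fun.coord) auto
qed

lemma eval2_prod: "eval2 (prod f A) x y = (\<Prod>i\<in>A. eval2 (f i) x y)"
  unfolding eval2_def by (simp add: poly_prod)

lemma eval2_has_derivative: "((\<lambda>y. eval2 Q x y) has_real_derivative eval2 (pderiv Q) x y) (at y)"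
proof (induction Q)
  case (pCons a Q)
  show ?case unfolding eval2_simps pderiv_pCons
    by (auto intro!: derivative_eq_intros pCons)
qed (simp add: eval2_simps)

lemma isCont_pfun_line:
  assumes "pfun f"
  shows "isCont (\<lambda>t. f (x(i := t))) s"
proof -
  obtain F where "\<forall>x t. f (x(i := t)) = poly (F x) t" using pfun_as_poly[OF assms, of i] by blast
  then show ?thesis by simp
qed

lemma eventually_positive_line:
  assumes "finite P" "\<And>f. f \<in> P \<Longrightarrow> pfun f" "\<And>f. f \<in> P \<Longrightarrow> 0 < f x"
  shows "\<forall>\<^sub>F t in nhds (x i). \<forall>f\<in>P. 0 < f (x(i := t))"
proof (intro eventually_ball_finite ballI assms(1))
  fix f assume f: "f \<in> P"
  have "isCont (\<lambda>t. f (x(i := t))) (x i)" using isCont_pfun_line assms(2)[OF f] by blast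
  then have "((\<lambda>t. f (x(i := t))) \<longlongrightarrow> f x) (at (x i))" by (simp add: isCont_def)
  then have "\<forall>\<^sub>F t in at (x i). 0 < f (x(i := t))" using assms(3)[OF f] by (rule order_tendstoD)
  then show "\<forall>\<^sub>F t in nhds (x i). 0 < f (x(i := t))"
    using assms(3)[OF f] by (simp add: eventually_nhds_conv_at)
qed

text \<open>A nonempty basic semialgebraic piece of the graph satisfies a nontrivial polynomial
  equation, and the product of these equations holds on the whole graph.\<close>

lemma sfun_algebraic:
  assumes "sfun 1 D h"
  shows "\<exists>Q. Q \<noteq> 0 \<and> (\<forall>x\<in>D. eval2 Q (x 0) (h x) = 0)"
proof -
  obtain R where R: "definable R" "\<And>x t. x \<in> vecs 1 \<Longrightarrow> R (x(1 := t)) \<longleftrightarrow> x \<in> D \<and> t = h x"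
    and D: "semialg 1 D" using assms unfolding sfun_def by blast
  define S where "S = {z \<in> vecs 2. R z}"
  have upd: "x(1 := t) \<in> vecs 2" if "x \<in> vecs 1" for x t using that by (auto simp: vecs_iff)
  have S: "z 1 = h (vfst 1 z)" if "z \<in> S" for z
  proof -
    have "(vfst 1 z)(1 := z 1) = z"
    proof
      fix i show "((vfst 1 z)(1 := z 1)) i = z i"
        using that by (cases "i = 0"; cases "i = 1") (auto simp: S_def vfst_def vecs_iff)
    qed
    then show ?thesis using R(2)[of "vfst 1 z" "z 1"] that by (simp add: S_def)
  qed
  have "semialg 2 S" unfolding S_def by (rule definable_imp_semialgebraic[OF R(1)])
  then obtain F where F: "finite F" "\<And>B. B \<in> F \<Longrightarrow> basic_semialgebraic 2 B" "S = \<Union>F" by auto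
  have "\<exists>Q. Q \<noteq> 0 \<and> (\<forall>z\<in>B. eval2 Q (z 0) (z 1) = 0)" if B: "B \<in> F" for B
  proof -
    obtain P G where PG: "finite P" "finite G" "\<And>f. f \<in> P \<Longrightarrow> polynomial_fun 2 f" "\<And>f. f \<in> G \<Longrightarrow> polynomial_fun 2 f"
      "B = {z \<in> vecs 2. (\<forall>f\<in>P. f z > 0) \<and> (\<forall>g\<in>G. g z = 0)}"
      using F(2)[OF B] unfolding basic_semialgebraic_def by blast
    show ?thesis
    proof (cases "\<exists>g\<in>G. \<exists>z. g z \<noteq> 0")
      case True
      then obtain g z where g: "g \<in> G" "g z \<noteq> 0" by blast
      obtain Q where Q: "\<forall>z. g z = eval2 Q (z 0) (z 1)" using polynomial_fun_2_eval2[OF PG(4)[OF g(1)]] by blast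
      have "Q \<noteq> 0" using g(2) Q by (auto simp: eval2_simps)
      moreover have "eval2 Q (z 0) (z 1) = 0" if "z \<in> B" for z using that g(1) Q PG(5) by auto
      ultimately show ?thesis by blast
    next
      case False
      \<comment> \<open>Without a nontrivial equation the piece is open, and a graph contains no open set.\<close>
      have "B = {}"
      proof (rule ccontr)
        assume "B \<noteq> {}"
        then obtain z where z: "z \<in> B" by blast
        have "\<forall>\<^sub>F t in nhds (z 1). \<forall>f\<in>P. 0 < f (z(1 := t))"
          using z PG by (intro eventually_positive_line) (auto simp: pfun_def)
        then have "\<forall>\<^sub>F t in at (z 1). t \<noteq> z 1 \<and> (\<forall>f\<in>P. 0 < f (z(1 := t)))"
          by (simp add: eventually_at_filter eventually_mono)
        then obtain t where t: "t \<noteq> z 1" "\<forall>f\<in>P. 0 < f (z(1 := t))"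
          using eventually_happens'[OF at_neq_bot] by blast
        have "z(1 := t) \<in> vecs 2" using z PG(5) by (auto simp: vecs_iff)
        then have "z(1 := t) \<in> B" using t False PG(5) by blast
        moreover have "vfst 1 (z(1 := t)) = vfst 1 z" by (auto simp: vfst_def)
        ultimately have "z 1 = t" using S[of z] S[of "z(1 := t)"] z F(3) B by auto
        then show False using t by simp
      qed
      then show ?thesis by (intro exI[of _ 1]) simp
    qed
  qed
  then obtain Q where Q: "\<And>B. B \<in> F \<Longrightarrow> Q B \<noteq> 0" "\<And>B z. B \<in> F \<Longrightarrow> z \<in> B \<Longrightarrow> eval2 (Q B) (z 0) (z 1) = 0"
    by metis
  have "eval2 (prod Q F) (x 0) (h x) = 0" if x: "x \<in> D" for x
  proof -
    have xv: "x \<in> vecs 1" using x semialgebraic_subset[OF D] by blast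
    then have "x(1 := h x) \<in> S" using R(2)[OF xv] upd[OF xv] x by (simp add: S_def)
    then obtain B where B: "B \<in> F" "x(1 := h x) \<in> B" using F(3) by blast
    have "eval2 (Q B) (x 0) (h x) = 0" using Q(2)[OF B] by simp
    then show ?thesis unfolding eval2_prod using F(1) B(1) by (auto simp: prod_zero_iff)
  qed
  moreover have "prod Q F \<noteq> 0" using Q(1) F(1) by (simp add: prod_zero_iff)
  ultimately show ?thesis by blast
qed

text \<open>A basic piece with infinitely many points makes each of its equations trivial, and
  inequalities define an open set.\<close>

lemma semialgebraic_line_contains_interval:
  assumes S: "semialg 1 S" and inf: "infinite S"
  shows "\<exists>a b. a < b \<and> (\<forall>t. a < t \<and> t < b \<longrightarrow> one_vec t \<in> S)"
proof -
  obtain F where F: "finite F" "\<And>B. B \<in> F \<Longrightarrow> basic_semialgebraic 1 B" "S = \<Union>F" using S by auto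
  then obtain B where B: "B \<in> F" "infinite B" using inf finite_Union by blast
  obtain P G where PG: "finite P" "finite G" "\<And>f. f \<in> P \<Longrightarrow> polynomial_fun 1 f" "\<And>f. f \<in> G \<Longrightarrow> polynomial_fun 1 f"
    "B = {z \<in> vecs 1. (\<forall>f\<in>P. f z > 0) \<and> (\<forall>g\<in>G. g z = 0)}"
    using F(2)[OF B(1)] unfolding basic_semialgebraic_def by blast
  have up: "x(0 := t) = one_vec t" if "x \<in> vecs 1" for x t using that by (auto simp: vecs_iff one_vec_def)
  have z0: "g (one_vec t) = 0" if g: "g \<in> G" for g t
  proof -
    obtain H where H: "\<forall>x t. g (x(0 := t)) = poly (H x) t"
      using pfun_as_poly[of g 0] PG(4)[OF g] unfolding pfun_def by blast
    have H': "g (one_vec t) = poly (H (one_vec 0)) t" for t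
      using H[rule_format, of "one_vec 0" t] up[OF one_vec_in_vecs] by simp
    have "inj_on (\<lambda>x. x 0) B"
    proof (rule inj_onI)
      fix x y assume "x \<in> B" "y \<in> B" "x 0 = y 0"
      moreover from this have "one_vec (x 0) = x" "one_vec (y 0) = y"
        by (auto simp: PG(5) one_vec_def vecs_iff)
      ultimately show "x = y" by metis
    qed
    then have "infinite ((\<lambda>x. x 0) ` B)" using B(2) finite_imageD by blast
    moreover have "(\<lambda>x. x 0) ` B \<subseteq> {t. poly (H (one_vec 0)) t = 0}"
    proof
      fix t assume "t \<in> (\<lambda>x. x 0) ` B"
      then obtain x where x: "x \<in> B" "t = x 0" by blast
      then have "one_vec t = x" by (auto simp: PG(5) one_vec_def vecs_iff)
      then show "t \<in> {t. poly (H (one_vec 0)) t = 0}" using x g H'[of t] by (auto simp: PG(5))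
    qed
    ultimately have "H (one_vec 0) = 0" using poly_roots_finite finite_subset by blast
    then show ?thesis using H' by simp
  qed
  obtain z where z: "z \<in> B" using B(2) by fastforce
  have "\<forall>\<^sub>F t in nhds (z 0). \<forall>f\<in>P. 0 < f (z(0 := t))"
    using z PG by (intro eventually_positive_line) (auto simp: pfun_def)
  then obtain e where e: "e > 0" "\<And>t. dist t (z 0) < e \<Longrightarrow> \<forall>f\<in>P. 0 < f (z(0 := t))"
    unfolding eventually_nhds_metric by blast
  have "one_vec t \<in> S" if "z 0 - e < t" "t < z 0 + e" for t
  proof -
    have "z(0 := t) = one_vec t" using z by (intro up) (simp add: PG(5))
    moreover have "\<forall>f\<in>P. 0 < f (z(0 := t))" using that by (intro e(2)) (auto simp: dist_real_def)
    ultimately have "one_vec t \<in> B" using z0 by (simp add: PG(5))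
    then show ?thesis using F(3) B(1) by blast
  qed
  then show ?thesis using e(1) by (intro exI[of _ "z 0 - e"] exI[of _ "z 0 + e"]) auto
qed

text \<open>The functions \<open>B i\<close> are divided differences and become the partial derivatives of \<open>P\<close> on
  the diagonal. The exact formula for \<open>P y - P z\<close> yields the derivative of a continuous implicit
  function without estimates.\<close>

lemma polynomial_divided_differences:
  assumes "polynomial_fun n P"
  shows "\<exists>B. (\<forall>y z. P y - P z = (\<Sum>i<n. (y i - z i) * B i y z)) \<and> (\<forall>i. pfun (\<lambda>z. B i z z)) \<and>
    (\<forall>i \<gamma> s. (\<forall>j. isCont (\<lambda>t. \<gamma> t j) s) \<longrightarrow> isCont (\<lambda>t. B i (\<gamma> t) (\<gamma> s)) (s::real))"
    (is "\<exists>B. ?good P B")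
proof -
  have "pfun P \<and> (\<forall>\<gamma> s. (\<forall>j. isCont (\<lambda>t. \<gamma> t j) s) \<longrightarrow> isCont (\<lambda>t. P (\<gamma> t)) (s::real)) \<and> (\<exists>B. ?good P B)"
    using assms
  proof (induction rule: polynomial_fun.induct)
    case (const c)
    show ?case by (intro conjI exI[of _ "\<lambda>i y z. 0"]) auto
  next
    case (coord k)
    have "y k - z k = (\<Sum>i<n. (y i - z i) * (if i = k then 1 else 0))" for y z :: rvec
      using coord by (simp add: sum.delta if_distrib cong: if_cong)
    then show ?case by (intro conjI exI[of _ "\<lambda>i y z. if i = k then 1 else 0"]) auto
  next
    case (add f g)
    then obtain B C where B: "?good f B" and C: "?good g C" by blast
    have "f y + g y - (f z + g z) = (\<Sum>i<n. (y i - z i) * (B i y z + C i y z))" for y z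
    proof -
      have "f y + g y - (f z + g z) = (f y - f z) + (g y - g z)" by simp
      also have "\<dots> = (\<Sum>i<n. (y i - z i) * B i y z) + (\<Sum>i<n. (y i - z i) * C i y z)"
        using B C by simp
      finally show ?thesis by (simp add: sum.distrib distrib_left)
    qed
    then show ?case using add B C
      by (intro conjI exI[of _ "\<lambda>i y z. B i y z + C i y z"]) (auto intro!: continuous_intros)
  next
    case (mult f g)
    then obtain B C where B: "?good f B" and C: "?good g C" by blast
    have "f y * g y - f z * g z = (\<Sum>i<n. (y i - z i) * (B i y z * g y + f z * C i y z))" for y z
    proof -
      have "f y * g y - f z * g z = (f y - f z) * g y + f z * (g y - g z)" by (simp add: algebra_simps)
      also have "\<dots> = (\<Sum>i<n. (y i - z i) * B i y z) * g y + f z * (\<Sum>i<n. (y i - z i) * C i y z)"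
        using B C by simp
      also have "\<dots> = (\<Sum>i<n. (y i - z i) * (B i y z * g y + f z * C i y z))"
        by (simp add: sum_distrib_left sum_distrib_right mult_ac flip: sum.distrib)
          (simp add: algebra_simps)
      finally show ?thesis .
    qed
    then show ?case using mult B C
      by (intro conjI exI[of _ "\<lambda>i y z. B i y z * g y + f z * C i y z"])
        (auto intro!: continuous_intros pfun_add pfun_mult)
  qed
  then show ?thesis by blast
qed

definition line_interval :: "real \<Rightarrow> real \<Rightarrow> rvec set" where
  "line_interval a b = {x \<in> vecs 1. a < x 0 \<and> x 0 < b}"

lemma line_interval_iff [simp]: "one_vec t \<in> line_interval a b \<longleftrightarrow> a < t \<and> t < b"
  by (simp add: line_interval_def)

lemma line_interval_eq: "x \<in> line_interval a b \<Longrightarrow> one_vec (x 0) = x"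
  by (auto simp: line_interval_def one_vec_def vecs_iff)

lemma line_interval_open: "openin (euc 1) (line_interval a b)"
  unfolding openin_Euclidean_box
proof (intro conjI ballI)
  show "line_interval a b \<subseteq> vecs 1" by (auto simp: line_interval_def)
  fix x assume x: "x \<in> line_interval a b"
  have "y \<in> line_interval a b" if "y \<in> vecs 1" "\<forall>i<1. \<bar>y i - x i\<bar> < min (x 0 - a) (b - x 0)" for y
  proof -
    have "\<bar>y 0 - x 0\<bar> < min (x 0 - a) (b - x 0)" using that(2) by simp
    then show ?thesis using that(1) by (auto simp: line_interval_def)
  qed
  then show "\<exists>e>0. \<forall>y\<in>vecs 1. (\<forall>i<1. \<bar>y i - x i\<bar> < e) \<longrightarrow> y \<in> line_interval a b"
    using x by (intro exI[of _ "min (x 0 - a) (b - x 0)"]) (auto simp: line_interval_def)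
qed

lemma line_interval_semialgebraic: "semialg 1 (line_interval a b)"
  unfolding line_interval_def by (intro definable_imp_semialgebraic definable_conj definable_less pfun_coord pfun_const)

lemma line_interval_nonempty: "a < b \<Longrightarrow> line_interval a b \<noteq> {}"
proof -
  assume "a < b"
  then have "one_vec ((a + b) / 2) \<in> line_interval a b" by (simp add: field_simps)
  then show ?thesis by blast
qed

text \<open>The derivative of \<open>H\<close> is minus the quotient of the partial derivatives of \<open>Q\<close> along the
  graph, a polynomial expression in \<open>H\<close> divided by another one; so \<open>H\<close> gains one derivative
  after the other.\<close>

lemma implicit_function_smooth:
  assumes H: "\<And>t. a < t \<Longrightarrow> t < b \<Longrightarrow> isCont H t"
    and Q0: "\<And>t. a < t \<Longrightarrow> t < b \<Longrightarrow> eval2 Q t (H t) = 0"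
    and Q1: "\<And>t. a < t \<Longrightarrow> t < b \<Longrightarrow> eval2 (pderiv Q) t (H t) \<noteq> 0"
  shows "Ck_on k 1 (line_interval a b) (\<lambda>x. H (x 0))"
proof -
  define P where "P = (\<lambda>z::rvec. eval2 Q (z 0) (z 1))"
  obtain B where B: "\<And>y z. P y - P z = (\<Sum>i<2. (y i - z i) * B i y z)" "\<And>i. pfun (\<lambda>z. B i z z)"
    "\<And>i \<gamma> s. (\<And>j. isCont (\<lambda>t. \<gamma> t j) s) \<Longrightarrow> isCont (\<lambda>t. B i (\<gamma> t) (\<gamma> s)) (s::real)"
    using polynomial_divided_differences[OF polynomial_fun_eval2[of Q]] unfolding P_def by blast
  have two: "(\<Sum>i<2. f i) = f 0 + f 1" for f :: "nat \<Rightarrow> real" by (simp add: numeral_2_eq_2 One_nat_def)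
  define pt where "pt x y = (\<lambda>i::nat. if i = 0 then x else if i = 1 then y else (0::real))" for x y
  have B1: "B 1 (pt x y) (pt x y) = eval2 (pderiv Q) x y" for x y
  proof -
    have "P (pt x u) - P (pt x y) = B 1 (pt x u) (pt x y) * (u - y)" for u
      using B(1)[of "pt x u" "pt x y"] by (simp add: two pt_def)
    moreover have "isCont (\<lambda>u. B 1 (pt x u) (pt x y)) y"
    proof (rule B(3))
      fix j show "isCont (\<lambda>t. pt x t j) y" unfolding pt_def by (cases "j = 0"; cases "j = 1") auto
    qed
    ultimately have "((\<lambda>u. P (pt x u)) has_real_derivative B 1 (pt x y) (pt x y)) (at y)"
      unfolding CARAT_DERIV by (intro exI[of _ "\<lambda>u. B 1 (pt x u) (pt x y)"]) simp
    moreover have "P (pt x u) = eval2 Q x u" for u by (simp add: P_def pt_def)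
    ultimately have "((\<lambda>u. eval2 Q x u) has_real_derivative B 1 (pt x y) (pt x y)) (at y)" by simp
    then show ?thesis by (rule DERIV_unique[OF _ eval2_has_derivative])
  qed
  define D where "D t = - B 0 (pt t (H t)) (pt t (H t)) * inverse (B 1 (pt t (H t)) (pt t (H t)))" for t
  have deriv: "(H has_real_derivative D s) (at s)" if s: "a < s" "s < b" for s
  proof -
    define b0 b1 where "b0 t = B 0 (pt t (H t)) (pt s (H s))" and "b1 t = B 1 (pt t (H t)) (pt s (H s))" for t
    have c: "isCont (\<lambda>t. B i (pt t (H t)) (pt s (H s))) s" for i
    proof (rule B(3))
      fix j show "isCont (\<lambda>t. pt t (H t) j) s" unfolding pt_def using H[OF s] by (cases "j = 0"; cases "j = 1") auto
    qed
    have b1s: "b1 s \<noteq> 0" using Q1[OF s] B1 by (simp add: b1_def)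
    have lim: "((\<lambda>t. - b0 t / b1 t) \<longlongrightarrow> D s) (at s)"
    proof -
      have "((\<lambda>t. - b0 t / b1 t) \<longlongrightarrow> - b0 s / b1 s) (at s)"
        using c[of 0] c[of 1] b1s unfolding b0_def b1_def isCont_def by (intro tendsto_intros)
      moreover have "- b0 s / b1 s = D s" by (simp add: D_def b0_def b1_def divide_inverse)
      ultimately show ?thesis by simp
    qed
    have "\<forall>\<^sub>F t in at s. t \<in> {a<..<b}" using s by (intro eventually_at_in_open') auto
    moreover have "\<forall>\<^sub>F t in at s. b1 t \<noteq> 0"
      using c[of 1] b1s unfolding b1_def isCont_def by (rule tendsto_imp_eventually_ne)
    moreover have "\<forall>\<^sub>F t in at s. t \<noteq> s" by (simp add: eventually_at_filter)
    ultimately have "\<forall>\<^sub>F t in at s. - b0 t / b1 t = (H t - H s) / (t - s)"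
    proof eventually_elim
      case (elim t)
      have "P (pt t (H t)) - P (pt s (H s)) = (t - s) * b0 t + (H t - H s) * b1 t"
        using B(1)[of "pt t (H t)" "pt s (H s)"] by (simp add: two b0_def b1_def) (simp add: pt_def)
      moreover have "P (pt t (H t)) = 0" "P (pt s (H s)) = 0" using Q0 elim(1) s by (auto simp: P_def pt_def)
      ultimately have "(H t - H s) * b1 t = - b0 t * (t - s)" by (simp add: algebra_simps)
      then show ?case using elim by (simp add: field_simps)
    qed
    then show ?thesis unfolding has_field_derivative_iff using lim by (rule Lim_transform_eventually[rotated])
  qed
  show ?thesis
  proof (induction k)
    case 0
    have 1: "continuous_map (subtopology (euc 1) (line_interval a b)) (top_of_set {a<..<b}) (\<lambda>x. x 0)"
      using continuous_map_first_coord by (auto simp: continuous_map_in_subtopology line_interval_def)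
    have 2: "continuous_map (top_of_set {a<..<b}) euclideanreal H"
      using H by (simp add: continuous_at_imp_continuous_on)
    from continuous_map_compose[OF 1 2] show ?case by (simp add: o_def)
  next
    case (Suc k)
    have comp: "Ck_on k 1 (line_interval a b) (\<lambda>x. p (pt (x 0) (H (x 0))))" if "pfun p" for p
      using that
    proof (induction rule: pfun_induct)
      case (coord i)
      then show ?case unfolding pt_def using Suc.IH
        by (cases "i = 0"; cases "i = 1") (auto intro: Ck_coord Ck_const)
    qed (auto intro: Ck_const Ck_add Ck_mult)
    show ?case
    proof (rule Ck_SucI[where g = "\<lambda>i x. D (x 0)"])
      show "continuous_map (subtopology (euc 1) (line_interval a b)) euclideanreal (\<lambda>x. H (x 0))"
        using Ck_continuous[OF Suc.IH] .
      show "((\<lambda>t. H ((x(i := t)) 0)) has_real_derivative D (x 0)) (at (x i))"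
        if "i < 1" "x \<in> line_interval a b" for i x
        using deriv[of "x 0"] that by (simp add: line_interval_def)
      have "Ck_on k 1 (line_interval a b) (\<lambda>x. - 1 * B 0 (pt (x 0) (H (x 0))) (pt (x 0) (H (x 0))) *
          inverse (B 1 (pt (x 0) (H (x 0))) (pt (x 0) (H (x 0)))))"
        using comp[OF B(2)[of 0]] comp[OF B(2)[of 1]] Q1 B1
        by (intro Ck_mult Ck_const Ck_inverse) (auto simp: line_interval_def)
      then show "Ck_on k 1 (line_interval a b) (\<lambda>x. D (x 0))" by (simp add: D_def)
    qed
  qed
qed

text \<open>Among the nonzero polynomials that vanish along the graph over some subinterval, choose
  one of least degree in the value variable. Its derivative in this variable has smaller degree,
  hence it does not vanish somewhere, and the implicit function theorem applies near that
  point.\<close>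

lemma sfun_smooth_on_subinterval:
  assumes h: "sfun 1 D h" and ab: "a < b" and D: "\<And>t. a < t \<Longrightarrow> t < b \<Longrightarrow> one_vec t \<in> D"
    and c: "\<And>t. a < t \<Longrightarrow> t < b \<Longrightarrow> isCont (\<lambda>t. h (one_vec t)) t"
  shows "\<exists>a' b'. a \<le> a' \<and> a' < b' \<and> b' \<le> b \<and> (\<forall>k. Ck_on k 1 (line_interval a' b') h)"
proof -
  define H where "H t = h (one_vec t)" for t
  define good where "good Q a' b' \<longleftrightarrow> Q \<noteq> 0 \<and> a \<le> a' \<and> a' < b' \<and> b' \<le> b \<and>
    (\<forall>t. a' < t \<and> t < b' \<longrightarrow> eval2 Q t (H t) = 0)" for Q a' b'
  obtain Q0 where Q0: "Q0 \<noteq> 0" "\<And>x. x \<in> D \<Longrightarrow> eval2 Q0 (x 0) (h x) = 0" using sfun_algebraic[OF h] by blast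
  have "good Q0 a b" unfolding good_def using Q0(1) ab Q0(2)[OF D] by (auto simp: H_def)
  then have "\<exists>n Q a' b'. good Q a' b' \<and> degree Q = n" by blast
  then obtain n where n: "\<exists>Q a' b'. good Q a' b' \<and> degree Q = n"
    "\<And>m. m < n \<Longrightarrow> \<not> (\<exists>Q a' b'. good Q a' b' \<and> degree Q = m)"
    using exists_least_iff[of "\<lambda>n. \<exists>Q a' b'. good Q a' b' \<and> degree Q = n"] by blast
  then obtain Q a' b' where Q: "good Q a' b'" "degree Q = n" by blast
  note Q' = Q(1)[unfolded good_def]
  (* An equation of degree 0 in the value variable would have a whole interval of roots. *)
  have n0: "n \<noteq> 0"
  proof
    assume "n = 0"
    then obtain q where q: "Q = [:q:]" using Q(2) degree0_coeffs by blast
    have "{a'<..<b'} \<subseteq> {t. poly q t = 0}" using Q' q by (auto simp: eval2_def)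
    moreover have "infinite {a'<..<b'}" using Q' by simp
    ultimately have "q = 0" using poly_roots_finite finite_subset by blast
    then show False using Q' q by simp
  qed
  obtain m where m: "n = Suc m" using n0 not0_implies_Suc by blast
  have "coeff (pderiv Q) m = of_nat (Suc m) * lead_coeff Q" using Q(2) m by (simp add: coeff_pderiv)
  moreover have "(of_nat (Suc m) :: real poly) \<noteq> 0" by (simp add: of_nat_poly del: of_nat_Suc)
  ultimately have "pderiv Q \<noteq> 0" using Q' by (metis coeff_0 leading_coeff_0_iff mult_eq_0_iff)
  moreover have "degree (pderiv Q) < n"
  proof -
    have "degree (pderiv Q) \<le> m" by (rule degree_le) (auto simp: coeff_pderiv coeff_eq_0 Q(2) m)
    then show ?thesis using m by simp
  qed
  ultimately have "\<not> (\<forall>t. a' < t \<and> t < b' \<longrightarrow> eval2 (pderiv Q) t (H t) = 0)"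
    using n(2)[of "degree (pderiv Q)"] Q' unfolding good_def by blast
  then obtain t0 where t0: "a' < t0" "t0 < b'" "eval2 (pderiv Q) t0 (H t0) \<noteq> 0" by blast
  have Hc: "isCont H t" if "a' < t" "t < b'" for t
    using c[of t] that Q' unfolding H_def by simp
  have "isCont (\<lambda>t. eval2 R t (H t)) t0" for R
  proof (induction R)
    case (pCons p R)
    then show ?case unfolding eval2_simps using Hc[OF t0(1,2)] by (intro continuous_intros) auto
  qed (simp add: eval2_simps)
  then have "\<forall>\<^sub>F t in at t0. eval2 (pderiv Q) t (H t) \<noteq> 0"
    using t0(3) unfolding isCont_def by (rule tendsto_imp_eventually_ne)
  then have "\<forall>\<^sub>F t in nhds t0. eval2 (pderiv Q) t (H t) \<noteq> 0" using t0(3) by (simp add: eventually_nhds_conv_at)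
  then obtain e where e: "e > 0" "\<And>t. dist t t0 < e \<Longrightarrow> eval2 (pderiv Q) t (H t) \<noteq> 0"
    unfolding eventually_nhds_metric by blast
  define a1 b1 where "a1 = max a' (t0 - e)" and "b1 = min b' (t0 + e)"
  have "Ck_on k 1 (line_interval a1 b1) (\<lambda>x. H (x 0))" for k
  proof (rule implicit_function_smooth[where Q = Q])
    fix t assume t: "a1 < t" "t < b1"
    show "isCont H t" using t by (intro Hc) (auto simp: a1_def b1_def)
    show "eval2 Q t (H t) = 0" using t Q' by (auto simp: a1_def b1_def)
    show "eval2 (pderiv Q) t (H t) \<noteq> 0" using t by (intro e(2)) (auto simp: a1_def b1_def dist_real_def)
  qed
  then have "Ck_on k 1 (line_interval a1 b1) h" for k
    by (rule Ck_cong[OF line_interval_open]) (simp add: H_def line_interval_eq)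
  moreover have "a \<le> a1" "a1 < b1" "b1 \<le> b" using Q' t0 e(1) by (auto simp: a1_def b1_def)
  ultimately show ?thesis by blast
qed

section \<open>Nash endomorphisms of the positive reals\<close>

text \<open>Divide by the fastest growing exponential and let \<open>s\<close> tend to infinity.\<close>

lemma exp_sum_independent:
  fixes c e :: "'t \<Rightarrow> real"
  assumes fin: "finite T" and inj: "inj_on e T" and ne: "T \<noteq> {}" and c: "\<And>t. t \<in> T \<Longrightarrow> c t \<noteq> 0"
    and z: "\<And>s. (\<Sum>t\<in>T. c t * exp (e t * s)) = 0"
  shows False
proof -
  obtain t0 where t0: "t0 \<in> T" "\<And>t. t \<in> T \<Longrightarrow> e t \<le> e t0"
  proof -
    have "Max (e ` T) \<in> e ` T" using fin ne by (intro Max_in) auto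
    then obtain t0 where "t0 \<in> T" "e t0 = Max (e ` T)" by auto
    then show ?thesis using that[of t0] fin by simp
  qed
  have "((\<lambda>s. \<Sum>t\<in>T. c t * exp ((e t - e t0) * s)) \<longlongrightarrow> (\<Sum>t\<in>T. c t * (if t = t0 then 1 else 0))) at_top"
  proof (intro tendsto_sum tendsto_mult tendsto_const)
    fix t assume t: "t \<in> T"
    show "((\<lambda>s. exp ((e t - e t0) * s)) \<longlongrightarrow> (if t = t0 then 1 else 0)) at_top"
    proof (cases "t = t0")
      case False
      then have "e t - e t0 < 0" using t0 t inj by (metis inj_onD le_less diff_less_0_iff_less)
      then have "filterlim (\<lambda>s. (e t - e t0) * s) at_bot at_top"
        by (intro filterlim_tendsto_neg_mult_at_bot[OF tendsto_const _ filterlim_ident])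
      then show ?thesis using False filterlim_compose[OF exp_at_bot] by simp
    qed simp
  qed
  moreover have "(\<Sum>t\<in>T. c t * exp ((e t - e t0) * s)) = 0" for s
  proof -
    have "exp ((e t - e t0) * s) = exp (e t * s) * exp (- e t0 * s)" for t
      by (simp add: left_diff_distrib flip: exp_add)
    then have "(\<Sum>t\<in>T. c t * exp ((e t - e t0) * s)) = (\<Sum>t\<in>T. c t * exp (e t * s)) * exp (- e t0 * s)"
      by (simp add: sum_distrib_right mult.assoc)
    then show ?thesis using z by simp
  qed
  moreover have "(\<Sum>t\<in>T. c t * (if t = t0 then 1 else 0)) = c t0"
    using fin t0(1) by (simp add: sum.delta if_distrib cong: if_cong)
  ultimately have "((\<lambda>s::real. 0) \<longlongrightarrow> c t0) at_top" by simp
  then have "c t0 = 0" by (simp add: tendsto_const_iff)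
  then show False using c t0(1) by simp
qed

text \<open>For irrational \<open>a\<close> the exponents \<open>i + j * a\<close> of the monomials \<open>x ^ i * (x powr a) ^ j\<close> are
  distinct, and with \<open>x = exp s\<close> the equation would be a linear dependence between distinct
  exponentials.\<close>

lemma algebraic_power_rational:
  assumes Q: "Q \<noteq> 0" and z: "\<And>x. 0 < x \<Longrightarrow> eval2 Q x (x powr a) = 0"
  shows "a \<in> \<rat>"
proof (rule ccontr)
  assume irr: "a \<notin> \<rat>"
  define N where "N = (MAX j\<in>{..degree Q}. degree (coeff Q j))"
  have N: "degree (coeff Q j) \<le> N" if "j \<le> degree Q" for j
    unfolding N_def using that by (intro Max_ge) auto
  define T where "T = {p \<in> {..degree Q} \<times> {..N}. coeff (coeff Q (fst p)) (snd p) \<noteq> 0}"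
  define c where "c p = coeff (coeff Q (fst p)) (snd p)" for p :: "nat \<times> nat"
  define e where "e p = real (snd p) + real (fst p) * a" for p :: "nat \<times> nat"
  have fin: "finite T" unfolding T_def by (rule finite_subset[of _ "{..degree Q} \<times> {..N}"]) auto
  have inj: "inj_on e T"
  proof (rule inj_onI)
    fix p q assume "e p = e q"
    then have eq: "(real (fst p) - real (fst q)) * a = real (snd q) - real (snd p)"
      by (simp add: e_def algebra_simps)
    have "fst p = fst q"
    proof (rule ccontr)
      assume "fst p \<noteq> fst q"
      then have "a = (real (snd q) - real (snd p)) / (real (fst p) - real (fst q))"
        using eq by (simp add: field_simps)
      also have "\<dots> \<in> \<rat>" by (intro Rats_divide Rats_diff Rats_of_nat)
      finally show False using irr by simp
    qed
    then show "p = q" using eq by (simp add: prod_eq_iff)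
  qed
  have ne: "T \<noteq> {}"
  proof -
    let ?q = "lead_coeff Q"
    have "?q \<noteq> 0" using Q by simp
    then have "(degree Q, degree ?q) \<in> T" using N[of "degree Q"] by (simp add: T_def)
    then show ?thesis by blast
  qed
  have "(\<Sum>p\<in>T. c p * exp (e p * s)) = 0" for s
  proof -
    have pw: "poly (coeff Q j) x * y ^ j = (\<Sum>i\<le>N. coeff (coeff Q j) i * x ^ i * y ^ j)" if "j \<le> degree Q" for j x y
    proof -
      have "poly (coeff Q j) x = (\<Sum>i\<le>N. coeff (coeff Q j) i * x ^ i)"
        unfolding poly_altdef using N[OF that]
        by (intro sum.mono_neutral_left) (auto simp: coeff_eq_0)
      then show ?thesis by (simp add: sum_distrib_right)
    qed
    have "eval2 Q x y = (\<Sum>j\<le>degree Q. poly (coeff Q j) x * y ^ j)" for x y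
    proof -
      have "poly Q [:y:] = (\<Sum>j\<le>degree Q. coeff Q j * [:y:] ^ j)" by (rule poly_altdef)
      then show ?thesis by (simp add: eval2_def poly_sum poly_const_pow mult.commute)
    qed
    then have "eval2 Q x y = (\<Sum>j\<le>degree Q. \<Sum>i\<le>N. coeff (coeff Q j) i * x ^ i * y ^ j)" for x y
      using pw by simp
    then have "eval2 Q x y = (\<Sum>p\<in>{..degree Q} \<times> {..N}. c p * x ^ snd p * y ^ fst p)" for x y
      by (simp add: sum.cartesian_product c_def case_prod_unfold)
    also have "(\<Sum>p\<in>{..degree Q} \<times> {..N}. c p * x ^ snd p * y ^ fst p) = (\<Sum>p\<in>T. c p * x ^ snd p * y ^ fst p)" for x y
      by (rule sum.mono_neutral_right) (auto simp: T_def c_def)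
    finally have ev: "eval2 Q x y = (\<Sum>p\<in>T. c p * x ^ snd p * y ^ fst p)" for x y .
    have "exp s ^ snd p * (exp s powr a) ^ fst p = exp (e p * s)" for p
    proof -
      have "exp s powr a = exp (a * s)" by (simp add: powr_def)
      then show ?thesis
        by (simp add: e_def flip: exp_of_nat_mult exp_add) (simp add: algebra_simps)
    qed
    then have "(\<Sum>p\<in>T. c p * exp (e p * s)) = eval2 Q (exp s) (exp s powr a)" unfolding ev by (simp add: mult.assoc)
    then show ?thesis using z[of "exp s"] by simp
  qed
  then show False using exp_sum_independent[OF fin inj ne, of c] by (auto simp: T_def c_def)
qed

lemma additive_differentiable_linear:
  fixes u :: "real \<Rightarrow> real"
  assumes add: "\<And>s t. u (s + t) = u s + u t" and d: "(u has_real_derivative a) (at 0)"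
  shows "u s = a * s"
proof -
  have "(u has_real_derivative a) (at t)" for t
  proof -
    have "((\<lambda>s. u (s - t)) has_real_derivative a * 1) (at t)"
      by (rule DERIV_chain2[where f = u and g = "\<lambda>s. s - t"]) (use d in \<open>auto intro!: derivative_eq_intros\<close>)
    then have "((\<lambda>s. u t + u (s - t)) has_real_derivative a) (at t)"
      by (auto intro!: derivative_eq_intros)
    moreover have "u t + u (s - t) = u s" for s using add[of t "s - t"] by simp
    ultimately show ?thesis by simp
  qed
  then have "((\<lambda>s. u s - a * s) has_real_derivative 0) (at t)" for t
    by (auto intro!: derivative_eq_intros)
  then have "u s - a * s = u 0 - a * 0" using DERIV_isconst_all by blast
  moreover have "u 0 = 0" using add[of 0 0] by simp
  ultimately show ?thesis by simp
qed

text \<open>In the logarithmic coordinate \<open>f\<close> is additive and differentiable, so it is linear and \<open>f\<close>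
  is a real power. A semialgebraic function satisfies a polynomial equation, which leaves only
  rational exponents.\<close>

lemma nash_hom_Rpos_Rpos:
  assumes f: "nash_map (nspace Rpos) (nspace Rpos) f"
    and pos: "\<And>t. 0 < t \<Longrightarrow> 0 < f t" and hom: "\<And>s t. 0 < s \<Longrightarrow> 0 < t \<Longrightarrow> f (s * t) = f s * f t"
  obtains r where "\<And>t. 0 < t \<Longrightarrow> f t = t powr of_rat r"
proof -
  have "nash_map (Opn 1 (Upos 1)) (Opn 1 (Upos 1)) (\<lambda>x. one_vec (f (x 0)))"
    using nash_map_compose[OF Opn_manif(1)[OF Upos_good] Rpos_manif(1) Opn_manif(1)[OF Upos_good] _ nash_map_one_vec]
      f unfolding nash_map_from_Rpos[OF Rpos_manif(1)] by blast
  then have nf: "nashf 1 1 (Upos 1) (Upos 1) (\<lambda>x. one_vec (f (x 0)))"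
    unfolding nash_map_Opn_Opn[OF Upos_good Upos_good] .
  have sf: "sfun 1 (Upos 1) (\<lambda>x. f (x 0))"
    using smap_component[OF nashf_D(2)[OF nf], of 0] by simp
  have ck: "Ck_on (Suc 0) 1 (Upos 1) (\<lambda>x. f (x 0))"
    using nashf_D(3)[OF nf, unfolded smooth_map_iff, rule_format, of 0 "Suc 0"] by (simp del: Ck_on.simps)
  obtain g where g: "\<And>i x. i < 1 \<Longrightarrow> x \<in> Upos 1 \<Longrightarrow> ((\<lambda>t. f ((x(i := t)) 0)) has_real_derivative g i x) (at (x i))"
    by (rule Ck_SucE[OF ck], rule that)
  have d1: "(f has_real_derivative g 0 (one_vec 1)) (at 1)" using g[of 0 "one_vec 1"] by simp
  define u where "u s = ln (f (exp s))" for s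
  have add: "u (s + t) = u s + u t" for s t
    using pos[of "exp s"] pos[of "exp t"] by (simp add: u_def exp_add hom ln_mult)
  have f1: "0 < f 1" using pos by simp
  have "((\<lambda>s. f (exp s)) has_real_derivative g 0 (one_vec 1) * 1) (at 0)"
    by (rule DERIV_chain2[where f = f and g = exp]) (use d1 in \<open>auto intro!: derivative_eq_intros\<close>)
  then have "(u has_real_derivative g 0 (one_vec 1) / f 1) (at 0)"
    unfolding u_def using f1 by (auto intro!: derivative_eq_intros)
  then have lin: "u s = g 0 (one_vec 1) / f 1 * s" for s using additive_differentiable_linear[OF add] by blast
  define a where "a = g 0 (one_vec 1) / f 1"
  have fp: "f t = t powr a" if t: "0 < t" for t
  proof -
    have "ln (f t) = a * ln t" using lin[of "ln t"] t by (simp add: u_def a_def)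
    then have "exp (ln (f t)) = exp (a * ln t)" by simp
    then show ?thesis using pos[OF t] t by (simp add: powr_def)
  qed
  obtain Q where Q: "Q \<noteq> 0" "\<And>x. x \<in> Upos 1 \<Longrightarrow> eval2 Q (x 0) (f (x 0)) = 0" using sfun_algebraic[OF sf] by blast
  have "eval2 Q t (t powr a) = 0" if "0 < t" for t using Q(2)[of "one_vec t"] fp that by simp
  then have "a \<in> \<rat>" by (rule algebraic_power_rational[OF Q(1)])
  then obtain r where "a = of_rat r" by (rule Rats_cases)
  then show ?thesis using that fp by blast
qed

section \<open>Smoothness of semialgebraic homomorphisms\<close>

text \<open>The domain is a projection of the graph.\<close>

lemma graph_domain_semialgebraic:
  assumes "semialg (m + n) (graph_of m D f)" "D \<subseteq> vecs m" "f \<in> D \<rightarrow> vecs n"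
  shows "semialg m D"
proof -
  have "semialg m {x \<in> vecs m. \<exists>y\<in>vecs n. vjoin m x y \<in> graph_of m D f}"
    by (rule semialgebraic_ex_vec, rule definable_mem[OF assms(1)]) (auto intro!: pfun_entry)
  moreover have "{x \<in> vecs m. \<exists>y\<in>vecs n. vjoin m x y \<in> graph_of m D f} = D"
  proof (intro equalityI subsetI)
    fix x assume x: "x \<in> D"
    then have "x \<in> vecs m" "f x \<in> vecs n" using assms(2,3) by auto
    moreover from this x have "vjoin m x (f x) \<in> graph_of m D f" using vjoin_in_graph[OF assms(2)] by blast
    ultimately show "x \<in> {x \<in> vecs m. \<exists>y\<in>vecs n. vjoin m x y \<in> graph_of m D f}" by blast
  qed (use vjoin_in_graph[OF assms(2)] in blast)
  ultimately show ?thesis by metis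
qed

text \<open>The graph of the solution \<open>G\<close> of the equation \<open>K y = E x\<close> is the preimage of the diagonal
  under a Nash map. An inverse of an injective Nash map is therefore semialgebraic in charts
  before anything is known about its continuity.\<close>

lemma smap_of_equation:
  assumes E: "nashf k n D (vecs n) E" and K: "nashf m n V (vecs n) K"
    and G: "\<And>x. x \<in> D' \<Longrightarrow> G x \<in> V" and D': "D' \<subseteq> D"
    and eq: "\<And>x y. x \<in> D \<Longrightarrow> y \<in> V \<Longrightarrow> K y = E x \<longleftrightarrow> x \<in> D' \<and> y = G x"
  shows "smap k m D' V G"
proof -
  note d = nashf_D[OF E] and v = nashf_D[OF K]
  have sub: "D \<subseteq> vecs k" "V \<subseteq> vecs m" using open_subset_vecs[OF d(1)] open_subset_vecs[OF v(1)] by blast+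
  note pr = nashf_vfst_vsnd[OF d(1,4) v(1,4)]
  have "nashf (k + m) n (vprod k D V) (vecs n) (\<lambda>z. E (vfst k z))"
    by (rule nashf_compose[OF pr(1) E]) (use nashf_D(6)[OF pr(1)] in blast)
  moreover have "nashf (k + m) n (vprod k D V) (vecs n) (\<lambda>z. K (vsnd k z))"
    by (rule nashf_compose[OF pr(2) K]) (use nashf_D(6)[OF pr(2)] in blast)
  ultimately have EK: "nashf (k + m) (n + n) (vprod k D V) (vprod n (vecs n) (vecs n))
      (\<lambda>z. vjoin n (E (vfst k z)) (K (vsnd k z)))" by (rule nashf_vjoin)
  have "definable (\<lambda>w. \<forall>i<n. w i = w (n + i))" by (intro definable_all_less definable_eq pfun_coord)
  then have diag: "semialg (n + n) {w \<in> vecs (n + n). \<forall>i<n. w i = w (n + i)}"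
    by (rule definable_imp_semialgebraic)
  have "semialg (k + m) {z \<in> vprod k D V. vjoin n (E (vfst k z)) (K (vsnd k z)) \<in>
      {w \<in> vecs (n + n). \<forall>i<n. w i = w (n + i)}}"
    by (rule smap_preimage[OF nashf_D(2)[OF EK] diag])
  moreover have "{z \<in> vprod k D V. vjoin n (E (vfst k z)) (K (vsnd k z)) \<in>
      {w \<in> vecs (n + n). \<forall>i<n. w i = w (n + i)}} = graph_of k D' G"
  proof -
    have vi: "vjoin n e f \<in> {w \<in> vecs (n + n). \<forall>i<n. w i = w (n + i)} \<longleftrightarrow> f = e"
      if "e \<in> vecs n" "f \<in> vecs n" for e f
    proof -
      have "(\<forall>i<n. vjoin n e f i = vjoin n e f (n + i)) \<longleftrightarrow> (\<forall>i<n. e i = f i)" by (simp add: vjoin_def)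
      also have "\<dots> \<longleftrightarrow> f = e" using that unfolding vecs_iff by (metis ext not_le)
      finally show ?thesis using that by simp
    qed
    show ?thesis
    proof (intro equalityI subsetI)
      fix z assume "z \<in> {z \<in> vprod k D V. vjoin n (E (vfst k z)) (K (vsnd k z)) \<in>
        {w \<in> vecs (n + n). \<forall>i<n. w i = w (n + i)}}"
      then have z: "vfst k z \<in> D" "vsnd k z \<in> V" "K (vsnd k z) = E (vfst k z)"
        using vi[OF d(6) v(6)] by (auto simp: vprod_iff[OF sub(1)])
      then have "vfst k z \<in> D'" "vsnd k z = G (vfst k z)" using eq by blast+
      then show "z \<in> graph_of k D' G" unfolding graph_of_def
        by (intro image_eqI[of _ _ "vfst k z"]) (metis vjoin_vfst_vsnd, simp)
    next
      fix z assume "z \<in> graph_of k D' G"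
      then obtain x where x: "x \<in> D'" "z = vjoin k x (G x)" by (auto simp: graph_of_def)
      have xD: "x \<in> D" "x \<in> vecs k" "G x \<in> V" using x D' G sub by auto
      have zz: "vfst k z = x" "vsnd k z = G x" using x xD by auto
      have "K (G x) = E x" using eq[OF xD(1,3)] x(1) by blast
      then show "z \<in> {z \<in> vprod k D V. vjoin n (E (vfst k z)) (K (vsnd k z)) \<in>
        {w \<in> vecs (n + n). \<forall>i<n. w i = w (n + i)}}"
        using vi[OF d(6)[OF xD(1)] v(6)[OF xD(3)]] xD by (simp only: zz vprod_iff[OF sub(1)] mem_Collect_eq)
    qed
  qed
  ultimately have g: "semialg (k + m) (graph_of k D' G)" by simp
  moreover have "semialg k D'"
    by (rule graph_domain_semialgebraic[OF g]) (use D' sub G in auto)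
  ultimately show ?thesis using v(4) G by (auto simp: smap_iff simp del: semialgebraic.simps)
qed

lemma box_compactin:
  "compactin (euc d) {y \<in> vecs d. \<forall>i<d. p i \<le> y i \<and> y i \<le> q i}"
proof -
  let ?S = "\<lambda>i. if i < d then {p i..q i} else {0::real}"
  have K: "{y \<in> vecs d. \<forall>i<d. p i \<le> y i \<and> y i \<le> q i} = (\<Pi>\<^sub>E i\<in>UNIV. ?S i)"
    by (auto simp: vecs_iff PiE_iff split: if_splits)
  have "compactin (powertop_real UNIV) (\<Pi>\<^sub>E i\<in>UNIV. ?S i)"
    unfolding compactin_PiE by simp
  then show ?thesis unfolding Euclidean_space_def compactin_subtopology K[symmetric] by (auto simp: vecs_iff)
qed

lemma box_semialgebraic: "semialg d {y \<in> vecs d. \<forall>i<d. p i \<le> y i \<and> y i \<le> q i}"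
  by (intro definable_imp_semialgebraic definable_all_less definable_conj definable_le pfun_coord pfun_const)

text \<open>Rational corners leave only countably many boxes.\<close>

lemma rational_box_in_open:
  assumes V: "openin (euc d) V" and y: "y \<in> V"
  shows "\<exists>p\<in>{..<d} \<rightarrow>\<^sub>E \<rat>. \<exists>q\<in>{..<d} \<rightarrow>\<^sub>E \<rat>. {z \<in> vecs d. \<forall>i<d. p i \<le> z i \<and> z i \<le> q i} \<subseteq> V \<and>
    (\<forall>i<d. p i \<le> y i \<and> y i \<le> q i)"
proof -
  obtain e where e: "e > 0" "\<And>z. z \<in> vecs d \<Longrightarrow> (\<And>i. i < d \<Longrightarrow> \<bar>z i - y i\<bar> < e) \<Longrightarrow> z \<in> V"
    using open_boxE[OF V y] by blast
  have "\<exists>r\<in>\<rat>. y i - e < r \<and> r < y i" "\<exists>r\<in>\<rat>. y i < r \<and> r < y i + e" for i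
    using Rats_dense_in_real[of "y i - e" "y i"] Rats_dense_in_real[of "y i" "y i + e"] e(1) by auto
  then obtain p q where p: "\<And>i. p i \<in> \<rat>" "\<And>i. y i - e < p i" "\<And>i. p i < y i"
    and q: "\<And>i. q i \<in> \<rat>" "\<And>i. y i < q i" "\<And>i. q i < y i + e" by metis
  have "z \<in> V" if z: "z \<in> vecs d" "\<And>i. i < d \<Longrightarrow> p i \<le> z i \<and> z i \<le> q i" for z
  proof (rule e(2)[OF z(1)])
    fix i assume "i < d"
    then show "\<bar>z i - y i\<bar> < e" using z(2)[of i] p(2)[of i] q(3)[of i] by auto
  qed
  then show ?thesis
    by (intro bexI[of _ "restrict p {..<d}"] bexI[of _ "restrict q {..<d}"])
      (use p q in \<open>auto intro: less_imp_le\<close>)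
qed

lemma chart_param_nash:
  assumes N: "manif N d" and c: "(\<psi>, V, V') \<in> ncharts N" and W: "openin (euc d) W" "semialg d W" "W \<noteq> {}" "W \<subseteq> V"
  shows "nash_map (Opn d W) N \<psi>"
proof -
  note ch = is_chartD[OF manif_chart[OF N c]]
  obtain C where C: "C \<subseteq> ncharts N" "chart_cover (ntop N) d C" using manif_cover[OF N] .
  show ?thesis
  proof (rule nash_map_from_Opn[OF W(1-3) N _ C])
    show "continuous_map (subtopology (euc d) W) (ntop N) \<psi>"
      using ch(9) W(4) continuous_map_from_subtopology_mono by blast
    fix \<theta> T T' assume "(\<theta>, T, T') \<in> C"
    then have t: "(\<theta>, T, T') \<in> ncharts N" using C(1) by blast
    have l: "nashf d d {x \<in> V. \<psi> x \<in> T'} T (\<lambda>x. inv_into T \<theta> (\<psi> x))"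
      using manif_compat[OF N c t] by (simp add: lrep_iff)
    have "{x \<in> W. \<psi> x \<in> T'} = {x \<in> V. \<psi> x \<in> T'} \<inter> W" using W(4) by auto
    then show "nashf d d {x \<in> W. \<psi> x \<in> T'} T (\<lambda>x. inv_into T \<theta> (\<psi> x))"
      using nashf_restrict[OF l semialgebraic_Int[OF nashf_D(4)[OF l] W(2)]] nashf_D(1)[OF l] W(1) by auto
  qed
qed

text \<open>Smoothness is a local property, but semialgebraicity is not, since an infinite union of
  semialgebraic sets need not be semialgebraic. So it enters as a global hypothesis in each
  chart.\<close>

lemma nash_map_local_line:
  assumes N: "manif N d" and ab: "\<And>s. 0 < s \<Longrightarrow> \<exists>a b. 0 \<le> a \<and> a < s \<and> s < b \<and> nash_map (Opn 1 (line_interval a b)) N (\<lambda>x. g (x 0))"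
    and sm: "\<And>\<psi> V V'. (\<psi>, V, V') \<in> ncharts N \<Longrightarrow> smap 1 d {x \<in> Upos 1. g (x 0) \<in> V'} V (\<lambda>x. inv_into V \<psi> (g (x 0)))"
  shows "nash_map (nspace Rpos) N g"
  unfolding nash_map_from_Rpos[OF N]
proof -
  obtain C where C: "C \<subseteq> ncharts N" "chart_cover (ntop N) d C" using manif_cover[OF N] .
  have loc: "\<exists>a b. x \<in> line_interval a b \<and> line_interval a b \<subseteq> Upos 1 \<and> line_interval a b \<noteq> {} \<and>
      nash_map (Opn 1 (line_interval a b)) N (\<lambda>x. g (x 0))" if "x \<in> Upos 1" for x
  proof -
    have x0: "0 < x 0" "x \<in> vecs 1" using Upos_1_pos[OF that] Upos_D(1)[OF that] by auto
    obtain a b where "0 \<le> a" "a < x 0" "x 0 < b" "nash_map (Opn 1 (line_interval a b)) N (\<lambda>x. g (x 0))"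
      using ab[OF x0(1)] by blast
    moreover have "line_interval a b \<subseteq> Upos 1" using \<open>0 \<le> a\<close> by (auto simp: line_interval_def Upos_def)
    moreover have "x \<in> line_interval a b" using calculation x0 by (simp add: line_interval_def)
    ultimately show ?thesis by blast
  qed
  have LI: "manif (Opn 1 (line_interval a b)) 1" if "line_interval a b \<noteq> {}" for a b
    using Opn_manif(1)[OF line_interval_open line_interval_semialgebraic that] .
  have cont: "continuous_map (subtopology (euc 1) (Upos 1)) (ntop N) (\<lambda>x. g (x 0))"
  proof (rule continuous_local[OF Upos_open])
    fix x assume "x \<in> Upos 1"
    then obtain a b where J: "x \<in> line_interval a b" "line_interval a b \<subseteq> Upos 1" "line_interval a b \<noteq> {}"
      "nash_map (Opn 1 (line_interval a b)) N (\<lambda>x. g (x 0))" using loc by blast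
    have "continuous_map (subtopology (euc 1) (line_interval a b)) (ntop N) (\<lambda>x. g (x 0))"
      using J(4) unfolding nash_map_iff[OF LI[OF J(3)] N] by simp
    then show "\<exists>V. openin (euc 1) V \<and> x \<in> V \<and> V \<subseteq> Upos 1 \<and>
        continuous_map (subtopology (euc 1) V) (ntop N) (\<lambda>x. g (x 0))"
      using J line_interval_open by blast
  qed
  show "nash_map (Opn 1 (Upos 1)) N (\<lambda>x. g (x 0))"
  proof (rule nash_map_from_Opn[OF Upos_good N cont C])
    fix \<psi> V V' assume "(\<psi>, V, V') \<in> C"
    then have c: "(\<psi>, V, V') \<in> ncharts N" using C(1) by blast
    let ?D = "{x \<in> Upos 1. g (x 0) \<in> V'}" and ?G = "\<lambda>x. inv_into V \<psi> (g (x 0))"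
    have op: "openin (euc 1) ?D"
      using cont is_chartD(3)[OF manif_chart[OF N c]]
      unfolding continuous_map_open_subtopology[OF Upos_open] by blast
    have "smooth_map (Some 1) (Some d) ?D ?G"
    proof (rule smooth_map_local[OF op])
      fix x assume x: "x \<in> ?D"
      then obtain a b where J: "x \<in> line_interval a b" "line_interval a b \<subseteq> Upos 1" "line_interval a b \<noteq> {}"
        "nash_map (Opn 1 (line_interval a b)) N (\<lambda>x. g (x 0))" using loc by blast
      have "lrep 1 d (\<lambda>x. g (x 0)) (\<lambda>x\<in>line_interval a b. x, line_interval a b, line_interval a b) (\<psi>, V, V')"
        using J(4) Opn_manif(2)[OF line_interval_open line_interval_semialgebraic J(3)] c
        unfolding nash_map_iff[OF LI[OF J(3)] N] by blast
      then have "nashf 1 d {x \<in> line_interval a b. g (x 0) \<in> V'} V ?G" unfolding lrep_Opn_domain .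
      then show "\<exists>W. openin (euc 1) W \<and> x \<in> W \<and> W \<subseteq> ?D \<and> smooth_map (Some 1) (Some d) W ?G"
        using J(1,2) x nashf_D(1,3) by (intro exI[of _ "{x \<in> line_interval a b. g (x 0) \<in> V'}"]) blast
    qed
    then show "nashf 1 d ?D V ?G" using op sm[OF c] by (simp add: nashf_def)
  qed
qed

lemma common_smooth_subinterval:
  assumes G: "smap 1 d D V G" and ab: "a < b" and D: "\<And>t. a < t \<Longrightarrow> t < b \<Longrightarrow> one_vec t \<in> D"
    and c: "\<And>i t. i < d \<Longrightarrow> a < t \<Longrightarrow> t < b \<Longrightarrow> isCont (\<lambda>t. G (one_vec t) i) t"
  shows "\<exists>a' b'. a \<le> a' \<and> a' < b' \<and> b' \<le> b \<and> (\<forall>i<d. \<forall>k. Ck_on k 1 (line_interval a' b') (\<lambda>x. G x i))"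
proof -
  have "\<exists>a' b'. a \<le> a' \<and> a' < b' \<and> b' \<le> b \<and> (\<forall>i<n. \<forall>k. Ck_on k 1 (line_interval a' b') (\<lambda>x. G x i))" if "n \<le> d" for n
    using that
  proof (induction n)
    case 0
    then show ?case using ab by (intro exI[of _ a] exI[of _ b]) simp
  next
    case (Suc n)
    then obtain a' b' where ab': "a \<le> a'" "a' < b'" "b' \<le> b" "\<forall>i<n. \<forall>k. Ck_on k 1 (line_interval a' b') (\<lambda>x. G x i)"
      by auto
    have "\<exists>a'' b''. a' \<le> a'' \<and> a'' < b'' \<and> b'' \<le> b' \<and> (\<forall>k. Ck_on k 1 (line_interval a'' b'') (\<lambda>x. G x n))"
      using ab' D c Suc.prems by (intro sfun_smooth_on_subinterval[OF smap_component[OF G]]) auto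
    then obtain a'' b'' where ab'': "a' \<le> a''" "a'' < b''" "b'' \<le> b'" "\<forall>k. Ck_on k 1 (line_interval a'' b'') (\<lambda>x. G x n)"
      by blast
    have sub: "line_interval a'' b'' \<subseteq> line_interval a' b'" using ab'' by (auto simp: line_interval_def)
    have "\<forall>i<Suc n. \<forall>k. Ck_on k 1 (line_interval a'' b'') (\<lambda>x. G x i)"
      using ab'(4) ab''(4) Ck_subset[OF _ sub] by (simp add: less_Suc_eq)
    then show ?case using ab' ab'' by (intro exI[of _ a''] exI[of _ b'']) auto
  qed
  then show ?thesis by blast
qed

text \<open>Some compact box inside a single chart contains the values of \<open>g\<close> over a whole interval:
  countably many boxes suffice for all values, so one of them receives infinitely many
  parameters, and an infinite semialgebraic subset of the line contains an interval. On a
  compact box the injective map \<open>F\<close> is a homeomorphism onto its image, so \<open>g\<close> is continuous over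
  this interval, and it is smooth over a smaller one.\<close>

lemma semialgebraic_curve_nash_somewhere:
  assumes N: "manif N d" and F: "nash_map N (Opn n (Upos n)) F" and inj: "inj_on F (points N)"
    and E: "nash_map (nspace Rpos) (Opn n (Upos n)) E"
    and g: "\<And>t. 0 < t \<Longrightarrow> g t \<in> points N" "\<And>t. 0 < t \<Longrightarrow> F (g t) = E t"
  shows "\<And>\<psi> V V'. (\<psi>, V, V') \<in> ncharts N \<Longrightarrow> smap 1 d {x \<in> Upos 1. g (x 0) \<in> V'} V (\<lambda>x. inv_into V \<psi> (g (x 0)))"
    and "\<exists>a b. 0 \<le> a \<and> a < b \<and> nash_map (Opn 1 (line_interval a b)) N (\<lambda>x. g (x 0))"
proof -
  note O = Opn_manif(1)[OF Upos_good]
  have E': "nashf 1 n (Upos 1) (Upos n) (\<lambda>x. E (x 0))"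
    using E unfolding nash_map_from_Rpos[OF O] nash_map_Opn_Opn[OF Upos_good Upos_good] .
  have E'': "nashf 1 n (Upos 1) (vecs n) (\<lambda>x. E (x 0))"
    by (rule nashf_codomain[OF E' semialgebraic_vecs]) (use nashf_D(6)[OF E'] Upos_D(1) in blast)
  have K': "nashf d n V (vecs n) (\<lambda>y. F (\<psi> y))" if c: "(\<psi>, V, V') \<in> ncharts N" for \<psi> V V'
  proof (cases "V = {}")
    case True
    have "nashf d n {} (vecs n) (\<lambda>y i. 0)"
      by (rule nashf_pfun[OF _ semialgebraic_empty semialgebraic_vecs]) auto
    then show ?thesis unfolding True by (rule nashf_cong) simp
  next
    case False
    note ch = is_chartD[OF manif_chart[OF N c]]
    have "nash_map (Opn d V) N \<psi>" by (rule chart_param_nash[OF N c ch(1,2) False subset_refl])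
    from nash_map_compose[OF Opn_manif(1)[OF ch(1,2) False] N O this F]
    have *: "nashf d n V (Upos n) (\<lambda>y. F (\<psi> y))" unfolding nash_map_Opn_Opn[OF ch(1,2) False Upos_good] .
    show ?thesis by (rule nashf_codomain[OF * semialgebraic_vecs]) (use nashf_D(6)[OF *] Upos_D(1) in blast)
  qed
  show sm: "smap 1 d {x \<in> Upos 1. g (x 0) \<in> V'} V (\<lambda>x. inv_into V \<psi> (g (x 0)))"
    if c: "(\<psi>, V, V') \<in> ncharts N" for \<psi> V V'
  proof (rule smap_of_equation[OF E'' K'[OF c]])
    note chart = manif_chart[OF N c]
    note ch = is_chartD[OF chart] and ci = chart_inv[OF chart]
    show "inv_into V \<psi> (g (x 0)) \<in> V" if "x \<in> {x \<in> Upos 1. g (x 0) \<in> V'}" for x using ci(1) that by blast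
    fix x y assume x: "x \<in> Upos 1" and y: "y \<in> V"
    have gx: "g (x 0) \<in> points N" "F (g (x 0)) = E (x 0)" using g Upos_1_pos[OF x] by auto
    have \<psi>y: "\<psi> y \<in> V'" "\<psi> y \<in> points N" using ch(6)[OF y] openin_subset[OF ch(3)] by auto
    have "F (\<psi> y) = E (x 0) \<longleftrightarrow> \<psi> y = g (x 0)" using inj_onD[OF inj] gx \<psi>y by metis
    also have "\<dots> \<longleftrightarrow> x \<in> {x \<in> Upos 1. g (x 0) \<in> V'} \<and> y = inv_into V \<psi> (g (x 0))"
      using ci(2)[of "g (x 0)"] ci(3)[OF y] \<psi>y x by auto
    finally show "F (\<psi> y) = E (x 0) \<longleftrightarrow> x \<in> {x \<in> Upos 1. g (x 0) \<in> V'} \<and> y = inv_into V \<psi> (g (x 0))" .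
  qed auto
  obtain C where C: "C \<subseteq> ncharts N" "chart_cover (ntop N) d C" using manif_cover[OF N] .
  define box where "box p q = {y \<in> vecs d. \<forall>i<d. p i \<le> y i \<and> y i \<le> q i}" for p q :: rvec
  define T where "T = (\<lambda>((\<psi>, V, V'), p, q). {x \<in> {x \<in> Upos 1. g (x 0) \<in> V'}. inv_into V \<psi> (g (x 0)) \<in> box p q})"
  define I where "I = {((\<psi>, V, V'), p, q). (\<psi>, V, V') \<in> C \<and> p \<in> {..<d} \<rightarrow>\<^sub>E \<rat> \<and> q \<in> {..<d} \<rightarrow>\<^sub>E \<rat> \<and> box p q \<subseteq> V}"
  have "I \<subseteq> C \<times> (({..<d} \<rightarrow>\<^sub>E \<rat>) \<times> ({..<d} \<rightarrow>\<^sub>E \<rat>))" by (auto simp: I_def)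
  moreover have "countable (C \<times> (({..<d} \<rightarrow>\<^sub>E \<rat>) \<times> ({..<d} \<rightarrow>\<^sub>E (\<rat>::real set))))"
    using C(2) by (intro countable_SIGMA countable_PiE countable_rat) (auto simp: chart_cover_def countable_finite)
  ultimately have Ic: "countable I" using countable_subset by blast
  have cover: "one_vec ` {0<..} \<subseteq> (\<Union>i\<in>I. T i)"
  proof
    fix x assume "x \<in> one_vec ` {0<..}"
    then obtain t where t: "0 < t" "x = one_vec t" by auto
    obtain \<psi> V V' where c: "(\<psi>, V, V') \<in> C" "g t \<in> V'" using chart_coverE[OF C(2) g(1)[OF t(1)]] .
    then have "is_chart (ntop N) (Some d) (\<psi>, V, V')" using C(2) by (auto simp: chart_cover_def)
    note ch = is_chartD[OF this] and ci = chart_inv[OF this]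
    have y: "inv_into V \<psi> (g t) \<in> V" using ci(1)[OF c(2)] .
    obtain p q where "p \<in> {..<d} \<rightarrow>\<^sub>E \<rat>" "q \<in> {..<d} \<rightarrow>\<^sub>E \<rat>" "box p q \<subseteq> V"
      "\<forall>i<d. p i \<le> inv_into V \<psi> (g t) i \<and> inv_into V \<psi> (g t) i \<le> q i"
      using rational_box_in_open[OF ch(1) y] unfolding box_def by blast
    then have "((\<psi>, V, V'), p, q) \<in> I" "x \<in> T ((\<psi>, V, V'), p, q)"
      using c t y open_subset_vecs[OF ch(1)] by (auto simp: I_def T_def box_def)
    then show "x \<in> (\<Union>i\<in>I. T i)" by blast
  qed
  have "\<exists>i\<in>I. infinite (T i)"
  proof (rule ccontr)
    assume "\<not> (\<exists>i\<in>I. infinite (T i))"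
    then have "countable (\<Union>i\<in>I. T i)" using Ic by (intro countable_UN) (auto intro: countable_finite)
    then have "countable (one_vec ` {0<..})" using cover countable_subset by blast
    moreover have "inj_on one_vec {0<..}" by (rule inj_onI) (metis one_vec_0)
    ultimately have "countable {0::real<..}" using countable_image_inj_on by blast
    then have "countable {0<..<(1::real)}" by (rule countable_subset[rotated]) auto
    then show False using uncountable_open_interval[of 0 "1::real"] by simp
  qed
  then obtain \<psi> V V' p q where i: "(\<psi>, V, V') \<in> C" "box p q \<subseteq> V" "infinite (T ((\<psi>, V, V'), p, q))"
    by (auto simp: I_def)
  have c: "(\<psi>, V, V') \<in> ncharts N" using i C by blast
  note chart = manif_chart[OF N c]
  note ch = is_chartD[OF chart] and ci = chart_inv[OF chart]
  let ?D = "{x \<in> Upos 1. g (x 0) \<in> V'}" and ?G = "\<lambda>x. inv_into V \<psi> (g (x 0))"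
  have "semialg 1 (T ((\<psi>, V, V'), p, q))"
    unfolding T_def prod.case by (rule smap_preimage[OF sm[OF c]]) (simp only: box_def box_semialgebraic)
  then obtain a b where ab: "a < b" "\<And>t. a < t \<Longrightarrow> t < b \<Longrightarrow> one_vec t \<in> T ((\<psi>, V, V'), p, q)"
    using semialgebraic_line_contains_interval[OF _ i(3)] by blast
  then have J: "0 < t" "g t \<in> V'" "inv_into V \<psi> (g t) \<in> box p q" if "a < t" "t < b" for t
    using ab(2)[OF that] by (auto simp: T_def)
  have a0: "0 \<le> a"
  proof (rule ccontr)
    assume "\<not> 0 \<le> a"
    then have "a < (a + min b 0) / 2" "(a + min b 0) / 2 < b" "(a + min b 0) / 2 < 0"
      using ab(1) by (auto simp: min_def)
    then show False using J(1)[of "(a + min b 0) / 2"] by linarith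
  qed
  have cont: "continuous_map (top_of_set {a<..<b}) (euc d) (\<lambda>t. inv_into V \<psi> (g t))"
  proof -
    (* On the compact box, ?K has a continuous inverse h, and g t = \<psi> (h (E t)) on the interval. *)
    let ?X = "subtopology (euc d) (box p q)" and ?K = "\<lambda>y. F (\<psi> y)"
    let ?Y = "subtopology (euc n) (?K ` box p q)"
    have Kin: "?K y \<in> vecs n" if "y \<in> V" for y using nashf_D(6)[OF K'[OF c] that] .
    have tsX: "topspace ?X = box p q" by (auto simp: box_def)
    have tsY: "topspace ?Y = ?K ` box p q" using Kin i(2) by auto
    have "continuous_map (subtopology (euc d) V) (subtopology (euc n) (vecs n)) ?K"
      by (rule nashf_continuous[OF K'[OF c]]) (use nashf_D(6)[OF K'[OF c]] in auto)
    then have "continuous_map ?X (euc n) ?K"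
      using continuous_map_from_subtopology_mono[OF _ i(2)] by (simp add: subtopology_topspace)
    then have cK: "continuous_map ?X ?Y ?K" by (auto simp: continuous_map_in_subtopology tsX)
    have injK: "inj_on ?K (topspace ?X)"
    proof (rule inj_onI)
      fix y z assume "y \<in> topspace ?X" "z \<in> topspace ?X" and eq: "F (\<psi> y) = F (\<psi> z)"
      then have yz: "y \<in> V" "z \<in> V" using tsX i(2) by auto
      then have "\<psi> y \<in> points N" "\<psi> z \<in> points N" using ch(6) openin_subset[OF ch(3)] by auto
      then have "\<psi> y = \<psi> z" using inj_onD[OF inj eq] by blast
      then show "y = z" using inj_onD[OF ch(7)] yz by blast
    qed
    have "homeomorphic_map ?X ?Y ?K"
    proof (rule continuous_imp_homeomorphic_map[OF cK _ _ _ injK])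
      show "compact_space ?X" using box_compactin[of d p q] by (simp add: box_def compact_space_subtopology)
      show "Hausdorff_space ?Y" by (simp add: Hausdorff_space_subtopology Hausdorff_Euclidean_space)
      show "?K ` topspace ?X = topspace ?Y" using tsX tsY by simp
    qed
    then obtain h where h: "homeomorphic_maps ?X ?Y ?K h" using homeomorphic_map_maps by blast
    have hK: "h (?K y) = y" if "y \<in> box p q" for y using h that tsX by (auto simp: homeomorphic_maps_def)
    have ch': "continuous_map ?Y ?X h" using h by (simp add: homeomorphic_maps_def)
    have KE: "?K (inv_into V \<psi> (g t)) = E t" if "a < t" "t < b" for t
      using ci(2)[OF J(2)[OF that]] g(2)[OF J(1)[OF that]] by simp
    have "continuous_map (top_of_set {0<..}) (euc n) E"
      using E unfolding nash_map_iff[OF Rpos_manif(1) O] by (simp add: continuous_map_in_subtopology)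
    then have "continuous_map (top_of_set {a<..<b}) (euc n) E"
      by (rule continuous_map_from_subtopology_mono) (use a0 in auto)
    moreover have "E t \<in> ?K ` box p q" if "a < t" "t < b" for t using KE[OF that] J(3)[OF that] by (metis image_eqI)
    ultimately have "continuous_map (top_of_set {a<..<b}) ?Y E" by (auto simp: continuous_map_in_subtopology)
    from continuous_map_compose[OF this ch']
    have "continuous_map (top_of_set {a<..<b}) (euc d) (\<lambda>t. h (E t))"
      by (simp add: continuous_map_in_subtopology o_def)
    then show ?thesis
    proof (rule continuous_map_eq)
      fix t assume "t \<in> topspace (top_of_set {a<..<b})"
      then have "a < t" "t < b" by auto
      then show "h (E t) = inv_into V \<psi> (g t)" using hK[OF J(3)] KE by metis
    qed
  qed
  have "isCont (\<lambda>t. ?G (one_vec t) j) t" if "j < d" "a < t" "t < b" for j t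
  proof -
    have "continuous_map (euc d) euclideanreal (\<lambda>y. y j)"
      using continuous_map_first_coord[of d "vecs d" j] by (simp add: subtopology_topspace)
    from continuous_map_compose[OF cont this]
    have "continuous_on {a<..<b} (\<lambda>t. inv_into V \<psi> (g t) j)" by (simp add: o_def)
    then show ?thesis using that by (simp add: continuous_on_eq_continuous_at)
  qed
  moreover have "one_vec t \<in> ?D" if "a < t" "t < b" for t using J[OF that] by simp
  ultimately obtain a' b' where ab': "a \<le> a'" "a' < b'" "b' \<le> b"
    "\<forall>j<d. \<forall>k. Ck_on k 1 (line_interval a' b') (\<lambda>x. ?G x j)"
    using common_smooth_subinterval[OF sm[OF c] ab(1)] by blast
  let ?J = "line_interval a' b'"
  note Jg = line_interval_open[of a' b'] line_interval_semialgebraic[of a' b'] line_interval_nonempty[OF ab'(2)]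
  have sub: "?J \<subseteq> ?D"
  proof
    fix x assume x: "x \<in> ?J"
    then have "a < x 0" "x 0 < b" "one_vec (x 0) = x" using ab' line_interval_eq by (auto simp: line_interval_def)
    then show "x \<in> ?D" using J[of "x 0"] one_vec_in[of "x 0"] by simp
  qed
  have nG: "nashf 1 d ?J V ?G"
    unfolding nashf_def smooth_map_iff using ab'(4) smap_restrict[OF sm[OF c] Jg(2) sub] Jg(1) by blast
  have Vne: "V \<noteq> {}" using nashf_D(6)[OF nG] Jg(3) by blast
  have "nash_map (Opn 1 ?J) (Opn d V) ?G" using nG unfolding nash_map_Opn_Opn[OF Jg ch(1,2) Vne] .
  from nash_map_compose[OF Opn_manif(1)[OF Jg] Opn_manif(1)[OF ch(1,2) Vne] N this chart_param_nash[OF N c ch(1,2) Vne subset_refl]]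
  have "nash_map (Opn 1 ?J) N (\<lambda>x. \<psi> (?G x))" .
  then have "nash_map (Opn 1 ?J) N (\<lambda>x. g (x 0))"
  proof (rule nash_map_cong[OF Opn_manif(1)[OF Jg] N])
    fix x assume "x \<in> points (Opn 1 ?J)"
    then have "x \<in> ?D" using sub by auto
    then show "\<psi> (?G x) = g (x 0)" using ci(2) by simp
  qed
  then show "\<exists>a b. 0 \<le> a \<and> a < b \<and> nash_map (Opn 1 (line_interval a b)) N (\<lambda>x. g (x 0))"
    using a0 ab' by (intro exI[of _ a'] exI[of _ b']) simp
qed

text \<open>By the preceding lemma \<open>g\<close> is Nash near some parameter. The equation
  \<open>g (r * s) = g r \<otimes> g s\<close> expresses \<open>g\<close> near any other parameter as a translate of this part of
  the curve.\<close>

theorem inverse_curve_nash: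
  assumes A: "nash_group A" and F: "nash_map (nspace A) (Opn n (Upos n)) F" and inj: "inj_on F (carrier A)"
    and E: "nash_map (nspace Rpos) (Opn n (Upos n)) E"
    and g: "\<And>t. 0 < t \<Longrightarrow> g t \<in> carrier A" "\<And>t. 0 < t \<Longrightarrow> F (g t) = E t"
      "\<And>s t. 0 < s \<Longrightarrow> 0 < t \<Longrightarrow> g (s * t) = g s \<otimes>\<^bsub>A\<^esub> g t"
  shows "nash_map (nspace Rpos) (nspace A) g"
proof -
  note N = nash_groupD(1)[OF A] and ts = nash_groupD(2)[OF A]
  note curve = semialgebraic_curve_nash_somewhere[OF N F _ E, of g, unfolded ts, OF inj g(1,2)]
  obtain a b where ab: "0 \<le> a" "a < b" "nash_map (Opn 1 (line_interval a b)) (nspace A) (\<lambda>x. g (x 0))"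
    using curve(2) by blast
  define t0 where "t0 = (a + b) / 2"
  have t0: "a < t0" "t0 < b" "0 < t0" using ab by (auto simp: t0_def)
  show ?thesis
  proof (rule nash_map_local_line[OF N _ curve(1)])
    fix s :: real assume s: "0 < s"
    (* Multiplication by r moves t0 to s. *)
    define r where "r = s / t0"
    have r: "0 < r" using s t0 by (simp add: r_def)
    have as: "r * a < s" "s < r * b" using s t0 by (simp_all add: r_def field_simps)
    let ?I = "line_interval (r * a) (r * b)" and ?J = "line_interval a b"
    have Ine: "?I \<noteq> {}" using as by (intro line_interval_nonempty) simp
    have Jne: "?J \<noteq> {}" using ab by (intro line_interval_nonempty) simp
    note I = line_interval_open[of "r * a" "r * b"] line_interval_semialgebraic[of "r * a" "r * b"] Ine
    note J = line_interval_open[of a b] line_interval_semialgebraic[of a b] Jne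
    have "nash_map (Opn 1 ?I) (Opn 1 ?J) (\<lambda>x. one_vec (inverse r * x 0))"
      unfolding nash_map_Opn_Opn[OF I J]
    proof (rule nashf_pfun[OF I(1,2) J(2)])
      show "(\<lambda>x. one_vec (inverse r * x 0)) \<in> ?I \<rightarrow> ?J"
        using r by (auto simp: line_interval_def field_simps)
    qed (auto simp: one_vec_def)
    from nash_map_compose[OF Opn_manif(1)[OF I] Opn_manif(1)[OF J] N this ab(3)]
    have 1: "nash_map (Opn 1 ?I) (nspace A) (\<lambda>x. g (inverse r * x 0))" by simp
    have 2: "nash_map (Opn 1 ?I) (nspace A) (\<lambda>x. g r)"
      by (rule nash_map_const[OF Opn_manif(1)[OF I] N]) (use g(1)[OF r] ts in simp)
    have "nash_map (Opn 1 ?I) (nspace A) (\<lambda>x. g (x 0))"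
    proof (rule nash_map_cong[OF Opn_manif(1)[OF I] N nash_map_mult[OF A Opn_manif(1)[OF I] 2 1]])
      fix x assume "x \<in> points (Opn 1 ?I)"
      then have "r * a < x 0" by (auto simp: line_interval_def)
      then have "0 < x 0" using r ab(1) by (smt (verit) mult_nonneg_nonneg)
      then have "0 < inverse r * x 0" using r by simp
      from g(3)[OF r this] have "g (r * (inverse r * x 0)) = g r \<otimes>\<^bsub>A\<^esub> g (inverse r * x 0)" .
      moreover have "r * (inverse r * x 0) = x 0" using r by (simp add: field_simps)
      ultimately show "g r \<otimes>\<^bsub>A\<^esub> g (inverse r * x 0) = g (x 0)" by metis
    qed
    moreover have "0 \<le> r * a" using r ab(1) by simp
    ultimately show "\<exists>a b. 0 \<le> a \<and> a < s \<and> s < b \<and> nash_map (Opn 1 (line_interval a b)) (nspace A) (\<lambda>x. g (x 0))"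
      using as by blast
  qed
qed

section \<open>Rational vector spaces\<close>

lemma rat_ring_simps [simp]:
  "carrier rat_ring = UNIV" "x \<otimes>\<^bsub>rat_ring\<^esub> y = x * y" "\<one>\<^bsub>rat_ring\<^esub> = 1" "\<zero>\<^bsub>rat_ring\<^esub> = 0"
  "x \<oplus>\<^bsub>rat_ring\<^esub> y = x + y"
  by (simp_all add: rat_ring_def)

lemma cring_rat_ring: "cring rat_ring"
proof (rule cringI)
  show "abelian_group rat_ring"
  proof (rule abelian_groupI)
    fix x assume "x \<in> carrier rat_ring"
    show "\<exists>y\<in>carrier rat_ring. y \<oplus>\<^bsub>rat_ring\<^esub> x = \<zero>\<^bsub>rat_ring\<^esub>" by (intro bexI[of _ "- x"]) auto
  qed auto
  show "Group.comm_monoid rat_ring" by (rule Group.comm_monoidI) auto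
qed (auto simp: distrib_right)

locale qvs = Module.module rat_ring E for E :: "(rat, 'e) module" (structure)

context qvs
begin

lemma smult_in [simp]: "v \<in> carrier E \<Longrightarrow> r \<odot>\<^bsub>E\<^esub> v \<in> carrier E"
  by (rule smult_closed) auto

lemma smult_add: "v \<in> carrier E \<Longrightarrow> (r + s) \<odot>\<^bsub>E\<^esub> v = r \<odot>\<^bsub>E\<^esub> v \<oplus>\<^bsub>E\<^esub> s \<odot>\<^bsub>E\<^esub> v"
  using smult_l_distr[of r s v] by simp

lemma smult_mult: "v \<in> carrier E \<Longrightarrow> (r * s) \<odot>\<^bsub>E\<^esub> v = r \<odot>\<^bsub>E\<^esub> (s \<odot>\<^bsub>E\<^esub> v)"
  using smult_assoc1[of r s v] by simp

lemma smult_distrib: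
  "v \<in> carrier E \<Longrightarrow> w \<in> carrier E \<Longrightarrow> r \<odot>\<^bsub>E\<^esub> (v \<oplus>\<^bsub>E\<^esub> w) = r \<odot>\<^bsub>E\<^esub> v \<oplus>\<^bsub>E\<^esub> r \<odot>\<^bsub>E\<^esub> w"
  using smult_r_distr[of r v w] by simp

lemma smult_1: "v \<in> carrier E \<Longrightarrow> 1 \<odot>\<^bsub>E\<^esub> v = v"
  using smult_one[of v] by simp

lemma smult_0: "v \<in> carrier E \<Longrightarrow> 0 \<odot>\<^bsub>E\<^esub> v = \<zero>\<^bsub>E\<^esub>"
  using smult_add[of v 0 0] by (simp add: M.add.l_cancel_one')

lemma smult_zero: "r \<odot>\<^bsub>E\<^esub> \<zero>\<^bsub>E\<^esub> = \<zero>\<^bsub>E\<^esub>"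
  using smult_distrib[of "\<zero>\<^bsub>E\<^esub>" "\<zero>\<^bsub>E\<^esub>" r] by (simp add: M.add.l_cancel_one')

lemma finsum_smult:
  "finite A \<Longrightarrow> w \<in> A \<rightarrow> carrier E \<Longrightarrow> r \<odot>\<^bsub>E\<^esub> (\<Oplus>\<^bsub>E\<^esub>i\<in>A. w i) = (\<Oplus>\<^bsub>E\<^esub>i\<in>A. r \<odot>\<^bsub>E\<^esub> w i)"
proof (induction A rule: finite_induct)
  case (insert i A)
  then show ?case by (simp add: Pi_iff smult_distrib)
qed (simp add: smult_zero)

definition lincomb :: "'e list \<Rightarrow> (nat \<Rightarrow> rat) \<Rightarrow> 'e" where
  "lincomb bs c = (\<Oplus>\<^bsub>E\<^esub>i\<in>{..<length bs}. c i \<odot>\<^bsub>E\<^esub> (bs ! i))"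

definition coord :: "'e list \<Rightarrow> 'e \<Rightarrow> nat \<Rightarrow> rat" where
  "coord bs v = (THE c. c \<in> extensional {..<length bs} \<and> v = lincomb bs c)"

context
  fixes bs :: "'e list"
  assumes basis: "is_basis E bs"
begin

lemma basis_in: "i < length bs \<Longrightarrow> bs ! i \<in> carrier E"
  using basis nth_mem unfolding is_basis_def by blast

lemma lincomb_in [simp]: "lincomb bs c \<in> carrier E"
  unfolding lincomb_def by (rule finsum_closed) (simp add: basis_in)

lemma coord_props:
  assumes "v \<in> carrier E"
  shows "coord bs v \<in> extensional {..<length bs}" "lincomb bs (coord bs v) = v"
proof -
  have "\<exists>!c. c \<in> extensional {..<length bs} \<and> v = lincomb bs c"
    using basis assms unfolding is_basis_def lincomb_def by blast
  from theI'[OF this] show "coord bs v \<in> extensional {..<length bs}" "lincomb bs (coord bs v) = v"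
    unfolding coord_def by auto
qed

lemma lincomb_cong: "(\<And>i. i < length bs \<Longrightarrow> c i = d i) \<Longrightarrow> lincomb bs c = lincomb bs d"
  unfolding lincomb_def by (intro finsum_cong') (auto simp: basis_in)

lemma coord_lincomb: "i < length bs \<Longrightarrow> coord bs (lincomb bs c) i = c i"
proof -
  assume i: "i < length bs"
  have "\<exists>!d. d \<in> extensional {..<length bs} \<and> lincomb bs c = lincomb bs d"
    using basis lincomb_in[of c] unfolding is_basis_def lincomb_def by blast
  moreover have "restrict c {..<length bs} \<in> extensional {..<length bs} \<and> lincomb bs c = lincomb bs (restrict c {..<length bs})"
    by (auto intro: lincomb_cong)
  ultimately have "coord bs (lincomb bs c) = restrict c {..<length bs}"
    unfolding coord_def
    by (rule the1_equality[of "\<lambda>d. d \<in> extensional {..<length bs} \<and> lincomb bs c = lincomb bs d"])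
  then show ?thesis using i by simp
qed

lemma lincomb_add: "lincomb bs c \<oplus>\<^bsub>E\<^esub> lincomb bs d = lincomb bs (\<lambda>i. c i + d i)"
proof -
  have "lincomb bs (\<lambda>i. c i + d i) = (\<Oplus>\<^bsub>E\<^esub>i\<in>{..<length bs}. c i \<odot>\<^bsub>E\<^esub> (bs ! i) \<oplus>\<^bsub>E\<^esub> d i \<odot>\<^bsub>E\<^esub> (bs ! i))"
    unfolding lincomb_def by (rule finsum_cong') (auto simp: basis_in smult_add)
  also have "\<dots> = lincomb bs c \<oplus>\<^bsub>E\<^esub> lincomb bs d"
    unfolding lincomb_def by (rule finsum_addf) (auto simp: basis_in)
  finally show ?thesis by simp
qed

lemma lincomb_smult: "r \<odot>\<^bsub>E\<^esub> lincomb bs c = lincomb bs (\<lambda>i. r * c i)"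
  unfolding lincomb_def
  by (subst finsum_smult) (auto simp: basis_in smult_mult intro!: finsum_cong')

lemma coord_add:
  assumes "v \<in> carrier E" "w \<in> carrier E" "i < length bs"
  shows "coord bs (v \<oplus>\<^bsub>E\<^esub> w) i = coord bs v i + coord bs w i"
proof -
  have "v \<oplus>\<^bsub>E\<^esub> w = lincomb bs (\<lambda>i. coord bs v i + coord bs w i)"
    using coord_props(2)[OF assms(1)] coord_props(2)[OF assms(2)] lincomb_add by metis
  then show ?thesis using coord_lincomb[OF assms(3)] by simp
qed

lemma coord_smult:
  assumes "v \<in> carrier E" "i < length bs"
  shows "coord bs (r \<odot>\<^bsub>E\<^esub> v) i = r * coord bs v i"
proof -
  have "r \<odot>\<^bsub>E\<^esub> v = lincomb bs (\<lambda>i. r * coord bs v i)"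
    using coord_props(2)[OF assms(1)] lincomb_smult by metis
  then show ?thesis using coord_lincomb[OF assms(2)] by simp
qed

lemma coord_zero: "i < length bs \<Longrightarrow> coord bs \<zero>\<^bsub>E\<^esub> i = 0"
  using coord_smult[of "\<zero>\<^bsub>E\<^esub>" i 0] by (simp add: smult_zero)

lemma coord_finsum:
  "finite A \<Longrightarrow> w \<in> A \<rightarrow> carrier E \<Longrightarrow> i < length bs \<Longrightarrow>
    coord bs (\<Oplus>\<^bsub>E\<^esub>k\<in>A. w k) i = (\<Sum>k\<in>A. coord bs (w k) i)"
proof (induction A rule: finite_induct)
  case (insert k A)
  then show ?case by (simp add: Pi_iff coord_add)
qed (simp add: coord_zero)

lemma lincomb_unit: "j < length bs \<Longrightarrow> lincomb bs (\<lambda>i. if i = j then 1 else 0) = bs ! j"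
proof -
  assume j: "j < length bs"
  have "lincomb bs (\<lambda>i. if i = j then 1 else 0) = (\<Oplus>\<^bsub>E\<^esub>i\<in>{..<length bs}. if j = i then bs ! i else \<zero>\<^bsub>E\<^esub>)"
    unfolding lincomb_def by (intro finsum_cong') (auto simp: basis_in smult_1 smult_0)
  also have "\<dots> = bs ! j"
    using j by (intro M.add.finprod_singleton) (auto simp: basis_in)
  finally show ?thesis .
qed

lemma coord_basis: "i < length bs \<Longrightarrow> j < length bs \<Longrightarrow> coord bs (bs ! j) i = (if i = j then 1 else 0)"
  using coord_lincomb[of i "\<lambda>i. if i = j then 1 else 0"] lincomb_unit[of j] by simp

lemma coord_eqI:
  assumes "v \<in> carrier E" "w \<in> carrier E" "\<And>i. i < length bs \<Longrightarrow> coord bs v i = coord bs w i"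
  shows "v = w"
  using lincomb_cong[of "coord bs v" "coord bs w", OF assms(3)]
  unfolding coord_props(2)[OF assms(1)] coord_props(2)[OF assms(2)] .

end

text \<open>If \<open>S\<close> and \<open>T\<close> are inverse base change matrices, then \<open>S T\<close> and \<open>T S\<close> are identity
  matrices with the same trace.\<close>

lemma basis_length_unique:
  assumes b: "is_basis E bs" and b': "is_basis E bs'"
  shows "length bs = length bs'"
proof -
  have id: "(\<Sum>k<length bs'. coord bs' (bs ! j) k * coord bs (bs' ! k) j) = 1"
    if b: "is_basis E bs" and b': "is_basis E bs'" and j: "j < length bs" for bs bs' j
  proof -
    have "coord bs (lincomb bs' (coord bs' (bs ! j))) j =
        (\<Sum>k<length bs'. coord bs (coord bs' (bs ! j) k \<odot>\<^bsub>E\<^esub> (bs' ! k)) j)"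
      unfolding lincomb_def using basis_in[OF b'] by (intro coord_finsum[OF b _ _ j]) auto
    also have "\<dots> = (\<Sum>k<length bs'. coord bs' (bs ! j) k * coord bs (bs' ! k) j)"
      using basis_in[OF b'] coord_smult[OF b _ j] by (intro sum.cong) auto
    finally show ?thesis
      using coord_props(2)[OF b' basis_in[OF b j]] coord_basis[OF b j j] by simp
  qed
  have "(of_nat (length bs) :: rat) = (\<Sum>j<length bs. \<Sum>k<length bs'. coord bs' (bs ! j) k * coord bs (bs' ! k) j)"
    using id[OF b b'] by simp
  also have "\<dots> = (\<Sum>k<length bs'. \<Sum>j<length bs. coord bs (bs' ! k) j * coord bs' (bs ! j) k)"
    by (subst sum.swap) (simp add: mult.commute)
  also have "\<dots> = of_nat (length bs')" using id[OF b' b] by simp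
  finally show ?thesis by simp
qed

end

section \<open>The tensor product\<close>

context qvs
begin

abbreviation "tfree \<equiv> free_Abelian_group (carrier Rpos \<times> carrier E)"
abbreviation "trel \<equiv> generate tfree (tensor_relations E)"

lemma tfree_add: "a \<in> carrier tfree \<Longrightarrow> b \<in> carrier tfree \<Longrightarrow> a + b \<in> carrier tfree"
  using monoid.m_closed[OF group.is_monoid[OF group_free_Abelian_group[of "carrier Rpos \<times> carrier E"]], of a b]
  unfolding mult_free_Abelian_group .

lemma relations_in: "tensor_relations E \<subseteq> carrier tfree"
proof -
  have d: "a - b \<in> carrier tfree" if "a \<in> carrier tfree" "b \<in> carrier tfree" for a b
    using that keys_diff[of a b] by auto
  have f: "frag_of (x, v) \<in> carrier tfree" if "x \<in> carrier Rpos" "v \<in> carrier E" for x v using that by simp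
  show ?thesis
    unfolding tensor_relations_def
    by (intro Un_least subsetI; elim CollectE exE conjE; hypsubst; intro d f) (auto simp: Rpos_sel)
qed

lemma trel_subgroup: "subgroup trel tfree"
  by (rule group.generate_is_subgroup[OF group_free_Abelian_group relations_in])

lemma trel_normal: "trel \<lhd> tfree"
  by (rule comm_group.subgroup_imp_normal[OF abelian_free_Abelian_group trel_subgroup])

lemma tensor_group_eq: "tensor_group E = tfree Mod trel"
  by (simp add: tensor_group_def Let_def)

lemma comm_tensor_group: "comm_group (tensor_group E)"
  unfolding tensor_group_eq by (rule comm_group.abelian_FactGroup[OF abelian_free_Abelian_group trel_subgroup])

lemma group_tensor_group: "group (tensor_group E)"
  using comm_tensor_group comm_group.axioms(2) by blast

definition tproj :: "((real \<times> 'e) \<Rightarrow>\<^sub>0 int) \<Rightarrow> 'e tens" where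
  "tproj a = trel #>\<^bsub>tfree\<^esub> a"

lemma tproj_hom: "tproj \<in> hom tfree (tensor_group E)"
  unfolding tensor_group_eq tproj_def[abs_def] by (rule normal.r_coset_hom_Mod[OF trel_normal])

lemma tproj_surj: "X \<in> carrier (tensor_group E) \<Longrightarrow> \<exists>a\<in>carrier tfree. X = tproj a"
  unfolding tensor_group_eq tproj_def carrier_FactGroup by blast

lemma tproj_trel: "a \<in> trel \<Longrightarrow> tproj a = \<one>\<^bsub>tensor_group E\<^esub>"
proof -
  assume a: "a \<in> trel"
  then have "a \<in> carrier tfree" using subgroup.mem_carrier[OF trel_subgroup] by blast
  then show ?thesis using group.coset_join2[OF group_free_Abelian_group _ trel_subgroup a]
    unfolding tensor_group_eq tproj_def by (simp add: FactGroup_def)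
qed

lemma pure_tensor_eq: "pure_tensor E x v = tproj (frag_of (x, v))"
  by (simp add: pure_tensor_def tproj_def Let_def)

lemma pure_tensor_in [simp]: "0 < x \<Longrightarrow> v \<in> carrier E \<Longrightarrow> pure_tensor E x v \<in> carrier (tensor_group E)"
  unfolding pure_tensor_eq by (rule hom_in_carrier[OF tproj_hom]) (simp add: Rpos_sel)

lemma tproj_add:
  "a \<in> carrier tfree \<Longrightarrow> b \<in> carrier tfree \<Longrightarrow> tproj (a + b) = tproj a \<otimes>\<^bsub>tensor_group E\<^esub> tproj b"
  using hom_mult[OF tproj_hom] by simp

lemma tproj_eqI:
  assumes "a \<in> carrier tfree" "b \<in> carrier tfree" "a - b \<in> tensor_relations E"
  shows "tproj a = tproj b"
proof -
  have r: "a - b \<in> carrier tfree" using assms(3) relations_in by blast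
  have "tproj a = tproj ((a - b) + b)" by simp
  also have "\<dots> = tproj (a - b) \<otimes>\<^bsub>tensor_group E\<^esub> tproj b" by (rule tproj_add[OF r assms(2)])
  also have "tproj (a - b) = \<one>\<^bsub>tensor_group E\<^esub>" by (rule tproj_trel[OF generate.incl[OF assms(3)]])
  also have "\<one>\<^bsub>tensor_group E\<^esub> \<otimes>\<^bsub>tensor_group E\<^esub> tproj b = tproj b"
    by (rule monoid.l_one[OF group.is_monoid[OF group_tensor_group] hom_in_carrier[OF tproj_hom assms(2)]])
  finally show ?thesis .
qed

lemma pure_tensor_mult:
  assumes "0 < x" "0 < y" "v \<in> carrier E"
  shows "pure_tensor E (x * y) v = pure_tensor E x v \<otimes>\<^bsub>tensor_group E\<^esub> pure_tensor E y v"
proof -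
  have in': "frag_of (x * y, v) \<in> carrier tfree" "frag_of (x, v) \<in> carrier tfree" "frag_of (y, v) \<in> carrier tfree"
    using assms by (simp_all add: Rpos_sel)
  have "tproj (frag_of (x * y, v)) = tproj (frag_of (x, v) + frag_of (y, v))"
  proof (rule tproj_eqI[OF in'(1)])
    show "frag_of (x, v) + frag_of (y, v) \<in> carrier tfree"
      by (rule tfree_add[OF in'(2,3)])
    have "frag_of (x * y, v) - frag_of (x, v) - frag_of (y, v) \<in> tensor_relations E"
      unfolding tensor_relations_def using assms by (intro UnI1 CollectI exI[of _ x] exI[of _ y] exI[of _ v]) (simp add: Rpos_sel)
    then show "frag_of (x * y, v) - (frag_of (x, v) + frag_of (y, v)) \<in> tensor_relations E" by (simp add: diff_diff_add)
  qed
  then show ?thesis unfolding pure_tensor_eq using tproj_add[OF in'(2,3)] by simp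
qed

lemma pure_tensor_add:
  assumes "0 < x" "v \<in> carrier E" "w \<in> carrier E"
  shows "pure_tensor E x (v \<oplus>\<^bsub>E\<^esub> w) = pure_tensor E x v \<otimes>\<^bsub>tensor_group E\<^esub> pure_tensor E x w"
proof -
  have in': "frag_of (x, v \<oplus>\<^bsub>E\<^esub> w) \<in> carrier tfree" "frag_of (x, v) \<in> carrier tfree" "frag_of (x, w) \<in> carrier tfree"
    using assms by (simp_all add: Rpos_sel)
  have "tproj (frag_of (x, v \<oplus>\<^bsub>E\<^esub> w)) = tproj (frag_of (x, v) + frag_of (x, w))"
  proof (rule tproj_eqI[OF in'(1)])
    show "frag_of (x, v) + frag_of (x, w) \<in> carrier tfree"
      by (rule tfree_add[OF in'(2,3)])
    have "frag_of (x, v \<oplus>\<^bsub>E\<^esub> w) - frag_of (x, v) - frag_of (x, w) \<in> tensor_relations E"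
      unfolding tensor_relations_def using assms
      by (intro UnI1[of _ "_ \<union> _"] UnI2 CollectI exI[of _ x] exI[of _ v] exI[of _ w] UnI1) (simp add: Rpos_sel)
    then show "frag_of (x, v \<oplus>\<^bsub>E\<^esub> w) - (frag_of (x, v) + frag_of (x, w)) \<in> tensor_relations E" by (simp add: diff_diff_add)
  qed
  then show ?thesis unfolding pure_tensor_eq using tproj_add[OF in'(2,3)] by simp
qed

lemma pure_tensor_powr:
  assumes "0 < x" "v \<in> carrier E"
  shows "pure_tensor E (x powr of_rat r) v = pure_tensor E x (r \<odot>\<^bsub>E\<^esub> v)"
  unfolding pure_tensor_eq
proof (rule tproj_eqI)
  show "frag_of (x powr of_rat r, v) \<in> carrier tfree" "frag_of (x, r \<odot>\<^bsub>E\<^esub> v) \<in> carrier tfree"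
    using assms by (simp_all add: Rpos_sel)
  show "frag_of (x powr of_rat r, v) - frag_of (x, r \<odot>\<^bsub>E\<^esub> v) \<in> tensor_relations E"
    unfolding tensor_relations_def using assms
    by (intro UnI2 CollectI exI[of _ x] exI[of _ r] exI[of _ v]) (simp add: Rpos_sel)
qed

text \<open>The pure tensors generate the tensor product.\<close>

lemma tensor_hom_ext:
  assumes H: "group H" and h: "h \<in> hom (tensor_group E) H" and h': "h' \<in> hom (tensor_group E) H"
    and eq: "\<And>x v. 0 < x \<Longrightarrow> v \<in> carrier E \<Longrightarrow> h (pure_tensor E x v) = h' (pure_tensor E x v)"
    and X: "X \<in> carrier (tensor_group E)"
  shows "h X = h' X"
proof -
  obtain a where a: "Poly_Mapping.keys a \<subseteq> carrier Rpos \<times> carrier E" "X = tproj a" using tproj_surj[OF X] by auto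
  interpret p: group_hom tfree "tensor_group E" tproj
    by (intro group_hom.intro group_hom_axioms.intro group_free_Abelian_group group_tensor_group tproj_hom)
  interpret h: group_hom "tensor_group E" H h
    by (intro group_hom.intro group_hom_axioms.intro group_tensor_group H h)
  interpret h': group_hom "tensor_group E" H h'
    by (intro group_hom.intro group_hom_axioms.intro group_tensor_group H h')
  have "h (tproj a) = h' (tproj a)"
  proof (rule free_Abelian_group_induct[OF a(1)])
    have "tproj 0 = \<one>\<^bsub>tensor_group E\<^esub>" using p.hom_one by simp
    then show "h (tproj 0) = h' (tproj 0)" by simp
  next
    fix b c assume bc: "Poly_Mapping.keys b \<subseteq> carrier Rpos \<times> carrier E" "Poly_Mapping.keys c \<subseteq> carrier Rpos \<times> carrier E"
      "h (tproj b) = h' (tproj b)" "h (tproj c) = h' (tproj c)"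
    have in': "b \<in> carrier tfree" "c \<in> carrier tfree" using bc by auto
    have "b - c = b \<otimes>\<^bsub>tfree\<^esub> inv\<^bsub>tfree\<^esub> c" using bc by simp
    then have "tproj (b - c) = tproj b \<otimes>\<^bsub>tensor_group E\<^esub> inv\<^bsub>tensor_group E\<^esub> tproj c"
      using in' by (metis p.hom_inv p.hom_mult p.G.inv_closed)
    then show "h (tproj (b - c)) = h' (tproj (b - c))"
      using bc in' p.hom_closed by (metis h.hom_inv h.hom_mult h'.hom_inv h'.hom_mult p.H.inv_closed)
  next
    fix p assume "p \<in> carrier Rpos \<times> carrier E"
    then show "h (tproj (frag_of p)) = h' (tproj (frag_of p))"
      using eq[of "fst p" "snd p"] by (auto simp: pure_tensor_eq Rpos_sel)
  qed
  then show ?thesis using a(2) by simp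
qed

lemma tensor_universal:
  assumes H: "comm_group H"
    and f: "\<And>x v. 0 < x \<Longrightarrow> v \<in> carrier E \<Longrightarrow> f x v \<in> carrier H"
    and mult: "\<And>x y v. 0 < x \<Longrightarrow> 0 < y \<Longrightarrow> v \<in> carrier E \<Longrightarrow> f (x * y) v = f x v \<otimes>\<^bsub>H\<^esub> f y v"
    and add: "\<And>x v w. 0 < x \<Longrightarrow> v \<in> carrier E \<Longrightarrow> w \<in> carrier E \<Longrightarrow> f x (v \<oplus>\<^bsub>E\<^esub> w) = f x v \<otimes>\<^bsub>H\<^esub> f x w"
    and powr: "\<And>x r v. 0 < x \<Longrightarrow> v \<in> carrier E \<Longrightarrow> f (x powr of_rat r) v = f x (r \<odot>\<^bsub>E\<^esub> v)"
  obtains h where "h \<in> hom (tensor_group E) H"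
    "\<And>x v. 0 < x \<Longrightarrow> v \<in> carrier E \<Longrightarrow> h (pure_tensor E x v) = f x v"
proof -
  interpret H: comm_group H by fact
  have "(\<lambda>(x, v). f x v) ` (carrier Rpos \<times> carrier E) \<subseteq> carrier H" using f by (auto simp: Rpos_sel)
  then obtain k where k: "k \<in> hom tfree H" "\<And>p. p \<in> carrier Rpos \<times> carrier E \<Longrightarrow> k (frag_of p) = (case p of (x, v) \<Rightarrow> f x v)"
    using H.free_Abelian_group_universal[of "\<lambda>(x, v). f x v" "carrier Rpos \<times> carrier E"] by metis
  interpret k: group_hom tfree H k
    by (intro group_hom.intro group_hom_axioms.intro group_free_Abelian_group H.is_group k(1))
  have kf: "k (frag_of (x, v)) = f x v" if "0 < x" "v \<in> carrier E" for x v
    using k(2)[of "(x, v)"] that by (simp add: Rpos_sel)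
  have in': "frag_of (x, v) \<in> carrier tfree" if "0 < x" "v \<in> carrier E" for x v using that by (simp add: Rpos_sel)
  have kdiff: "k (a - b) = k a \<otimes>\<^bsub>H\<^esub> inv\<^bsub>H\<^esub> k b" if "a \<in> carrier tfree" "b \<in> carrier tfree" for a b
  proof -
    have "a - b = a \<otimes>\<^bsub>tfree\<^esub> inv\<^bsub>tfree\<^esub> b" using that by simp
    then show ?thesis using that by (metis k.hom_inv k.hom_mult k.G.inv_closed)
  qed
  have din: "a - b \<in> carrier tfree" if "a \<in> carrier tfree" "b \<in> carrier tfree" for a b
    using that keys_diff[of a b] by auto
  have k1: "k (a - b - c) = \<one>\<^bsub>H\<^esub>"
    if abc: "a \<in> carrier tfree" "b \<in> carrier tfree" "c \<in> carrier tfree" "k a = k b \<otimes>\<^bsub>H\<^esub> k c" for a b c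
  proof -
    note H = k.hom_closed[OF abc(2)] k.hom_closed[OF abc(3)]
    have "k (a - b - c) = k b \<otimes>\<^bsub>H\<^esub> k c \<otimes>\<^bsub>H\<^esub> inv\<^bsub>H\<^esub> k b \<otimes>\<^bsub>H\<^esub> inv\<^bsub>H\<^esub> k c"
      unfolding kdiff[OF din[OF abc(1,2)] abc(3)] kdiff[OF abc(1,2)] abc(4) ..
    also have "\<dots> = (k b \<otimes>\<^bsub>H\<^esub> k c) \<otimes>\<^bsub>H\<^esub> inv\<^bsub>H\<^esub> (k b \<otimes>\<^bsub>H\<^esub> k c)"
      using H by (simp add: H.m_assoc H.inv_mult)
    also have "\<dots> = \<one>\<^bsub>H\<^esub>" using H by simp
    finally show ?thesis .
  qed
  have "tensor_relations E \<subseteq> kernel tfree H k"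
  proof
    fix a assume a: "a \<in> tensor_relations E"
    have "k a = \<one>\<^bsub>H\<^esub>"
      using a unfolding tensor_relations_def
    proof (elim UnE CollectE exE conjE)
      fix x y v assume a: "a = frag_of (x * y, v) - frag_of (x, v) - frag_of (y, v)"
        and "x \<in> carrier Rpos" "y \<in> carrier Rpos" and v: "v \<in> carrier E"
      then have xy: "0 < x" "0 < y" "0 < x * y" by (simp_all add: Rpos_sel)
      show ?thesis unfolding a
        by (rule k1[OF in'[OF xy(3) v] in'[OF xy(1) v] in'[OF xy(2) v]]) (simp add: kf xy v mult)
    next
      fix x v w assume a: "a = frag_of (x, v \<oplus>\<^bsub>E\<^esub> w) - frag_of (x, v) - frag_of (x, w)"
        and "x \<in> carrier Rpos" and vw: "v \<in> carrier E" "w \<in> carrier E"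
      then have x: "0 < x" and s: "v \<oplus>\<^bsub>E\<^esub> w \<in> carrier E" by (simp_all add: Rpos_sel)
      show ?thesis unfolding a
        by (rule k1[OF in'[OF x s] in'[OF x vw(1)] in'[OF x vw(2)]]) (simp add: kf x vw add)
    next
      fix x r v assume "a = frag_of (x powr of_rat r, v) - frag_of (x, r \<odot>\<^bsub>E\<^esub> v)" "x \<in> carrier Rpos" "v \<in> carrier E"
      then show ?thesis
        using f[of x "r \<odot>\<^bsub>E\<^esub> v"] powr[of x v r] by (simp add: Rpos_sel kdiff in' kf del: carrier_free_Abelian_group_iff)
    qed
    then show "a \<in> kernel tfree H k" using a relations_in unfolding kernel_def by blast
  qed
  then have ker: "trel \<subseteq> kernel tfree H k"
    by (rule k.G.generate_subgroup_incl[OF _ k.subgroup_kernel])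
  have "k a = k b" if "a \<in> carrier tfree" "b \<in> carrier tfree" "trel #>\<^bsub>tfree\<^esub> a = trel #>\<^bsub>tfree\<^esub> b" for a b
  proof -
    have "a \<in> trel #>\<^bsub>tfree\<^esub> b" using that group.rcos_self[OF group_free_Abelian_group _ trel_subgroup] by metis
    then obtain c where c: "c \<in> trel" "a = c \<otimes>\<^bsub>tfree\<^esub> b" by (auto simp: r_coset_def)
    have "c \<in> carrier tfree" "k c = \<one>\<^bsub>H\<^esub>" using c(1) ker by (auto simp: kernel_def)
    then show ?thesis unfolding c(2) using that(2) by (simp only: k.hom_mult k.hom_closed H.l_one)
  qed
  from FactGroup_universal[OF k(1) trel_normal this]
  obtain h where h: "h \<in> hom (tfree Mod trel) H" "\<And>a. a \<in> carrier tfree \<Longrightarrow> h (trel #>\<^bsub>tfree\<^esub> a) = k a" by metis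
  show ?thesis
  proof (rule that)
    show "h \<in> hom (tensor_group E) H" using h(1) by (simp add: tensor_group_eq)
    show "h (pure_tensor E x v) = f x v" if "0 < x" "v \<in> carrier E" for x v
      using h(2)[OF in'[OF that]] kf[OF that] by (simp add: pure_tensor_eq tproj_def)
  qed
qed

lemma pure_tensor_one: "0 < x \<Longrightarrow> pure_tensor E x \<zero>\<^bsub>E\<^esub> = \<one>\<^bsub>tensor_group E\<^esub>"
  using pure_tensor_add[of x "\<zero>\<^bsub>E\<^esub>" "\<zero>\<^bsub>E\<^esub>"] group.l_cancel_one'[OF group_tensor_group, of "pure_tensor E x \<zero>\<^bsub>E\<^esub>" "pure_tensor E x \<zero>\<^bsub>E\<^esub>"]
  by simp

lemma pure_tensor_finsum:
  assumes "0 < x"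
  shows "finite A \<Longrightarrow> w \<in> A \<rightarrow> carrier E \<Longrightarrow>
    pure_tensor E x (\<Oplus>\<^bsub>E\<^esub>i\<in>A. w i) = (\<Otimes>\<^bsub>tensor_group E\<^esub>i\<in>A. pure_tensor E x (w i))"
proof (induction A rule: finite_induct)
  case empty
  interpret T: comm_group "tensor_group E" by (rule comm_tensor_group)
  show ?case using pure_tensor_one[OF assms] by simp
next
  case (insert i A)
  interpret T: comm_group "tensor_group E" by (rule comm_tensor_group)
  show ?case using insert assms by (simp add: Pi_iff pure_tensor_add)
qed

end

lemma finprod_Rpos_pow:
  assumes "finite A" "f \<in> A \<rightarrow> Upos n"
  shows "(\<Otimes>\<^bsub>Rpos_pow n\<^esub>i\<in>A. f i) = (\<lambda>k. if k < n then \<Prod>i\<in>A. f i k else 0)"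
proof -
  interpret R: comm_group "Rpos_pow n" by (rule group_Rpos_pow)
  show ?thesis using assms
  proof (induction A rule: finite_induct)
    case (insert i A)
    have "f i k = 0" if "\<not> k < n" for k using insert.prems Upos_D(1)[of "f i" n] that by (simp add: vecs_iff)
    then show ?case using insert by (subst R.finprod_insert) (auto simp: Rpos_pow_sel Pi_iff fun_eq_iff)
  qed (simp add: Rpos_pow_sel fun_eq_iff)
qed

definition power_vec :: "nat \<Rightarrow> real \<Rightarrow> (nat \<Rightarrow> rat) \<Rightarrow> rvec" where
  "power_vec n x c = (\<lambda>i. if i < n then x powr of_rat (c i) else 0)"

lemma power_vec_in: "0 < x \<Longrightarrow> power_vec n x c \<in> Upos n"
  by (simp add: power_vec_def Upos_def)

context qvs
begin

context
  fixes bs :: "'e list"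
  assumes basis: "is_basis E bs"
begin

lemma basis_map_in: "t \<in> Upos (length bs) \<Longrightarrow> basis_map E bs t \<in> carrier (tensor_group E)"
proof -
  assume t: "t \<in> Upos (length bs)"
  interpret T: comm_group "tensor_group E" by (rule comm_tensor_group)
  show ?thesis unfolding basis_map_def
    by (rule T.finprod_closed) (use basis_in[OF basis] Upos_D(2)[OF t] in auto)
qed

lemma basis_map_hom: "basis_map E bs \<in> hom (Rpos_pow (length bs)) (tensor_group E)"
proof (rule homI)
  interpret T: comm_group "tensor_group E" by (rule comm_tensor_group)
  fix s t assume "s \<in> carrier (Rpos_pow (length bs))" "t \<in> carrier (Rpos_pow (length bs))"
  then have s: "s \<in> Upos (length bs)" and t: "t \<in> Upos (length bs)" by (simp_all add: Rpos_pow_sel)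
  have "basis_map E bs (s \<otimes>\<^bsub>Rpos_pow (length bs)\<^esub> t) =
      (\<Otimes>\<^bsub>tensor_group E\<^esub>i\<in>{..<length bs}. pure_tensor E (s i) (bs ! i) \<otimes>\<^bsub>tensor_group E\<^esub> pure_tensor E (t i) (bs ! i))"
    unfolding basis_map_def Rpos_pow_sel
    by (rule T.finprod_cong') (use basis_in[OF basis] Upos_D(2)[OF s] Upos_D(2)[OF t] in \<open>auto simp: pure_tensor_mult\<close>)
  also have "\<dots> = basis_map E bs s \<otimes>\<^bsub>tensor_group E\<^esub> basis_map E bs t"
    unfolding basis_map_def
    by (rule T.finprod_multf) (use basis_in[OF basis] Upos_D(2)[OF s] Upos_D(2)[OF t] in auto)
  finally show "basis_map E bs (s \<otimes>\<^bsub>Rpos_pow (length bs)\<^esub> t) = basis_map E bs s \<otimes>\<^bsub>tensor_group E\<^esub> basis_map E bs t" .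
qed (simp add: Rpos_pow_sel basis_map_in)

lemma basis_map_power_vec: "0 < x \<Longrightarrow> basis_map E bs (power_vec (length bs) x c) = pure_tensor E x (lincomb bs c)"
proof -
  assume x: "0 < x"
  interpret T: comm_group "tensor_group E" by (rule comm_tensor_group)
  have "basis_map E bs (power_vec (length bs) x c) = (\<Otimes>\<^bsub>tensor_group E\<^esub>i\<in>{..<length bs}. pure_tensor E x (c i \<odot>\<^bsub>E\<^esub> (bs ! i)))"
    unfolding basis_map_def
    by (rule T.finprod_cong') (use x basis_in[OF basis] in \<open>auto simp: power_vec_def pure_tensor_powr\<close>)
  also have "\<dots> = pure_tensor E x (lincomb bs c)"
    unfolding lincomb_def using basis_in[OF basis] by (intro pure_tensor_finsum[OF x, symmetric]) auto
  finally show ?thesis .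
qed

text \<open>In coordinates, \<open>x \<otimes> v\<close> is the vector of the powers of \<open>x\<close> with the coordinates of \<open>v\<close> as
  exponents. This map exists by the universal property; one composite with the basis map is
  computed on vectors, the other one on pure tensors.\<close>

lemma tensor_coordinates:
  obtains \<Psi> where "\<Psi> \<in> hom (tensor_group E) (Rpos_pow (length bs))"
    "\<And>x v. 0 < x \<Longrightarrow> v \<in> carrier E \<Longrightarrow> \<Psi> (pure_tensor E x v) = power_vec (length bs) x (coord bs v)"
    "\<And>t. t \<in> Upos (length bs) \<Longrightarrow> \<Psi> (basis_map E bs t) = t"
    "\<And>X. X \<in> carrier (tensor_group E) \<Longrightarrow> basis_map E bs (\<Psi> X) = X"
proof -
  let ?n = "length bs"
  interpret R: comm_group "Rpos_pow ?n" by (rule group_Rpos_pow)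
  interpret T: comm_group "tensor_group E" by (rule comm_tensor_group)
  obtain \<Psi> where \<Psi>: "\<Psi> \<in> hom (tensor_group E) (Rpos_pow ?n)"
    "\<And>x v. 0 < x \<Longrightarrow> v \<in> carrier E \<Longrightarrow> \<Psi> (pure_tensor E x v) = power_vec ?n x (coord bs v)"
  proof (rule tensor_universal[OF group_Rpos_pow, of "\<lambda>x v. power_vec ?n x (coord bs v)" ?n])
    fix x y :: real and r v w assume x: "0 < x" and v: "v \<in> carrier E"
    show "power_vec ?n x (coord bs v) \<in> carrier (Rpos_pow ?n)" using power_vec_in[OF x] by (simp add: Rpos_pow_sel)
    show "power_vec ?n (x * y) (coord bs v) = power_vec ?n x (coord bs v) \<otimes>\<^bsub>Rpos_pow ?n\<^esub> power_vec ?n y (coord bs v)"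
      if "0 < y" using x that by (auto simp: power_vec_def Rpos_pow_sel powr_mult)
    show "power_vec ?n x (coord bs (v \<oplus>\<^bsub>E\<^esub> w)) = power_vec ?n x (coord bs v) \<otimes>\<^bsub>Rpos_pow ?n\<^esub> power_vec ?n x (coord bs w)"
      if "w \<in> carrier E" using that v by (auto simp: power_vec_def Rpos_pow_sel coord_add[OF basis] of_rat_add powr_add)
    show "power_vec ?n (x powr of_rat r) (coord bs v) = power_vec ?n x (coord bs (r \<odot>\<^bsub>E\<^esub> v))"
      using v x by (auto simp: power_vec_def coord_smult[OF basis] of_rat_mult powr_powr)
  qed auto
  have inv1: "\<Psi> (basis_map E bs t) = t" if t: "t \<in> Upos ?n" for t
  proof -
    interpret h: group_hom "tensor_group E" "Rpos_pow ?n" \<Psi>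
      by (intro group_hom.intro group_hom_axioms.intro T.is_group R.is_group \<Psi>(1))
    have pin: "(\<lambda>i. pure_tensor E (t i) (bs ! i)) \<in> {..<?n} \<rightarrow> carrier (tensor_group E)"
      using basis_in[OF basis] Upos_D(2)[OF t] by auto
    have fin: "\<Psi> (\<Otimes>\<^bsub>tensor_group E\<^esub>i\<in>A. u i) = (\<Otimes>\<^bsub>Rpos_pow ?n\<^esub>i\<in>A. \<Psi> (u i))"
      if "finite A" "u \<in> A \<rightarrow> carrier (tensor_group E)" for A and u :: "nat \<Rightarrow> 'e tens"
      using that
    proof (induction A rule: finite_induct)
      case (insert i A)
      then show ?case by (simp add: Pi_iff)
    qed simp
    have "\<Psi> (basis_map E bs t) = (\<Otimes>\<^bsub>Rpos_pow ?n\<^esub>i\<in>{..<?n}. \<Psi> (pure_tensor E (t i) (bs ! i)))"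
      unfolding basis_map_def by (rule fin[OF _ pin]) simp
    also have "\<dots> = (\<Otimes>\<^bsub>Rpos_pow ?n\<^esub>i\<in>{..<?n}. power_vec ?n (t i) (coord bs (bs ! i)))"
      by (rule R.finprod_cong') (use basis_in[OF basis] Upos_D(2)[OF t] \<Psi>(2) power_vec_in in \<open>auto simp: Rpos_pow_sel\<close>)
    also have "\<dots> = (\<lambda>k. if k < ?n then \<Prod>i<?n. power_vec ?n (t i) (coord bs (bs ! i)) k else 0)"
      by (rule finprod_Rpos_pow) (use Upos_D(2)[OF t] power_vec_in in auto)
    also have "\<dots> = t"
    proof
      fix k
      show "(if k < ?n then \<Prod>i<?n. power_vec ?n (t i) (coord bs (bs ! i)) k else 0) = t k"
      proof (cases "k < ?n")
        case True
        have "(\<Prod>i<?n. power_vec ?n (t i) (coord bs (bs ! i)) k) = (\<Prod>i<?n. if i = k then t k else 1)"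
        proof (rule prod.cong)
          fix i assume "i \<in> {..<?n}"
          then show "power_vec ?n (t i) (coord bs (bs ! i)) k = (if i = k then t k else 1)"
            using True Upos_D(2)[OF t, of i] by (cases "i = k") (simp_all add: power_vec_def coord_basis[OF basis])
        qed simp
        then show ?thesis using True by (simp add: prod.delta)
      qed (use Upos_D(1)[OF t] in \<open>simp add: vecs_iff\<close>)
    qed
    finally show ?thesis .
  qed
  have inv2: "basis_map E bs (\<Psi> X) = X" if X: "X \<in> carrier (tensor_group E)" for X
  proof -
    have "(basis_map E bs \<circ> \<Psi>) X = (\<lambda>X. X) X"
    proof (rule tensor_hom_ext[OF T.is_group _ _ _ X])
      show "basis_map E bs \<circ> \<Psi> \<in> hom (tensor_group E) (tensor_group E)"
        using \<Psi>(1) basis_map_hom by (rule hom_compose)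
      show "(\<lambda>X. X) \<in> hom (tensor_group E) (tensor_group E)" by (simp add: hom_def)
      show "(basis_map E bs \<circ> \<Psi>) (pure_tensor E x v) = pure_tensor E x v" if "0 < x" "v \<in> carrier E" for x v
        using \<Psi>(2)[OF that] basis_map_power_vec[OF that(1)] coord_props(2)[OF basis that(2)] by simp
    qed
    then show ?thesis by simp
  qed
  show ?thesis using that \<Psi> inv1 inv2 by blast
qed

end

end

section \<open>The Nash structure of the tensor product\<close>

lemma nash_map_in: "nash_map M N f \<Longrightarrow> a \<in> points M \<Longrightarrow> f a \<in> points N"
  unfolding nash_map_def continuous_map_def by blast

text \<open>Separating the group from its Nash structure makes it possible to compare the structures
  that come from different bases.\<close>

definition with_space :: "('a, 'b) monoid_scheme \<Rightarrow> 'a nash_space \<Rightarrow> 'a nash_grp" where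
  "with_space G S = \<lparr>carrier = carrier G, monoid.mult = monoid.mult G, one = one G, nspace = S\<rparr>"

lemma with_space_sel [simp]:
  "carrier (with_space G S) = carrier G" "x \<otimes>\<^bsub>with_space G S\<^esub> y = x \<otimes>\<^bsub>G\<^esub> y"
  "\<one>\<^bsub>with_space G S\<^esub> = \<one>\<^bsub>G\<^esub>" "nspace (with_space G S) = S" "monoid.mult (with_space G S) = monoid.mult G"
  by (simp_all add: with_space_def)

lemma with_space_inv [simp]: "m_inv (with_space G S) = m_inv G"
  by (simp add: m_inv_def fun_eq_iff)

lemma with_space_hom [simp]: "hom (with_space G S) H = hom G H" "hom K (with_space G S) = hom K G"
  by (simp_all add: hom_def)

lemma with_space_group [simp]: "group (with_space G S) \<longleftrightarrow> group G" "comm_group (with_space G S) \<longleftrightarrow> comm_group G"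
proof -
  have u: "Units (with_space G S) = Units G" by (simp add: Units_def)
  have m: "Group.monoid (with_space G S) \<longleftrightarrow> Group.monoid G" by (simp only: Group.monoid_def with_space_sel)
  show g: "group (with_space G S) \<longleftrightarrow> group G"
    by (simp only: Group.group_def group_axioms_def m u with_space_sel)
  show "comm_group (with_space G S) \<longleftrightarrow> comm_group G"
    by (simp only: comm_group_def Group.comm_monoid_def comm_monoid_axioms_def m g with_space_sel)
qed

lemma nash_group_transport:
  assumes G: "nash_group G" and H: "group H"
    and \<kappa>: "\<kappa> \<in> hom G H" "bij_betw \<kappa> (carrier G) (carrier H)"
  shows "nash_group (with_space H (nash_image \<kappa> (nspace G)))"
proof -
  define N where "N = nash_image \<kappa> (nspace G)"
  note d = nash_groupD[OF G]
  interpret G: group G by fact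
  interpret H: group H by fact
  interpret k: group_hom G H \<kappa> by (intro group_hom.intro group_hom_axioms.intro G.is_group H.is_group \<kappa>(1))
  define \<mu> where "\<mu> = inv_into (carrier G) \<kappa>"
  have inj: "inj_on \<kappa> (points (nspace G))" using \<kappa>(2) d(2) by (simp add: bij_betw_def)
  note I = nash_image_manif[OF d(1) inj, unfolded d(2) \<mu>_def[symmetric] N_def[symmetric]]
  have ts: "points N = carrier H"
    using nash_image_homeomorphic(2)[OF inj, folded N_def] \<kappa>(2) d(2) by (simp add: bij_betw_def)
  have ne: "points N \<noteq> {}" using ts by auto
  have surj: "\<kappa> ` carrier G = carrier H" by (rule bij_betw_imp_surj_on[OF \<kappa>(2)])
  have \<mu>: "\<mu> y \<in> carrier G" "\<kappa> (\<mu> y) = y" if "y \<in> carrier H" for y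
  proof -
    have "y \<in> \<kappa> ` carrier G" using that surj by simp
    then show "\<mu> y \<in> carrier G" "\<kappa> (\<mu> y) = y" unfolding \<mu>_def by (rule inv_into_into, rule f_inv_into_f)
  qed
  note P = nash_prod_manif[OF I(1) I(1) ne ne] and fs = nash_map_fst_snd[OF I(1) I(1) ne ne]
  have P': "points (nash_prod N N) = carrier H \<times> carrier H" using P(3) ts by simp
  have "nash_map (nash_prod N N) N (\<lambda>p. \<kappa> (\<mu> (fst p) \<otimes>\<^bsub>G\<^esub> \<mu> (snd p)))"
    by (intro nash_map_compose[OF P(1) d(1) I(1) _ I(2)] nash_map_mult[OF G P(1)]
        nash_map_compose[OF P(1) I(1) d(1) fs(1) I(3)] nash_map_compose[OF P(1) I(1) d(1) fs(2) I(3)])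
  then have mult: "nash_map (nash_prod N N) N (\<lambda>(x, y). x \<otimes>\<^bsub>H\<^esub> y)"
  proof (rule nash_map_cong[OF P(1) I(1)])
    fix p assume "p \<in> points (nash_prod N N)"
    then have "fst p \<in> carrier H" "snd p \<in> carrier H" unfolding P' mem_Times_iff by simp_all
    then show "\<kappa> (\<mu> (fst p) \<otimes>\<^bsub>G\<^esub> \<mu> (snd p)) = (case p of (x, y) \<Rightarrow> x \<otimes>\<^bsub>H\<^esub> y)"
      using \<mu> by (simp add: case_prod_beta)
  qed
  have i: "nash_map (nspace G) (nspace G) (\<lambda>x. inv\<^bsub>G\<^esub> x)" using G by (simp add: nash_group_def)
  have "nash_map N N (\<lambda>y. \<kappa> (inv\<^bsub>G\<^esub> (\<mu> y)))"
    by (rule nash_map_compose[OF I(1) d(1) I(1) nash_map_compose[OF I(1) d(1) d(1) I(3) i] I(2)])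
  then have inv: "nash_map N N (\<lambda>y. inv\<^bsub>H\<^esub> y)"
    by (rule nash_map_cong[OF I(1) I(1)]) (use \<mu> ts in auto)
  show ?thesis
    unfolding nash_group_def N_def[symmetric] using mult inv ts I(1) H by (simp add: manif_def)
qed

lemma nash_map_finprod:
  assumes A: "nash_group A" "comm_group A" and P: "manif P k" and I: "finite I"
    and f: "\<And>i. i \<in> I \<Longrightarrow> nash_map P (nspace A) (f i)"
  shows "nash_map P (nspace A) (\<lambda>a. \<Otimes>\<^bsub>A\<^esub>i\<in>I. f i a)"
  using I f
proof (induction I rule: finite_induct)
  note d = nash_groupD[OF A(1)]
  interpret A: comm_group A by fact
  case empty
  show ?case by (simp, rule nash_map_const[OF P d(1)]) (simp add: d(2))
next
  note d = nash_groupD[OF A(1)]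
  interpret A: comm_group A by fact
  case (insert i I)
  have "nash_map P (nspace A) (\<lambda>a. f i a \<otimes>\<^bsub>A\<^esub> (\<Otimes>\<^bsub>A\<^esub>i\<in>I. f i a))"
    using insert by (intro nash_map_mult[OF A(1) P]) auto
  then show ?case
  proof (rule nash_map_cong[OF P d(1)])
    fix a assume a: "a \<in> points P"
    have "f j a \<in> carrier A" if "j \<in> insert i I" for j using nash_map_in[OF insert.prems[OF that] a] d(2) by simp
    then show "f i a \<otimes>\<^bsub>A\<^esub> (\<Otimes>\<^bsub>A\<^esub>i\<in>I. f i a) = (\<Otimes>\<^bsub>A\<^esub>i\<in>insert i I. f i a)"
      using insert.hyps by (subst A.finprod_insert) auto
  qed
qed

lemma nash_map_power_vec: "nash_map (nspace Rpos) (Opn n (Upos n)) (\<lambda>x. power_vec n x c)"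
  by (rule nash_map_into_Opn[OF Rpos_manif(1) Upos_good])
    (simp_all add: power_vec_in, simp add: power_vec_def nash_map_powr)

lemma hom_finprod:
  assumes "comm_group G" "comm_group H" "h \<in> hom G H" "finite I" "f \<in> I \<rightarrow> carrier G"
  shows "h (\<Otimes>\<^bsub>G\<^esub>i\<in>I. f i) = (\<Otimes>\<^bsub>H\<^esub>i\<in>I. h (f i))"
proof -
  interpret G: comm_group G by fact
  interpret H: comm_group H by fact
  interpret h: group_hom G H h by (intro group_hom.intro group_hom_axioms.intro G.is_group H.is_group assms(3))
  show ?thesis using assms(4,5)
    by (induction I rule: finite_induct) (simp_all add: Pi_iff)
qed

context qvs
begin

definition tspace :: "'e list \<Rightarrow> 'e tens nash_space" where
  "tspace bs = nash_image (basis_map E bs) (nspace (Rpos_pow (length bs)))"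

abbreviation "tgrp bs \<equiv> with_space (tensor_group E) (tspace bs)"

lemma basis_map_bij:
  assumes "is_basis E bs"
  shows "bij_betw (basis_map E bs) (carrier (Rpos_pow (length bs))) (carrier (tensor_group E))"
proof -
  obtain \<Psi> where \<Psi>: "\<Psi> \<in> hom (tensor_group E) (Rpos_pow (length bs))"
    "\<And>x v. 0 < x \<Longrightarrow> v \<in> carrier E \<Longrightarrow> \<Psi> (pure_tensor E x v) = power_vec (length bs) x (coord bs v)"
    "\<And>t. t \<in> Upos (length bs) \<Longrightarrow> \<Psi> (basis_map E bs t) = t"
    "\<And>X. X \<in> carrier (tensor_group E) \<Longrightarrow> basis_map E bs (\<Psi> X) = X"
    by (rule tensor_coordinates[OF assms], rule that)
  show ?thesis unfolding Rpos_pow_sel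
    by (rule bij_betw_byWitness[where f' = \<Psi>])
      (use \<Psi>(3,4) basis_map_in[OF assms] hom_in_carrier[OF \<Psi>(1)] in \<open>auto simp: Rpos_pow_sel\<close>)
qed

lemma nash_group_tgrp: "is_basis E bs \<Longrightarrow> nash_group (tgrp bs)"
  unfolding tspace_def
  by (rule nash_group_transport[OF nash_group_Rpos_pow group_tensor_group basis_map_hom basis_map_bij])

context
  fixes bs :: "'e list"
  assumes basis: "is_basis E bs"
begin

lemma basis_map_inj: "inj_on (basis_map E bs) (points (Opn (length bs) (Upos (length bs))))"
  using basis_map_bij[OF basis] by (simp add: bij_betw_def Rpos_pow_sel)

lemma tspace_manif:
  "manif (tspace bs) (length bs)"
  "nash_map (Opn (length bs) (Upos (length bs))) (tspace bs) (basis_map E bs)"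
  "nash_map (tspace bs) (Opn (length bs) (Upos (length bs))) (inv_into (Upos (length bs)) (basis_map E bs))"
  using nash_image_manif[OF Opn_manif(1)[OF Upos_good] basis_map_inj]
  unfolding tspace_def Rpos_pow_sel topspace_Opn_Upos by blast+

lemma tspace_topspace: "points (tspace bs) = carrier (tensor_group E)"
  using nash_image_homeomorphic(2)[OF basis_map_inj] basis_map_bij[OF basis]
  by (simp add: tspace_def Rpos_pow_sel bij_betw_def)

lemma nash_map_from_tspace:
  assumes N: "manif N n" and f: "nash_map (Opn (length bs) (Upos (length bs))) N (\<lambda>t. f (basis_map E bs t))"
  shows "nash_map (tspace bs) N f"
proof -
  have "nash_map (tspace bs) N (\<lambda>X. f (basis_map E bs (inv_into (Upos (length bs)) (basis_map E bs) X)))"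
    by (rule nash_map_compose[OF tspace_manif(1) Opn_manif(1)[OF Upos_good] N tspace_manif(3) f])
  then show ?thesis
    by (rule nash_map_cong[OF tspace_manif(1) N])
      (use basis_map_bij[OF basis] in \<open>simp add: tspace_topspace bij_betw_def Rpos_pow_sel f_inv_into_f\<close>)
qed

lemma pure_tensor_nash_tspace:
  assumes v: "v \<in> carrier E"
  shows "nash_map (nspace Rpos) (tspace bs) (\<lambda>x. pure_tensor E x v)"
proof -
  have "nash_map (nspace Rpos) (tspace bs) (\<lambda>x. basis_map E bs (power_vec (length bs) x (coord bs v)))"
    by (rule nash_map_compose[OF Rpos_manif(1) Opn_manif(1)[OF Upos_good] tspace_manif(1) nash_map_power_vec tspace_manif(2)])
  then show ?thesis
    by (rule nash_map_cong[OF Rpos_manif(1) tspace_manif(1)])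
      (simp add: basis_map_power_vec[OF basis] coord_props(2)[OF basis v])
qed

text \<open>In the coordinates of a basis, a homomorphism from the tensor product is a finite product
  of its values along curves \<open>x \<mapsto> x \<otimes> v\<close> of pure tensors.\<close>

lemma nash_map_from_tensor:
  assumes A: "nash_group A" "comm_group A" and h: "h \<in> hom (tensor_group E) A"
    and pure: "\<And>v. v \<in> carrier E \<Longrightarrow> nash_map (nspace Rpos) (nspace A) (\<lambda>x. h (pure_tensor E x v))"
  shows "nash_map (tspace bs) (nspace A) h"
proof -
  let ?n = "length bs"
  note d = nash_groupD[OF A(1)]
  note O = Opn_manif(1)[OF Upos_good, of ?n]
  have "nash_map (Opn ?n (Upos ?n)) (nspace A) (\<lambda>t. \<Otimes>\<^bsub>A\<^esub>i\<in>{..<?n}. h (pure_tensor E (t i) (bs ! i)))"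
  proof (rule nash_map_finprod[OF A O])
    fix i assume "i \<in> {..<?n}"
    then have i: "i < ?n" by simp
    from nash_map_compose[OF O Rpos_manif(1) d(1) nash_map_coord_Upos[OF i] pure[OF basis_in[OF basis i]]]
    show "nash_map (Opn ?n (Upos ?n)) (nspace A) (\<lambda>t. h (pure_tensor E (t i) (bs ! i)))" .
  qed simp
  then have "nash_map (Opn ?n (Upos ?n)) (nspace A) (\<lambda>t. h (basis_map E bs t))"
  proof (rule nash_map_cong[OF O d(1)])
    fix t assume "t \<in> points (Opn ?n (Upos ?n))"
    then have t: "t \<in> Upos ?n" by simp
    have "(\<lambda>i. pure_tensor E (t i) (bs ! i)) \<in> {..<?n} \<rightarrow> carrier (tensor_group E)"
      using basis_in[OF basis] Upos_D(2)[OF t] by auto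
    then show "(\<Otimes>\<^bsub>A\<^esub>i\<in>{..<?n}. h (pure_tensor E (t i) (bs ! i))) = h (basis_map E bs t)"
      unfolding basis_map_def by (intro hom_finprod[OF comm_tensor_group A(2) h, symmetric]) auto
  qed
  then show ?thesis by (rule nash_map_from_tspace[OF d(1)])
qed

end

text \<open>The curves of pure tensors are Nash for the structure of either basis, so the identity is
  Nash in both directions.\<close>

lemma tspace_unique:
  assumes "is_basis E bs" "is_basis E bs'"
  shows "tspace bs = tspace bs'"
proof (rule manif_eqI[OF tspace_manif(1)[OF assms(1)]])
  show "manif (tspace bs') (length bs)" using tspace_manif(1)[OF assms(2)] basis_length_unique[OF assms] by simp
  have "nash_map (tspace bs) (tspace bs') (\<lambda>a. a)" if b: "is_basis E bs" "is_basis E bs'" for bs bs'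
    using nash_map_from_tensor[OF b(1) nash_group_tgrp[OF b(2)], of "\<lambda>a. a"] comm_tensor_group
      pure_tensor_nash_tspace[OF b(2)] by (simp add: hom_def)
  then show "nash_map (tspace bs) (tspace bs') (\<lambda>a. a)" "nash_map (tspace bs') (tspace bs) (\<lambda>a. a)"
    using assms by blast+
qed

lemma tensor_obj_eq:
  assumes "is_basis E bs"
  shows "tensor_obj E = tgrp bs"
proof -
  have "(THE S. \<forall>bs. is_basis E bs \<longrightarrow> S = tspace bs) = tspace bs"
    by (rule the_equality) (use assms tspace_unique in blast)+
  then show ?thesis by (simp add: tensor_obj_def with_space_def tspace_def)
qed

end

lemma fin_dim_qvsE:
  assumes "fin_dim_qvs E"
  obtains bs where "qvs E" "is_basis E bs"
  using assms unfolding fin_dim_qvs_def qvs_def by blast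

lemma tensor_obj_sel:
  "carrier (tensor_obj E) = carrier (tensor_group E)" "x \<otimes>\<^bsub>tensor_obj E\<^esub> y = x \<otimes>\<^bsub>tensor_group E\<^esub> y"
  "\<one>\<^bsub>tensor_obj E\<^esub> = \<one>\<^bsub>tensor_group E\<^esub>"
  "hom (tensor_obj E) H = hom (tensor_group E) H" "hom K (tensor_obj E) = hom K (tensor_group E)"
  by (simp_all add: tensor_obj_def hom_def)

lemma tensor_obj_nash:
  assumes "fin_dim_qvs E"
  shows "nash_group (tensor_obj E)" "comm_group (tensor_obj E)"
    "v \<in> carrier E \<Longrightarrow> nash_map (nspace Rpos) (nspace (tensor_obj E)) (\<lambda>x. pure_tensor E x v)"
proof -
  obtain bs where bs: "qvs E" "is_basis E bs" using assms by (rule fin_dim_qvsE)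
  interpret qvs E by fact
  show "nash_group (tensor_obj E)" "comm_group (tensor_obj E)"
    unfolding tensor_obj_eq[OF bs(2)] using nash_group_tgrp[OF bs(2)] comm_tensor_group by simp_all
  show "nash_map (nspace Rpos) (nspace (tensor_obj E)) (\<lambda>x. pure_tensor E x v)" if "v \<in> carrier E"
    unfolding tensor_obj_eq[OF bs(2)] using pure_tensor_nash_tspace[OF bs(2) that] by simp
qed

lemma nash_hom_from_tensor:
  assumes E: "fin_dim_qvs E" and A: "nash_group A" "comm_group A" and h: "h \<in> hom (tensor_group E) A"
    and pure: "\<And>v. v \<in> carrier E \<Longrightarrow> nash_map (nspace Rpos) (nspace A) (\<lambda>x. h (pure_tensor E x v))"
  shows "restrict h (carrier (tensor_group E)) \<in> nash_hom (tensor_obj E) A"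
proof -
  obtain bs where bs: "qvs E" "is_basis E bs" using E by (rule fin_dim_qvsE)
  interpret qvs E by fact
  note d = nash_groupD[OF A(1)]
  have "nash_map (tspace bs) (nspace A) (restrict h (carrier (tensor_group E)))"
  proof (rule nash_map_cong[OF tspace_manif(1)[OF bs(2)] d(1) nash_map_from_tensor[OF bs(2) A h pure]])
    fix a assume "a \<in> points (tspace bs)"
    then show "h a = restrict h (carrier (tensor_group E)) a" unfolding tspace_topspace[OF bs(2)] by simp
  qed
  moreover have "restrict h (carrier (tensor_group E)) \<in> hom (tensor_group E) A"
    using h group.is_monoid[OF group_tensor_group] by (auto simp: hom_def monoid.m_closed)
  ultimately show ?thesis unfolding nash_hom_def tensor_obj_eq[OF bs(2)] by simp
qed

lemma hyperbolic_tensor_obj: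
  assumes E: "fin_dim_qvs E"
  shows "hyperbolic (tensor_obj E)"
proof -
  obtain bs where bs: "qvs E" "is_basis E bs" using E by (rule fin_dim_qvsE)
  interpret qvs E by fact
  let ?n = "length bs"
  obtain \<Psi> where \<Psi>: "\<Psi> \<in> hom (tensor_group E) (Rpos_pow ?n)"
    "\<And>x v. 0 < x \<Longrightarrow> v \<in> carrier E \<Longrightarrow> \<Psi> (pure_tensor E x v) = power_vec ?n x (coord bs v)"
    "\<And>t. t \<in> Upos ?n \<Longrightarrow> \<Psi> (basis_map E bs t) = t"
    "\<And>X. X \<in> carrier (tensor_group E) \<Longrightarrow> basis_map E bs (\<Psi> X) = X"
    by (rule tensor_coordinates[OF bs(2)], rule that)
  have "nash_map (nspace Rpos) (nspace (Rpos_pow ?n)) (\<lambda>x. \<Psi> (pure_tensor E x v))" if "v \<in> carrier E" for v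
    unfolding Rpos_pow_sel
    by (rule nash_map_cong[OF Rpos_manif(1) Opn_manif(1)[OF Upos_good] nash_map_power_vec]) (simp add: \<Psi>(2) that)
  then have "restrict \<Psi> (carrier (tensor_group E)) \<in> nash_hom (tensor_obj E) (Rpos_pow ?n)"
    by (rule nash_hom_from_tensor[OF E nash_group_Rpos_pow group_Rpos_pow \<Psi>(1)])
  moreover have "bij_betw \<Psi> (carrier (tensor_group E)) (carrier (Rpos_pow ?n))"
    unfolding Rpos_pow_sel
    by (rule bij_betw_byWitness[where f' = "basis_map E bs"])
      (use \<Psi>(3,4) basis_map_in[OF bs(2)] hom_in_carrier[OF \<Psi>(1)] in \<open>auto simp: Rpos_pow_sel\<close>)
  ultimately have "restrict \<Psi> (carrier (tensor_group E)) \<in> nash_iso (tensor_obj E) (Rpos_pow ?n)"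
    by (simp only: nash_iso_def tensor_obj_sel mem_Collect_eq bij_betw_restrict_eq)
  then show ?thesis unfolding hyperbolic_def using tensor_obj_nash(1)[OF E] by blast
qed

lemma tensor_mor:
  assumes E: "fin_dim_qvs E" and F: "fin_dim_qvs F" and f: "f \<in> linear_maps E F"
  shows "tensor_mor E F f \<in> nash_hom (tensor_obj E) (tensor_obj F)"
    "\<And>x v. 0 < x \<Longrightarrow> v \<in> carrier E \<Longrightarrow> tensor_mor E F f (pure_tensor E x v) = pure_tensor F x (f v)"
proof -
  interpret E: qvs E using E by (rule fin_dim_qvsE)
  interpret F: qvs F using F by (rule fin_dim_qvsE)
  have f': "f v \<in> carrier F" "f (v \<oplus>\<^bsub>E\<^esub> w) = f v \<oplus>\<^bsub>F\<^esub> f w" "f (r \<odot>\<^bsub>E\<^esub> v) = r \<odot>\<^bsub>F\<^esub> f v"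
    if "v \<in> carrier E" "w \<in> carrier E" for v w r using f that by (auto simp: linear_maps_def)
  obtain h where h: "h \<in> hom (tensor_group E) (tensor_group F)"
    "\<And>x v. 0 < x \<Longrightarrow> v \<in> carrier E \<Longrightarrow> h (pure_tensor E x v) = pure_tensor F x (f v)"
    by (rule E.tensor_universal[OF F.comm_tensor_group, of "\<lambda>x v. pure_tensor F x (f v)"])
      (auto simp: f' F.pure_tensor_mult F.pure_tensor_add F.pure_tensor_powr)
  let ?h = "restrict h (carrier (tensor_group E))"
  have "nash_map (nspace Rpos) (nspace (tensor_obj F)) (\<lambda>x. h (pure_tensor E x v))" if v: "v \<in> carrier E" for v
  proof -
    note d = nash_groupD[OF tensor_obj_nash(1)[OF F]]
    show ?thesis
      by (rule nash_map_cong[OF Rpos_manif(1) d(1) tensor_obj_nash(3)[OF F f'(1)[OF v v]]]) (simp add: h(2) v)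
  qed
  then have nash: "?h \<in> nash_hom (tensor_obj E) (tensor_obj F)"
    using nash_hom_from_tensor[OF E tensor_obj_nash(1,2)[OF F], of h] h(1) by (simp add: tensor_obj_sel)
  have "tensor_mor E F f = ?h"
    unfolding tensor_mor_def
  proof (rule the_equality)
    show "?h \<in> hom (tensor_group E) (tensor_group F) \<and> ?h \<in> extensional (carrier (tensor_group E)) \<and>
        (\<forall>x\<in>carrier Rpos. \<forall>v\<in>carrier E. ?h (pure_tensor E x v) = pure_tensor F x (f v))"
      using nash h(2) by (auto simp: nash_hom_def tensor_obj_sel Rpos_sel)
    fix k assume k: "k \<in> hom (tensor_group E) (tensor_group F) \<and> k \<in> extensional (carrier (tensor_group E)) \<and>
        (\<forall>x\<in>carrier Rpos. \<forall>v\<in>carrier E. k (pure_tensor E x v) = pure_tensor F x (f v))"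
    then have kp: "\<And>x v. 0 < x \<Longrightarrow> v \<in> carrier E \<Longrightarrow> k (pure_tensor E x v) = h (pure_tensor E x v)"
      using h(2) by (simp add: Rpos_sel)
    show "k = ?h"
      by (rule extensionalityI[of _ "carrier (tensor_group E)"])
        (use k E.tensor_hom_ext[OF F.group_tensor_group _ h(1) kp] in auto)
  qed
  then show "tensor_mor E F f \<in> nash_hom (tensor_obj E) (tensor_obj F)"
    "\<And>x v. 0 < x \<Longrightarrow> v \<in> carrier E \<Longrightarrow> tensor_mor E F f (pure_tensor E x v) = pure_tensor F x (f v)"
    using nash h(2) by simp_all
qed

section \<open>One-parameter subgroups of hyperbolic Nash groups\<close>

lemma nash_hom_RposD:
  assumes "\<phi> \<in> nash_hom Rpos A"
  shows "0 < x \<Longrightarrow> \<phi> x \<in> carrier A" "0 < x \<Longrightarrow> 0 < y \<Longrightarrow> \<phi> (x * y) = \<phi> x \<otimes>\<^bsub>A\<^esub> \<phi> y"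
    "\<phi> \<in> extensional {0<..}" "nash_map (nspace Rpos) (nspace A) \<phi>"
  using assms by (auto simp: nash_hom_def hom_def Rpos_sel(1,2))

lemma nash_hom_RposI:
  assumes A: "nash_group A" and in': "\<And>x. 0 < x \<Longrightarrow> f x \<in> carrier A"
    and mult: "\<And>x y. 0 < x \<Longrightarrow> 0 < y \<Longrightarrow> f (x * y) = f x \<otimes>\<^bsub>A\<^esub> f y"
    and nash: "nash_map (nspace Rpos) (nspace A) f"
  shows "(\<lambda>x\<in>carrier Rpos. f x) \<in> nash_hom Rpos A"
proof -
  note d = nash_groupD[OF A]
  have "nash_map (nspace Rpos) (nspace A) (\<lambda>x\<in>carrier Rpos. f x)"
    by (rule nash_map_cong[OF Rpos_manif(1) d(1) nash]) (simp add: Rpos_sel(1))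
  then show ?thesis unfolding nash_hom_def using in' mult by (auto simp: hom_def Rpos_sel(1,2))
qed

text \<open>These are the curves that \<open>F\<close> maps to the one-parameter subgroups
  \<open>x \<mapsto> (x powr c\<^sub>0, x powr c\<^sub>1, \<dots>)\<close>.\<close>

lemma curve_nash_hom:
  assumes A: "nash_group A" "comm_group A" and F: "F \<in> nash_iso A (Rpos_pow n)"
  shows "(\<lambda>x\<in>carrier Rpos. inv_into (carrier A) F (power_vec n x c)) \<in> nash_hom Rpos A"
proof -
  interpret A: comm_group A by fact
  interpret R: comm_group "Rpos_pow n" by (rule group_Rpos_pow)
  have bij: "bij_betw F (carrier A) (Upos n)" and Fh: "F \<in> hom A (Rpos_pow n)"
    and nF: "nash_map (nspace A) (Opn n (Upos n)) F"
    using F by (auto simp: nash_iso_def nash_hom_def Rpos_pow_sel(1,2))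
  let ?g = "\<lambda>x. inv_into (carrier A) F (power_vec n x c)"
  have g: "?g x \<in> carrier A" "F (?g x) = power_vec n x c" if "0 < x" for x
    using bij_betw_imp_surj_on[OF bij] power_vec_in[OF that, of n c]
    by (auto intro: inv_into_into f_inv_into_f)
  have m: "?g (x * y) = ?g x \<otimes>\<^bsub>A\<^esub> ?g y" if xy: "0 < x" "0 < y" for x y
  proof (rule inj_onD[OF bij_betw_imp_inj_on[OF bij]])
    have "F (?g x \<otimes>\<^bsub>A\<^esub> ?g y) = power_vec n x c \<otimes>\<^bsub>Rpos_pow n\<^esub> power_vec n y c"
      using hom_mult[OF Fh g(1)[OF xy(1)] g(1)[OF xy(2)]] by (simp add: g(2) xy)
    also have "\<dots> = power_vec n (x * y) c" using xy by (auto simp: power_vec_def Rpos_pow_sel powr_mult)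
    finally show "F (?g (x * y)) = F (?g x \<otimes>\<^bsub>A\<^esub> ?g y)" using g(2)[of "x * y"] xy by simp
    show "?g (x * y) \<in> carrier A" by (rule g(1)) (use xy in simp)
    show "?g x \<otimes>\<^bsub>A\<^esub> ?g y \<in> carrier A" by (rule A.m_closed[OF g(1)[OF xy(1)] g(1)[OF xy(2)]])
  qed
  show ?thesis
    by (rule nash_hom_RposI[OF A(1) g(1) m inverse_curve_nash[OF A(1) nF bij_betw_imp_inj_on[OF bij] nash_map_power_vec g m]])
qed

text \<open>Every coordinate of \<open>F \<circ> \<phi>\<close> is a Nash endomorphism of the positive reals.\<close>

lemma nash_hom_Rpos_power_vec:
  assumes A: "nash_group A" and F: "F \<in> nash_hom A (Rpos_pow n)" and \<phi>: "\<phi> \<in> nash_hom Rpos A"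
  obtains c where "\<And>x. 0 < x \<Longrightarrow> F (\<phi> x) = power_vec n x c"
proof -
  note d = nash_groupD[OF A]
  note p = nash_hom_RposD[OF \<phi>]
  have Fh: "F \<in> hom A (Rpos_pow n)" and nF: "nash_map (nspace A) (Opn n (Upos n)) F"
    using F by (auto simp: nash_hom_def Rpos_pow_sel(2))
  have Fin: "F (\<phi> x) \<in> Upos n" if "0 < x" for x
    using hom_in_carrier[OF Fh p(1)[OF that]] by (simp add: Rpos_pow_sel)
  have "\<exists>r. \<forall>x>0. F (\<phi> x) i = x powr of_rat r" if i: "i < n" for i
  proof -
    note O = Opn_manif(1)[OF Upos_good, of n]
    have n1: "nash_map (nspace Rpos) (nspace Rpos) (\<lambda>x. F (\<phi> x) i)"
      by (rule nash_map_compose[OF Rpos_manif(1) O Rpos_manif(1)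
            nash_map_compose[OF Rpos_manif(1) d(1) O p(4) nF] nash_map_coord_Upos[OF i]])
    have n2: "0 < F (\<phi> x) i" if "0 < x" for x using Upos_D(2)[OF Fin[OF that] i] .
    have n3: "F (\<phi> (x * y)) i = F (\<phi> x) i * F (\<phi> y) i" if "0 < x" "0 < y" for x y
      using hom_mult[OF Fh p(1)[OF that(1)] p(1)[OF that(2)]] p(2)[OF that] by (simp add: Rpos_pow_sel)
    show ?thesis
    proof (rule nash_hom_Rpos_Rpos[where f = "\<lambda>x. F (\<phi> x) i"])
      fix r assume "\<And>t. 0 < t \<Longrightarrow> F (\<phi> t) i = t powr of_rat r"
      then show ?thesis by blast
    qed (use n1 n2 n3 in blast)+
  qed
  then obtain c where c: "\<And>i x. i < n \<Longrightarrow> 0 < x \<Longrightarrow> F (\<phi> x) i = x powr of_rat (c i)" by metis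
  have "F (\<phi> x) = power_vec n x c" if "0 < x" for x
    using c[OF _ that] Upos_D(1)[OF Fin[OF that]] by (auto simp: power_vec_def vecs_iff fun_eq_iff)
  then show ?thesis by (rule that)
qed

lemma power_vec_eqD:
  assumes "0 < x" "x \<noteq> 1" "power_vec n x c = power_vec n x d" "i < n"
  shows "c i = d i"
proof -
  have "x powr of_rat (c i) = x powr of_rat (d i)"
    using fun_cong[OF assms(3), of i] assms(4) by (simp add: power_vec_def)
  then show ?thesis using assms(1,2) by (simp add: powr_inj)
qed

lemma hyperbolicE:
  assumes "hyperbolic A"
  obtains n F where "nash_group A" "comm_group A" "F \<in> nash_iso A (Rpos_pow n)"
proof -
  obtain n F where A: "nash_group A" and F: "F \<in> nash_iso A (Rpos_pow n)" using assms by (auto simp: hyperbolic_def)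
  then interpret A: group A by (simp add: nash_group_def)
  interpret R: comm_group "Rpos_pow n" by (rule group_Rpos_pow)
  have inj: "inj_on F (carrier A)" and Fh: "F \<in> hom A (Rpos_pow n)"
    using F by (auto simp: nash_iso_def nash_hom_def bij_betw_def)
  have "comm_group A"
  proof (rule A.group_comm_groupI)
    fix x y assume xy: "x \<in> carrier A" "y \<in> carrier A"
    have "F (x \<otimes>\<^bsub>A\<^esub> y) = F (y \<otimes>\<^bsub>A\<^esub> x)"
      using hom_mult[OF Fh] hom_in_carrier[OF Fh] xy by (simp add: R.m_comm)
    then show "x \<otimes>\<^bsub>A\<^esub> y = y \<otimes>\<^bsub>A\<^esub> x" using inj_onD[OF inj] xy by simp
  qed
  then show ?thesis using that A F by blast
qed

section \<open>The vector space of one-parameter subgroups\<close>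

lemma Hom_obj_sel [simp]:
  "carrier (Hom_obj A) = nash_hom Rpos A"
  "\<zero>\<^bsub>Hom_obj A\<^esub> = (\<lambda>x \<in> carrier Rpos. \<one>\<^bsub>A\<^esub>)"
  "\<phi> \<oplus>\<^bsub>Hom_obj A\<^esub> \<psi> = (\<lambda>x \<in> carrier Rpos. \<phi> x \<otimes>\<^bsub>A\<^esub> \<psi> x)"
  "r \<odot>\<^bsub>Hom_obj A\<^esub> \<phi> = (\<lambda>x \<in> carrier Rpos. \<phi> (x powr of_rat r))"
  by (simp_all add: Hom_obj_def)

lemma nash_hom_Rpos_eqI:
  assumes "\<phi> \<in> nash_hom Rpos A" "\<psi> \<in> nash_hom Rpos A" "\<And>x. 0 < x \<Longrightarrow> \<phi> x = \<psi> x"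
  shows "\<phi> = \<psi>"
  by (rule extensionalityI[OF nash_hom_RposD(3)[OF assms(1)] nash_hom_RposD(3)[OF assms(2)]]) (simp add: assms(3))

context
  fixes A :: "'a nash_grp"
  assumes A: "nash_group A" "comm_group A"
begin

interpretation A: comm_group A by (rule A(2))

lemma Hom_one: "(\<lambda>x \<in> carrier Rpos. \<one>\<^bsub>A\<^esub>) \<in> nash_hom Rpos A"
proof -
  note d = nash_groupD[OF A(1)]
  show ?thesis
    by (rule nash_hom_RposI[OF A(1) _ _ nash_map_const[OF Rpos_manif(1) d(1)]]) (simp_all add: d(2))
qed

lemma Hom_mult:
  assumes f: "\<phi> \<in> nash_hom Rpos A" and g: "\<psi> \<in> nash_hom Rpos A"
  shows "(\<lambda>x \<in> carrier Rpos. \<phi> x \<otimes>\<^bsub>A\<^esub> \<psi> x) \<in> nash_hom Rpos A"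
  by (rule nash_hom_RposI[OF A(1) _ _ nash_map_mult[OF A(1) Rpos_manif(1) nash_hom_RposD(4)[OF f] nash_hom_RposD(4)[OF g]]])
    (simp_all add: nash_hom_RposD(1,2)[OF f] nash_hom_RposD(1,2)[OF g] A.m_ac)

lemma Hom_powr:
  assumes f: "\<phi> \<in> nash_hom Rpos A"
  shows "(\<lambda>x \<in> carrier Rpos. \<phi> (x powr of_rat r)) \<in> nash_hom Rpos A"
proof -
  note d = nash_groupD[OF A(1)]
  show ?thesis
    by (rule nash_hom_RposI[OF A(1) _ _ nash_map_compose[OF Rpos_manif(1) Rpos_manif(1) d(1) nash_map_powr nash_hom_RposD(4)[OF f]]])
      (simp_all add: nash_hom_RposD(1,2)[OF f] powr_mult)
qed

lemma Hom_abelian_group: "abelian_group (Hom_obj A)"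
proof (rule abelian_groupI)
  fix \<phi> assume f: "\<phi> \<in> carrier (Hom_obj A)"
  then have f': "\<phi> \<in> nash_hom Rpos A" by simp
  note p = nash_hom_RposD(1,2)[OF f']
  have 1: "\<phi> 1 = \<one>\<^bsub>A\<^esub>" using p(2)[of 1 1] p(1)[of 1] by (simp add: A.l_cancel_one')
  show "\<zero>\<^bsub>Hom_obj A\<^esub> \<oplus>\<^bsub>Hom_obj A\<^esub> \<phi> = \<phi>"
    by (rule nash_hom_Rpos_eqI[OF _ f']) (use Hom_mult[OF Hom_one f'] p in \<open>simp_all add: Rpos_sel(1)\<close>)
  show "\<exists>\<psi>\<in>carrier (Hom_obj A). \<psi> \<oplus>\<^bsub>Hom_obj A\<^esub> \<phi> = \<zero>\<^bsub>Hom_obj A\<^esub>"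
  proof
    let ?\<psi> = "\<lambda>x \<in> carrier Rpos. \<phi> (x powr of_rat (-1))"
    show "?\<psi> \<in> carrier (Hom_obj A)" using Hom_powr[OF f', of "-1"] by simp
    have "\<phi> (x powr of_rat (-1)) \<otimes>\<^bsub>A\<^esub> \<phi> x = \<one>\<^bsub>A\<^esub>" if "0 < x" for x
      using p(2)[of "x powr of_rat (-1)" x] that 1 by (simp add: powr_minus_divide)
    then show "?\<psi> \<oplus>\<^bsub>Hom_obj A\<^esub> \<phi> = \<zero>\<^bsub>Hom_obj A\<^esub>" by (auto simp: Rpos_sel(1) restrict_def fun_eq_iff)
  qed
next
  fix \<phi> \<psi> \<theta> assume "\<phi> \<in> carrier (Hom_obj A)" "\<psi> \<in> carrier (Hom_obj A)" "\<theta> \<in> carrier (Hom_obj A)"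
  then have "\<phi> \<in> nash_hom Rpos A" "\<psi> \<in> nash_hom Rpos A" "\<theta> \<in> nash_hom Rpos A" by simp_all
  note p = nash_hom_RposD(1)[OF this(1)] nash_hom_RposD(1)[OF this(2)] nash_hom_RposD(1)[OF this(3)]
  show "\<phi> \<oplus>\<^bsub>Hom_obj A\<^esub> \<psi> \<oplus>\<^bsub>Hom_obj A\<^esub> \<theta> = \<phi> \<oplus>\<^bsub>Hom_obj A\<^esub> (\<psi> \<oplus>\<^bsub>Hom_obj A\<^esub> \<theta>)"
    by (simp add: restrict_def fun_eq_iff Rpos_sel(1) p A.m_assoc)
next
  fix \<phi> \<psi> assume "\<phi> \<in> carrier (Hom_obj A)" "\<psi> \<in> carrier (Hom_obj A)"
  then have "\<phi> \<in> nash_hom Rpos A" "\<psi> \<in> nash_hom Rpos A" by simp_all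
  note p = nash_hom_RposD(1)[OF this(1)] nash_hom_RposD(1)[OF this(2)]
  show "\<phi> \<oplus>\<^bsub>Hom_obj A\<^esub> \<psi> = \<psi> \<oplus>\<^bsub>Hom_obj A\<^esub> \<phi>"
    by (simp add: restrict_def fun_eq_iff Rpos_sel(1) p A.m_comm)
qed (simp_all add: Hom_mult Hom_one)

lemma Hom_qvs: "qvs (Hom_obj A)"
  unfolding qvs_def
proof (rule module.intro[OF cring_rat_ring Hom_abelian_group], unfold_locales)
  fix r s \<phi> assume "\<phi> \<in> carrier (Hom_obj A)"
  then have f': "\<phi> \<in> nash_hom Rpos A" by simp
  note p = nash_hom_RposD(1,2)[OF f']
  show "r \<odot>\<^bsub>Hom_obj A\<^esub> \<phi> \<in> carrier (Hom_obj A)" using Hom_powr[OF f'] by simp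
  show "(r \<oplus>\<^bsub>rat_ring\<^esub> s) \<odot>\<^bsub>Hom_obj A\<^esub> \<phi> = r \<odot>\<^bsub>Hom_obj A\<^esub> \<phi> \<oplus>\<^bsub>Hom_obj A\<^esub> s \<odot>\<^bsub>Hom_obj A\<^esub> \<phi>"
    by (simp add: restrict_def fun_eq_iff Rpos_sel(1) p of_rat_add powr_add)
  show "(r \<otimes>\<^bsub>rat_ring\<^esub> s) \<odot>\<^bsub>Hom_obj A\<^esub> \<phi> = r \<odot>\<^bsub>Hom_obj A\<^esub> (s \<odot>\<^bsub>Hom_obj A\<^esub> \<phi>)"
    by (simp add: restrict_def fun_eq_iff Rpos_sel(1) of_rat_mult powr_powr)
  show "\<one>\<^bsub>rat_ring\<^esub> \<odot>\<^bsub>Hom_obj A\<^esub> \<phi> = \<phi>"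
    by (rule nash_hom_Rpos_eqI[OF _ f']) (use Hom_powr[OF f', of 1] in \<open>simp_all add: Rpos_sel(1)\<close>)
next
  fix r \<phi> \<psi>
  show "r \<odot>\<^bsub>Hom_obj A\<^esub> (\<phi> \<oplus>\<^bsub>Hom_obj A\<^esub> \<psi>) = r \<odot>\<^bsub>Hom_obj A\<^esub> \<phi> \<oplus>\<^bsub>Hom_obj A\<^esub> r \<odot>\<^bsub>Hom_obj A\<^esub> \<psi>"
    by (simp add: restrict_def fun_eq_iff Rpos_sel(1))
qed

lemma Hom_finsum:
  assumes "finite I" "\<psi> \<in> I \<rightarrow> nash_hom Rpos A" "0 < x"
  shows "(\<Oplus>\<^bsub>Hom_obj A\<^esub>i\<in>I. \<psi> i) x = (\<Otimes>\<^bsub>A\<^esub>i\<in>I. \<psi> i x)"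
proof -
  interpret H: abelian_group "Hom_obj A" by (rule Hom_abelian_group)
  show ?thesis using assms(1,2)
  proof (induction I rule: finite_induct)
    case (insert i I)
    then have p: "\<psi> i \<in> nash_hom Rpos A" "\<psi> \<in> I \<rightarrow> nash_hom Rpos A" by auto
    have q: "\<psi> j x \<in> carrier A" if "j \<in> insert i I" for j
      using insert.prems that nash_hom_RposD(1)[OF _ assms(3)] by blast
    have "(\<Oplus>\<^bsub>Hom_obj A\<^esub>j\<in>insert i I. \<psi> j) = \<psi> i \<oplus>\<^bsub>Hom_obj A\<^esub> (\<Oplus>\<^bsub>Hom_obj A\<^esub>j\<in>I. \<psi> j)"
      by (rule H.finsum_insert) (use insert.hyps p in simp_all)
    moreover have "(\<Otimes>\<^bsub>A\<^esub>j\<in>insert i I. \<psi> j x) = \<psi> i x \<otimes>\<^bsub>A\<^esub> (\<Otimes>\<^bsub>A\<^esub>j\<in>I. \<psi> j x)"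
      by (rule A.finprod_insert) (use insert.hyps q in auto)
    ultimately show ?case using insert.IH[OF p(2)] assms(3) by (simp add: Rpos_sel(1))
  qed (use assms(3) in \<open>simp add: Rpos_sel(1)\<close>)
qed

context
  fixes F n
  assumes F: "F \<in> nash_iso A (Rpos_pow n)"
begin

definition curve :: "(nat \<Rightarrow> rat) \<Rightarrow> real \<Rightarrow> 'a" where
  "curve c = (\<lambda>x\<in>carrier Rpos. inv_into (carrier A) F (power_vec n x c))"

definition curve_basis :: "(real \<Rightarrow> 'a) list" where
  "curve_basis = map (\<lambda>i. curve (\<lambda>k. if k = i then 1 else 0)) [0..<n]"

lemma curve_in: "curve c \<in> nash_hom Rpos A"
  unfolding curve_def by (rule curve_nash_hom[OF A F])

lemma iso_hom: "F \<in> hom A (Rpos_pow n)" "bij_betw F (carrier A) (Upos n)"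
  using F by (simp_all add: nash_iso_def nash_hom_def Rpos_pow_sel(1))

lemma iso_curve: "0 < x \<Longrightarrow> F (curve c x) = power_vec n x c"
  using bij_betw_imp_surj_on[OF iso_hom(2)] power_vec_in[of x n c]
  by (simp add: curve_def Rpos_sel(1) f_inv_into_f)

lemma curve_exists:
  assumes "\<phi> \<in> nash_hom Rpos A"
  obtains c where "\<phi> = curve c"
proof -
  have F': "F \<in> nash_hom A (Rpos_pow n)" using F by (simp add: nash_iso_def)
  obtain c where c: "\<And>x. 0 < x \<Longrightarrow> F (\<phi> x) = power_vec n x c"
    by (rule nash_hom_Rpos_power_vec[OF A(1) F' assms], rule that)
  have "\<phi> = curve c"
  proof (rule nash_hom_Rpos_eqI[OF assms curve_in])
    fix x :: real assume x: "0 < x"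
    show "\<phi> x = curve c x"
      by (rule inj_onD[OF bij_betw_imp_inj_on[OF iso_hom(2)] _ nash_hom_RposD(1)[OF assms x] nash_hom_RposD(1)[OF curve_in x]])
        (simp add: c iso_curve x)
  qed
  then show ?thesis by (rule that)
qed

text \<open>This product is Nash in \<open>t\<close>, since each of the curves is. It is the inverse of \<open>F\<close>.\<close>

lemma iso_product_of_curves:
  assumes "t \<in> Upos n"
  shows "(\<Otimes>\<^bsub>A\<^esub>i\<in>{..<n}. (curve_basis ! i) (t i)) \<in> carrier A"
    "F (\<Otimes>\<^bsub>A\<^esub>i\<in>{..<n}. (curve_basis ! i) (t i)) = t"
proof -
  have in': "(\<lambda>i. (curve_basis ! i) (t i)) \<in> {..<n} \<rightarrow> carrier A"
    using Upos_D(2)[OF assms] nash_hom_RposD(1)[OF curve_in] by (auto simp: curve_basis_def)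
  then show "(\<Otimes>\<^bsub>A\<^esub>i\<in>{..<n}. (curve_basis ! i) (t i)) \<in> carrier A" by simp
  have "F (\<Otimes>\<^bsub>A\<^esub>i\<in>{..<n}. (curve_basis ! i) (t i)) = (\<Otimes>\<^bsub>Rpos_pow n\<^esub>i\<in>{..<n}. F ((curve_basis ! i) (t i)))"
    by (rule hom_finprod[OF A(2) group_Rpos_pow iso_hom(1) _ in']) simp
  also have "\<dots> = (\<lambda>k. if k < n then \<Prod>i<n. F ((curve_basis ! i) (t i)) k else 0)"
    using in' bij_betw_imp_surj_on[OF iso_hom(2)] by (intro finprod_Rpos_pow) auto
  also have "\<dots> = t"
  proof
    fix k
    show "(if k < n then \<Prod>i<n. F ((curve_basis ! i) (t i)) k else 0) = t k"
    proof (cases "k < n")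
      case True
      have "(\<Prod>i<n. F ((curve_basis ! i) (t i)) k) = (\<Prod>i<n. if i = k then t k else 1)"
      proof (rule prod.cong)
        fix i assume "i \<in> {..<n}"
        then show "F ((curve_basis ! i) (t i)) k = (if i = k then t k else 1)"
          using True Upos_D(2)[OF assms, of i]
          by (cases "i = k") (simp_all add: curve_basis_def iso_curve power_vec_def)
      qed simp
      then show ?thesis using True by (simp add: prod.delta)
    qed (use Upos_D(1)[OF assms] in \<open>simp add: vecs_iff\<close>)
  qed
  finally show "F (\<Otimes>\<^bsub>A\<^esub>i\<in>{..<n}. (curve_basis ! i) (t i)) = t" .
qed

lemma lincomb_curve_basis:
  "(\<Oplus>\<^bsub>Hom_obj A\<^esub>i\<in>{..<n}. c i \<odot>\<^bsub>Hom_obj A\<^esub> (curve_basis ! i)) = curve c"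
proof -
  interpret H: abelian_group "Hom_obj A" by (rule Hom_abelian_group)
  have b: "curve_basis ! i \<in> nash_hom Rpos A" if "i < n" for i using that curve_in by (simp add: curve_basis_def)
  have in': "(\<lambda>i. c i \<odot>\<^bsub>Hom_obj A\<^esub> (curve_basis ! i)) \<in> {..<n} \<rightarrow> nash_hom Rpos A"
    using Hom_powr[OF b] by auto
  show ?thesis
  proof (rule nash_hom_Rpos_eqI[OF _ curve_in])
    show "(\<Oplus>\<^bsub>Hom_obj A\<^esub>i\<in>{..<n}. c i \<odot>\<^bsub>Hom_obj A\<^esub> (curve_basis ! i)) \<in> nash_hom Rpos A"
      using H.finsum_closed in' by fastforce
    fix x :: real assume x: "0 < x"
    note P = iso_product_of_curves[OF power_vec_in[OF x], of c]
    have "(\<Oplus>\<^bsub>Hom_obj A\<^esub>i\<in>{..<n}. c i \<odot>\<^bsub>Hom_obj A\<^esub> (curve_basis ! i)) x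
        = (\<Otimes>\<^bsub>A\<^esub>i\<in>{..<n}. (c i \<odot>\<^bsub>Hom_obj A\<^esub> (curve_basis ! i)) x)"
      by (rule Hom_finsum[OF _ in' x]) simp
    also have "\<dots> = (\<Otimes>\<^bsub>A\<^esub>i\<in>{..<n}. (curve_basis ! i) (power_vec n x c i))"
      using x nash_hom_RposD(1)[OF b] by (intro A.finprod_cong') (auto simp: Rpos_sel(1) power_vec_def)
    also have "\<dots> = curve c x"
      by (rule inj_onD[OF bij_betw_imp_inj_on[OF iso_hom(2)] _ P(1) nash_hom_RposD(1)[OF curve_in x]])
        (simp add: P(2) iso_curve x)
    finally show "(\<Oplus>\<^bsub>Hom_obj A\<^esub>i\<in>{..<n}. c i \<odot>\<^bsub>Hom_obj A\<^esub> (curve_basis ! i)) x = curve c x" .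
  qed
qed

lemma curve_basis_length [simp]: "length curve_basis = n"
  by (simp add: curve_basis_def)

lemma is_basis_curve_basis: "is_basis (Hom_obj A) curve_basis"
  unfolding is_basis_def curve_basis_length lincomb_curve_basis
proof (intro conjI ballI)
  show "set curve_basis \<subseteq> carrier (Hom_obj A)" using curve_in by (auto simp: curve_basis_def)
  fix \<phi> assume "\<phi> \<in> carrier (Hom_obj A)"
  then obtain c where c: "\<phi> = curve c" using curve_exists by auto
  show "\<exists>!c. c \<in> extensional {..<n} \<and> \<phi> = curve c"
  proof (rule ex1I)
    have "curve (restrict c {..<n}) = curve c" by (simp add: curve_def power_vec_def cong: if_cong)
    then show "restrict c {..<n} \<in> extensional {..<n} \<and> \<phi> = curve (restrict c {..<n})" using c by simp
    fix d assume d: "d \<in> extensional {..<n} \<and> \<phi> = curve d"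
    (* Any positive base other than 1 determines the exponents. *)
    have "power_vec n 2 c = power_vec n 2 d" using iso_curve[of 2 c] iso_curve[of 2 d] c d by simp
    then have "c i = d i" if "i < n" for i using power_vec_eqD[of 2 n c d i] that by simp
    then show "d = restrict c {..<n}" using d by (intro extensionalityI[of _ "{..<n}"]) auto
  qed
qed

end

end

lemma fin_dim_Hom_obj: "hyperbolic A \<Longrightarrow> fin_dim_qvs (Hom_obj A)"
proof -
  assume "hyperbolic A"
  then obtain n F where A: "nash_group A" "comm_group A" "F \<in> nash_iso A (Rpos_pow n)" by (rule hyperbolicE)
  then show ?thesis unfolding fin_dim_qvs_def using Hom_qvs[OF A(1,2)] is_basis_curve_basis[OF A] by (auto simp: qvs_def)
qed

section \<open>The two functors\<close>

lemma hyperbolic_nash_group: "hyperbolic A \<Longrightarrow> nash_group A"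
  by (simp add: hyperbolic_def)

lemma nash_homD:
  assumes "f \<in> nash_hom A B"
  shows "f \<in> hom A B" "f \<in> extensional (carrier A)" "nash_map (nspace A) (nspace B) f"
    "x \<in> carrier A \<Longrightarrow> f x \<in> carrier B"
    "x \<in> carrier A \<Longrightarrow> y \<in> carrier A \<Longrightarrow> f (x \<otimes>\<^bsub>A\<^esub> y) = f x \<otimes>\<^bsub>B\<^esub> f y"
  using assms by (auto simp: nash_hom_def hom_def)

lemma nash_hom_restrictI:
  assumes A: "nash_group A" and B: "nash_group B" and f: "f \<in> hom A B" "nash_map (nspace A) (nspace B) f"
  shows "restrict f (carrier A) \<in> nash_hom A B"
proof -
  note m = nash_groupD[OF A]
  note n = nash_groupD[OF B]
  interpret A: group A by fact
  have "nash_map (nspace A) (nspace B) (restrict f (carrier A))"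
    by (rule nash_map_cong[OF m(1) n(1) f(2)]) (simp add: m(2))
  then show ?thesis using f(1) by (auto simp: nash_hom_def hom_def)
qed

lemma nash_hom_id: "nash_group A \<Longrightarrow> (\<lambda>x \<in> carrier A. x) \<in> nash_hom A A"
proof -
  assume A: "nash_group A"
  note m = nash_groupD[OF A]
  show ?thesis by (rule nash_hom_restrictI[OF A A _ nash_map_id[OF m(1)]]) (simp add: hom_def)
qed

lemma nash_hom_compose:
  assumes A: "nash_group A" and B: "nash_group B" and C: "nash_group C"
    and f: "f \<in> nash_hom A B" and g: "g \<in> nash_hom B C"
  shows "compose (carrier A) g f \<in> nash_hom A C"
proof -
  note l = nash_groupD[OF A]
  note m = nash_groupD[OF B]
  note n = nash_groupD[OF C]
  have "(\<lambda>x. g (f x)) \<in> hom A C" using nash_homD(4,5)[OF f] nash_homD(4,5)[OF g] by (simp add: hom_def)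
  from nash_hom_restrictI[OF A C this nash_map_compose[OF l(1) m(1) n(1) nash_homD(3)[OF f] nash_homD(3)[OF g]]]
  show ?thesis by (simp add: compose_def)
qed

lemma hyperbolic_category: "is_category hyperbolic_cat"
proof -
  have "nash_hom A B \<subseteq> carrier A \<rightarrow>\<^sub>E carrier B" for A B :: "'a nash_grp"
  proof
    fix f assume f: "f \<in> nash_hom A B"
    show "f \<in> carrier A \<rightarrow>\<^sub>E carrier B" unfolding PiE_iff using nash_homD(2,4)[OF f] by blast
  qed
  then show ?thesis
    by (simp add: is_category_def hyperbolic_cat_def hyperbolic_nash_group nash_hom_id)
      (blast intro: nash_hom_compose hyperbolic_nash_group)
qed

lemma linear_mapsD:
  assumes "f \<in> linear_maps E F"
  shows "f \<in> extensional (carrier E)" "v \<in> carrier E \<Longrightarrow> f v \<in> carrier F"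
    "v \<in> carrier E \<Longrightarrow> w \<in> carrier E \<Longrightarrow> f (v \<oplus>\<^bsub>E\<^esub> w) = f v \<oplus>\<^bsub>F\<^esub> f w"
    "v \<in> carrier E \<Longrightarrow> f (r \<odot>\<^bsub>E\<^esub> v) = r \<odot>\<^bsub>F\<^esub> f v"
  using assms by (auto simp: linear_maps_def PiE_iff)

lemma linear_maps_id: "qvs E \<Longrightarrow> (\<lambda>v \<in> carrier E. v) \<in> linear_maps E E"
proof -
  assume "qvs E"
  then interpret qvs E .
  show ?thesis by (simp add: linear_maps_def)
qed

lemma linear_maps_compose:
  assumes "qvs E" and f: "f \<in> linear_maps E F" and g: "g \<in> linear_maps F G"
  shows "compose (carrier E) g f \<in> linear_maps E G"
proof -
  interpret qvs E by fact
  show ?thesis using linear_mapsD(2-4)[OF f] linear_mapsD(2-4)[OF g]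
    by (simp add: linear_maps_def compose_def PiE_iff)
qed

lemma fin_dim_qvs: "fin_dim_qvs E \<Longrightarrow> qvs E"
  by (simp add: fin_dim_qvs_def qvs_def)

lemma qvs_category: "is_category qvs_cat"
proof -
  have "linear_maps E F \<subseteq> carrier E \<rightarrow>\<^sub>E carrier F" for E F :: "(rat, 'a) module"
    by (auto simp: linear_maps_def)
  then show ?thesis
    using linear_maps_id[OF fin_dim_qvs] linear_maps_compose[OF fin_dim_qvs]
    by (simp add: is_category_def qvs_cat_def) blast
qed

lemma Hom_mor_in:
  assumes A: "nash_group A" and B: "nash_group B" and f: "f \<in> nash_hom A B" and \<phi>: "\<phi> \<in> nash_hom Rpos A"
  shows "compose (carrier Rpos) f \<phi> \<in> nash_hom Rpos B"
proof -
  note m = nash_groupD[OF A]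
  note n = nash_groupD[OF B]
  note p = nash_hom_RposD[OF \<phi>]
  show ?thesis unfolding compose_def
    by (rule nash_hom_RposI[OF B _ _ nash_map_compose[OF Rpos_manif(1) m(1) n(1) p(4) nash_homD(3)[OF f]]])
      (simp_all add: p(1,2) nash_homD(4,5)[OF f])
qed

lemma Hom_mor_linear:
  assumes A: "hyperbolic A" and B: "hyperbolic B" and f: "f \<in> nash_hom A B"
  shows "Hom_mor A B f \<in> linear_maps (Hom_obj A) (Hom_obj B)"
proof -
  interpret qvs "Hom_obj A" by (rule fin_dim_qvs[OF fin_dim_Hom_obj[OF A]])
  note in' = Hom_mor_in[OF hyperbolic_nash_group[OF A] hyperbolic_nash_group[OF B] f]
  have "Hom_mor A B f (\<phi> \<oplus>\<^bsub>Hom_obj A\<^esub> \<psi>) = Hom_mor A B f \<phi> \<oplus>\<^bsub>Hom_obj B\<^esub> Hom_mor A B f \<psi>"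
    if "\<phi> \<in> nash_hom Rpos A" "\<psi> \<in> nash_hom Rpos A" for \<phi> \<psi>
    using that M.add.m_closed[of \<phi> \<psi>] nash_hom_RposD(1)[OF that(1)] nash_hom_RposD(1)[OF that(2)] nash_homD(5)[OF f]
    by (simp add: Hom_mor_def compose_def restrict_def fun_eq_iff Rpos_sel(1))
  moreover have "Hom_mor A B f (r \<odot>\<^bsub>Hom_obj A\<^esub> \<phi>) = r \<odot>\<^bsub>Hom_obj B\<^esub> Hom_mor A B f \<phi>"
    if "\<phi> \<in> nash_hom Rpos A" for r \<phi>
    using that smult_in[of \<phi> r] by (simp add: Hom_mor_def compose_def restrict_def fun_eq_iff Rpos_sel(1))
  ultimately show ?thesis
    unfolding linear_maps_def using in' by (simp add: Hom_mor_def PiE_iff del: Hom_obj_sel(2-4))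
qed

lemma Hom_functor: "is_functor (hyperbolic_cat :: ('a nash_grp, 'a) ccat) qvs_cat Hom_obj Hom_mor"
proof -
  have id: "Hom_mor A A (\<lambda>x \<in> carrier A. x) = (\<lambda>\<phi> \<in> nash_hom Rpos A. \<phi>)" for A :: "'a nash_grp"
  proof -
    have "compose (carrier Rpos) (\<lambda>x \<in> carrier A. x) \<phi> = \<phi>" if "\<phi> \<in> nash_hom Rpos A" for \<phi>
      using nash_hom_RposD(1,3)[OF that]
      by (intro extensionalityI[of _ "{0<..}"]) (auto simp: compose_def Rpos_sel(1))
    then show ?thesis by (auto simp: Hom_mor_def)
  qed
  have comp: "Hom_mor A C (compose (carrier A) g f) = compose (nash_hom Rpos A) (Hom_mor B C g) (Hom_mor A B f)"
    if "hyperbolic A" "hyperbolic B" "f \<in> nash_hom A B" for A B C :: "'a nash_grp" and f g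
  proof
    fix \<phi>
    show "Hom_mor A C (compose (carrier A) g f) \<phi> = compose (nash_hom Rpos A) (Hom_mor B C g) (Hom_mor A B f) \<phi>"
    proof (cases "\<phi> \<in> nash_hom Rpos A")
      case True
      then show ?thesis
        using Hom_mor_in[OF hyperbolic_nash_group[OF that(1)] hyperbolic_nash_group[OF that(2)] that(3) True] nash_hom_RposD(1)[OF True]
        by (auto simp: Hom_mor_def compose_def restrict_def fun_eq_iff Rpos_sel(1))
    qed (simp add: Hom_mor_def compose_def)
  qed
  show ?thesis
    unfolding is_functor_def using hyperbolic_category qvs_category id comp
    by (simp add: hyperbolic_cat_def qvs_cat_def fin_dim_Hom_obj Hom_mor_linear)
qed

lemma tensor_nash_hom_eqI:
  assumes E: "fin_dim_qvs E" and A: "nash_group A"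
    and h: "h \<in> nash_hom (tensor_obj E) A" and h': "h' \<in> nash_hom (tensor_obj E) A"
    and eq: "\<And>x v. 0 < x \<Longrightarrow> v \<in> carrier E \<Longrightarrow> h (pure_tensor E x v) = h' (pure_tensor E x v)"
  shows "h = h'"
proof (rule extensionalityI[OF nash_homD(2)[OF h] nash_homD(2)[OF h']])
  interpret qvs E by (rule fin_dim_qvs[OF E])
  fix X assume "X \<in> carrier (tensor_obj E)"
  then have X: "X \<in> carrier (tensor_group E)" by (simp add: tensor_obj_sel)
  have "group A" using A by (simp add: nash_group_def)
  from tensor_hom_ext[where h = h and h' = h', OF this _ _ eq X] show "h X = h' X"
    using nash_homD(1)[OF h] nash_homD(1)[OF h'] by (simp add: tensor_obj_sel)
qed

lemma pure_tensor_in_obj: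
  assumes "fin_dim_qvs E" "0 < x" "v \<in> carrier E"
  shows "pure_tensor E x v \<in> carrier (tensor_obj E)"
proof -
  interpret qvs E by (rule fin_dim_qvs[OF assms(1)])
  show ?thesis using assms(2,3) by (simp add: tensor_obj_sel)
qed

lemma tensor_functor:
  "is_functor (qvs_cat :: ((rat, 'e) module, 'e) ccat) hyperbolic_cat tensor_obj tensor_mor"
proof -
  have id: "tensor_mor E E (\<lambda>v \<in> carrier E. v) = (\<lambda>X \<in> carrier (tensor_obj E). X)"
    if E: "fin_dim_qvs E" for E :: "(rat, 'e) module"
  proof (rule tensor_nash_hom_eqI[OF E tensor_obj_nash(1)[OF E] tensor_mor(1)[OF E E] nash_hom_id[OF tensor_obj_nash(1)[OF E]]])
    show l: "(\<lambda>v \<in> carrier E. v) \<in> linear_maps E E" by (rule linear_maps_id[OF fin_dim_qvs[OF E]])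
    fix x :: real and v assume xv: "0 < x" "v \<in> carrier E"
    show "tensor_mor E E (\<lambda>v \<in> carrier E. v) (pure_tensor E x v) = (\<lambda>X \<in> carrier (tensor_obj E). X) (pure_tensor E x v)"
      using tensor_mor(2)[OF E E l xv] pure_tensor_in_obj[OF E xv] xv by simp
  qed
  have comp: "tensor_mor E G (compose (carrier E) g f) = compose (carrier (tensor_obj E)) (tensor_mor F G g) (tensor_mor E F f)"
    if E: "fin_dim_qvs E" and F: "fin_dim_qvs F" and G: "fin_dim_qvs G" and f: "f \<in> linear_maps E F" and g: "g \<in> linear_maps F G"
    for E F G :: "(rat, 'e) module" and f g
  proof -
    have l: "compose (carrier E) g f \<in> linear_maps E G" by (rule linear_maps_compose[OF fin_dim_qvs[OF E] f g])
    show ?thesis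
    proof (rule tensor_nash_hom_eqI[OF E tensor_obj_nash(1)[OF G] tensor_mor(1)[OF E G l]])
      show "compose (carrier (tensor_obj E)) (tensor_mor F G g) (tensor_mor E F f) \<in> nash_hom (tensor_obj E) (tensor_obj G)"
        by (rule nash_hom_compose[OF tensor_obj_nash(1)[OF E] tensor_obj_nash(1)[OF F] tensor_obj_nash(1)[OF G]
              tensor_mor(1)[OF E F f] tensor_mor(1)[OF F G g]])
      fix x :: real and v assume xv: "0 < x" "v \<in> carrier E"
      show "tensor_mor E G (compose (carrier E) g f) (pure_tensor E x v)
          = compose (carrier (tensor_obj E)) (tensor_mor F G g) (tensor_mor E F f) (pure_tensor E x v)"
        using tensor_mor(2)[OF E G l xv] tensor_mor(2)[OF E F f xv] tensor_mor(2)[OF F G g xv(1) linear_mapsD(2)[OF f xv(2)]]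
          pure_tensor_in_obj[OF E xv] xv by (simp add: compose_def)
    qed
  qed
  show ?thesis
    unfolding is_functor_def using hyperbolic_category qvs_category id comp
    by (simp add: hyperbolic_cat_def qvs_cat_def hyperbolic_tensor_obj tensor_mor(1))
qed

section \<open>Unit and counit\<close>

text \<open>The evaluation sends \<open>x \<otimes> \<phi>\<close> to \<open>\<phi> x\<close>. Its inverse \<open>e\<close> is the component of the unit at
  \<open>A\<close>.\<close>

definition is_evaluation :: "'a nash_grp \<Rightarrow> ('a \<Rightarrow> (real \<Rightarrow> 'a) tens) \<Rightarrow> ((real \<Rightarrow> 'a) tens \<Rightarrow> 'a) \<Rightarrow> bool" where
  "is_evaluation A e ev \<longleftrightarrow>
     e \<in> nash_hom A (tensor_obj (Hom_obj A)) \<and> ev \<in> nash_hom (tensor_obj (Hom_obj A)) A \<and>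
     (\<forall>a\<in>carrier A. ev (e a) = a) \<and> (\<forall>X\<in>carrier (tensor_obj (Hom_obj A)). e (ev X) = X) \<and>
     (\<forall>x>0. \<forall>\<phi>\<in>nash_hom Rpos A. ev (pure_tensor (Hom_obj A) x \<phi>) = \<phi> x)"

text \<open>With the coordinate curves of \<open>F\<close> as a basis of the space of one-parameter subgroups, the
  evaluation after the basis map is the inverse of \<open>F\<close>. Hence the inverse of the evaluation is
  the basis map after \<open>F\<close>, which is Nash.\<close>

lemma evaluation_exists:
  assumes hA: "hyperbolic A"
  shows "\<exists>e ev. is_evaluation A e ev"
proof -
  obtain n F where A: "nash_group A" "comm_group A" "F \<in> nash_iso A (Rpos_pow n)" using hA by (rule hyperbolicE)
  let ?E = "Hom_obj A"
  define bs where "bs = curve_basis A F n"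
  have len: "length bs = n" by (simp add: bs_def curve_basis_length[OF A])
  note E = fin_dim_Hom_obj[OF hA] and basis = is_basis_curve_basis[OF A, folded bs_def]
  interpret E: qvs ?E by (rule fin_dim_qvs[OF E])
  interpret A: comm_group A by fact
  note d = nash_groupD[OF A(1)]
  note Fh = iso_hom[OF A]
  have nF: "nash_map (nspace A) (Opn n (Upos n)) F" using A(3) by (simp add: nash_iso_def nash_hom_def Rpos_pow_sel(2))
  obtain h where h: "h \<in> hom (tensor_group ?E) A"
    "\<And>x \<phi>. 0 < x \<Longrightarrow> \<phi> \<in> carrier ?E \<Longrightarrow> h (pure_tensor ?E x \<phi>) = \<phi> x"
    by (rule E.tensor_universal[OF A(2), of "\<lambda>x \<phi>. \<phi> x"]) (auto simp: nash_hom_RposD(1,2) Rpos_sel(1))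
  have hB: "h (basis_map ?E bs t) \<in> carrier A \<and> F (h (basis_map ?E bs t)) = t" if t: "t \<in> Upos n" for t
  proof -
    note b = E.basis_in[OF basis, unfolded len]
    have inA: "(bs ! i) (t i) \<in> carrier A" if "i < n" for i
      by (rule nash_hom_RposD(1)[OF _ Upos_D(2)[OF t that]]) (use b[OF that] in simp)
    have in': "(\<lambda>i. pure_tensor ?E (t i) (bs ! i)) \<in> {..<n} \<rightarrow> carrier (tensor_group ?E)"
      using b Upos_D(2)[OF t] by (auto simp del: Hom_obj_sel)
    have "h (basis_map ?E bs t) = (\<Otimes>\<^bsub>A\<^esub>i\<in>{..<n}. h (pure_tensor ?E (t i) (bs ! i)))"
      unfolding basis_map_def len by (rule hom_finprod[OF E.comm_tensor_group A(2) h(1) _ in']) simp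
    also have "\<dots> = (\<Otimes>\<^bsub>A\<^esub>i\<in>{..<n}. (bs ! i) (t i))"
      using h(2)[OF Upos_D(2)[OF t] b] inA by (intro A.finprod_cong') auto
    finally show ?thesis using iso_product_of_curves[OF A t] unfolding bs_def by simp
  qed
  let ?e = "\<lambda>a\<in>carrier A. basis_map ?E bs (F a)" and ?ev = "restrict h (carrier (tensor_group ?E))"
  have FU: "F a \<in> Upos n" if "a \<in> carrier A" for a using bij_betw_imp_surj_on[OF Fh(2)] that by blast
  have he: "h (basis_map ?E bs (F a)) = a" if a: "a \<in> carrier A" for a
    using inj_onD[OF bij_betw_imp_inj_on[OF Fh(2)], of "h (basis_map ?E bs (F a))" a] hB[OF FU[OF a]] a by blast
  have eh: "basis_map ?E bs (F (h X)) = X" if "X \<in> carrier (tensor_group ?E)" for X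
  proof -
    have "X \<in> basis_map ?E bs ` Upos n"
      using that bij_betw_imp_surj_on[OF E.basis_map_bij[OF basis]] by (simp only: len Rpos_pow_sel(1))
    then obtain t where t: "t \<in> Upos n" and X: "X = basis_map ?E bs t" by (rule imageE)
    show ?thesis unfolding X using hB[OF t] by simp
  qed
  have in': "basis_map ?E bs (F a) \<in> carrier (tensor_group ?E)" if "a \<in> carrier A" for a
    using E.basis_map_in[OF basis] FU[OF that] len by simp
  have "?e \<in> nash_hom A (tensor_obj ?E)"
  proof (rule nash_hom_restrictI[OF A(1) tensor_obj_nash(1)[OF E]])
    show "(\<lambda>a. basis_map ?E bs (F a)) \<in> hom A (tensor_obj ?E)"
      using hom_compose[OF Fh(1) E.basis_map_hom[OF basis, unfolded len]] by (simp add: tensor_obj_sel o_def)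
    show "nash_map (nspace A) (nspace (tensor_obj ?E)) (\<lambda>a. basis_map ?E bs (F a))"
      using nash_map_compose[OF d(1) Opn_manif(1)[OF Upos_good] E.tspace_manif(1)[OF basis] nF E.tspace_manif(2)[OF basis, unfolded len]]
      by (simp add: E.tensor_obj_eq[OF basis])
  qed
  moreover have "?ev \<in> nash_hom (tensor_obj ?E) A"
  proof (rule nash_hom_from_tensor[OF E A(1,2) h(1)])
    fix \<phi> assume \<phi>: "\<phi> \<in> carrier ?E"
    then have "nash_map (nspace Rpos) (nspace A) \<phi>" using nash_hom_RposD(4) by simp
    then show "nash_map (nspace Rpos) (nspace A) (\<lambda>x. h (pure_tensor ?E x \<phi>))"
      by (rule nash_map_cong[OF Rpos_manif(1) d(1)]) (use h(2) \<phi> in simp)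
  qed
  moreover have "?ev (?e a) = a" if "a \<in> carrier A" for a using he in' that by simp
  moreover have "?e (?ev X) = X" if "X \<in> carrier (tensor_obj ?E)" for X
    using eh that hom_in_carrier[OF h(1)] by (simp add: tensor_obj_sel)
  moreover have "?ev (pure_tensor ?E x \<phi>) = \<phi> x" if "0 < x" "\<phi> \<in> nash_hom Rpos A" for x \<phi>
    using h(2)[of x \<phi>] E.pure_tensor_in[of x \<phi>] that by simp
  ultimately show ?thesis unfolding is_evaluation_def by blast
qed

text \<open>The evaluations commute with \<open>f\<close> on pure tensors, hence everywhere, and so do their
  inverses.\<close>

lemma evaluation_natural:
  assumes A: "hyperbolic A" and B: "hyperbolic B" and f: "f \<in> nash_hom A B"
    and e: "is_evaluation A e ev" and e': "is_evaluation B e' ev'" and a: "a \<in> carrier A"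
  shows "e' (f a) = tensor_mor (Hom_obj A) (Hom_obj B) (Hom_mor A B f) (e a)"
proof -
  note A' = hyperbolic_nash_group[OF A] and B' = hyperbolic_nash_group[OF B]
  note E = fin_dim_Hom_obj[OF A] and F = fin_dim_Hom_obj[OF B] and l = Hom_mor_linear[OF A B f]
  let ?T = "tensor_mor (Hom_obj A) (Hom_obj B) (Hom_mor A B f)" and ?X = "carrier (tensor_obj (Hom_obj A))"
  note TE = tensor_obj_nash(1)[OF E] and TF = tensor_obj_nash(1)[OF F]
  have ev: "ev \<in> nash_hom (tensor_obj (Hom_obj A)) A" "ev' \<in> nash_hom (tensor_obj (Hom_obj B)) B"
    using e e' by (simp_all add: is_evaluation_def)
  have "compose ?X f ev = compose ?X ev' ?T"
  proof (rule tensor_nash_hom_eqI[OF E B' nash_hom_compose[OF TE A' B' ev(1) f]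
        nash_hom_compose[OF TE TF B' tensor_mor(1)[OF E F l] ev(2)]])
    fix x :: real and \<phi> assume x: "0 < x" and \<phi>: "\<phi> \<in> carrier (Hom_obj A)"
    then have "compose ?X f ev (pure_tensor (Hom_obj A) x \<phi>) = f (\<phi> x)"
      using pure_tensor_in_obj[OF E x \<phi>] e by (simp add: compose_def is_evaluation_def)
    moreover have "compose ?X ev' ?T (pure_tensor (Hom_obj A) x \<phi>) = f (\<phi> x)"
      using pure_tensor_in_obj[OF E x \<phi>] e' linear_mapsD(2)[OF l \<phi>] \<phi> x
      by (simp add: compose_def is_evaluation_def tensor_mor(2)[OF E F l x \<phi>])
        (simp add: Hom_mor_def compose_def Rpos_sel(1))
    ultimately show "compose ?X f ev (pure_tensor (Hom_obj A) x \<phi>) = compose ?X ev' ?T (pure_tensor (Hom_obj A) x \<phi>)" by simp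
  qed
  from fun_cong[OF this, of "e a"] have "f (ev (e a)) = ev' (?T (e a))"
    using e a nash_homD(4)[of e A "tensor_obj (Hom_obj A)" a] by (simp add: compose_def is_evaluation_def)
  then have "e' (f a) = e' (ev' (?T (e a)))" using e a by (simp add: is_evaluation_def)
  also have "\<dots> = ?T (e a)"
    using e e' a nash_homD(4)[OF tensor_mor(1)[OF E F l]] nash_homD(4)[of e A "tensor_obj (Hom_obj A)" a]
    by (simp add: is_evaluation_def)
  finally show ?thesis .
qed

lemma isosI:
  assumes "f \<in> H" "g \<in> H'" "\<And>x. x \<in> X \<Longrightarrow> g (f x) = x" "\<And>y. y \<in> Y \<Longrightarrow> f (g y) = y"
  shows "f \<in> isos X Y H H'"
  unfolding isos_def using assms by (auto simp: compose_def intro!: bexI[of _ g])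

lemma linear_bij_in_isos:
  assumes E: "qvs E" and f: "f \<in> linear_maps E F" and bij: "bij_betw f (carrier E) (carrier F)"
  shows "f \<in> isos (carrier E) (carrier F) (linear_maps E F) (linear_maps F E)"
proof (rule isosI[OF f])
  interpret qvs E by fact
  note l = linear_mapsD[OF f]
  let ?g = "inv_into (carrier E) f"
  have g: "?g y \<in> carrier E" "f (?g y) = y" if "y \<in> carrier F" for y
    using bij that by (simp_all add: bij_betw_def inv_into_into f_inv_into_f)
  have gI: "?g y = v" if "v \<in> carrier E" "f v = y" for v y
    using bij_betw_imp_inj_on[OF bij] that inv_into_f_f by metis
  have add: "?g (v \<oplus>\<^bsub>F\<^esub> w) = ?g v \<oplus>\<^bsub>E\<^esub> ?g w" if "v \<in> carrier F" "w \<in> carrier F" for v w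
    by (rule gI) (simp_all add: that g l(3))
  have smult: "?g (r \<odot>\<^bsub>F\<^esub> v) = r \<odot>\<^bsub>E\<^esub> ?g v" if "v \<in> carrier F" for v r
    by (rule gI) (simp_all add: that g l(4))
  have cl: "v \<oplus>\<^bsub>F\<^esub> w \<in> carrier F" "r \<odot>\<^bsub>F\<^esub> v \<in> carrier F" if "v \<in> carrier F" "w \<in> carrier F" for v w r
    using l(3)[OF g(1)[OF that(1)] g(1)[OF that(2)]] l(4)[OF g(1)[OF that(1)], of r]
      l(2)[of "?g v \<oplus>\<^bsub>E\<^esub> ?g w"] l(2)[of "r \<odot>\<^bsub>E\<^esub> ?g v"] g that by simp_all
  show "restrict ?g (carrier F) \<in> linear_maps F E"
    unfolding linear_maps_def using g add smult cl by simp
  show "restrict ?g (carrier F) (f v) = v" if "v \<in> carrier E" for v using gI[OF that refl] l(2)[OF that] by simp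
  show "f (restrict ?g (carrier F) y) = y" if "y \<in> carrier F" for y using g that by simp
qed

definition counit_map :: "(rat, 'e) module \<Rightarrow> 'e \<Rightarrow> real \<Rightarrow> 'e tens" where
  "counit_map E = (\<lambda>v\<in>carrier E. \<lambda>x\<in>carrier Rpos. pure_tensor E x v)"

lemma counit_in:
  assumes E: "fin_dim_qvs E" and v: "v \<in> carrier E"
  shows "counit_map E v \<in> nash_hom Rpos (tensor_obj E)"
proof -
  interpret qvs E by (rule fin_dim_qvs[OF E])
  have "(\<lambda>x\<in>carrier Rpos. pure_tensor E x v) \<in> nash_hom Rpos (tensor_obj E)"
    by (rule nash_hom_RposI[OF tensor_obj_nash(1)[OF E] _ _ tensor_obj_nash(3)[OF E v]])
      (simp_all add: tensor_obj_sel v pure_tensor_mult)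
  then show ?thesis using v by (simp add: counit_map_def)
qed

lemma counit_linear:
  assumes E: "fin_dim_qvs E"
  shows "counit_map E \<in> linear_maps E (Hom_obj (tensor_obj E))"
proof -
  interpret qvs E by (rule fin_dim_qvs[OF E])
  have "counit_map E (v \<oplus>\<^bsub>E\<^esub> w) = counit_map E v \<oplus>\<^bsub>Hom_obj (tensor_obj E)\<^esub> counit_map E w"
    if "v \<in> carrier E" "w \<in> carrier E" for v w
    using that by (auto simp: counit_map_def restrict_def fun_eq_iff Rpos_sel(1) tensor_obj_sel pure_tensor_add)
  moreover have "counit_map E (r \<odot>\<^bsub>E\<^esub> v) = r \<odot>\<^bsub>Hom_obj (tensor_obj E)\<^esub> counit_map E v" if "v \<in> carrier E" for v r
    using that by (auto simp: counit_map_def restrict_def fun_eq_iff Rpos_sel(1) pure_tensor_powr)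
  moreover have "counit_map E \<in> extensional (carrier E)" by (simp add: counit_map_def)
  ultimately show ?thesis
    unfolding linear_maps_def using counit_in[OF E] by (simp add: PiE_iff del: Hom_obj_sel(2-4))
qed

text \<open>In the coordinates of a basis, \<open>x \<otimes> v\<close> shows the coordinates of \<open>v\<close> as exponents, and
  every one-parameter subgroup consists of rational powers.\<close>

lemma counit_bij:
  assumes E: "fin_dim_qvs E"
  shows "bij_betw (counit_map E) (carrier E) (nash_hom Rpos (tensor_obj E))"
proof (rule bij_betwI')
  obtain bs where bs: "qvs E" "is_basis E bs" using E by (rule fin_dim_qvsE)
  interpret qvs E by fact
  let ?n = "length bs"
  obtain \<Psi> where \<Psi>: "\<Psi> \<in> hom (tensor_group E) (Rpos_pow ?n)"
    "\<And>x v. 0 < x \<Longrightarrow> v \<in> carrier E \<Longrightarrow> \<Psi> (pure_tensor E x v) = power_vec ?n x (coord bs v)"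
    "\<And>t. t \<in> Upos ?n \<Longrightarrow> \<Psi> (basis_map E bs t) = t"
    "\<And>X. X \<in> carrier (tensor_group E) \<Longrightarrow> basis_map E bs (\<Psi> X) = X"
    by (rule tensor_coordinates[OF bs(2)], rule that)
  show "counit_map E v \<in> nash_hom Rpos (tensor_obj E)" if "v \<in> carrier E" for v by (rule counit_in[OF E that])
  show "(counit_map E v = counit_map E w) = (v = w)" if vw: "v \<in> carrier E" "w \<in> carrier E" for v w
  proof
    assume "counit_map E v = counit_map E w"
    from fun_cong[OF this, of 2] have "pure_tensor E 2 v = pure_tensor E 2 w"
      using vw by (simp add: counit_map_def Rpos_sel(1))
    then have "power_vec ?n 2 (coord bs v) = power_vec ?n 2 (coord bs w)"
      using \<Psi>(2)[of 2 v] \<Psi>(2)[of 2 w] vw by simp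
    then show "v = w" by (intro coord_eqI[OF bs(2) vw] power_vec_eqD[of 2]) simp_all
  qed simp
  fix \<phi> assume \<phi>: "\<phi> \<in> nash_hom Rpos (tensor_obj E)"
  have "nash_map (nspace Rpos) (nspace (Rpos_pow ?n)) (\<lambda>x. \<Psi> (pure_tensor E x v))" if "v \<in> carrier E" for v
    unfolding Rpos_pow_sel
    by (rule nash_map_cong[OF Rpos_manif(1) Opn_manif(1)[OF Upos_good] nash_map_power_vec]) (simp add: \<Psi>(2) that)
  from nash_hom_Rpos_power_vec[OF tensor_obj_nash(1)[OF E]
      nash_hom_from_tensor[OF E nash_group_Rpos_pow group_Rpos_pow \<Psi>(1) this] \<phi>]
  obtain c where c: "\<And>x. 0 < x \<Longrightarrow> restrict \<Psi> (carrier (tensor_group E)) (\<phi> x) = power_vec ?n x c" by blast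
  have "\<phi> = counit_map E (lincomb bs c)"
  proof (rule nash_hom_Rpos_eqI[OF \<phi> counit_in[OF E lincomb_in[OF bs(2)]]])
    fix x :: real assume x: "0 < x"
    have p: "\<phi> x \<in> carrier (tensor_group E)" using nash_hom_RposD(1)[OF \<phi> x] by (simp add: tensor_obj_sel)
    have "\<phi> x = basis_map E bs (\<Psi> (\<phi> x))" using \<Psi>(4)[OF p] by simp
    also have "\<dots> = pure_tensor E x (lincomb bs c)"
      using c[OF x] p basis_map_power_vec[OF bs(2) x, of c] by simp
    finally show "\<phi> x = counit_map E (lincomb bs c) x"
      using x lincomb_in[OF bs(2)] by (simp add: counit_map_def Rpos_sel(1))
  qed
  then show "\<exists>v\<in>carrier E. \<phi> = counit_map E v" using lincomb_in[OF bs(2)] by blast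
qed

lemma counit_natural:
  assumes E: "fin_dim_qvs E" and F: "fin_dim_qvs F" and f: "f \<in> linear_maps E F" and v: "v \<in> carrier E"
  shows "counit_map F (f v) = Hom_mor (tensor_obj E) (tensor_obj F) (tensor_mor E F f) (counit_map E v)"
proof -
  have "compose (carrier Rpos) (tensor_mor E F f) (counit_map E v) = counit_map F (f v)"
    using v linear_mapsD(2)[OF f v] tensor_mor(2)[OF E F f _ v]
    by (auto simp: counit_map_def compose_def restrict_def fun_eq_iff Rpos_sel(1))
  then show ?thesis using counit_in[OF E v] by (simp add: Hom_mor_def)
qed

theorem theorem1p9:
  shows
    "is_functor (hyperbolic_cat :: ('a nash_grp, 'a) ccat)
       (qvs_cat :: ((rat, real \<Rightarrow> 'a) module, real \<Rightarrow> 'a) ccat) Hom_obj Hom_mor \<and>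
     is_functor (qvs_cat :: ((rat, 'e) module, 'e) ccat)
       (hyperbolic_cat :: ('e tens nash_grp, 'e tens) ccat) tensor_obj tensor_mor \<and>
     (\<exists>\<eta> :: 'a nash_grp \<Rightarrow> 'a \<Rightarrow> (real \<Rightarrow> 'a) tens.
        (\<forall>A. hyperbolic A \<longrightarrow>
           \<eta> A \<in> isos (carrier A) (carrier (tensor_obj (Hom_obj A)))
                   (nash_hom A (tensor_obj (Hom_obj A))) (nash_hom (tensor_obj (Hom_obj A)) A)) \<and>
        (\<forall>A B f. hyperbolic A \<and> hyperbolic B \<and> f \<in> nash_hom A B \<longrightarrow>
           compose (carrier A) (\<eta> B) f =
           compose (carrier A) (tensor_mor (Hom_obj A) (Hom_obj B) (Hom_mor A B f)) (\<eta> A))) \<and>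
     (\<exists>\<epsilon> :: (rat, 'e) module \<Rightarrow> 'e \<Rightarrow> (real \<Rightarrow> 'e tens).
        (\<forall>E. fin_dim_qvs E \<longrightarrow>
           \<epsilon> E \<in> isos (carrier E) (carrier (Hom_obj (tensor_obj E)))
                   (linear_maps E (Hom_obj (tensor_obj E))) (linear_maps (Hom_obj (tensor_obj E)) E)) \<and>
        (\<forall>E F f. fin_dim_qvs E \<and> fin_dim_qvs F \<and> f \<in> linear_maps E F \<longrightarrow>
           compose (carrier E) (\<epsilon> F) f =
           compose (carrier E) (Hom_mor (tensor_obj E) (tensor_obj F) (tensor_mor E F f)) (\<epsilon> E)))"
proof (intro conjI)
  show "is_functor (hyperbolic_cat :: ('a nash_grp, 'a) ccat)
      (qvs_cat :: ((rat, real \<Rightarrow> 'a) module, real \<Rightarrow> 'a) ccat) Hom_obj Hom_mor"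
    by (rule Hom_functor)
  show "is_functor (qvs_cat :: ((rat, 'e) module, 'e) ccat)
      (hyperbolic_cat :: ('e tens nash_grp, 'e tens) ccat) tensor_obj tensor_mor"
    by (rule tensor_functor)
  have "\<forall>A. hyperbolic A \<longrightarrow> (\<exists>e ev. is_evaluation A e ev)" for A :: "'a nash_grp"
    using evaluation_exists by blast
  then obtain \<eta> :: "'a nash_grp \<Rightarrow> 'a \<Rightarrow> (real \<Rightarrow> 'a) tens" and ev
    where \<eta>: "\<And>A. hyperbolic A \<Longrightarrow> is_evaluation A (\<eta> A) (ev A)" by metis
  have "\<eta> A \<in> isos (carrier A) (carrier (tensor_obj (Hom_obj A)))
      (nash_hom A (tensor_obj (Hom_obj A))) (nash_hom (tensor_obj (Hom_obj A)) A)" if "hyperbolic A" for A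
    using \<eta>[OF that] by (intro isosI[of _ _ "ev A"]) (simp_all add: is_evaluation_def)
  moreover have "compose (carrier A) (\<eta> B) f =
      compose (carrier A) (tensor_mor (Hom_obj A) (Hom_obj B) (Hom_mor A B f)) (\<eta> A)"
    if "hyperbolic A" "hyperbolic B" "f \<in> nash_hom A B" for A B f
    using evaluation_natural[OF that \<eta>[OF that(1)] \<eta>[OF that(2)]] by (simp add: compose_def restrict_def fun_eq_iff)
  ultimately show "\<exists>\<eta> :: 'a nash_grp \<Rightarrow> 'a \<Rightarrow> (real \<Rightarrow> 'a) tens.
      (\<forall>A. hyperbolic A \<longrightarrow>
         \<eta> A \<in> isos (carrier A) (carrier (tensor_obj (Hom_obj A)))
                 (nash_hom A (tensor_obj (Hom_obj A))) (nash_hom (tensor_obj (Hom_obj A)) A)) \<and>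
      (\<forall>A B f. hyperbolic A \<and> hyperbolic B \<and> f \<in> nash_hom A B \<longrightarrow>
         compose (carrier A) (\<eta> B) f =
         compose (carrier A) (tensor_mor (Hom_obj A) (Hom_obj B) (Hom_mor A B f)) (\<eta> A))"
    by (intro exI[of _ \<eta>]) blast
  have "counit_map E \<in> isos (carrier E) (carrier (Hom_obj (tensor_obj E)))
      (linear_maps E (Hom_obj (tensor_obj E))) (linear_maps (Hom_obj (tensor_obj E)) E)"
    if "fin_dim_qvs E" for E :: "(rat, 'e) module"
    by (rule linear_bij_in_isos[OF fin_dim_qvs[OF that] counit_linear[OF that]]) (simp add: counit_bij[OF that])
  moreover have "compose (carrier E) (counit_map F) f =
      compose (carrier E) (Hom_mor (tensor_obj E) (tensor_obj F) (tensor_mor E F f)) (counit_map E)"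
    if "fin_dim_qvs E" "fin_dim_qvs F" "f \<in> linear_maps E F" for E F :: "(rat, 'e) module" and f
    using counit_natural[OF that] by (simp add: compose_def restrict_def fun_eq_iff)
  ultimately show "\<exists>\<epsilon> :: (rat, 'e) module \<Rightarrow> 'e \<Rightarrow> (real \<Rightarrow> 'e tens).
      (\<forall>E. fin_dim_qvs E \<longrightarrow>
         \<epsilon> E \<in> isos (carrier E) (carrier (Hom_obj (tensor_obj E)))
                 (linear_maps E (Hom_obj (tensor_obj E))) (linear_maps (Hom_obj (tensor_obj E)) E)) \<and>
      (\<forall>E F f. fin_dim_qvs E \<and> fin_dim_qvs F \<and> f \<in> linear_maps E F \<longrightarrow>
         compose (carrier E) (\<epsilon> F) f =
         compose (carrier E) (Hom_mor (tensor_obj E) (tensor_obj F) (tensor_mor E F f)) (\<epsilon> E))"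
    by (intro exI[of _ counit_map]) blast
qed

end
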